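(* Let $X$ be a compact Hausdorff space, $\mathcal E\to X$ a vector bundle and $G\subseteq\mathbf U\mathcal E$ a closed group with spectral bundle $\mathcal G$. Then $\widehat G=\widehat{G'}$ for every closed group $G'\subseteq\mathbf U\mathcal E$ whose spectral bundle $\mathcal G'$ satisfies $\mathcal G=\mathcal G'$. In particular, $\widehat G=\widehat{SG}$ and $\mathcal O_G=\mathcal O_{SG}$.
   Context: $\mathcal E\to X$ is a complex Hermitian vector bundle of rank $d$. $\mathcal E^r$ is the $r$-fold tensor power, $\iota := \mathcal E^0 := X\times\mathbb C$. $(\mathcal E^r,\mathcal E^s)$ is the Banach $C(X)$-bimodule of vector bundle morphisms $\mathcal E^r\to\mathcal E^s$ (over $\mathrm{id}_X$). Cuntz–Pimsner algebra $\mathcal O_{\mathcal E}$ : embed $(\mathcal E^r,\mathcal E^s)\hookrightarrow(\mathcal E^{r+1},\mathcal E^{s+1})$ by $t\mapsto t\otimes 1$; for $k\in\mathbb Z$ let $\mathcal O^k$ be the inductive limit of $(\mathcal E^r,\mathcal E^{r+k})$ over $r$; composition and adjoint make $\bigoplus_k\mathcal O^k$ a $*$-algebra, and $\mathcal O_{\mathcal E}$ is its closure in the unique $C^*$-norm for which the circle action $t\mapsto z^kt$ ($t\in\mathcal O^k$) is isometric. The spaces $(\mathcal E^r,\mathcal E^s)$ are regarded inside $\mathcal O_{\mathcal E}$. $\mathcal O_{\mathcal E}$ is a continuous bundle of $C^*$-algebras over $X$ whose fibre $(\mathcal O_{\mathcal E})_x\simeq\mathcal O_d$ is the Cuntz algebra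 of the Hilbert space $\mathcal E_x$ (same construction with $\mathcal E_x$ in place of $\mathcal E$). $\mathbf U\mathcal E$ is the group of unitary elements of $(\mathcal E,\mathcal E)$, i.e. of continuous sections of the bundle $\mathcal U\mathcal E\to X$ whose fibre $\mathcal U\mathcal E_x\simeq\mathbb U(d)$ is the unitary group of $\mathcal E_x$; $g_x$ is the value of $g$ at $x$. Each $g\in\mathbf U\mathcal E$ defines an automorphism $\widehat g$ of $\mathcal O_{\mathcal E}$ by $\widehat g(t):=g^{\otimes s}\, t\, (g^* )^{\otimes r}$, $t\in(\mathcal E^r,\mathcal E^s)$; likewise each $u\in\mathcal U\mathcal E_x$ defines an automorphism $\widehat u$ of $(\mathcal O_{\mathcal E})_x$. Put $(\mathcal E^r,\mathcal E^s)_G:=\{y\in(\mathcal E^r,\mathcal E^s):\widehat g(y)=y,\ g\in G\}$; $\mathcal O_G\subseteq\mathcal O_{\mathcal E}$ is the $C^*$-subalgebra generated by all $(\mathcal E^r,\mathcal E^s)_G$, and $(\mathcal O_G)_x\subseteq(\mathcal O_{\mathcal E})_x$ its image in the fibre at $x$. The spectral bundle of $G$ is the topological subspace $\mathcal G:=\{u\in\mathcal U\mathcal E:\ u\in\mathcal U\mathcal E_x,\ x \in X,\ \widehat u(y)=y\ \ \forall y\in(\mathcal O_G)_x\}\subseteq\mathcal U\mathcal E$ with the restricted projection to $X$; and $SG:=\{g\in\mathbf U\mathcal E: g_x\in\mathcal G\ \forall x\in X\}$, a closed group. The dual $\widehat G$ is the symmetric tensor $C^*$-category with objects the tensor powers $\mathcal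 E^r$, $r\in\mathbb N$, and arrows the spaces $(\mathcal E^r,\mathcal E^s)_G$. *)

theory Defs
  imports "HOL-Analysis.Analysis" "HOL-Algebra.Group"
begin

section \<open>Hermitian vector bundles and their morphisms\<close>

record ('e, 'x) vbundle =
  base :: "'x topology"
  tot  :: "'e topology"
  prj  :: "'e \<Rightarrow> 'x"
  vadd :: "'e \<Rightarrow> 'e \<Rightarrow> 'e"
  vscl :: "complex \<Rightarrow> 'e \<Rightarrow> 'e"
  ip   :: "'e \<Rightarrow> 'e \<Rightarrow> complex"

definition fib :: "('e, 'x) vbundle \<Rightarrow> 'x \<Rightarrow> 'e set" where
  "fib E x = {v \<in> topspace (tot E). prj E v = x}"

text \<open>Scalar products are linear in the second variable. The vector space axioms in the fibres
  are not listed, because they are transported from $\mathbf{C}^d$ (the functions on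
  \<open>{..<d}\<close>) by the local trivialisations. The vector \<open>vscl E 0 v\<close> is the zero vector of the fibre
  of \<open>v\<close>.\<close>

locale hermitian_bundle =
  fixes E :: "('e, 'x) vbundle" and d :: nat
  assumes prj_continuous: "continuous_map (tot E) (base E) (prj E)"
    and vadd_closed: "\<And>x v w. v \<in> fib E x \<Longrightarrow> w \<in> fib E x \<Longrightarrow> vadd E v w \<in> fib E x"
    and vscl_closed: "\<And>x v c. v \<in> fib E x \<Longrightarrow> vscl E c v \<in> fib E x"
    and locally_trivial:
      "\<And>x. x \<in> topspace (base E) \<Longrightarrow>
        \<exists>U \<phi>. openin (base E) U \<and> x \<in> U \<and>
          homeomorphic_map
            (subtopology (tot E) {v \<in> topspace (tot E). prj E v \<in> U})
            (prod_topology (subtopology (base E) U)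
               (product_topology (\<lambda>_. euclidean :: complex topology) {..<d})) \<phi> \<and>
          (\<forall>y\<in>U. \<forall>v\<in>fib E y. fst (\<phi> v) = y) \<and>
          (\<forall>y\<in>U. \<forall>v\<in>fib E y. \<forall>w\<in>fib E y.
             snd (\<phi> (vadd E v w)) = (\<lambda>i\<in>{..<d}. snd (\<phi> v) i + snd (\<phi> w) i)) \<and>
          (\<forall>y\<in>U. \<forall>v\<in>fib E y. \<forall>c.
             snd (\<phi> (vscl E c v)) = (\<lambda>i\<in>{..<d}. c * snd (\<phi> v) i))"
    and ip_add: "\<And>x u v w. u \<in> fib E x \<Longrightarrow> v \<in> fib E x \<Longrightarrow> w \<in> fib E x \<Longrightarrow>
                   ip E u (vadd E v w) = ip E u v + ip E u w"
    and ip_scl: "\<And>x u v c. u \<in> fib E x \<Longrightarrow> v \<in> fib E x \<Longrightarrow>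
                   ip E u (vscl E c v) = c * ip E u v"
    and ip_herm: "\<And>x u v. u \<in> fib E x \<Longrightarrow> v \<in> fib E x \<Longrightarrow> ip E v u = cnj (ip E u v)"
    and ip_pos: "\<And>x v. v \<in> fib E x \<Longrightarrow> vscl E 0 v \<noteq> v \<Longrightarrow> 0 < Re (ip E v v)"
    and ip_continuous:
      "continuous_map
         (subtopology (prod_topology (tot E) (tot E)) {(v, w). prj E v = prj E w})
         euclidean (\<lambda>(v, w). ip E v w)"

definition local_section :: "('e, 'x) vbundle \<Rightarrow> 'x set \<Rightarrow> ('x \<Rightarrow> 'e) \<Rightarrow> bool" where
  "local_section E U \<sigma> \<longleftrightarrow>
     continuous_map (subtopology (base E) U) (tot E) \<sigma> \<and>
     (\<forall>x\<in>topspace (base E) \<inter> U. prj E (\<sigma> x) = x)"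

text \<open>Morphisms over the identity of the base; as maps they are extensional on the total space, so
  that equality of morphisms is equality in HOL. Composition is \<^const>\<open>compose\<close> on the total
  space of the source.\<close>

definition mor :: "('e, 'x) vbundle \<Rightarrow> ('f, 'x) vbundle \<Rightarrow> ('e \<Rightarrow> 'f) set" where
  "mor E F =
     {t \<in> extensional (topspace (tot E)).
        continuous_map (tot E) (tot F) t \<and>
        (\<forall>v\<in>topspace (tot E). prj F (t v) = prj E v) \<and>
        (\<forall>x. \<forall>v\<in>fib E x. \<forall>w\<in>fib E x. t (vadd E v w) = vadd F (t v) (t w)) \<and>
        (\<forall>x. \<forall>v\<in>fib E x. \<forall>c. t (vscl E c v) = vscl F c (t v))}"

definition mid :: "('e, 'x) vbundle \<Rightarrow> 'e \<Rightarrow> 'e" where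
  "mid E = (\<lambda>v\<in>topspace (tot E). v)"

definition mcomp :: "('e, 'x) vbundle \<Rightarrow> ('f \<Rightarrow> 'g) \<Rightarrow> ('e \<Rightarrow> 'f) \<Rightarrow> 'e \<Rightarrow> 'g" where
  "mcomp E t' t = compose (topspace (tot E)) t' t"

definition madd ::
    "('e, 'x) vbundle \<Rightarrow> ('f, 'x) vbundle \<Rightarrow> ('e \<Rightarrow> 'f) \<Rightarrow> ('e \<Rightarrow> 'f) \<Rightarrow> 'e \<Rightarrow> 'f" where
  "madd E F t t' = (\<lambda>v\<in>topspace (tot E). vadd F (t v) (t' v))"

definition mscl ::
    "('e, 'x) vbundle \<Rightarrow> ('f, 'x) vbundle \<Rightarrow> complex \<Rightarrow> ('e \<Rightarrow> 'f) \<Rightarrow> 'e \<Rightarrow> 'f" where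
  "mscl E F c t = (\<lambda>v\<in>topspace (tot E). vscl F c (t v))"

definition madj :: "('e, 'x) vbundle \<Rightarrow> ('f, 'x) vbundle \<Rightarrow> ('e \<Rightarrow> 'f) \<Rightarrow> 'f \<Rightarrow> 'e" where
  "madj E F t = (\<lambda>u\<in>topspace (tot F).
     THE v. v \<in> fib E (prj F u) \<and> (\<forall>w\<in>fib E (prj F u). ip E w v = ip F (t w) u))"

definition mnorm :: "('e, 'x) vbundle \<Rightarrow> ('f, 'x) vbundle \<Rightarrow> ('e \<Rightarrow> 'f) \<Rightarrow> real" where
  "mnorm E F t = Sup (insert 0 {sqrt (Re (ip F (t v) (t v))) | v.
                        v \<in> topspace (tot E) \<and> Re (ip E v v) \<le> 1})"

text \<open>The restriction of a bundle to a one-point base is the Hilbert space that is its fibre.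
  Everything below is defined for bundles, hence also for a single fibre.\<close>

definition at_pt :: "('e, 'x) vbundle \<Rightarrow> 'x \<Rightarrow> ('e, 'x) vbundle" where
  "at_pt E x = E\<lparr>base := subtopology (base E) {x}, tot := subtopology (tot E) (fib E x)\<rparr>"


section \<open>Tensor powers\<close>

text \<open>The $r$-fold tensor power of a finite-dimensional Hilbert space $V$ is realised as the space
  of forms on $V^r$ that are conjugate linear in each variable: $v_1 \otimes \dots \otimes v_r$ is
  the form $(w_1, \dots, w_r) \mapsto \prod_i \langle w_i, v_i\rangle$, so that
  $\Phi(w_1, \dots, w_r) = \langle w_1 \otimes \dots \otimes w_r, \Phi\rangle$.
  Arguments are lists; a form vanishes on all lists that do not belong to $V^r$.\<close>

definition tup :: "('e, 'x) vbundle \<Rightarrow> nat \<Rightarrow> 'x \<Rightarrow> 'e list set" where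
  "tup E r x = {ws. length ws = r \<and> set ws \<subseteq> fib E x}"

definition tfib :: "('e, 'x) vbundle \<Rightarrow> nat \<Rightarrow> 'x \<Rightarrow> ('e list \<Rightarrow> complex) set" where
  "tfib E r x =
     {\<Phi>. (\<forall>ws. ws \<notin> tup E r x \<longrightarrow> \<Phi> ws = 0) \<and>
         (\<forall>us v w zs. us @ v # zs \<in> tup E r x \<and> w \<in> fib E x \<longrightarrow>
            \<Phi> (us @ vadd E v w # zs) = \<Phi> (us @ v # zs) + \<Phi> (us @ w # zs)) \<and>
         (\<forall>us v zs c. us @ v # zs \<in> tup E r x \<longrightarrow>
            \<Phi> (us @ vscl E c v # zs) = cnj c * \<Phi> (us @ v # zs))}"

definition onb :: "('e, 'x) vbundle \<Rightarrow> 'x \<Rightarrow> 'e set \<Rightarrow> bool" where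
  "onb E x B \<longleftrightarrow> finite B \<and> B \<subseteq> fib E x \<and>
     (\<forall>a\<in>B. \<forall>b\<in>B. ip E a b = (if a = b then 1 else 0)) \<and>
     (\<forall>v\<in>fib E x. (\<forall>b\<in>B. ip E b v = 0) \<longrightarrow> vscl E 0 v = v)"

text \<open>The scalar product for which the tensors of vectors of an orthonormal basis are an
  orthonormal basis; it does not depend on the choice of the basis.\<close>

definition tip :: "('e, 'x) vbundle \<Rightarrow> nat \<Rightarrow> 'x \<Rightarrow> ('e list \<Rightarrow> complex) \<Rightarrow> ('e list \<Rightarrow> complex) \<Rightarrow> complex" where
  "tip E r x \<Phi> \<Psi> =
     (\<Sum>bs | length bs = r \<and> set bs \<subseteq> (SOME B. onb E x B). cnj (\<Phi> bs) * \<Psi> bs)"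

text \<open>The topology on the total space of the $r$-th tensor power is generated by the functions
  $\Phi \mapsto \langle \sigma_1(x) \otimes \dots \otimes \sigma_r(x), \Phi\rangle$
  ($\Phi$ in the fibre at $x \in U$) for local continuous sections $\sigma_i$ over open $U$. With a
  local frame for the $\sigma_i$ these are the coordinates of a local trivialisation. For
  \<open>r = 0\<close> one obtains the trivial line bundle.\<close>

definition ttop :: "('e, 'x) vbundle \<Rightarrow> nat \<Rightarrow> ('x \<times> ('e list \<Rightarrow> complex)) topology" where
  "ttop E r = topology_generated_by
     {{(x, \<Phi>). x \<in> U \<and> \<Phi> \<in> tfib E r x \<and> \<Phi> (map (\<lambda>\<sigma>. \<sigma> x) \<sigma>s) \<in> W} | U \<sigma>s W.
        openin (base E) U \<and> length \<sigma>s = r \<and> (\<forall>\<sigma>\<in>set \<sigma>s. local_section E U \<sigma>) \<and> open W}"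

type_synonym ('e, 'x) tvec = "'x \<times> ('e list \<Rightarrow> complex)"
type_synonym ('e, 'x) tmor = "('e, 'x) tvec \<Rightarrow> ('e, 'x) tvec"

definition tpow :: "('e, 'x) vbundle \<Rightarrow> nat \<Rightarrow> (('e, 'x) tvec, 'x) vbundle" where
  "tpow E r =
     \<lparr>base = base E,
      tot = ttop E r,
      prj = fst,
      vadd = (\<lambda>(x, \<Phi>) (_, \<Psi>). (x, \<lambda>ws. \<Phi> ws + \<Psi> ws)),
      vscl = (\<lambda>c (x, \<Phi>). (x, \<lambda>ws. c * \<Phi> ws)),
      ip = (\<lambda>(x, \<Phi>) (_, \<Psi>). tip E r x \<Phi> \<Psi>)\<rparr>"

abbreviation tmors :: "('e, 'x) vbundle \<Rightarrow> nat \<Rightarrow> nat \<Rightarrow> ('e, 'x) tmor set" where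
  "tmors E r s \<equiv> mor (tpow E r) (tpow E s)"

text \<open>The zero morphism from the $r$-th to any other tensor power.\<close>

definition tzero :: "('e, 'x) vbundle \<Rightarrow> nat \<Rightarrow> ('e, 'x) tmor" where
  "tzero E r = (\<lambda>v\<in>topspace (tot (tpow E r)). (fst v, \<lambda>_. 0))"

text \<open>The tensor product of \<open>t\<close> from the $r$-th to the $s$-th with \<open>t'\<close> from the $r'$-th to the
  $s'$-th tensor power: \<open>t'\<close> is applied to the last $r'$ and \<open>t\<close> to the first $r$ variables.\<close>

definition tens ::
    "('e, 'x) vbundle \<Rightarrow> nat \<Rightarrow> nat \<Rightarrow> nat \<Rightarrow> nat \<Rightarrow> ('e, 'x) tmor \<Rightarrow> ('e, 'x) tmor \<Rightarrow> ('e, 'x) tmor" where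
  "tens E r s r' s' t t' = (\<lambda>(x, \<Phi>)\<in>topspace (tot (tpow E (r + r'))).
     (x, \<lambda>zs. if zs \<in> tup E (s + s') x
              then snd (t (x, \<lambda>ws. if ws \<in> tup E r x
                                   then snd (t' (x, \<lambda>ws'. \<Phi> (ws @ ws'))) (drop s zs)
                                   else 0)) (take s zs)
              else 0))"

text \<open>The symmetry, \<open>v \<otimes> w \<mapsto> w \<otimes> v\<close> with \<open>v\<close> in the $r$-th and \<open>w\<close> in the $s$-th
  tensor power.\<close>

definition tflip :: "('e, 'x) vbundle \<Rightarrow> nat \<Rightarrow> nat \<Rightarrow> ('e, 'x) tmor" where
  "tflip E r s = (\<lambda>(x, \<Phi>)\<in>topspace (tot (tpow E (r + s))).
     (x, \<lambda>us. if us \<in> tup E (s + r) x then \<Phi> (drop s us @ take s us) else 0))"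

text \<open>The $r$-th tensor power of a morphism \<open>g\<close> from \<open>E\<close> to \<open>E\<close>; the adjoint appears because
  $\langle w, g v\rangle = \langle g^* w, v\rangle$.\<close>

definition gpow :: "('e, 'x) vbundle \<Rightarrow> nat \<Rightarrow> ('e \<Rightarrow> 'e) \<Rightarrow> ('e, 'x) tmor" where
  "gpow E r g = (\<lambda>(x, \<Phi>)\<in>topspace (tot (tpow E r)).
     (x, \<lambda>ws. if ws \<in> tup E r x then \<Phi> (map (madj E E g) ws) else 0))"


section \<open>Normed star-algebras and their completions\<close>

record 'a star_alg =
  car   :: "'a set"
  alg_plus  :: "'a \<Rightarrow> 'a \<Rightarrow> 'a"
  alg_scl   :: "complex \<Rightarrow> 'a \<Rightarrow> 'a"
  alg_times :: "'a \<Rightarrow> 'a \<Rightarrow> 'a"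
  alg_star  :: "'a \<Rightarrow> 'a"

record 'a nstar_alg = "'a star_alg" +
  nrm :: "'a \<Rightarrow> real"

definition minus_in :: "('a, 'z) star_alg_scheme \<Rightarrow> 'a \<Rightarrow> 'a \<Rightarrow> 'a" where
  "minus_in A a b = alg_plus A a (alg_scl A (- 1) b)"

definition cstar_norm :: "('a, 'z) star_alg_scheme \<Rightarrow> ('a \<Rightarrow> real) \<Rightarrow> bool" where
  "cstar_norm A p \<longleftrightarrow>
     (\<forall>a\<in>car A. 0 \<le> p a) \<and>
     (\<forall>a\<in>car A. p a = 0 \<longleftrightarrow> a = alg_scl A 0 a) \<and>
     (\<forall>a\<in>car A. \<forall>b\<in>car A. p (alg_plus A a b) \<le> p a + p b) \<and>
     (\<forall>a\<in>car A. \<forall>c. p (alg_scl A c a) = cmod c * p a) \<and>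
     (\<forall>a\<in>car A. \<forall>b\<in>car A. p (alg_times A a b) \<le> p a * p b) \<and>
     (\<forall>a\<in>car A. p (alg_times A (alg_star A a) a) = (p a)\<^sup>2)"

definition qmap :: "('b \<times> 'b) set \<Rightarrow> ('a \<Rightarrow> 'b) \<Rightarrow> 'a set \<Rightarrow> 'b set" where
  "qmap R f A = (\<Union>a\<in>A. R `` {f a})"

definition qmap2 :: "('a \<times> 'a) set \<Rightarrow> ('a \<Rightarrow> 'a \<Rightarrow> 'a) \<Rightarrow> 'a set \<Rightarrow> 'a set \<Rightarrow> 'a set" where
  "qmap2 R f A B = (\<Union>a\<in>A. \<Union>b\<in>B. R `` {f a b})"

definition cauchy_in :: "('a, 'z) star_alg_scheme \<Rightarrow> ('a \<Rightarrow> real) \<Rightarrow> (nat \<Rightarrow> 'a) set" where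
  "cauchy_in A p =
     {f. (\<forall>n. f n \<in> car A) \<and>
         (\<forall>\<epsilon>>0. \<exists>M. \<forall>m\<ge>M. \<forall>n\<ge>M. p (minus_in A (f m) (f n)) < \<epsilon>)}"

definition null_rel ::
    "('a, 'z) star_alg_scheme \<Rightarrow> ('a \<Rightarrow> real) \<Rightarrow> ((nat \<Rightarrow> 'a) \<times> (nat \<Rightarrow> 'a)) set" where
  "null_rel A p =
     {(f, g). f \<in> cauchy_in A p \<and> g \<in> cauchy_in A p \<and>
              (\<lambda>n. p (minus_in A (f n) (g n))) \<longlonglongrightarrow> 0}"

definition completion ::
    "('a, 'z) star_alg_scheme \<Rightarrow> ('a \<Rightarrow> real) \<Rightarrow> (nat \<Rightarrow> 'a) set nstar_alg" where
  "completion A p =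
     \<lparr>car = cauchy_in A p // null_rel A p,
      alg_plus = qmap2 (null_rel A p) (\<lambda>f g n. alg_plus A (f n) (g n)),
      alg_scl = (\<lambda>c. qmap (null_rel A p) (\<lambda>f n. alg_scl A c (f n))),
      alg_times = qmap2 (null_rel A p) (\<lambda>f g n. alg_times A (f n) (g n)),
      alg_star = qmap (null_rel A p) (\<lambda>f n. alg_star A (f n)),
      nrm = (\<lambda>y. lim (\<lambda>n. p ((SOME f. f \<in> y) n)))\<rparr>"

definition cstar_subalgebra :: "('a, 'z) nstar_alg_scheme \<Rightarrow> 'a set \<Rightarrow> bool" where
  "cstar_subalgebra B C \<longleftrightarrow>
     C \<subseteq> car B \<and> C \<noteq> {} \<and>
     (\<forall>a\<in>C. \<forall>b\<in>C. alg_plus B a b \<in> C \<and> alg_times B a b \<in> C) \<and>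
     (\<forall>a\<in>C. alg_star B a \<in> C \<and> (\<forall>c. alg_scl B c a \<in> C)) \<and>
     (\<forall>y\<in>car B. (\<forall>\<epsilon>>0. \<exists>a\<in>C. nrm B (minus_in B y a) < \<epsilon>) \<longrightarrow> y \<in> C)"

definition cstar_generated :: "('a, 'z) nstar_alg_scheme \<Rightarrow> 'a set \<Rightarrow> 'a set" where
  "cstar_generated B S = \<Inter>{C. cstar_subalgebra B C \<and> S \<subseteq> C}"


section \<open>The Cuntz--Pimsner algebra of a bundle\<close>

text \<open>The direct sum over $k \in \mathbf{Z}$ of the inductive limits of the spaces
  \<open>tmors E r (r + k)\<close> under $t \mapsto t \otimes 1$. An inductive limit consists of the sequences
  that are eventually compatible with the connecting maps, modulo eventual equality. All degrees
  are treated simultaneously: the component of degree $k$ of \<open>a\<close> is the diagonal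
  \<open>a n (n + k)\<close>, and only finitely many diagonals are non-zero. The product and the adjoint of the
  inductive limit are then those of matrices of morphisms, with \<open>a n m\<close> as the entry from the
  $n$-th to the $m$-th tensor power.\<close>

type_synonym ('e, 'x) tmat = "nat \<Rightarrow> nat \<Rightarrow> ('e, 'x) tmor"
type_synonym ('e, 'x) cpcore = "('e, 'x) tmat set"
type_synonym ('e, 'x) cpalg = "(nat \<Rightarrow> ('e, 'x) cpcore) set"

definition amplify :: "('e, 'x) vbundle \<Rightarrow> nat \<Rightarrow> nat \<Rightarrow> ('e, 'x) tmor \<Rightarrow> ('e, 'x) tmor" where
  "amplify E r s t = tens E r s 1 1 t (mid (tpow E 1))"

definition tmats :: "('e, 'x) vbundle \<Rightarrow> ('e, 'x) tmat set" where
  "tmats E =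
     {a. (\<forall>n m. a n m \<in> tmors E n m) \<and>
         (\<exists>K. \<forall>n m. n + K < m \<or> m + K < n \<longrightarrow> a n m = tzero E n) \<and>
         (\<exists>N. \<forall>n\<ge>N. \<forall>m. a (Suc n) (Suc m) = amplify E n m (a n m))}"

definition tmat_rel :: "('e, 'x) vbundle \<Rightarrow> (('e, 'x) tmat \<times> ('e, 'x) tmat) set" where
  "tmat_rel E = {(a, b). a \<in> tmats E \<and> b \<in> tmats E \<and> (\<exists>N. \<forall>n\<ge>N. \<forall>m. a n m = b n m)}"

definition tmat_mult :: "('e, 'x) vbundle \<Rightarrow> ('e, 'x) tmat \<Rightarrow> ('e, 'x) tmat \<Rightarrow> ('e, 'x) tmat" where
  "tmat_mult E a b = (\<lambda>n m. \<lambda>v\<in>topspace (tot (tpow E n)).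
     (fst v, \<lambda>ws. \<Sum>l | b n l \<noteq> tzero E n. snd (a l m (b n l v)) ws))"

definition cp_core :: "('e, 'x) vbundle \<Rightarrow> ('e, 'x) cpcore star_alg" where
  "cp_core E =
     \<lparr>car = tmats E // tmat_rel E,
      alg_plus = qmap2 (tmat_rel E) (\<lambda>a b n m. madd (tpow E n) (tpow E m) (a n m) (b n m)),
      alg_scl = (\<lambda>c. qmap (tmat_rel E) (\<lambda>a n m. mscl (tpow E n) (tpow E m) c (a n m))),
      alg_times = qmap2 (tmat_rel E) (tmat_mult E),
      alg_star = qmap (tmat_rel E) (\<lambda>a n m. madj (tpow E m) (tpow E n) (a m n))\<rparr>"

definition circle_action :: "('e, 'x) vbundle \<Rightarrow> complex \<Rightarrow> ('e, 'x) cpcore \<Rightarrow> ('e, 'x) cpcore" where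
  "circle_action E z =
     qmap (tmat_rel E)
       (\<lambda>a n m. mscl (tpow E n) (tpow E m) (z powi (int m - int n)) (a n m))"

text \<open>There is exactly one $C^*$-norm for which the circle action is isometric; the supremum over
  this one-element set of norms is its value.\<close>

definition cp_norm :: "('e, 'x) vbundle \<Rightarrow> ('e, 'x) cpcore \<Rightarrow> real" where
  "cp_norm E a =
     (SUP p \<in> {p. cstar_norm (cp_core E) p \<and>
                  (\<forall>z. cmod z = 1 \<longrightarrow> (\<forall>b\<in>car (cp_core E). p (circle_action E z b) = p b))}. p a)"

definition cuntz_pimsner :: "('e, 'x) vbundle \<Rightarrow> ('e, 'x) cpalg nstar_alg" where
  "cuntz_pimsner E = completion (cp_core E) (cp_norm E)"

abbreviation cp_rel ::
    "('e, 'x) vbundle \<Rightarrow> ((nat \<Rightarrow> ('e, 'x) cpcore) \<times> (nat \<Rightarrow> ('e, 'x) cpcore)) set" where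
  "cp_rel E \<equiv> null_rel (cp_core E) (cp_norm E)"

text \<open>The image in the Cuntz--Pimsner algebra of \<open>t\<close> in \<open>tmors E r s\<close>.\<close>

primrec amplify_iter :: "('e, 'x) vbundle \<Rightarrow> nat \<Rightarrow> nat \<Rightarrow> nat \<Rightarrow> ('e, 'x) tmor \<Rightarrow> ('e, 'x) tmor" where
  "amplify_iter E r s 0 t = t"
| "amplify_iter E r s (Suc j) t = amplify E (r + j) (s + j) (amplify_iter E r s j t)"

definition cp_embed :: "('e, 'x) vbundle \<Rightarrow> nat \<Rightarrow> nat \<Rightarrow> ('e, 'x) tmor \<Rightarrow> ('e, 'x) cpalg" where
  "cp_embed E r s t =
     cp_rel E `` {\<lambda>_. tmat_rel E ``
       {\<lambda>n m. if r \<le> n \<and> m = s + (n - r) then amplify_iter E r s (n - r) t else tzero E n}}"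

definition cp_map ::
    "('e, 'x) vbundle \<Rightarrow> (('e, 'x) tmat \<Rightarrow> ('e, 'x) tmat) \<Rightarrow> ('e, 'x) cpalg \<Rightarrow> ('e, 'x) cpalg" where
  "cp_map F h = qmap (cp_rel F) (\<lambda>f n. qmap (tmat_rel F) h (f n))"

text \<open>Evaluation at \<open>x\<close>, from the Cuntz--Pimsner algebra of \<open>E\<close> to its fibre
  \<open>cuntz_pimsner (at_pt E x)\<close>.\<close>

definition cp_eval :: "('e, 'x) vbundle \<Rightarrow> 'x \<Rightarrow> ('e, 'x) cpalg \<Rightarrow> ('e, 'x) cpalg" where
  "cp_eval E x =
     cp_map (at_pt E x) (\<lambda>a n m. restrict (a n m) (topspace (tot (tpow (at_pt E x) n))))"


section \<open>Groups of unitaries, spectral bundles and duals\<close>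

definition unitary_group :: "('e, 'x) vbundle \<Rightarrow> ('e \<Rightarrow> 'e) monoid" where
  "unitary_group E =
     \<lparr>carrier = {g \<in> mor E E. mcomp E (madj E E g) g = mid E \<and> mcomp E g (madj E E g) = mid E},
      mult = mcomp E,
      one = mid E\<rparr>"

definition closed_unitary_subgroup :: "('e, 'x) vbundle \<Rightarrow> ('e \<Rightarrow> 'e) set \<Rightarrow> bool" where
  "closed_unitary_subgroup E G \<longleftrightarrow>
     subgroup G (unitary_group E) \<and>
     (\<forall>u\<in>carrier (unitary_group E).
        (\<forall>\<epsilon>>0. \<exists>g\<in>G. mnorm E E (madd E E u (mscl E E (- 1) g)) < \<epsilon>) \<longrightarrow> u \<in> G)"

definition hat_mor :: "('e, 'x) vbundle \<Rightarrow> ('e \<Rightarrow> 'e) \<Rightarrow> nat \<Rightarrow> nat \<Rightarrow> ('e, 'x) tmor \<Rightarrow> ('e, 'x) tmor" where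
  "hat_mor E g r s t =
     mcomp (tpow E r) (gpow E s g) (mcomp (tpow E r) t (gpow E r (madj E E g)))"

definition hat :: "('e, 'x) vbundle \<Rightarrow> ('e \<Rightarrow> 'e) \<Rightarrow> ('e, 'x) cpalg \<Rightarrow> ('e, 'x) cpalg" where
  "hat E g = cp_map E (\<lambda>a n m. hat_mor E g n m (a n m))"

definition invariant_mors ::
    "('e, 'x) vbundle \<Rightarrow> ('e \<Rightarrow> 'e) set \<Rightarrow> nat \<Rightarrow> nat \<Rightarrow> ('e, 'x) tmor set" where
  "invariant_mors E G r s = {y \<in> tmors E r s. \<forall>g\<in>G. hat_mor E g r s y = y}"

definition O_alg :: "('e, 'x) vbundle \<Rightarrow> ('e \<Rightarrow> 'e) set \<Rightarrow> ('e, 'x) cpalg set" where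
  "O_alg E G =
     cstar_generated (cuntz_pimsner E) (\<Union>r s. cp_embed E r s ` invariant_mors E G r s)"

text \<open>The total space of the bundle of unitary groups of the fibres, with the topology generated
  by the matrix coefficients along local continuous sections; its projection is \<^const>\<open>fst\<close>.\<close>

definition unitary_bundle :: "('e, 'x) vbundle \<Rightarrow> ('x \<times> ('e \<Rightarrow> 'e)) topology" where
  "unitary_bundle E = topology_generated_by
     {{(x, u). x \<in> U \<and> u \<in> carrier (unitary_group (at_pt E x)) \<and> ip E (\<sigma> x) (u (\<tau> x)) \<in> W} | U \<sigma> \<tau> W.
        openin (base E) U \<and> local_section E U \<sigma> \<and> local_section E U \<tau> \<and> open W}"

definition spectral_bundle ::
    "('e, 'x) vbundle \<Rightarrow> ('e \<Rightarrow> 'e) set \<Rightarrow> ('x \<times> ('e \<Rightarrow> 'e)) topology" where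
  "spectral_bundle E G = subtopology (unitary_bundle E)
     {(x, u). x \<in> topspace (base E) \<and> u \<in> carrier (unitary_group (at_pt E x)) \<and>
              (\<forall>y\<in>cp_eval E x ` O_alg E G. hat (at_pt E x) u y = y)}"

definition spectral_group :: "('e, 'x) vbundle \<Rightarrow> ('e \<Rightarrow> 'e) set \<Rightarrow> ('e \<Rightarrow> 'e) set" where
  "spectral_group E G =
     {g \<in> carrier (unitary_group E).
        \<forall>x\<in>topspace (base E). (x, restrict g (fib E x)) \<in> topspace (spectral_bundle E G)}"

text \<open>Symmetric tensor $C^*$-categories whose objects are labelled by natural numbers, the label of a
  tensor product being the sum of the labels. The structure maps take the labels of the objects
  between which their arguments act.\<close>

record ('o, 'm) tensor_category =
  obj        :: "nat \<Rightarrow> 'o"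
  arrows     :: "nat \<Rightarrow> nat \<Rightarrow> 'm set"
  arr_id     :: "nat \<Rightarrow> 'm"
  arr_comp   :: "nat \<Rightarrow> nat \<Rightarrow> nat \<Rightarrow> 'm \<Rightarrow> 'm \<Rightarrow> 'm"
  arr_add    :: "nat \<Rightarrow> nat \<Rightarrow> 'm \<Rightarrow> 'm \<Rightarrow> 'm"
  arr_scl    :: "nat \<Rightarrow> nat \<Rightarrow> complex \<Rightarrow> 'm \<Rightarrow> 'm"
  arr_adj    :: "nat \<Rightarrow> nat \<Rightarrow> 'm \<Rightarrow> 'm"
  arr_norm   :: "nat \<Rightarrow> nat \<Rightarrow> 'm \<Rightarrow> real"
  arr_tensor :: "nat \<Rightarrow> nat \<Rightarrow> nat \<Rightarrow> nat \<Rightarrow> 'm \<Rightarrow> 'm \<Rightarrow> 'm"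
  arr_flip   :: "nat \<Rightarrow> nat \<Rightarrow> 'm"

definition dual ::
    "('e, 'x) vbundle \<Rightarrow> ('e \<Rightarrow> 'e) set \<Rightarrow>
     ((('e, 'x) tvec, 'x) vbundle, ('e, 'x) tmor) tensor_category" where
  "dual E G =
     \<lparr>obj = tpow E,
      arrows = invariant_mors E G,
      arr_id = (\<lambda>r. mid (tpow E r)),
      arr_comp = (\<lambda>r s q t' t. mcomp (tpow E r) t' t),
      arr_add = (\<lambda>r s. madd (tpow E r) (tpow E s)),
      arr_scl = (\<lambda>r s. mscl (tpow E r) (tpow E s)),
      arr_adj = (\<lambda>r s. madj (tpow E r) (tpow E s)),
      arr_norm = (\<lambda>r s. mnorm (tpow E r) (tpow E s)),
      arr_tensor = tens E,
      arr_flip = tflip E\<rparr>"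

end

theory Submission
  imports Defs
begin

text \<open>
The dual and the algebra \<open>O_alg E G\<close> depend on \<open>G\<close> only through the spaces of invariant morphisms, so
it suffices to recover these spaces from the spectral bundle. This is done pointwise: a morphism is
\<open>G\<close>-invariant if and only if, for every point \<open>(x, u)\<close> of the spectral bundle, its value at \<open>x\<close> is
fixed by the automorphism that \<open>u\<close> induces on the fibre over \<open>x\<close>
(\<open>invariant_iff_spectral\<close>). The right-hand side mentions the spectral bundle only, which gives the
first claim; as the spectral group consists of the unitaries with values in the spectral bundle,
it has the same invariants as \<open>G\<close> (\<open>invariant_spectral_group\<close>). The two implications in
\<open>invariant_iff_spectral\<close> have different reasons.

Values of elements of \<open>G\<close> lie in the spectral bundle (\<open>group_in_spectral\<close>). For \<open>g\<close> in \<open>G\<close> with value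
\<open>u\<close> at \<open>x\<close>, evaluation at \<open>x\<close> and evaluation at \<open>x\<close> followed by \<open>u\<close> are two contractive
\<open>*\<close>-homomorphisms from the Cuntz--Pimsner algebra of \<open>E\<close> to that of the fibre. They agree on invariant
morphisms, and the set where they agree is a \<open>C\<^sup>*\<close>-subalgebra (\<open>equalizer_cstar_subalgebra\<close>), so they
agree on the algebra generated by the invariant morphisms. Therefore a morphism that all points of
the spectral bundle fix is fixed by \<open>G\<close>.

Conversely, points of the spectral bundle fix the values of invariant morphisms
(\<open>spectral_fixes_invariant\<close>). By definition they fix the image of such a value in the Cuntz algebra of
the fibre, so injectivity of the embedding of the morphism spaces is what is needed. An element of
norm zero vanishes after sufficiently many tensorings with an identity, and tensoring with the
identity of a non-zero Hilbert space loses nothing (\<open>amplify_inject\<close>). Over a zero fibre the embedding is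
not injective, but there the action on every morphism is trivial (\<open>cp_embed_fixed\<close>).

Both arguments need that \<^const>\<open>cp_norm\<close>, defined as a supremum over all circle-invariant \<open>C\<^sup>*\<close>-norms, is a
finite seminorm that dominates each of them. At least one norm exists: a matrix of morphisms acts on
the Fock spaces of the fibres, and its operator norm on vectors that are supported in sufficiently high
tensor powers is a circle-invariant \<open>C\<^sup>*\<close>-norm (\<open>op_norm_circle_norms\<close>). All of them are bounded at each
element by a common constant (\<open>circle_norm_bounded\<close>), since with a global frame \<open>\<xi>\<^sub>j\<close> of the source every
morphism is a finite sum of products \<open>(t \<xi>\<^sub>j) \<xi>\<^sub>j\<^sup>*\<close> of sections and adjoints of sections, and a section
\<open>\<xi>\<close> has \<open>\<xi>\<^sup>* \<xi>\<close> a continuous function, whose norm its maximum controls. Hence the supremum is a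
submultiplicative seminorm. A functor \<open>H\<close> to another category of tensor powers is contractive because,
for every norm \<open>q\<close> in the family of the target, the maximum of the operator norm and \<open>q \<circ> H\<close> is in the
family of the source (\<open>max_circle_norms\<close>).

The locale \<open>framed_bundle\<close> provides the setting for this: fibrewise Hilbert spaces, continuity of scalar
products of sections, and local orthonormal frames. The given bundle has the latter by Gram--Schmidt
orthonormalisation in charts (\<open>framed\<close>), and each fibre is such a bundle over a point
(\<open>at_pt_point_bundle\<close>).
\<close>

section \<open>Bundles of finite-dimensional Hilbert spaces with local orthonormal frames\<close>

definition frame :: "('e, 'x) vbundle \<Rightarrow> 'x set \<Rightarrow> nat \<Rightarrow> (nat \<Rightarrow> 'x \<Rightarrow> 'e) \<Rightarrow> bool" where
  "frame E U n s \<longleftrightarrow>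
     (\<forall>i<n. local_section E U (s i)) \<and>
     (\<forall>y\<in>U. \<forall>i<n. \<forall>j<n. ip E (s i y) (s j y) = (if i = j then 1 else 0)) \<and>
     (\<forall>y\<in>U. \<forall>v\<in>fib E y. (\<forall>i<n. ip E (s i y) v = 0) \<longrightarrow> vscl E 0 v = v)"

text \<open>The forms that make up a tensor power are of this kind in each variable.\<close>

definition conj_linear :: "('e, 'x) vbundle \<Rightarrow> 'x \<Rightarrow> ('e \<Rightarrow> complex) \<Rightarrow> bool" where
  "conj_linear E x L \<longleftrightarrow>
     (\<forall>v\<in>fib E x. \<forall>w\<in>fib E x. L (vadd E v w) = L v + L w) \<and>
     (\<forall>v\<in>fib E x. \<forall>c. L (vscl E c v) = cnj c * L v)"

text \<open>The words in an orthonormal basis index the induced orthonormal basis of a tensor power.\<close>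

definition words :: "'a set \<Rightarrow> nat \<Rightarrow> 'a list set" where
  "words B r = {bs. length bs = r \<and> set bs \<subseteq> B}"

text \<open>The basis in the definition of \<^const>\<open>tip\<close>.\<close>

definition chosen_onb :: "('e, 'x) vbundle \<Rightarrow> 'x \<Rightarrow> 'e set" where
  "chosen_onb E x = (SOME B. onb E x B)"

definition ip_list :: "('e, 'x) vbundle \<Rightarrow> 'e list \<Rightarrow> 'e list \<Rightarrow> complex" where
  "ip_list E us vs = prod_list (map2 (ip E) us vs)"

text \<open>The elementary tensor $v_1 \otimes \dots \otimes v_r$, as a form.\<close>

definition simple_tensor :: "('e, 'x) vbundle \<Rightarrow> 'x \<Rightarrow> 'e list \<Rightarrow> 'e list \<Rightarrow> complex" where
  "simple_tensor E x vs = (\<lambda>us. if us \<in> tup E (length vs) x then ip_list E us vs else 0)"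

lemma words_0 [simp]: "words B 0 = {[]}"
  by (auto simp: words_def)

lemma finite_words: "finite B \<Longrightarrow> finite (words B r)"
  unfolding words_def using finite_lists_length_eq[of B r] by (simp add: conj_commute)

lemma sum_words_Suc:
  assumes "finite B"
  shows "(\<Sum>bs\<in>words B (Suc r). f bs) = (\<Sum>b\<in>B. \<Sum>bs\<in>words B r. f (b # bs))"
proof -
  have "words B (Suc r) = (\<lambda>(b, bs). b # bs) ` (B \<times> words B r)"
    by (auto simp: words_def image_iff length_Suc_conv)
  moreover have "inj_on (\<lambda>(b, bs). b # bs) (B \<times> words B r)"
    by (auto simp: inj_on_def)
  ultimately show ?thesis
    by (simp add: sum.reindex sum.cartesian_product case_prod_unfold)
qed

lemma sum_words_snoc:
  assumes "finite B"
  shows "(\<Sum>bs\<in>words B (Suc r). f bs) = (\<Sum>b\<in>B. \<Sum>bs\<in>words B r. f (bs @ [b]))"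
proof -
  have "words B (Suc r) = (\<lambda>(b, bs). bs @ [b]) ` (B \<times> words B r)"
  proof (intro equalityI subsetI)
    fix ws assume "ws \<in> words B (Suc r)"
    then obtain b bs where "ws = bs @ [b]" "length bs = r" "set ws \<subseteq> B"
      by (auto simp: words_def length_Suc_conv_rev)
    then show "ws \<in> (\<lambda>(b, bs). bs @ [b]) ` (B \<times> words B r)"
      by (auto simp: words_def image_iff)
  qed (auto simp: words_def)
  moreover have "inj_on (\<lambda>(b, bs). bs @ [b]) (B \<times> words B r)"
    by (auto simp: inj_on_def)
  ultimately show ?thesis
    by (simp add: sum.reindex sum.cartesian_product case_prod_unfold)
qed

lemma ip_list_simps [simp]:
  "ip_list E [] [] = 1"
  "ip_list E (u # us) (v # vs) = ip E u v * ip_list E us vs"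
  by (simp_all add: ip_list_def)

lemma ip_list_append: "length us = length vs \<Longrightarrow> ip_list E (us @ us') (vs @ vs') = ip_list E us vs * ip_list E us' vs'"
  by (simp add: ip_list_def)

lemma tup_0 [simp]: "tup E 0 x = {[]}"
  by (auto simp: tup_def)

lemma tup_Cons [simp]: "w # ws \<in> tup E (Suc r) x \<longleftrightarrow> w \<in> fib E x \<and> ws \<in> tup E r x"
  by (auto simp: tup_def)

lemma tup_append_iff: "length us = r \<Longrightarrow> us @ ws \<in> tup E (r + s) x \<longleftrightarrow> us \<in> tup E r x \<and> ws \<in> tup E s x"
  by (auto simp: tup_def)

lemma tup_length: "ws \<in> tup E r x \<Longrightarrow> length ws = r"
  by (simp add: tup_def)

lemma tfib_outside: "\<Phi> \<in> tfib E r x \<Longrightarrow> ws \<notin> tup E r x \<Longrightarrow> \<Phi> ws = 0"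
  by (simp add: tfib_def)

lemma tfib_ext:
  assumes "\<Phi> \<in> tfib E r x" "\<Psi> \<in> tfib E r x" "\<And>ws. ws \<in> tup E r x \<Longrightarrow> \<Phi> ws = \<Psi> ws"
  shows "\<Phi> = \<Psi>"
proof
  fix ws show "\<Phi> ws = \<Psi> ws"
    using assms(3) tfib_outside[OF assms(1), of ws] tfib_outside[OF assms(2), of ws]
    by (cases "ws \<in> tup E r x") auto
qed

lemma tfib_zero [simp]: "(\<lambda>_. 0) \<in> tfib E r x"
  by (simp add: tfib_def)

lemma tfib_add: "\<Phi> \<in> tfib E r x \<Longrightarrow> \<Psi> \<in> tfib E r x \<Longrightarrow> (\<lambda>ws. \<Phi> ws + \<Psi> ws) \<in> tfib E r x"
  unfolding tfib_def by (auto simp: algebra_simps)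

lemma tfib_scl: "\<Phi> \<in> tfib E r x \<Longrightarrow> (\<lambda>ws. c * \<Phi> ws) \<in> tfib E r x"
  unfolding tfib_def by (auto simp: algebra_simps)

lemma tfib_sum: "(\<And>i. i \<in> I \<Longrightarrow> \<Phi> i \<in> tfib E r x) \<Longrightarrow> (\<lambda>ws. \<Sum>i\<in>I. \<Phi> i ws) \<in> tfib E r x"
proof (induction I rule: infinite_finite_induct)
  case (insert i I)
  then show ?case using tfib_add[of "\<Phi> i" E r x "\<lambda>ws. \<Sum>i\<in>I. \<Phi> i ws"] by simp
qed auto

lemma tfib_slot:
  assumes "\<Phi> \<in> tfib E r x" "length us + Suc (length zs) = r" "set us \<subseteq> fib E x" "set zs \<subseteq> fib E x"
  shows "conj_linear E x (\<lambda>v. \<Phi> (us @ v # zs))"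
proof -
  have "us @ v # zs \<in> tup E r x" if "v \<in> fib E x" for v
    using assms that by (auto simp: tup_def)
  then show ?thesis using assms(1) unfolding tfib_def conj_linear_def by blast
qed

text \<open>Both a Hermitian bundle over a compact space and the bundle over a point that each of its fibres
  forms are of this kind. By \<open>diff_zero_eq\<close> and definiteness, vectors of a fibre with
  the same scalar products are equal.\<close>

locale framed_bundle =
  fixes E :: "('e, 'x) vbundle"
  assumes compact_base: "compact_space (base E)"
    and Hausdorff_base: "Hausdorff_space (base E)"
    and fib_base: "v \<in> fib E x \<Longrightarrow> x \<in> topspace (base E)"
    and vadd_fib: "v \<in> fib E x \<Longrightarrow> w \<in> fib E x \<Longrightarrow> vadd E v w \<in> fib E x"
    and vscl_fib: "v \<in> fib E x \<Longrightarrow> vscl E c v \<in> fib E x"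
    and ip_vadd: "u \<in> fib E x \<Longrightarrow> v \<in> fib E x \<Longrightarrow> w \<in> fib E x \<Longrightarrow>
                   ip E u (vadd E v w) = ip E u v + ip E u w"
    and ip_vscl: "u \<in> fib E x \<Longrightarrow> v \<in> fib E x \<Longrightarrow> ip E u (vscl E c v) = c * ip E u v"
    and ip_cnj: "u \<in> fib E x \<Longrightarrow> v \<in> fib E x \<Longrightarrow> ip E v u = cnj (ip E u v)"
    and ip_definite: "v \<in> fib E x \<Longrightarrow> vscl E 0 v \<noteq> v \<Longrightarrow> 0 < Re (ip E v v)"
    and diff_zero_eq: "v \<in> fib E x \<Longrightarrow> w \<in> fib E x \<Longrightarrow>
           vscl E 0 (vadd E v (vscl E (- 1) w)) = vadd E v (vscl E (- 1) w) \<Longrightarrow> v = w"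
    and local_frame: "x \<in> topspace (base E) \<Longrightarrow> \<exists>U n s. openin (base E) U \<and> x \<in> U \<and> frame E U n s"
    and local_section_exists:
      "x \<in> topspace (base E) \<Longrightarrow> \<exists>U \<sigma>. openin (base E) U \<and> x \<in> U \<and> local_section E U \<sigma>"
    and section_ip_continuous: "openin (base E) U \<Longrightarrow> local_section E U \<sigma> \<Longrightarrow> local_section E U \<tau> \<Longrightarrow>
           continuous_map (subtopology (base E) U) euclidean (\<lambda>y. ip E (\<sigma> y) (\<tau> y))"
begin

lemma conj_linear_ip: "u \<in> fib E x \<Longrightarrow> conj_linear E x (\<lambda>v. ip E v u)"
proof -
  assume u: "u \<in> fib E x"
  show ?thesis
    unfolding conj_linear_def
  proof (intro conjI ballI allI)
    fix v w assume "v \<in> fib E x" "w \<in> fib E x"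
    then show "ip E (vadd E v w) u = ip E v u + ip E w u"
      using u ip_cnj[of u x] ip_vadd[of u x v w] vadd_fib[of v x w] by simp
  next
    fix v c assume "v \<in> fib E x"
    then show "ip E (vscl E c v) u = cnj c * ip E v u"
      using u ip_cnj[of u x] ip_vscl[of u x v c] vscl_fib[of v x c] by simp
  qed
qed

text \<open>Fibres are sets with operations and not types, so that \<^const>\<open>sum\<close> does not apply to
  vectors. A linear combination is characterised by its values under conjugate linear functionals
  instead.\<close>

lemma lincomb:
  assumes "finite B" "v0 \<in> fib E x" "\<And>b. b \<in> B \<Longrightarrow> f b \<in> fib E x"
  obtains s where "s \<in> fib E x" "\<And>L. conj_linear E x L \<Longrightarrow> L s = (\<Sum>b\<in>B. cnj (c b) * L (f b))"
proof -
  have "\<exists>s\<in>fib E x. \<forall>L. conj_linear E x L \<longrightarrow> L s = (\<Sum>b\<in>B. cnj (c b) * L (f b))"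
    using assms(1,3)
  proof (induction B rule: finite_induct)
    case empty
    have "L (vscl E 0 v0) = 0" if "conj_linear E x L" for L
      using that assms(2) by (simp add: conj_linear_def)
    then show ?case
      using vscl_fib[OF assms(2)] by (intro bexI[of _ "vscl E 0 v0"]) auto
  next
    case (insert b B)
    then obtain s where s: "s \<in> fib E x" "\<forall>L. conj_linear E x L \<longrightarrow> L s = (\<Sum>b\<in>B. cnj (c b) * L (f b))"
      by auto
    have b: "f b \<in> fib E x" using insert by simp
    have "L (vadd E (vscl E (c b) (f b)) s) = (\<Sum>b\<in>insert b B. cnj (c b) * L (f b))"
      if "conj_linear E x L" for L
      using that s b insert vscl_fib[of "f b" x "c b"] by (simp add: conj_linear_def)
    then show ?case using s b vadd_fib vscl_fib by blast
  qed
  then show ?thesis using that by blast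
qed

lemma conj_linear_zero: "conj_linear E x L \<Longrightarrow> v \<in> fib E x \<Longrightarrow> vscl E 0 v = v \<Longrightarrow> L v = 0"
  unfolding conj_linear_def by (metis complex_cnj_zero mult_zero_left)

text \<open>The linear combination $\sum_b \langle b, v\rangle b$ has the same scalar products with
  \<open>B\<close> as \<open>v\<close>; completeness of the basis makes it equal to
  \<open>v\<close>, and \<open>L\<close> can be evaluated on it.\<close>

lemma onb_expand:
  assumes B: "onb E x B" and L: "conj_linear E x L" and v: "v \<in> fib E x"
  shows "L v = (\<Sum>b\<in>B. ip E v b * L b)"
proof -
  have fin: "finite B" and sub: "\<And>b. b \<in> B \<Longrightarrow> b \<in> fib E x"
    and on: "\<And>a b. a \<in> B \<Longrightarrow> b \<in> B \<Longrightarrow> ip E a b = (if a = b then 1 else 0)"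
    and compl: "\<And>v. v \<in> fib E x \<Longrightarrow> (\<And>b. b \<in> B \<Longrightarrow> ip E b v = 0) \<Longrightarrow> vscl E 0 v = v"
    using B by (auto simp: onb_def)
  obtain s where s: "s \<in> fib E x" "\<And>L. conj_linear E x L \<Longrightarrow> L s = (\<Sum>b\<in>B. cnj (ip E b v) * L b)"
    using lincomb[of B v x "\<lambda>b. b" "\<lambda>b. ip E b v"] fin sub v by auto
  define w where "w = vadd E v (vscl E (-1) s)"
  have w: "w \<in> fib E x" unfolding w_def using v s vadd_fib vscl_fib by blast
  have Lw: "L w = L v - L s" if "conj_linear E x L" for L
    using that v s vscl_fib[of s x "-1"] unfolding w_def conj_linear_def by simp
  have "ip E b w = 0" if b: "b \<in> B" for b
  proof -
    have "ip E s b = (\<Sum>a\<in>B. cnj (ip E a v) * ip E a b)"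
      using s(2)[OF conj_linear_ip[OF sub[OF b]]] .
    also have "\<dots> = (\<Sum>a\<in>B. if a = b then cnj (ip E a v) else 0)"
      using on b by (intro sum.cong) auto
    also have "\<dots> = cnj (ip E b v)" using fin b by simp
    also have "\<dots> = ip E v b" using ip_cnj[of b x v] sub b v by simp
    finally have "ip E w b = 0" using Lw[OF conj_linear_ip[OF sub[OF b]]] by simp
    then show ?thesis using ip_cnj[of w x b] w sub b by simp
  qed
  then have "vscl E 0 w = w" using compl w by blast
  then have "L w = 0" using conj_linear_zero L w by blast
  then have "L v = L s" using Lw[OF L] by simp
  also have "\<dots> = (\<Sum>b\<in>B. cnj (ip E b v) * L b)" using s L by blast
  also have "\<dots> = (\<Sum>b\<in>B. ip E v b * L b)"
    using ip_cnj[of _ x v] sub v by (intro sum.cong) auto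
  finally show ?thesis .
qed

lemma local_section_fib: "local_section E U \<sigma> \<Longrightarrow> y \<in> topspace (base E) \<inter> U \<Longrightarrow> \<sigma> y \<in> fib E y"
  unfolding local_section_def fib_def
  using continuous_map_image_subset_topspace[of "subtopology (base E) U" "tot E" \<sigma>] by auto

lemma frame_fib: "frame E U n s \<Longrightarrow> U \<subseteq> topspace (base E) \<Longrightarrow> i < n \<Longrightarrow> y \<in> U \<Longrightarrow> s i y \<in> fib E y"
proof -
  assume *: "frame E U n s" "U \<subseteq> topspace (base E)" "i < n" "y \<in> U"
  then have "local_section E U (s i)" by (simp add: frame_def)
  then show ?thesis using *(2,4) local_section_fib by blast
qed

lemma frame_ip: "frame E U n s \<Longrightarrow> y \<in> U \<Longrightarrow> i < n \<Longrightarrow> j < n \<Longrightarrow> ip E (s i y) (s j y) = (if i = j then 1 else 0)"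
  unfolding frame_def by blast

lemma frame_inj: "frame E U n s \<Longrightarrow> y \<in> U \<Longrightarrow> inj_on (\<lambda>i. s i y) {..<n}"
proof (rule inj_onI, rule ccontr)
  fix i j assume *: "frame E U n s" "y \<in> U" "i \<in> {..<n}" "j \<in> {..<n}" "s i y = s j y" "i \<noteq> j"
  then have h: "ip E (s i y) (s i y) = 1" "ip E (s i y) (s j y) = 0"
    using frame_ip[OF *(1,2), of i i] frame_ip[OF *(1,2), of i j] by simp_all
  from h(1) h(2)[folded *(5)] show False by simp
qed

lemma frame_onb:
  assumes "frame E U n s" "U \<subseteq> topspace (base E)" "y \<in> U"
  shows "onb E y ((\<lambda>i. s i y) ` {..<n})"
  unfolding onb_def
proof (intro conjI ballI impI)
  show "(\<lambda>i. s i y) ` {..<n} \<subseteq> fib E y" using frame_fib[OF assms(1,2)] assms(3) by auto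
  fix a b assume "a \<in> (\<lambda>i. s i y) ` {..<n}" "b \<in> (\<lambda>i. s i y) ` {..<n}"
  then show "ip E a b = (if a = b then 1 else 0)"
  proof (elim imageE)
    fix i j assume *: "a = s i y" "b = s j y" "i \<in> {..<n}" "j \<in> {..<n}"
    have "ip E (s i y) (s j y) = (if i = j then 1 else 0)"
      using frame_ip[OF assms(1,3)] *(3,4) by blast
    moreover have "s i y = s j y \<longleftrightarrow> i = j" using inj_on_eq_iff[OF frame_inj[OF assms(1,3)] *(3,4)] .
    ultimately show ?thesis unfolding * by simp
  qed
next
  fix v assume "v \<in> fib E y" "\<forall>b\<in>(\<lambda>i. s i y) ` {..<n}. ip E b v = 0"
  then show "vscl E 0 v = v" using assms(1,3) unfolding frame_def by blast
qed simp

lemma onb_chosen_onb: "x \<in> topspace (base E) \<Longrightarrow> onb E x (chosen_onb E x)"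
proof -
  assume "x \<in> topspace (base E)"
  then obtain U n s where "openin (base E) U" "x \<in> U" "frame E U n s" using local_frame by blast
  then have "onb E x ((\<lambda>i. s i x) ` {..<n})" using frame_onb openin_subset by blast
  then show "onb E x (chosen_onb E x)" unfolding chosen_onb_def by (rule someI)
qed

lemma finite_chosen_onb: "x \<in> topspace (base E) \<Longrightarrow> finite (chosen_onb E x)"
  using onb_chosen_onb by (simp add: onb_def)

lemma words_onb_tup: "onb E x B \<Longrightarrow> bs \<in> words B r \<Longrightarrow> bs \<in> tup E r x"
  by (auto simp: onb_def words_def tup_def)

text \<open>Expansion of one variable after the other; the prefix \<open>us\<close> holds the variables that are
  not expanded.\<close>

lemma tfib_expand_append:
  assumes B: "onb E x B" and "us @ ws \<in> tup E r x" and \<Phi>: "\<Phi> \<in> tfib E r x"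
  shows "\<Phi> (us @ ws) = (\<Sum>bs\<in>words B (length ws). ip_list E ws bs * \<Phi> (us @ bs))"
  using assms(2)
proof (induction ws arbitrary: us)
  case Nil
  then show ?case by simp
next
  case (Cons w ws)
  have fin: "finite B" and sub: "B \<subseteq> fib E x" using B by (auto simp: onb_def)
  have t: "set us \<subseteq> fib E x" "set ws \<subseteq> fib E x" "w \<in> fib E x" "length us + Suc (length ws) = r"
    using Cons.prems by (auto simp: tup_def)
  have IH: "\<Phi> (us @ b # ws) = (\<Sum>bs\<in>words B (length ws). ip_list E ws bs * \<Phi> (us @ b # bs))" if "b \<in> B" for b
  proof -
    have "(us @ [b]) @ ws \<in> tup E r x" using t that sub by (auto simp: tup_def)
    from Cons.IH[OF this] show ?thesis by simp
  qed
  have "\<Phi> (us @ w # ws) = (\<Sum>b\<in>B. ip E w b * \<Phi> (us @ b # ws))"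
    using onb_expand[OF B tfib_slot[OF \<Phi> t(4,1,2)] t(3)] .
  also have "\<dots> = (\<Sum>b\<in>B. \<Sum>bs\<in>words B (length ws). ip_list E (w # ws) (b # bs) * \<Phi> (us @ b # bs))"
    using IH by (simp add: sum_distrib_left mult_ac)
  also have "\<dots> = (\<Sum>bs\<in>words B (Suc (length ws)). ip_list E (w # ws) bs * \<Phi> (us @ bs))"
    by (simp only: sum_words_Suc[OF fin])
  finally show ?case by simp
qed

lemma tfib_expand:
  assumes "onb E x B" "ws \<in> tup E r x" "\<Phi> \<in> tfib E r x"
  shows "\<Phi> ws = (\<Sum>bs\<in>words B r. ip_list E ws bs * \<Phi> bs)"
  using tfib_expand_append[OF assms(1) _ assms(3), of "[]" ws] assms(2) tup_length[OF assms(2)]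
  by (simp only: append_Nil)

lemma cnj_ip_list:
  assumes "us \<in> tup E r x" "vs \<in> tup E r x"
  shows "cnj (ip_list E us vs) = ip_list E vs us"
proof -
  have "length us = length vs" using assms by (simp add: tup_def)
  moreover have "set us \<subseteq> fib E x" "set vs \<subseteq> fib E x" using assms by (auto simp: tup_def)
  ultimately show ?thesis
  proof (induction us vs rule: list_induct2)
    case (Cons u us v vs)
    then have "ip E v u = cnj (ip E u v)" using ip_cnj[of u x v] by simp
    then show ?case using Cons by simp
  qed simp
qed

lemma ip_list_conj_linear:
  assumes "length us = length vs1" "length zs = length vs2" "v1 \<in> fib E x"
  shows "conj_linear E x (\<lambda>v. ip_list E (us @ v # zs) (vs1 @ v1 # vs2))"
  using conj_linear_ip[OF assms(3)]
  by (simp add: conj_linear_def ip_list_append[OF assms(1)] algebra_simps)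

lemma simple_tensor_tfib:
  assumes "vs \<in> tup E r x"
  shows "simple_tensor E x vs \<in> tfib E r x"
proof -
  have l: "length vs = r" using tup_length[OF assms] .
  have sl: "conj_linear E x (\<lambda>v. ip_list E (us @ v # zs) vs)" if "us @ v # zs \<in> tup E r x" for us v zs
  proof -
    have len: "length us + Suc (length zs) = length vs" using that l by (auto simp: tup_def)
    then have eq: "vs = take (length us) vs @ vs ! length us # drop (Suc (length us)) vs"
      by (intro id_take_nth_drop) simp
    have "vs ! length us \<in> fib E x" using assms len by (auto simp: tup_def)
    then show ?thesis
      by (subst eq) (use len in \<open>auto intro!: ip_list_conj_linear\<close>)
  qed
  have in1: "us @ vadd E v w # zs \<in> tup E r x" "us @ w # zs \<in> tup E r x"
    if "us @ v # zs \<in> tup E r x" "w \<in> fib E x" for us v w zs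
    using that vadd_fib by (auto simp: tup_def)
  have in2: "us @ vscl E c v # zs \<in> tup E r x" if "us @ v # zs \<in> tup E r x" for us v c zs
    using that vscl_fib by (auto simp: tup_def)
  have in3: "v \<in> fib E x" if "us @ v # zs \<in> tup E r x" for us v zs
    using that by (auto simp: tup_def)
  show ?thesis
    unfolding tfib_def simple_tensor_def l
  proof (intro CollectI conjI allI impI; (elim conjE)?)
    fix us v w zs assume v: "us @ v # zs \<in> tup E r x" "w \<in> fib E x"
    then show "(if us @ vadd E v w # zs \<in> tup E r x then ip_list E (us @ vadd E v w # zs) vs else 0) =
       (if us @ v # zs \<in> tup E r x then ip_list E (us @ v # zs) vs else 0) +
       (if us @ w # zs \<in> tup E r x then ip_list E (us @ w # zs) vs else 0)"
      using sl[OF v(1)] in1[OF v] in3[OF v(1)] by (simp add: conj_linear_def)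
  next
    fix us v zs c assume v: "us @ v # zs \<in> tup E r x"
    then show "(if us @ vscl E c v # zs \<in> tup E r x then ip_list E (us @ vscl E c v # zs) vs else 0) =
       cnj c * (if us @ v # zs \<in> tup E r x then ip_list E (us @ v # zs) vs else 0)"
      using sl[OF v(1)] in2[OF v] in3[OF v(1)] by (simp add: conj_linear_def)
  qed simp
qed

lemma tip_words: "tip E r x \<Phi> \<Psi> = (\<Sum>bs\<in>words (chosen_onb E x) r. cnj (\<Phi> bs) * \<Psi> bs)"
  by (simp add: tip_def words_def chosen_onb_def)

text \<open>The scalar product is defined by a sum over a basis; the expansion of \<open>\<Phi>\<close> in that
  basis evaluates it. This identity is the reason for realising tensors as forms.\<close>

lemma tip_simple_tensor:
  assumes x: "x \<in> topspace (base E)" and vs: "vs \<in> tup E r x" and "\<Phi> \<in> tfib E r x"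
  shows "tip E r x (simple_tensor E x vs) \<Phi> = \<Phi> vs"
proof -
  have l: "length vs = r" using tup_length[OF vs] .
  show ?thesis
    using tfib_expand[OF onb_chosen_onb[OF x] vs assms(3)] cnj_ip_list[OF _ vs] words_onb_tup[OF onb_chosen_onb[OF x]]
    by (auto simp: tip_words simple_tensor_def l intro!: sum.cong)
qed

lemma tip_cnj: "cnj (tip E r x \<Phi> \<Psi>) = tip E r x \<Psi> \<Phi>"
  by (simp add: tip_words mult.commute)

lemma tip_simple_tensor_right:
  assumes "x \<in> topspace (base E)" "vs \<in> tup E r x" "\<Phi> \<in> tfib E r x"
  shows "tip E r x \<Phi> (simple_tensor E x vs) = cnj (\<Phi> vs)"
  using tip_simple_tensor[OF assms] tip_cnj by metis

lemma tip_sum_right: "tip E r x \<Phi> (\<lambda>ws. \<Sum>i\<in>I. c i * \<Psi> i ws) = (\<Sum>i\<in>I. c i * tip E r x \<Phi> (\<Psi> i))"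
  unfolding tip_words by (simp add: sum_distrib_left sum.swap[of _ I] mult_ac)

lemma tip_sum_left: "tip E r x (\<lambda>ws. \<Sum>i\<in>I. c i * \<Psi> i ws) \<Phi> = (\<Sum>i\<in>I. cnj (c i) * tip E r x (\<Psi> i) \<Phi>)"
  unfolding tip_words by (simp add: sum_distrib_left sum_distrib_right sum.swap[of _ I] mult_ac)

lemma tfib_simple_tensor_sum:
  assumes "onb E x B" "\<Phi> \<in> tfib E r x"
  shows "\<Phi> = (\<lambda>ws. \<Sum>bs\<in>words B r. \<Phi> bs * simple_tensor E x bs ws)"
proof (rule tfib_ext[OF assms(2)])
  show "(\<lambda>ws. \<Sum>bs\<in>words B r. \<Phi> bs * simple_tensor E x bs ws) \<in> tfib E r x"
    using simple_tensor_tfib words_onb_tup[OF assms(1)] by (intro tfib_sum tfib_scl) blast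
  fix ws assume ws: "ws \<in> tup E r x"
  show "\<Phi> ws = (\<Sum>bs\<in>words B r. \<Phi> bs * simple_tensor E x bs ws)"
    unfolding tfib_expand[OF assms(1) ws assms(2)]
    using ws by (intro sum.cong) (auto simp: simple_tensor_def words_def)
qed

text \<open>Independence of the basis, as the previous identities characterise the scalar product on simple
  tensors.\<close>

lemma tip_onb:
  assumes x: "x \<in> topspace (base E)" and B: "onb E x B" and \<Phi>: "\<Phi> \<in> tfib E r x" and \<Psi>: "\<Psi> \<in> tfib E r x"
  shows "tip E r x \<Phi> \<Psi> = (\<Sum>bs\<in>words B r. cnj (\<Phi> bs) * \<Psi> bs)"
proof -
  have "tip E r x \<Phi> \<Psi> = tip E r x \<Phi> (\<lambda>ws. \<Sum>bs\<in>words B r. \<Psi> bs * simple_tensor E x bs ws)"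
    using tfib_simple_tensor_sum[OF B \<Psi>] by simp
  also have "\<dots> = (\<Sum>bs\<in>words B r. \<Psi> bs * tip E r x \<Phi> (simple_tensor E x bs))"
    by (rule tip_sum_right)
  also have "\<dots> = (\<Sum>bs\<in>words B r. cnj (\<Phi> bs) * \<Psi> bs)"
    using tip_simple_tensor_right[OF x _ \<Phi>] words_onb_tup[OF B] by (intro sum.cong) auto
  finally show ?thesis .
qed

lemma tip_self: "tip E r x \<Phi> \<Phi> = complex_of_real (\<Sum>bs\<in>words (chosen_onb E x) r. (cmod (\<Phi> bs))\<^sup>2)"
  unfolding tip_words of_real_sum by (intro sum.cong refl) (metis complex_norm_square mult.commute)

lemma tip_zero_imp:
  assumes x: "x \<in> topspace (base E)" and \<Phi>: "\<Phi> \<in> tfib E r x" and "tip E r x \<Phi> \<Phi> = 0"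
  shows "\<Phi> = (\<lambda>_. 0)"
proof (rule tfib_ext[OF \<Phi> tfib_zero])
  fix ws assume ws: "ws \<in> tup E r x"
  have "(\<Sum>bs\<in>words (chosen_onb E x) r. (cmod (\<Phi> bs))\<^sup>2) = 0"
    using assms(3) unfolding tip_self of_real_eq_0_iff .
  then have "\<And>bs. bs \<in> words (chosen_onb E x) r \<Longrightarrow> \<Phi> bs = 0"
    using sum_nonneg_eq_0_iff[OF finite_words[OF finite_chosen_onb[OF x]], of r "\<lambda>bs. (cmod (\<Phi> bs))\<^sup>2"] by simp
  then show "\<Phi> ws = 0" using tfib_expand[OF onb_chosen_onb[OF x] ws \<Phi>] by simp
qed

end

section \<open>Topology and morphisms of the tensor powers\<close>

text \<open>The linear map of the fibres over \<open>x\<close> that belongs to the morphism \<open>t\<close>.\<close>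

definition act :: "('e, 'x) tmor \<Rightarrow> 'x \<Rightarrow> ('e list \<Rightarrow> complex) \<Rightarrow> 'e list \<Rightarrow> complex" where
  "act t x \<Phi> = snd (t (x, \<Phi>))"

text \<open>The morphism with the given maps of fibres. Together with \<open>act\<close> it reduces statements
  about morphisms to statements about linear maps of forms.\<close>

definition tmor_of ::
  "('e, 'x) vbundle \<Rightarrow> nat \<Rightarrow> ('x \<Rightarrow> ('e list \<Rightarrow> complex) \<Rightarrow> 'e list \<Rightarrow> complex) \<Rightarrow> ('e, 'x) tmor" where
  "tmor_of E r T = (\<lambda>(x, \<Phi>)\<in>topspace (ttop E r). (x, T x \<Phi>))"

definition tlinear ::
  "('e, 'x) vbundle \<Rightarrow> nat \<Rightarrow> nat \<Rightarrow> 'x \<Rightarrow> (('e list \<Rightarrow> complex) \<Rightarrow> 'e list \<Rightarrow> complex) \<Rightarrow> bool" where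
  "tlinear E r s x T \<longleftrightarrow>
     (\<forall>\<Phi>\<in>tfib E r x. T \<Phi> \<in> tfib E s x \<and> (\<forall>c. T (\<lambda>ws. c * \<Phi> ws) = (\<lambda>ws. c * T \<Phi> ws)) \<and>
        (\<forall>\<Psi>\<in>tfib E r x. T (\<lambda>ws. \<Phi> ws + \<Psi> ws) = (\<lambda>ws. T \<Phi> ws + T \<Psi> ws)))"

definition eval_secs :: "('x \<Rightarrow> 'e) list \<Rightarrow> 'x \<Rightarrow> 'e list" where
  "eval_secs \<sigma>s x = map (\<lambda>\<sigma>. \<sigma> x) \<sigma>s"

text \<open>The data of a subbasic coordinate function on the total space of the tensor power.\<close>

definition section_list :: "('e, 'x) vbundle \<Rightarrow> 'x set \<Rightarrow> nat \<Rightarrow> ('x \<Rightarrow> 'e) list \<Rightarrow> bool" where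
  "section_list E U r \<sigma>s \<longleftrightarrow> openin (base E) U \<and> length \<sigma>s = r \<and> (\<forall>\<sigma>\<in>set \<sigma>s. local_section E U \<sigma>)"

lemma tpow_simps [simp]:
  "base (tpow E r) = base E" "tot (tpow E r) = ttop E r" "prj (tpow E r) = fst"
  "vadd (tpow E r) (x, \<Phi>) (y, \<Psi>) = (x, \<lambda>ws. \<Phi> ws + \<Psi> ws)"
  "vscl (tpow E r) c (x, \<Phi>) = (x, \<lambda>ws. c * \<Phi> ws)"
  "ip (tpow E r) (x, \<Phi>) (y, \<Psi>) = tip E r x \<Phi> \<Psi>"
  by (simp_all add: tpow_def)

lemma mor_vadd: "t \<in> mor E F \<Longrightarrow> v \<in> fib E x \<Longrightarrow> w \<in> fib E x \<Longrightarrow> t (vadd E v w) = vadd F (t v) (t w)"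
  unfolding mor_def by blast

lemma mor_vscl: "t \<in> mor E F \<Longrightarrow> v \<in> fib E x \<Longrightarrow> t (vscl E c v) = vscl F c (t v)"
  unfolding mor_def by blast

lemma mor_prj: "t \<in> mor E F \<Longrightarrow> v \<in> topspace (tot E) \<Longrightarrow> prj F (t v) = prj E v"
  unfolding mor_def by blast

lemma continuous_map_local:
  assumes "\<And>z. z \<in> topspace Z \<Longrightarrow> \<exists>W. openin Z W \<and> z \<in> W \<and> continuous_map (subtopology Z W) Y f"
  shows "continuous_map Z Y f"
proof -
  obtain W where W: "\<And>z. z \<in> topspace Z \<Longrightarrow> openin Z (W z) \<and> z \<in> W z \<and> continuous_map (subtopology Z (W z)) Y f"
    using assms by metis
  show ?thesis
    by (rule pasting_lemma[where I = "topspace Z" and T = W and f = "\<lambda>_. f"]) (use W in auto)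
qed

lemma continuous_map_complex_mult:
  "continuous_map X euclidean f \<Longrightarrow> continuous_map X euclidean g \<Longrightarrow>
    continuous_map X euclidean (\<lambda>x. f x * g x :: complex)"
  by (simp add: continuous_map_atin tendsto_mult)

lemma continuous_map_cnj:
  "continuous_map X euclidean f \<Longrightarrow> continuous_map X euclidean (\<lambda>x. cnj (f x))"
  by (simp add: continuous_map_atin tendsto_cnj)

lemma words_image: "words (h ` A) r = map h ` words A r"
proof (intro equalityI subsetI)
  fix bs assume "bs \<in> words (h ` A) r"
  then have bs: "length bs = r" "set bs \<subseteq> h ` A" by (auto simp: words_def)
  let ?g = "inv_into A h"
  have "bs = map h (map ?g bs)"
    using bs(2) by (auto simp: f_inv_into_f intro!: map_idI[symmetric])
  moreover have "map ?g bs \<in> words A r"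
    using bs by (auto simp: words_def intro!: inv_into_into)
  ultimately show "bs \<in> map h ` words A r" by blast
next
  fix bs assume "bs \<in> map h ` words A r"
  then obtain as where "bs = map h as" "as \<in> words A r" by blast
  then show "bs \<in> words (h ` A) r" using image_mono[of "set as" A h] by (simp add: words_def)
qed

lemma sum_words_image:
  assumes "inj_on h A"
  shows "(\<Sum>bs\<in>words (h ` A) r. f bs) = (\<Sum>is\<in>words A r. f (map h is))"
proof -
  have "inj_on (map h) (words A r)"
  proof (rule inj_onI)
    fix xs ys assume xy: "xs \<in> words A r" "ys \<in> words A r" "map h xs = map h ys"
    then have "inj_on h (set xs \<union> set ys)" using inj_on_subset[OF assms] by (simp add: words_def)
    then show "xs = ys" by (rule map_inj_on[OF xy(3)])
  qed
  then show ?thesis unfolding words_image by (simp add: sum.reindex)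
qed

lemma tlinear_fib: "tlinear E r s x T \<Longrightarrow> \<Phi> \<in> tfib E r x \<Longrightarrow> T \<Phi> \<in> tfib E s x"
  by (simp add: tlinear_def)

lemma tlinear_scl: "tlinear E r s x T \<Longrightarrow> \<Phi> \<in> tfib E r x \<Longrightarrow> T (\<lambda>ws. c * \<Phi> ws) = (\<lambda>ws. c * T \<Phi> ws)"
  by (simp add: tlinear_def)

lemma tlinear_add: "tlinear E r s x T \<Longrightarrow> \<Phi> \<in> tfib E r x \<Longrightarrow> \<Psi> \<in> tfib E r x \<Longrightarrow>
    T (\<lambda>ws. \<Phi> ws + \<Psi> ws) = (\<lambda>ws. T \<Phi> ws + T \<Psi> ws)"
  by (simp add: tlinear_def)

lemma tlinear_zero: "tlinear E r s x T \<Longrightarrow> T (\<lambda>_. 0) = (\<lambda>_. 0)"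
  using tlinear_scl[of E r s x T "\<lambda>_. 0" 0] by simp

lemma tlinear_sum:
  assumes "tlinear E r s x T" "finite I" "\<And>i. i \<in> I \<Longrightarrow> \<Phi> i \<in> tfib E r x"
  shows "T (\<lambda>ws. \<Sum>i\<in>I. c i * \<Phi> i ws) = (\<lambda>ws. \<Sum>i\<in>I. c i * T (\<Phi> i) ws)"
  using assms(2,3)
proof (induction I rule: finite_induct)
  case empty
  then show ?case using tlinear_zero[OF assms(1)] by simp
next
  case (insert i I)
  have "(\<lambda>ws. \<Sum>i\<in>I. c i * \<Phi> i ws) \<in> tfib E r x"
    using insert.prems by (intro tfib_sum tfib_scl) auto
  moreover have "(\<lambda>ws. c i * \<Phi> i ws) \<in> tfib E r x"
    using insert.prems by (intro tfib_scl) auto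
  ultimately show ?case
    using tlinear_add[OF assms(1), of "\<lambda>ws. c i * \<Phi> i ws" "\<lambda>ws. \<Sum>i\<in>I. c i * \<Phi> i ws"]
      tlinear_scl[OF assms(1), of "\<Phi> i" "c i"] insert by simp
qed

lemma tlinear_compose: "tlinear E r s x T \<Longrightarrow> tlinear E s q x T' \<Longrightarrow> tlinear E r q x (\<lambda>\<Phi>. T' (T \<Phi>))"
  by (simp add: tlinear_def)

lemma eval_secs_simps [simp]: "eval_secs [] x = []" "eval_secs (\<sigma> # \<sigma>s) x = \<sigma> x # eval_secs \<sigma>s x"
  "eval_secs (\<sigma>s @ \<tau>s) x = eval_secs \<sigma>s x @ eval_secs \<tau>s x" "length (eval_secs \<sigma>s x) = length \<sigma>s"
  by (simp_all add: eval_secs_def)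

lemma local_section_mono: "local_section E U \<sigma> \<Longrightarrow> V \<subseteq> U \<Longrightarrow> local_section E V \<sigma>"
  unfolding local_section_def using continuous_map_from_subtopology_mono by blast

lemma section_list_mono: "section_list E U r \<sigma>s \<Longrightarrow> openin (base E) V \<Longrightarrow> V \<subseteq> U \<Longrightarrow> section_list E V r \<sigma>s"
  unfolding section_list_def using local_section_mono by blast

lemma ttop_open:
  assumes "section_list E U r \<sigma>s" "open W"
  shows "openin (ttop E r) {(x, \<Phi>). x \<in> U \<and> \<Phi> \<in> tfib E r x \<and> \<Phi> (eval_secs \<sigma>s x) \<in> W}"
  unfolding ttop_def by (rule topology_generated_by_Basis) (use assms in \<open>auto simp: section_list_def eval_secs_def\<close>)

context framed_bundle
begin

lemma section_list_tup: "section_list E U r \<sigma>s \<Longrightarrow> x \<in> U \<Longrightarrow> eval_secs \<sigma>s x \<in> tup E r x"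
  unfolding section_list_def tup_def eval_secs_def
  using local_section_fib[of U _ x] openin_subset[of "base E" U] by auto

lemma section_list_exists:
  assumes "x \<in> topspace (base E)"
  obtains U \<sigma>s where "section_list E U r \<sigma>s" "x \<in> U"
proof -
  obtain U \<sigma> where "openin (base E) U" "x \<in> U" "local_section E U \<sigma>"
    using local_section_exists[OF assms] by blast
  then show ?thesis using that[of U "replicate r \<sigma>"] by (simp add: section_list_def)
qed

lemma fib_nonempty: "x \<in> topspace (base E) \<Longrightarrow> \<exists>v. v \<in> fib E x"
  using local_section_exists[of x] local_section_fib[of _ _ x] by blast

lemma topspace_ttop: "topspace (ttop E r) = {(x, \<Phi>). x \<in> topspace (base E) \<and> \<Phi> \<in> tfib E r x}"
proof (intro equalityI subsetI)
  fix v assume "v \<in> topspace (ttop E r)"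
  then show "v \<in> {(x, \<Phi>). x \<in> topspace (base E) \<and> \<Phi> \<in> tfib E r x}"
    unfolding ttop_def topology_generated_by_topspace using openin_subset by fast
next
  fix v assume "v \<in> {(x, \<Phi>). x \<in> topspace (base E) \<and> \<Phi> \<in> tfib E r x}"
  then obtain x \<Phi> where v: "v = (x, \<Phi>)" "x \<in> topspace (base E)" "\<Phi> \<in> tfib E r x" by auto
  obtain U \<sigma>s where "section_list E U r \<sigma>s" "x \<in> U" using section_list_exists[OF v(2)] .
  then show "v \<in> topspace (ttop E r)"
    using openin_subset[OF ttop_open[of E U r \<sigma>s UNIV]] v by auto
qed

lemma mem_ttop [simp]: "(x, \<Phi>) \<in> topspace (ttop E r) \<longleftrightarrow> x \<in> topspace (base E) \<and> \<Phi> \<in> tfib E r x"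
  by (simp add: topspace_ttop)

lemma fib_tpow: "v \<in> fib (tpow E r) x \<longleftrightarrow> (\<exists>\<Phi>. v = (x, \<Phi>) \<and> x \<in> topspace (base E) \<and> \<Phi> \<in> tfib E r x)"
  by (cases v) (auto simp: fib_def)

text \<open>The topology of a tensor power is initial for the projection and the coefficients along local
  sections, the latter being defined only over open subsets of the base.\<close>

lemma continuous_into_ttop:
  assumes 1: "\<And>z. z \<in> topspace Z \<Longrightarrow> f z \<in> topspace (ttop E r)"
    and 2: "continuous_map Z (base E) (\<lambda>z. fst (f z))"
    and 3: "\<And>U \<sigma>s. section_list E U r \<sigma>s \<Longrightarrow>
       continuous_map (subtopology Z {z \<in> topspace Z. fst (f z) \<in> U}) euclidean (\<lambda>z. snd (f z) (eval_secs \<sigma>s (fst (f z))))"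
  shows "continuous_map Z (ttop E r) f"
  unfolding ttop_def
proof (rule continuous_on_generated_topo)
  fix S
  assume "S \<in> {{(x, \<Phi>). x \<in> U \<and> \<Phi> \<in> tfib E r x \<and> \<Phi> (map (\<lambda>\<sigma>. \<sigma> x) \<sigma>s) \<in> W} | U \<sigma>s W.
        openin (base E) U \<and> length \<sigma>s = r \<and> (\<forall>\<sigma>\<in>set \<sigma>s. local_section E U \<sigma>) \<and> open W}"
  then obtain U \<sigma>s W where S: "S = {(x, \<Phi>). x \<in> U \<and> \<Phi> \<in> tfib E r x \<and> \<Phi> (eval_secs \<sigma>s x) \<in> W}"
    and U: "section_list E U r \<sigma>s" and W: "open W"
    unfolding section_list_def eval_secs_def by blast
  let ?V = "{z \<in> topspace Z. fst (f z) \<in> U}"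
  have V: "openin Z ?V"
    using 2 U unfolding continuous_map_def section_list_def by auto
  have "openin (subtopology Z ?V) {z \<in> topspace (subtopology Z ?V). snd (f z) (eval_secs \<sigma>s (fst (f z))) \<in> W}"
    using 3[OF U] W unfolding continuous_map_def by auto
  then have "openin Z {z \<in> topspace (subtopology Z ?V). snd (f z) (eval_secs \<sigma>s (fst (f z))) \<in> W}"
    using V openin_trans_full by blast
  moreover have "{z \<in> topspace (subtopology Z ?V). snd (f z) (eval_secs \<sigma>s (fst (f z))) \<in> W} = f -` S \<inter> topspace Z"
  proof -
    have "snd (f z) \<in> tfib E r (fst (f z))" if "z \<in> topspace Z" for z
      using 1[OF that] by (cases "f z") simp
    then show ?thesis unfolding S by (auto simp: case_prod_beta)
  qed
  ultimately show "openin Z (f -` S \<inter> topspace Z)" by simp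
next
  show "f ` topspace Z \<subseteq> \<Union> {{(x, \<Phi>). x \<in> U \<and> \<Phi> \<in> tfib E r x \<and> \<Phi> (map (\<lambda>\<sigma>. \<sigma> x) \<sigma>s) \<in> W} | U \<sigma>s W.
        openin (base E) U \<and> length \<sigma>s = r \<and> (\<forall>\<sigma>\<in>set \<sigma>s. local_section E U \<sigma>) \<and> open W}"
    using 1 by (simp add: ttop_def image_subset_iff)
qed

lemma fst_continuous: "continuous_map (ttop E r) (base E) fst"
  unfolding continuous_map_def
proof (intro conjI allI impI)
  show "fst \<in> topspace (ttop E r) \<rightarrow> topspace (base E)" by auto
  fix V assume V: "openin (base E) V"
  show "openin (ttop E r) {v \<in> topspace (ttop E r). fst v \<in> V}"
    unfolding openin_subopen[of _ "{v \<in> topspace (ttop E r). fst v \<in> V}"]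
  proof
    fix v assume "v \<in> {v \<in> topspace (ttop E r). fst v \<in> V}"
    then obtain x \<Phi> where v: "v = (x, \<Phi>)" "x \<in> topspace (base E)" "\<Phi> \<in> tfib E r x" "x \<in> V"
      by (cases v) auto
    obtain U \<sigma>s where U: "section_list E U r \<sigma>s" "x \<in> U" using section_list_exists[OF v(2)] .
    have o: "openin (base E) (U \<inter> V)" using U V by (auto simp: section_list_def)
    then have "section_list E (U \<inter> V) r \<sigma>s" using section_list_mono U(1) by blast
    from ttop_open[OF this, of UNIV]
    show "\<exists>T. openin (ttop E r) T \<and> v \<in> T \<and> T \<subseteq> {v \<in> topspace (ttop E r). fst v \<in> V}"
      using v U openin_subset[OF o]
      by (intro exI[of _ "{(x, \<Phi>). x \<in> U \<inter> V \<and> \<Phi> \<in> tfib E r x \<and> \<Phi> (eval_secs \<sigma>s x) \<in> UNIV}"]) auto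
  qed
qed

lemma open_over: "openin (base E) U \<Longrightarrow> openin (ttop E r) {v \<in> topspace (ttop E r). fst v \<in> U}"
  using fst_continuous unfolding continuous_map_def by blast

lemma coef_continuous:
  assumes U: "section_list E U r \<sigma>s"
  shows "continuous_map (subtopology (ttop E r) {v \<in> topspace (ttop E r). fst v \<in> U}) euclidean
     (\<lambda>v. snd v (eval_secs \<sigma>s (fst v)))"
  unfolding continuous_map_def
proof (intro conjI allI impI)
  fix W :: "complex set" assume "openin euclidean W"
  then have "open W" by simp
  have sub: "U \<subseteq> topspace (base E)" using U openin_subset by (auto simp: section_list_def)
  let ?V = "{v \<in> topspace (ttop E r). fst v \<in> U}"
  have "openin (subtopology (ttop E r) ?V) {(x, \<Phi>). x \<in> U \<and> \<Phi> \<in> tfib E r x \<and> \<Phi> (eval_secs \<sigma>s x) \<in> W}"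
    using open_over[of U] U ttop_open[OF U \<open>open W\<close>] sub
    by (subst openin_open_subtopology) (auto simp: section_list_def)
  moreover have "{(x, \<Phi>). x \<in> U \<and> \<Phi> \<in> tfib E r x \<and> \<Phi> (eval_secs \<sigma>s x) \<in> W} =
     {v \<in> topspace (subtopology (ttop E r) ?V). snd v (eval_secs \<sigma>s (fst v)) \<in> W}"
    using sub by auto
  ultimately show "openin (subtopology (ttop E r) ?V) {v \<in> topspace (subtopology (ttop E r) ?V). snd v (eval_secs \<sigma>s (fst v)) \<in> W}"
    by simp
qed simp

lemma coef_comp:
  assumes f: "continuous_map Z (ttop E r) f" and U: "section_list E U r \<sigma>s"
  shows "continuous_map (subtopology Z {z \<in> topspace Z. fst (f z) \<in> U}) euclidean (\<lambda>z. snd (f z) (eval_secs \<sigma>s (fst (f z))))"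
proof -
  have "continuous_map (subtopology Z {z \<in> topspace Z. fst (f z) \<in> U})
     (subtopology (ttop E r) {v \<in> topspace (ttop E r). fst v \<in> U}) f"
    using continuous_map_image_subset_topspace[OF f]
    by (intro continuous_map_into_subtopology continuous_map_from_subtopology f) auto
  from continuous_map_compose[OF this coef_continuous[OF U]] show ?thesis by (simp add: o_def)
qed

lemma fst_comp: "continuous_map Z (ttop E r) f \<Longrightarrow> continuous_map Z (base E) (\<lambda>z. fst (f z))"
  using continuous_map_compose[OF _ fst_continuous] by (simp add: o_def)

text \<open>Near a given point a local frame supplies orthonormal bases of the fibres, and by independence of
  the basis the scalar product is a finite sum of products of coefficients along the frame.\<close>

lemma tip_continuous:
  assumes f: "continuous_map Z (ttop E r) (\<lambda>z. (q z, f z))" and g: "continuous_map Z (ttop E r) (\<lambda>z. (q z, g z))"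
  shows "continuous_map Z euclidean (\<lambda>z. tip E r (q z) (f z) (g z))"
proof (rule continuous_map_local)
  fix z assume z: "z \<in> topspace Z"
  have q: "continuous_map Z (base E) q" using fst_comp[OF f] by simp
  have in_f: "q y \<in> topspace (base E) \<and> f y \<in> tfib E r (q y)" if "y \<in> topspace Z" for y
    using continuous_map_image_subset_topspace[OF f] that mem_ttop[of "q y" "f y" r] by blast
  have in_g: "g y \<in> tfib E r (q y)" if "y \<in> topspace Z" for y
    using continuous_map_image_subset_topspace[OF g] that mem_ttop[of "q y" "g y" r] by blast
  obtain U n s where U: "openin (base E) U" "q z \<in> U" "frame E U n s"
    using local_frame[of "q z"] in_f[OF z] by blast
  have sub: "U \<subseteq> topspace (base E)" using U openin_subset by blast
  let ?W = "{y \<in> topspace Z. q y \<in> U}"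
  have "section_list E U r (map s is)" if "is \<in> words {..<n} r" for "is"
    using U that unfolding section_list_def frame_def words_def by auto
  then have c: "continuous_map (subtopology Z ?W) euclidean (\<lambda>y. f y (eval_secs (map s is) (q y)))"
       "continuous_map (subtopology Z ?W) euclidean (\<lambda>y. g y (eval_secs (map s is) (q y)))"
    if "is \<in> words {..<n} r" for "is"
    using coef_comp[OF f, of U "map s is"] coef_comp[OF g, of U "map s is"] that by simp_all
  have "continuous_map (subtopology Z ?W) euclidean
     (\<lambda>y. \<Sum>is\<in>words {..<n} r. cnj (f y (eval_secs (map s is) (q y))) * g y (eval_secs (map s is) (q y)))"
    using c by (intro continuous_map_sum continuous_map_complex_mult continuous_map_cnj finite_words) auto
  then have "continuous_map (subtopology Z ?W) euclidean (\<lambda>z. tip E r (q z) (f z) (g z))"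
  proof (rule continuous_map_eq)
    fix y assume "y \<in> topspace (subtopology Z ?W)"
    then have y: "y \<in> topspace Z" "q y \<in> U" by auto
    have "tip E r (q y) (f y) (g y) = (\<Sum>bs\<in>words ((\<lambda>i. s i (q y)) ` {..<n}) r. cnj (f y bs) * g y bs)"
      using tip_onb[OF _ frame_onb[OF U(3) sub y(2)]] in_f[OF y(1)] in_g[OF y(1)] by blast
    also have "\<dots> = (\<Sum>is\<in>words {..<n} r. cnj (f y (eval_secs (map s is) (q y))) * g y (eval_secs (map s is) (q y)))"
      by (subst sum_words_image[OF frame_inj[OF U(3) y(2)]]) (simp add: eval_secs_def o_def)
    finally show "(\<Sum>is\<in>words {..<n} r. cnj (f y (eval_secs (map s is) (q y))) * g y (eval_secs (map s is) (q y))) =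
         tip E r (q y) (f y) (g y)" by simp
  qed
  moreover have "openin Z ?W" using q U unfolding continuous_map_def by blast
  ultimately show "\<exists>W. openin Z W \<and> z \<in> W \<and> continuous_map (subtopology Z W) euclidean (\<lambda>z. tip E r (q z) (f z) (g z))"
    using z U by blast
qed

lemma ip_list_continuous:
  assumes "section_list E U r \<sigma>s" "section_list E U r \<tau>s"
  shows "continuous_map (subtopology (base E) U) euclidean (\<lambda>y. ip_list E (eval_secs \<sigma>s y) (eval_secs \<tau>s y))"
proof -
  have "length \<sigma>s = length \<tau>s" and o: "openin (base E) U" using assms by (auto simp: section_list_def)
  moreover have "\<forall>\<sigma>\<in>set \<sigma>s. local_section E U \<sigma>" "\<forall>\<sigma>\<in>set \<tau>s. local_section E U \<sigma>"
    using assms by (auto simp: section_list_def)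
  ultimately show ?thesis
  proof (induction \<sigma>s \<tau>s rule: list_induct2)
    case (Cons \<sigma> \<sigma>s \<tau> \<tau>s)
    then show ?case using section_ip_continuous[OF o, of \<sigma> \<tau>] continuous_map_complex_mult by auto
  qed simp
qed

lemma simple_tensor_section_continuous:
  assumes U: "section_list E U r \<sigma>s"
  shows "continuous_map (subtopology (base E) U) (ttop E r) (\<lambda>y. (y, simple_tensor E y (eval_secs \<sigma>s y)))"
proof (rule continuous_into_ttop)
  have sub: "U \<subseteq> topspace (base E)" using U openin_subset by (auto simp: section_list_def)
  fix z assume "z \<in> topspace (subtopology (base E) U)"
  then show "(z, simple_tensor E z (eval_secs \<sigma>s z)) \<in> topspace (ttop E r)"
    using simple_tensor_tfib[OF section_list_tup[OF U]] by auto
next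
  have sub: "U \<subseteq> topspace (base E)" using U openin_subset by (auto simp: section_list_def)
  fix V \<tau>s assume V: "section_list E V r \<tau>s"
  have o: "openin (base E) (U \<inter> V)" using U V by (auto simp: section_list_def)
  have "continuous_map (subtopology (base E) (U \<inter> V)) euclidean (\<lambda>y. ip_list E (eval_secs \<tau>s y) (eval_secs \<sigma>s y))"
    using ip_list_continuous section_list_mono[OF U o] section_list_mono[OF V o] by auto
  moreover have "subtopology (subtopology (base E) U) {z \<in> topspace (subtopology (base E) U). fst (z, simple_tensor E z (eval_secs \<sigma>s z)) \<in> V}
      = subtopology (base E) (U \<inter> V)"
    using sub by (auto simp: subtopology_subtopology intro!: arg_cong[where f = "subtopology (base E)"])
  moreover have "simple_tensor E y (eval_secs \<sigma>s y) (eval_secs \<tau>s y) = ip_list E (eval_secs \<tau>s y) (eval_secs \<sigma>s y)" if "y \<in> U \<inter> V" for y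
    using section_list_tup[OF V] U that by (auto simp: simple_tensor_def section_list_def)
  ultimately show "continuous_map (subtopology (subtopology (base E) U) {z \<in> topspace (subtopology (base E) U). fst (z, simple_tensor E z (eval_secs \<sigma>s z)) \<in> V}) euclidean
     (\<lambda>z. snd (z, simple_tensor E z (eval_secs \<sigma>s z)) (eval_secs \<tau>s (fst (z, simple_tensor E z (eval_secs \<sigma>s z)))))"
    using continuous_map_eq[of "subtopology (base E) (U \<inter> V)" euclidean
        "\<lambda>y. ip_list E (eval_secs \<tau>s y) (eval_secs \<sigma>s y)" "\<lambda>y. simple_tensor E y (eval_secs \<sigma>s y) (eval_secs \<tau>s y)"] by simp
qed (simp add: continuous_map_from_subtopology)

lemma tmor_of_apply: "x \<in> topspace (base E) \<Longrightarrow> \<Phi> \<in> tfib E r x \<Longrightarrow> tmor_of E r T (x, \<Phi>) = (x, T x \<Phi>)"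
  by (simp add: tmor_of_def)

lemma act_tmor_of [simp]: "x \<in> topspace (base E) \<Longrightarrow> \<Phi> \<in> tfib E r x \<Longrightarrow> act (tmor_of E r T) x \<Phi> = T x \<Phi>"
  by (simp add: act_def tmor_of_apply)

lemma tmor_of_cong: "(\<And>x \<Phi>. x \<in> topspace (base E) \<Longrightarrow> \<Phi> \<in> tfib E r x \<Longrightarrow> T x \<Phi> = T' x \<Phi>) \<Longrightarrow> tmor_of E r T = tmor_of E r T'"
  unfolding tmor_of_def by (intro restrict_ext) auto

text \<open>The coefficients of the image along local sections suffice for continuity.\<close>

lemma tmorI:
  assumes tlinear: "\<And>x. x \<in> topspace (base E) \<Longrightarrow> tlinear E r s x (T x)"
    and cont: "\<And>U \<sigma>s. section_list E U s \<sigma>s \<Longrightarrow>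
      continuous_map (subtopology (ttop E r) {v \<in> topspace (ttop E r). fst v \<in> U}) euclidean
        (\<lambda>v. T (fst v) (snd v) (eval_secs \<sigma>s (fst v)))"
  shows "tmor_of E r T \<in> tmors E r s"
proof -
  have "continuous_map (ttop E r) (ttop E s) (tmor_of E r T)"
  proof (rule continuous_into_ttop)
    fix z assume "z \<in> topspace (ttop E r)"
    then show "tmor_of E r T z \<in> topspace (ttop E s)"
      by (cases z) (simp add: tmor_of_apply tlinear_fib[OF tlinear])
  next
    show "continuous_map (ttop E r) (base E) (\<lambda>z. fst (tmor_of E r T z))"
      by (rule continuous_map_eq[OF fst_continuous]) (auto simp: tmor_of_apply)
  next
    fix U \<sigma>s assume U: "section_list E U s \<sigma>s"
    have eq: "{z \<in> topspace (ttop E r). fst (tmor_of E r T z) \<in> U} = {z \<in> topspace (ttop E r). fst z \<in> U}"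
      by (auto simp: tmor_of_apply)
    show "continuous_map (subtopology (ttop E r) {z \<in> topspace (ttop E r). fst (tmor_of E r T z) \<in> U}) euclidean
        (\<lambda>z. snd (tmor_of E r T z) (eval_secs \<sigma>s (fst (tmor_of E r T z))))"
      unfolding eq by (rule continuous_map_eq[OF cont[OF U]]) (auto simp: tmor_of_apply)
  qed
  moreover have "tmor_of E r T \<in> extensional (topspace (ttop E r))" by (simp add: tmor_of_def)
  ultimately show ?thesis
    unfolding mor_def
  proof (intro CollectI conjI allI ballI; (simp only: tpow_simps)?)
    fix v assume "v \<in> topspace (ttop E r)"
    then show "fst (tmor_of E r T v) = fst v" by (cases v) (simp add: tmor_of_apply)
  next
    fix x v w assume "v \<in> fib (tpow E r) x" "w \<in> fib (tpow E r) x"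
    then obtain \<Phi> \<Psi> where "v = (x, \<Phi>)" "w = (x, \<Psi>)" "x \<in> topspace (base E)" "\<Phi> \<in> tfib E r x" "\<Psi> \<in> tfib E r x"
      unfolding fib_tpow by blast
    then show "tmor_of E r T (vadd (tpow E r) v w) = vadd (tpow E s) (tmor_of E r T v) (tmor_of E r T w)"
      by (simp add: tmor_of_apply tfib_add tlinear_add[OF tlinear])
  next
    fix x v c assume "v \<in> fib (tpow E r) x"
    then obtain \<Phi> where "v = (x, \<Phi>)" "x \<in> topspace (base E)" "\<Phi> \<in> tfib E r x"
      unfolding fib_tpow by blast
    then show "tmor_of E r T (vscl (tpow E r) c v) = vscl (tpow E s) c (tmor_of E r T v)"
      by (simp add: tmor_of_apply tfib_scl tlinear_scl[OF tlinear])
  qed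
qed

lemma tmor_apply:
  assumes "t \<in> tmors E r s" "x \<in> topspace (base E)" "\<Phi> \<in> tfib E r x"
  shows "t (x, \<Phi>) = (x, act t x \<Phi>)"
proof -
  have "prj (tpow E s) (t (x, \<Phi>)) = prj (tpow E r) (x, \<Phi>)"
    using mor_prj[OF assms(1), of "(x, \<Phi>)"] assms by simp
  then show ?thesis by (cases "t (x, \<Phi>)") (simp add: act_def)
qed

lemma tmor_cont: "t \<in> tmors E r s \<Longrightarrow> continuous_map (ttop E r) (ttop E s) t"
  by (simp add: mor_def)

lemma tmor_tlinear:
  assumes t: "t \<in> tmors E r s" and x: "x \<in> topspace (base E)"
  shows "tlinear E r s x (act t x)"
  unfolding tlinear_def
proof (intro ballI conjI allI)
  fix \<Phi> assume \<Phi>: "\<Phi> \<in> tfib E r x"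
  have "t (x, \<Phi>) \<in> topspace (ttop E s)"
    using continuous_map_image_subset_topspace[OF tmor_cont[OF t]] x \<Phi> by auto
  then show "act t x \<Phi> \<in> tfib E s x" using tmor_apply[OF t x \<Phi>] by simp
  fix c
  have "t (vscl (tpow E r) c (x, \<Phi>)) = vscl (tpow E s) c (t (x, \<Phi>))"
    by (rule mor_vscl[OF t, of _ x]) (use x \<Phi> in \<open>simp add: fib_tpow\<close>)
  then show "act t x (\<lambda>ws. c * \<Phi> ws) = (\<lambda>ws. c * act t x \<Phi> ws)"
    using tmor_apply[OF t x \<Phi>] tmor_apply[OF t x tfib_scl[OF \<Phi>]] by simp
next
  fix \<Phi> \<Psi> assume \<Phi>: "\<Phi> \<in> tfib E r x" "\<Psi> \<in> tfib E r x"
  have "t (vadd (tpow E r) (x, \<Phi>) (x, \<Psi>)) = vadd (tpow E s) (t (x, \<Phi>)) (t (x, \<Psi>))"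
    by (rule mor_vadd[OF t, of _ x]) (use x \<Phi> in \<open>simp_all add: fib_tpow\<close>)
  then show "act t x (\<lambda>ws. \<Phi> ws + \<Psi> ws) = (\<lambda>ws. act t x \<Phi> ws + act t x \<Psi> ws)"
    using tmor_apply[OF t x \<Phi>(1)] tmor_apply[OF t x \<Phi>(2)] tmor_apply[OF t x tfib_add[OF \<Phi>]] by simp
qed

lemma tmor_tmor_of: "t \<in> tmors E r s \<Longrightarrow> t = tmor_of E r (act t)"
proof
  fix v assume t: "t \<in> tmors E r s"
  show "t v = tmor_of E r (act t) v"
  proof (cases "v \<in> topspace (ttop E r)")
    case True
    then show ?thesis by (cases v) (simp add: tmor_of_apply tmor_apply[OF t])
  next
    case False
    then have "t v = undefined" using t by (auto simp: mor_def intro: extensional_arb)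
    then show ?thesis using False by (simp add: tmor_of_def)
  qed
qed

lemma tmor_eqI:
  assumes "t \<in> tmors E r s" "t' \<in> tmors E r s'"
    "\<And>x \<Phi>. x \<in> topspace (base E) \<Longrightarrow> \<Phi> \<in> tfib E r x \<Longrightarrow> act t x \<Phi> = act t' x \<Phi>"
  shows "t = t'"
proof -
  have "t = tmor_of E r (act t)" by (rule tmor_tmor_of[OF assms(1)])
  also have "\<dots> = tmor_of E r (act t')" by (rule tmor_of_cong[OF assms(3)])
  also have "\<dots> = t'" by (rule tmor_tmor_of[OF assms(2), symmetric])
  finally show ?thesis .
qed

lemma act_tfib: "t \<in> tmors E r s \<Longrightarrow> x \<in> topspace (base E) \<Longrightarrow> \<Phi> \<in> tfib E r x \<Longrightarrow> act t x \<Phi> \<in> tfib E s x"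
  by (rule tlinear_fib[OF tmor_tlinear])

lemma tmor_coef:
  assumes t: "t \<in> tmors E r s" and U: "section_list E U s \<sigma>s"
  shows "continuous_map (subtopology (ttop E r) {v \<in> topspace (ttop E r). fst v \<in> U}) euclidean
        (\<lambda>v. act t (fst v) (snd v) (eval_secs \<sigma>s (fst v)))"
proof -
  have f: "fst (t v) = fst v" if "v \<in> topspace (ttop E r)" for v
    using that tmor_apply[OF t, of "fst v" "snd v"] by (cases v) simp
  then have eq: "{z \<in> topspace (ttop E r). fst (t z) \<in> U} = {z \<in> topspace (ttop E r). fst z \<in> U}" by auto
  show ?thesis
    using coef_comp[OF tmor_cont[OF t] U] unfolding eq
    by (rule continuous_map_eq) (auto simp: f act_def)
qed

end

section \<open>The algebra of morphisms\<close>

text \<open>The last variable is the one that amplification leaves alone, so that a form of $r + 1$ variables is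
  treated as a family of forms of $r$ variables.\<close>

definition slice :: "('e list \<Rightarrow> complex) \<Rightarrow> 'e \<Rightarrow> 'e list \<Rightarrow> complex" where
  "slice \<Phi> b = (\<lambda>ws. \<Phi> (ws @ [b]))"

text \<open>Forms determine their own adjoint formula, as $(t^*\Psi)(ws) = \langle ws, t^*\Psi\rangle = \langle
  t\, ws, \Psi\rangle$.\<close>

definition adj_form :: "('e, 'x) vbundle \<Rightarrow> nat \<Rightarrow> nat \<Rightarrow> ('e, 'x) tmor \<Rightarrow> 'x \<Rightarrow> ('e list \<Rightarrow> complex) \<Rightarrow> 'e list \<Rightarrow> complex" where
  "adj_form E r s t x \<Psi> ws = (if ws \<in> tup E r x then tip E s x (act t x (simple_tensor E x ws)) \<Psi> else 0)"

text \<open>The map $t \otimes 1$ on forms.\<close>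

definition amp_form :: "('e, 'x) vbundle \<Rightarrow> nat \<Rightarrow> ('e, 'x) tmor \<Rightarrow> 'x \<Rightarrow> ('e list \<Rightarrow> complex) \<Rightarrow> 'e list \<Rightarrow> complex" where
  "amp_form E s t x \<Phi> zs = (if zs \<in> tup E (Suc s) x then act t x (slice \<Phi> (last zs)) (butlast zs) else 0)"

definition mor_sum :: "('e, 'x) vbundle \<Rightarrow> nat \<Rightarrow> 'i set \<Rightarrow> ('i \<Rightarrow> ('e, 'x) tmor) \<Rightarrow> ('e, 'x) tmor" where
  "mor_sum E r I f = tmor_of E r (\<lambda>x \<Phi> ws. \<Sum>i\<in>I. act (f i) x \<Phi> ws)"

lemma tfibI:
  assumes "\<And>ws. ws \<notin> tup E r x \<Longrightarrow> \<Phi> ws = 0"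
    and "\<And>us v zs. us @ v # zs \<in> tup E r x \<Longrightarrow> conj_linear E x (\<lambda>v. \<Phi> (us @ v # zs))"
  shows "\<Phi> \<in> tfib E r x"
  unfolding tfib_def
proof (intro CollectI conjI allI impI; (elim conjE)?)
  fix ws assume "ws \<notin> tup E r x" then show "\<Phi> ws = 0" by (rule assms(1))
next
  fix us v w zs assume v: "us @ v # zs \<in> tup E r x" "w \<in> fib E x"
  then have "v \<in> fib E x" by (simp add: tup_def)
  then show "\<Phi> (us @ vadd E v w # zs) = \<Phi> (us @ v # zs) + \<Phi> (us @ w # zs)"
    using assms(2)[OF v(1)] v(2) by (simp add: conj_linear_def)
next
  fix us v zs c assume v: "us @ v # zs \<in> tup E r x"
  then have "v \<in> fib E x" by (simp add: tup_def)
  then show "\<Phi> (us @ vscl E c v # zs) = cnj c * \<Phi> (us @ v # zs)"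
    using assms(2)[OF v(1)] by (simp add: conj_linear_def)
qed

lemma tfib_slot':
  assumes "\<Phi> \<in> tfib E r x" "us @ v # zs \<in> tup E r x"
  shows "conj_linear E x (\<lambda>v. \<Phi> (us @ v # zs))"
  using assms(2) by (intro tfib_slot[OF assms(1)]) (auto simp: tup_def)

lemma tup_snoc: "zs @ [b] \<in> tup E (Suc s) x \<longleftrightarrow> zs \<in> tup E s x \<and> b \<in> fib E x"
  by (auto simp: tup_def)

lemma tup_Suc_snocE:
  assumes "zs \<in> tup E (Suc s) x"
  obtains us b where "zs = us @ [b]" "us \<in> tup E s x" "b \<in> fib E x"
proof -
  have "length zs = Suc s" using tup_length[OF assms] .
  then have "zs = butlast zs @ [last zs]" by (cases zs rule: rev_cases) auto
  then show ?thesis using that[of "butlast zs" "last zs"] assms tup_snoc[of "butlast zs" "last zs" E s x] by metis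
qed

lemma slice_tfib:
  assumes "\<Phi> \<in> tfib E (Suc r) x" "b \<in> fib E x"
  shows "slice \<Phi> b \<in> tfib E r x"
proof (rule tfibI)
  fix ws assume "ws \<notin> tup E r x"
  then have "ws @ [b] \<notin> tup E (Suc r) x" by (simp add: tup_snoc)
  then show "slice \<Phi> b ws = 0" using tfib_outside[OF assms(1)] by (simp add: slice_def)
next
  fix us v zs assume "us @ v # zs \<in> tup E r x"
  then have "us @ v # (zs @ [b]) \<in> tup E (Suc r) x"
    using tup_snoc[of "us @ v # zs" b E r x] assms(2) by simp
  from tfib_slot'[OF assms(1) this] show "conj_linear E x (\<lambda>v. slice \<Phi> b (us @ v # zs))"
    by (simp add: slice_def)
qed

lemma slice_conj_linear:
  assumes "\<Phi> \<in> tfib E (Suc r) x" "zs \<in> tup E r x"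
  shows "conj_linear E x (\<lambda>b. slice \<Phi> b zs)"
  unfolding slice_def using assms(2) by (intro tfib_slot[OF assms(1)]) (auto simp: tup_def)

text \<open>A form of $r + 1$ variables amounts to a conjugate linear family of forms of $r$ variables.\<close>

lemma tfib_SucI:
  assumes out: "\<And>zs. zs \<notin> tup E (Suc s) x \<Longrightarrow> \<Theta> zs = 0"
    and sl: "\<And>b. b \<in> fib E x \<Longrightarrow> slice \<Theta> b \<in> tfib E s x"
    and lst: "\<And>zs. zs \<in> tup E s x \<Longrightarrow> conj_linear E x (\<lambda>b. slice \<Theta> b zs)"
  shows "\<Theta> \<in> tfib E (Suc s) x"
proof (rule tfibI[OF out])
  fix us v zs assume t: "us @ v # zs \<in> tup E (Suc s) x"
  show "conj_linear E x (\<lambda>v. \<Theta> (us @ v # zs))"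
  proof (cases zs rule: rev_cases)
    case Nil
    then show ?thesis using lst[of us] t tup_snoc[of us v E s x] by (simp add: slice_def)
  next
    case (snoc zs' b)
    then have "us @ v # zs' \<in> tup E s x" "b \<in> fib E x"
      using t tup_snoc[of "us @ v # zs'" b E s x] by simp_all
    from tfib_slot'[OF sl[OF this(2)] this(1)] show ?thesis by (simp add: slice_def snoc)
  qed
qed

lemma tfib_Suc_ext:
  assumes "\<Phi> \<in> tfib E (Suc r) x" "\<Psi> \<in> tfib E (Suc r) x" "\<And>b. b \<in> fib E x \<Longrightarrow> slice \<Phi> b = slice \<Psi> b"
  shows "\<Phi> = \<Psi>"
proof (rule tfib_ext[OF assms(1,2)])
  fix ws assume "ws \<in> tup E (Suc r) x"
  then obtain us b where ws: "ws = us @ [b]" "b \<in> fib E x" by (rule tup_Suc_snocE)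
  show "\<Phi> ws = \<Psi> ws" using fun_cong[OF assms(3)[OF ws(2)], of us] by (simp add: slice_def ws)
qed

lemma slice_linear: "slice (\<lambda>ws. \<Phi> ws + \<Psi> ws) b = (\<lambda>ws. slice \<Phi> b ws + slice \<Psi> b ws)"
  "slice (\<lambda>ws. c * \<Phi> ws) b = (\<lambda>ws. c * slice \<Phi> b ws)"
  "slice (\<lambda>ws. 0) b = (\<lambda>ws. 0)"
  "slice (\<lambda>ws. \<Sum>i\<in>I. f i ws) b = (\<lambda>ws. \<Sum>i\<in>I. slice (f i) b ws)"
  by (simp_all add: slice_def)

context framed_bundle
begin

lemma tmor_of_eqI:
  assumes "f \<in> extensional (topspace (ttop E r))"
    "\<And>x \<Phi>. x \<in> topspace (base E) \<Longrightarrow> \<Phi> \<in> tfib E r x \<Longrightarrow> f (x, \<Phi>) = (x, T x \<Phi>)"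
  shows "f = tmor_of E r T"
proof
  fix v show "f v = tmor_of E r T v"
  proof (cases "v \<in> topspace (ttop E r)")
    case True
    then show ?thesis by (cases v) (simp add: tmor_of_apply assms(2))
  next
    case False
    then show ?thesis using extensional_arb[OF assms(1)] by (simp add: tmor_of_def)
  qed
qed

lemma mid_tmor_of: "mid (tpow E r) = tmor_of E r (\<lambda>x \<Phi>. \<Phi>)"
  by (rule tmor_of_eqI) (simp_all add: mid_def)

lemma tzero_tmor_of: "tzero E r = tmor_of E r (\<lambda>x \<Phi> _. 0)"
  by (rule tmor_of_eqI) (simp_all add: tzero_def)

lemma madd_tmor_of:
  "t \<in> tmors E r s \<Longrightarrow> t' \<in> tmors E r s \<Longrightarrow>
    madd (tpow E r) (tpow E s) t t' = tmor_of E r (\<lambda>x \<Phi> ws. act t x \<Phi> ws + act t' x \<Phi> ws)"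
  by (rule tmor_of_eqI) (simp_all add: madd_def tmor_apply[of t] tmor_apply[of t'])

lemma mscl_tmor_of:
  "t \<in> tmors E r s \<Longrightarrow> mscl (tpow E r) (tpow E s) c t = tmor_of E r (\<lambda>x \<Phi> ws. c * act t x \<Phi> ws)"
  by (rule tmor_of_eqI) (simp_all add: mscl_def tmor_apply[of t])

lemma mcomp_tmor_of:
  "t \<in> tmors E r s \<Longrightarrow> t' \<in> tmors E s q \<Longrightarrow> mcomp (tpow E r) t' t = tmor_of E r (\<lambda>x \<Phi>. act t' x (act t x \<Phi>))"
  by (rule tmor_of_eqI) (simp_all add: mcomp_def compose_def tmor_apply[of t] tmor_apply[of t'] act_tfib[of t])

lemma tmorI_cont:
  assumes tlinear: "\<And>x. x \<in> topspace (base E) \<Longrightarrow> tlinear E r s x (T x)"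
    and cont: "continuous_map (ttop E r) (ttop E s) (\<lambda>v. (fst v, T (fst v) (snd v)))"
  shows "tmor_of E r T \<in> tmors E r s"
proof (rule tmorI[OF tlinear])
  fix U \<sigma>s assume "section_list E U s \<sigma>s"
  from coef_comp[OF cont this] show "continuous_map (subtopology (ttop E r) {v \<in> topspace (ttop E r). fst v \<in> U}) euclidean
        (\<lambda>v. T (fst v) (snd v) (eval_secs \<sigma>s (fst v)))" by simp
qed

lemma tzero_tmor: "tzero E r \<in> tmors E r s"
  unfolding tzero_tmor_of by (rule tmorI) (simp_all add: tlinear_def)

lemma mor_sum_tmor:
  assumes "finite I" "\<And>i. i \<in> I \<Longrightarrow> f i \<in> tmors E r s"
  shows "mor_sum E r I f \<in> tmors E r s"
  unfolding mor_sum_def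
proof (rule tmorI)
  fix x assume x: "x \<in> topspace (base E)"
  have l: "tlinear E r s x (act (f i) x)" if "i \<in> I" for i using tmor_tlinear[OF assms(2)[OF that] x] .
  show "tlinear E r s x (\<lambda>\<Phi> ws. \<Sum>i\<in>I. act (f i) x \<Phi> ws)"
    unfolding tlinear_def
  proof (intro ballI conjI allI)
    fix \<Phi> assume \<Phi>: "\<Phi> \<in> tfib E r x"
    show "(\<lambda>ws. \<Sum>i\<in>I. act (f i) x \<Phi> ws) \<in> tfib E s x"
      using tlinear_fib[OF l \<Phi>] by (intro tfib_sum)
    show "(\<lambda>ws. \<Sum>i\<in>I. act (f i) x (\<lambda>ws. c * \<Phi> ws) ws) = (\<lambda>ws. c * (\<Sum>i\<in>I. act (f i) x \<Phi> ws))" for c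
      using tlinear_scl[OF l \<Phi>] by (simp add: sum_distrib_left)
    fix \<Psi> assume \<Psi>: "\<Psi> \<in> tfib E r x"
    show "(\<lambda>ws. \<Sum>i\<in>I. act (f i) x (\<lambda>ws. \<Phi> ws + \<Psi> ws) ws) =
       (\<lambda>ws. (\<Sum>i\<in>I. act (f i) x \<Phi> ws) + (\<Sum>i\<in>I. act (f i) x \<Psi> ws))"
      using tlinear_add[OF l \<Phi> \<Psi>] by (simp add: sum.distrib)
  qed
next
  fix U \<sigma>s assume "section_list E U s \<sigma>s"
  from tmor_coef[OF assms(2) this]
  show "continuous_map (subtopology (ttop E r) {v \<in> topspace (ttop E r). fst v \<in> U}) euclidean
        (\<lambda>v. \<Sum>i\<in>I. act (f i) (fst v) (snd v) (eval_secs \<sigma>s (fst v)))"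
    by (intro continuous_map_sum assms(1))
qed

lemma madd_mor_sum:
  assumes "t \<in> tmors E r s" "t' \<in> tmors E r s"
  shows "madd (tpow E r) (tpow E s) t t' = mor_sum E r UNIV (\<lambda>b. if b then t else t')"
  unfolding madd_tmor_of[OF assms] mor_sum_def by (simp add: UNIV_bool add.commute)

lemma madd_tmor: "t \<in> tmors E r s \<Longrightarrow> t' \<in> tmors E r s \<Longrightarrow> madd (tpow E r) (tpow E s) t t' \<in> tmors E r s"
  unfolding madd_mor_sum by (rule mor_sum_tmor) auto

lemma mscl_tmor:
  assumes t: "t \<in> tmors E r s"
  shows "mscl (tpow E r) (tpow E s) c t \<in> tmors E r s"
  unfolding mscl_tmor_of[OF t]
proof (rule tmorI)
  fix x assume x: "x \<in> topspace (base E)"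
  show "tlinear E r s x (\<lambda>\<Phi> ws. c * act t x \<Phi> ws)"
    using tmor_tlinear[OF t x] unfolding tlinear_def by (simp add: tfib_scl algebra_simps)
next
  fix U \<sigma>s assume "section_list E U s \<sigma>s"
  from tmor_coef[OF t this]
  show "continuous_map (subtopology (ttop E r) {v \<in> topspace (ttop E r). fst v \<in> U}) euclidean
        (\<lambda>v. c * act t (fst v) (snd v) (eval_secs \<sigma>s (fst v)))"
    by (intro continuous_map_complex_mult) simp_all
qed

lemma tmor_cont': "t \<in> tmors E r s \<Longrightarrow> continuous_map (ttop E r) (ttop E s) (\<lambda>v. (fst v, act t (fst v) (snd v)))"
proof -
  assume t: "t \<in> tmors E r s"
  show ?thesis
  proof (rule continuous_map_eq[OF tmor_cont[OF t]])
    fix v assume "v \<in> topspace (ttop E r)"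
    then show "t v = (fst v, act t (fst v) (snd v))"
      using tmor_apply[OF t, of "fst v" "snd v"] by (cases v) simp
  qed
qed

lemma mcomp_tmor:
  assumes t: "t \<in> tmors E r s" and t': "t' \<in> tmors E s q"
  shows "mcomp (tpow E r) t' t \<in> tmors E r q"
  unfolding mcomp_tmor_of[OF assms]
proof (rule tmorI_cont)
  fix x assume "x \<in> topspace (base E)"
  then show "tlinear E r q x (\<lambda>\<Phi>. act t' x (act t x \<Phi>))"
    by (intro tlinear_compose[OF tmor_tlinear[OF t] tmor_tlinear[OF t']])
next
  show "continuous_map (ttop E r) (ttop E q) (\<lambda>v. (fst v, act t' (fst v) (act t (fst v) (snd v))))"
    using continuous_map_compose[OF tmor_cont'[OF t] tmor_cont'[OF t']] by (simp add: o_def)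
qed

lemma simple_tensor_slot:
  assumes us: "us @ v # zs \<in> tup E r x"
  shows "w \<in> fib E x \<Longrightarrow> simple_tensor E x (us @ vadd E v w # zs) = (\<lambda>ws. simple_tensor E x (us @ v # zs) ws + simple_tensor E x (us @ w # zs) ws)"
    and "simple_tensor E x (us @ vscl E c v # zs) = (\<lambda>ws. c * simple_tensor E x (us @ v # zs) ws)"
proof -
  have v: "v \<in> fib E x" "us @ w # zs \<in> tup E r x" if "w \<in> fib E x" for w
    using us that by (auto simp: tup_def)
  have v': "v \<in> fib E x" using us by (auto simp: tup_def)
  have l: "length (us @ v # zs) = r" using us by (rule tup_length)
  have c: "simple_tensor E x (us @ w # zs) ws = cnj (simple_tensor E x ws (us @ w # zs))" if "w \<in> fib E x" "ws \<in> tup E r x" for w ws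
    using cnj_ip_list[OF v(2)[OF that(1)] that(2)] v(2)[OF that(1)] that(2) l tup_length[OF that(2)]
    by (simp add: simple_tensor_def)
  have z: "simple_tensor E x (us @ w # zs) ws = 0" if "ws \<notin> tup E r x" for w ws
    using that l by (simp add: simple_tensor_def)
  show "simple_tensor E x (us @ vadd E v w # zs) = (\<lambda>ws. simple_tensor E x (us @ v # zs) ws + simple_tensor E x (us @ w # zs) ws)"
    if w: "w \<in> fib E x"
  proof
    fix ws show "simple_tensor E x (us @ vadd E v w # zs) ws = simple_tensor E x (us @ v # zs) ws + simple_tensor E x (us @ w # zs) ws"
    proof (cases "ws \<in> tup E r x")
      case True
      have "conj_linear E x (\<lambda>v. simple_tensor E x ws (us @ v # zs))" using tfib_slot'[OF simple_tensor_tfib[OF True] us] .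
      then show ?thesis using c[OF w True] c[OF v' True] c[OF vadd_fib[OF v' w] True] v' w
        by (simp add: conj_linear_def)
    qed (simp add: z)
  qed
  show "simple_tensor E x (us @ vscl E c v # zs) = (\<lambda>ws. c * simple_tensor E x (us @ v # zs) ws)"
  proof
    fix ws show "simple_tensor E x (us @ vscl E c v # zs) ws = c * simple_tensor E x (us @ v # zs) ws"
    proof (cases "ws \<in> tup E r x")
      case True
      have "conj_linear E x (\<lambda>v. simple_tensor E x ws (us @ v # zs))" using tfib_slot'[OF simple_tensor_tfib[OF True] us] .
      then show ?thesis using c[OF v' True] c[OF vscl_fib[OF v'] True] v'
        by (simp add: conj_linear_def)
    qed (simp add: z)
  qed
qed

lemma tip_scl: "tip E r x \<Phi> (\<lambda>ws. c * \<Psi> ws) = c * tip E r x \<Phi> \<Psi>"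
  "tip E r x (\<lambda>ws. c * \<Phi> ws) \<Psi> = cnj c * tip E r x \<Phi> \<Psi>"
  by (simp_all add: tip_words sum_distrib_left mult_ac)

lemma tip_add: "tip E r x \<Phi> (\<lambda>ws. \<Psi> ws + \<Psi>' ws) = tip E r x \<Phi> \<Psi> + tip E r x \<Phi> \<Psi>'"
  "tip E r x (\<lambda>ws. \<Phi> ws + \<Phi>' ws) \<Psi> = tip E r x \<Phi> \<Psi> + tip E r x \<Phi>' \<Psi>"
  by (simp_all add: tip_words sum.distrib algebra_simps)

lemma tip_zero [simp]: "tip E r x \<Phi> (\<lambda>_. 0) = 0" "tip E r x (\<lambda>_. 0) \<Phi> = 0"
  by (simp_all add: tip_words)

lemma adj_form_tfib:
  assumes l: "tlinear E r s x (act t x)" and \<Psi>: "\<Psi> \<in> tfib E s x"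
  shows "adj_form E r s t x \<Psi> \<in> tfib E r x"
proof (rule tfibI)
  fix us v zs assume us: "us @ v # zs \<in> tup E r x"
  have t: "us @ w # zs \<in> tup E r x" if "w \<in> fib E x" for w
    using us that by (auto simp: tup_def)
  have vv: "v \<in> fib E x" using us by (auto simp: tup_def)
  show "conj_linear E x (\<lambda>v. adj_form E r s t x \<Psi> (us @ v # zs))"
    unfolding conj_linear_def
  proof (intro conjI ballI allI)
    fix v w assume v: "v \<in> fib E x" "w \<in> fib E x"
    show "adj_form E r s t x \<Psi> (us @ vadd E v w # zs) = adj_form E r s t x \<Psi> (us @ v # zs) + adj_form E r s t x \<Psi> (us @ w # zs)"
      using t[OF v(1)] t[OF v(2)] t[OF vadd_fib[OF v]]
      by (simp add: adj_form_def simple_tensor_slot(1)[OF t[OF v(1)] v(2)] tlinear_add[OF l simple_tensor_tfib simple_tensor_tfib] tip_add)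
  next
    fix v c assume v: "v \<in> fib E x"
    show "adj_form E r s t x \<Psi> (us @ vscl E c v # zs) = cnj c * adj_form E r s t x \<Psi> (us @ v # zs)"
      using t[OF v] t[OF vscl_fib[OF v]]
      by (simp add: adj_form_def simple_tensor_slot(2)[OF t[OF v]] tlinear_scl[OF l simple_tensor_tfib] tip_scl)
  qed
qed (simp add: adj_form_def)

lemma adj_form_tip:
  assumes x: "x \<in> topspace (base E)" and l: "tlinear E r s x (act t x)" and \<Phi>: "\<Phi> \<in> tfib E r x"
  shows "tip E r x \<Phi> (adj_form E r s t x \<Psi>) = tip E s x (act t x \<Phi>) \<Psi>"
proof -
  let ?B = "chosen_onb E x"
  have B: "onb E x ?B" "finite ?B" using onb_chosen_onb[OF x] finite_chosen_onb[OF x] by auto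
  have d: "simple_tensor E x bs \<in> tfib E r x" if "bs \<in> words ?B r" for bs
    by (rule simple_tensor_tfib[OF words_onb_tup[OF B(1) that]])
  have "act t x \<Phi> = act t x (\<lambda>ws. \<Sum>bs\<in>words ?B r. \<Phi> bs * simple_tensor E x bs ws)"
    using tfib_simple_tensor_sum[OF B(1) \<Phi>] by (rule arg_cong)
  also have "\<dots> = (\<lambda>ws. \<Sum>bs\<in>words ?B r. \<Phi> bs * act t x (simple_tensor E x bs) ws)"
    by (rule tlinear_sum[OF l finite_words[OF B(2)] d])
  finally have "tip E s x (act t x \<Phi>) \<Psi> = (\<Sum>bs\<in>words ?B r. cnj (\<Phi> bs) * tip E s x (act t x (simple_tensor E x bs)) \<Psi>)"
    by (simp only: tip_sum_left)
  also have "\<dots> = tip E r x \<Phi> (adj_form E r s t x \<Psi>)"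
    unfolding tip_words[of r] using words_onb_tup[OF B(1)] by (intro sum.cong) (auto simp: adj_form_def)
  finally show ?thesis by simp
qed

text \<open>Testing against simple tensors evaluates the form.\<close>

lemma tip_eqI:
  assumes x: "x \<in> topspace (base E)" and "\<Psi> \<in> tfib E r x" "\<Psi>' \<in> tfib E r x"
    "\<And>\<Phi>. \<Phi> \<in> tfib E r x \<Longrightarrow> tip E r x \<Phi> \<Psi> = tip E r x \<Phi> \<Psi>'"
  shows "\<Psi> = \<Psi>'"
proof (rule tfib_ext[OF assms(2,3)])
  fix ws assume ws: "ws \<in> tup E r x"
  show "\<Psi> ws = \<Psi>' ws"
    using assms(4)[OF simple_tensor_tfib[OF ws]] tip_simple_tensor[OF x ws assms(2)] tip_simple_tensor[OF x ws assms(3)] by simp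
qed

lemma madj_tmor_of:
  assumes t: "t \<in> tmors E r s"
  shows "madj (tpow E r) (tpow E s) t = tmor_of E s (adj_form E r s t)"
proof (rule tmor_of_eqI)
  fix x \<Psi> assume x: "x \<in> topspace (base E)" and \<Psi>: "\<Psi> \<in> tfib E s x"
  have l: "tlinear E r s x (act t x)" by (rule tmor_tlinear[OF t x])
  have "(THE v. v \<in> fib (tpow E r) x \<and> (\<forall>w\<in>fib (tpow E r) x. ip (tpow E r) w v = ip (tpow E s) (t w) (x, \<Psi>)))
     = (x, adj_form E r s t x \<Psi>)"
  proof (rule the_equality)
    show "(x, adj_form E r s t x \<Psi>) \<in> fib (tpow E r) x \<and>
      (\<forall>w\<in>fib (tpow E r) x. ip (tpow E r) w (x, adj_form E r s t x \<Psi>) = ip (tpow E s) (t w) (x, \<Psi>))"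
    proof (intro conjI ballI)
      show "(x, adj_form E r s t x \<Psi>) \<in> fib (tpow E r) x"
        using adj_form_tfib[OF l \<Psi>] x by (simp add: fib_tpow)
      fix w assume "w \<in> fib (tpow E r) x"
      then obtain \<Phi> where w: "w = (x, \<Phi>)" "\<Phi> \<in> tfib E r x" unfolding fib_tpow by blast
      show "ip (tpow E r) w (x, adj_form E r s t x \<Psi>) = ip (tpow E s) (t w) (x, \<Psi>)"
        using adj_form_tip[OF x l w(2)] by (simp add: w(1) tmor_apply[OF t x w(2)])
    qed
    fix v assume v: "v \<in> fib (tpow E r) x \<and> (\<forall>w\<in>fib (tpow E r) x. ip (tpow E r) w v = ip (tpow E s) (t w) (x, \<Psi>))"
    then obtain \<Theta> where v': "v = (x, \<Theta>)" "\<Theta> \<in> tfib E r x" unfolding fib_tpow by blast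
    have "\<Theta> = adj_form E r s t x \<Psi>"
    proof (rule tip_eqI[OF x v'(2) adj_form_tfib[OF l \<Psi>]])
      fix \<Phi> assume \<Phi>: "\<Phi> \<in> tfib E r x"
      have "(x, \<Phi>) \<in> fib (tpow E r) x" using \<Phi> x by (simp add: fib_tpow)
      then have "ip (tpow E r) (x, \<Phi>) v = ip (tpow E s) (t (x, \<Phi>)) (x, \<Psi>)" using v by blast
      then show "tip E r x \<Phi> \<Theta> = tip E r x \<Phi> (adj_form E r s t x \<Psi>)"
        using adj_form_tip[OF x l \<Phi>] by (simp add: v'(1) tmor_apply[OF t x \<Phi>])
    qed
    then show "v = (x, adj_form E r s t x \<Psi>)" using v'(1) by simp
  qed
  then show "madj (tpow E r) (tpow E s) t (x, \<Psi>) = (x, adj_form E r s t x \<Psi>)"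
    using x \<Psi> by (simp add: madj_def)
qed (simp add: madj_def)

text \<open>Continuity is tested on coefficients: $\langle \sigma, t^* v\rangle = \langle t\sigma, v\rangle$ is
  a scalar product of two continuous functions with values in the tensor power.\<close>

lemma madj_tmor:
  assumes t: "t \<in> tmors E r s"
  shows "madj (tpow E r) (tpow E s) t \<in> tmors E s r"
  unfolding madj_tmor_of[OF t]
proof (rule tmorI)
  fix x assume x: "x \<in> topspace (base E)"
  note l = tmor_tlinear[OF t x]
  show "tlinear E s r x (adj_form E r s t x)"
    unfolding tlinear_def by (auto simp: adj_form_tfib[OF l] adj_form_def tip_add tip_scl)
next
  fix U \<sigma>s assume U: "section_list E U r \<sigma>s"
  let ?Z = "subtopology (ttop E s) {v \<in> topspace (ttop E s). fst v \<in> U}"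
  have 1: "continuous_map ?Z (subtopology (base E) U) fst"
    by (intro continuous_map_into_subtopology continuous_map_from_subtopology fst_continuous) auto
  have 2: "continuous_map ?Z (ttop E s) (\<lambda>v. (fst v, act t (fst v) (simple_tensor E (fst v) (eval_secs \<sigma>s (fst v)))))"
    using continuous_map_compose[OF continuous_map_compose[OF 1 simple_tensor_section_continuous[OF U]] tmor_cont'[OF t]]
    by (simp add: o_def)
  have 3: "continuous_map ?Z (ttop E s) (\<lambda>v. (fst v, snd v))"
    by (simp add: continuous_map_from_subtopology)
  show "continuous_map ?Z euclidean (\<lambda>v. adj_form E r s t (fst v) (snd v) (eval_secs \<sigma>s (fst v)))"
    by (rule continuous_map_eq[OF tip_continuous[OF 2 3]]) (use section_list_tup[OF U] in \<open>auto simp: adj_form_def\<close>)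
qed

lemma act_tzero [simp]: "x \<in> topspace (base E) \<Longrightarrow> \<Phi> \<in> tfib E r x \<Longrightarrow> act (tzero E r) x \<Phi> = (\<lambda>_. 0)"
  by (simp add: tzero_tmor_of)

lemma act_mor_sum: "x \<in> topspace (base E) \<Longrightarrow> \<Phi> \<in> tfib E r x \<Longrightarrow>
    act (mor_sum E r I f) x \<Phi> = (\<lambda>ws. \<Sum>i\<in>I. act (f i) x \<Phi> ws)"
  by (simp add: mor_sum_def)

lemma act_madd: "t \<in> tmors E r s \<Longrightarrow> t' \<in> tmors E r s \<Longrightarrow> x \<in> topspace (base E) \<Longrightarrow> \<Phi> \<in> tfib E r x \<Longrightarrow>
    act (madd (tpow E r) (tpow E s) t t') x \<Phi> = (\<lambda>ws. act t x \<Phi> ws + act t' x \<Phi> ws)"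
  by (simp add: madd_tmor_of)

lemma act_mscl: "t \<in> tmors E r s \<Longrightarrow> x \<in> topspace (base E) \<Longrightarrow> \<Phi> \<in> tfib E r x \<Longrightarrow>
    act (mscl (tpow E r) (tpow E s) c t) x \<Phi> = (\<lambda>ws. c * act t x \<Phi> ws)"
  by (simp add: mscl_tmor_of)

lemma act_mcomp: "t \<in> tmors E r s \<Longrightarrow> t' \<in> tmors E s q \<Longrightarrow> x \<in> topspace (base E) \<Longrightarrow> \<Phi> \<in> tfib E r x \<Longrightarrow>
    act (mcomp (tpow E r) t' t) x \<Phi> = act t' x (act t x \<Phi>)"
  by (simp add: mcomp_tmor_of)

lemma tip_madj:
  assumes "t \<in> tmors E r s" "x \<in> topspace (base E)" "\<Phi> \<in> tfib E r x" "\<Psi> \<in> tfib E s x"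
  shows "tip E r x \<Phi> (act (madj (tpow E r) (tpow E s) t) x \<Psi>) = tip E s x (act t x \<Phi>) \<Psi>"
  using assms by (simp add: madj_tmor_of adj_form_tip[OF assms(2) tmor_tlinear[OF assms(1,2)]])

lemma madj_eqI:
  assumes t: "t \<in> tmors E r s" and t': "t' \<in> tmors E s r"
    and "\<And>x \<Phi> \<Psi>. x \<in> topspace (base E) \<Longrightarrow> \<Phi> \<in> tfib E r x \<Longrightarrow> \<Psi> \<in> tfib E s x \<Longrightarrow>
       tip E r x \<Phi> (act t' x \<Psi>) = tip E s x (act t x \<Phi>) \<Psi>"
  shows "madj (tpow E r) (tpow E s) t = t'"
proof (rule tmor_eqI[OF madj_tmor[OF t] t'])
  fix x \<Psi> assume x: "x \<in> topspace (base E)" and \<Psi>: "\<Psi> \<in> tfib E s x"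
  show "act (madj (tpow E r) (tpow E s) t) x \<Psi> = act t' x \<Psi>"
    by (rule tip_eqI[OF x act_tfib[OF madj_tmor[OF t] x \<Psi>] act_tfib[OF t' x \<Psi>]])
      (simp add: tip_madj[OF t x _ \<Psi>] assms(3)[OF x _ \<Psi>])
qed

lemma tip_madj_left:
  assumes t: "t \<in> tmors E r s" and x: "x \<in> topspace (base E)" and \<Phi>: "\<Phi> \<in> tfib E r x" and \<Psi>: "\<Psi> \<in> tfib E s x"
  shows "tip E r x (act (madj (tpow E r) (tpow E s) t) x \<Psi>) \<Phi> = tip E s x \<Psi> (act t x \<Phi>)"
  using arg_cong[OF tip_madj[OF t x \<Phi> \<Psi>], of cnj] by (simp add: tip_cnj)

lemma madj_madj: "t \<in> tmors E r s \<Longrightarrow> madj (tpow E s) (tpow E r) (madj (tpow E r) (tpow E s) t) = t"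
  by (rule madj_eqI) (simp_all add: madj_tmor tip_madj_left)

lemma madj_tzero: "madj (tpow E r) (tpow E s) (tzero E r) = tzero E s"
  by (rule madj_eqI) (simp_all add: tzero_tmor)

lemma madj_madd:
  "t \<in> tmors E r s \<Longrightarrow> t' \<in> tmors E r s \<Longrightarrow> madj (tpow E r) (tpow E s) (madd (tpow E r) (tpow E s) t t') =
     madd (tpow E s) (tpow E r) (madj (tpow E r) (tpow E s) t) (madj (tpow E r) (tpow E s) t')"
  by (rule madj_eqI) (simp_all add: madd_tmor madj_tmor act_madd tip_add tip_madj)

lemma madj_mscl:
  "t \<in> tmors E r s \<Longrightarrow> madj (tpow E r) (tpow E s) (mscl (tpow E r) (tpow E s) c t) =
     mscl (tpow E s) (tpow E r) (cnj c) (madj (tpow E r) (tpow E s) t)"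
  by (rule madj_eqI) (simp_all add: mscl_tmor madj_tmor act_mscl tip_scl tip_madj)

lemma tip_Suc:
  assumes "x \<in> topspace (base E)"
  shows "tip E (Suc r) x \<Phi> \<Psi> = (\<Sum>b\<in>chosen_onb E x. tip E r x (slice \<Phi> b) (slice \<Psi> b))"
  unfolding tip_words sum_words_snoc[OF finite_chosen_onb[OF assms]] by (simp add: slice_def)

lemma amplify_tmor_of:
  assumes t: "t \<in> tmors E r s"
  shows "amplify E r s t = tmor_of E (Suc r) (amp_form E s t)"
proof (rule tmor_of_eqI)
  fix x \<Phi> assume x: "x \<in> topspace (base E)" and \<Phi>: "\<Phi> \<in> tfib E (Suc r) x"
  let ?T = "\<lambda>zs. if zs \<in> tup E (s + 1) x
              then snd (t (x, \<lambda>ws. if ws \<in> tup E r x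
                                   then snd (mid (tpow E 1) (x, \<lambda>ws'. \<Phi> (ws @ ws'))) (drop s zs)
                                   else 0)) (take s zs)
              else 0"
  have "?T zs = amp_form E s t x \<Phi> zs" for zs
  proof (cases "zs \<in> tup E (Suc s) x")
    case True
    then obtain us b where zs: "zs = us @ [b]" "us \<in> tup E s x" "b \<in> fib E x" by (rule tup_Suc_snocE)
    have l: "length us = s" using tup_length[OF zs(2)] .
    have "(\<lambda>ws'. \<Phi> (ws @ ws')) \<in> tfib E 1 x" if ws: "ws \<in> tup E r x" for ws
    proof -
      have "\<Phi> (ws @ zs) = 0" if "zs \<notin> tup E 1 x" for zs
        using tup_append_iff[OF tup_length[OF ws], of zs E 1 x] that tfib_outside[OF \<Phi>, of "ws @ zs"] by simp
      moreover have "conj_linear E x (\<lambda>v. \<Phi> (ws @ us @ v # zs))" if "us @ v # zs \<in> tup E 1 x" for us v zs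
      proof -
        have e: "us = []" "zs = []" using tup_length[OF that] by auto
        then have "ws @ v # [] \<in> tup E (Suc r) x" using that ws by (simp add: tup_snoc)
        from tfib_slot'[OF \<Phi> this] show ?thesis by (simp add: e)
      qed
      ultimately show ?thesis by (intro tfibI) auto
    qed
    then have "snd (mid (tpow E 1) (x, \<lambda>ws'. \<Phi> (ws @ ws'))) = (\<lambda>ws'. \<Phi> (ws @ ws'))" if "ws \<in> tup E r x" for ws
      using x that by (simp add: mid_def)
    then have "(\<lambda>ws. if ws \<in> tup E r x then snd (mid (tpow E 1) (x, \<lambda>ws'. \<Phi> (ws @ ws'))) (drop s zs) else 0) = slice \<Phi> b"
      using tfib_outside[OF slice_tfib[OF \<Phi> zs(3)]] l by (auto simp: slice_def zs(1))
    then show ?thesis using True l by (simp add: amp_form_def act_def zs(1))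
  qed (simp add: amp_form_def)
  then have e: "?T = amp_form E s t x \<Phi>" by (rule ext)
  have "amplify E r s t (x, \<Phi>) = (x, ?T)"
    using x \<Phi> by (simp add: amplify_def tens_def cong: if_cong)
  then show "amplify E r s t (x, \<Phi>) = (x, amp_form E s t x \<Phi>)" unfolding e .
qed (simp add: amplify_def tens_def)

lemma slice_amp_form:
  assumes "tlinear E r s x (act t x)" "\<Phi> \<in> tfib E (Suc r) x" "b \<in> fib E x"
  shows "slice (amp_form E s t x \<Phi>) b = act t x (slice \<Phi> b)"
proof
  fix zs show "slice (amp_form E s t x \<Phi>) b zs = act t x (slice \<Phi> b) zs"
    using tfib_outside[OF tlinear_fib[OF assms(1) slice_tfib[OF assms(2,3)]], of zs] assms(3)
    by (auto simp: slice_def[of "amp_form E s t x \<Phi>"] amp_form_def tup_snoc)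
qed

lemma amp_form_tlinear:
  assumes l: "tlinear E r s x (act t x)"
  shows "tlinear E (Suc r) (Suc s) x (amp_form E s t x)"
proof -
  have m: "amp_form E s t x \<Phi> \<in> tfib E (Suc s) x" if \<Phi>: "\<Phi> \<in> tfib E (Suc r) x" for \<Phi>
  proof (rule tfib_SucI)
    fix b assume b: "b \<in> fib E x"
    show "slice (amp_form E s t x \<Phi>) b \<in> tfib E s x"
      unfolding slice_amp_form[OF l \<Phi> b] by (rule tlinear_fib[OF l slice_tfib[OF \<Phi> b]])
  next
    fix zs assume zs: "zs \<in> tup E s x"
    have add: "slice \<Phi> (vadd E v w) = (\<lambda>ws. slice \<Phi> v ws + slice \<Phi> w ws)" if "v \<in> fib E x" "w \<in> fib E x" for v w
    proof (rule tfib_ext[OF slice_tfib[OF \<Phi> vadd_fib[OF that]] tfib_add[OF slice_tfib[OF \<Phi> that(1)] slice_tfib[OF \<Phi> that(2)]]])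
      fix ws assume "ws \<in> tup E r x"
      from slice_conj_linear[OF \<Phi> this] show "slice \<Phi> (vadd E v w) ws = slice \<Phi> v ws + slice \<Phi> w ws"
        using that by (simp add: conj_linear_def)
    qed
    have scl: "slice \<Phi> (vscl E c v) = (\<lambda>ws. cnj c * slice \<Phi> v ws)" if "v \<in> fib E x" for v c
    proof (rule tfib_ext[OF slice_tfib[OF \<Phi> vscl_fib[OF that]] tfib_scl[OF slice_tfib[OF \<Phi> that]]])
      fix ws assume "ws \<in> tup E r x"
      from slice_conj_linear[OF \<Phi> this] show "slice \<Phi> (vscl E c v) ws = cnj c * slice \<Phi> v ws"
        using that by (simp add: conj_linear_def)
    qed
    show "conj_linear E x (\<lambda>b. slice (amp_form E s t x \<Phi>) b zs)"
      unfolding conj_linear_def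
      by (simp add: slice_amp_form[OF l \<Phi>] vadd_fib vscl_fib add scl tlinear_add[OF l] tlinear_scl[OF l] slice_tfib[OF \<Phi>])
  qed (simp add: amp_form_def)
  show ?thesis
    unfolding tlinear_def
  proof (intro ballI conjI allI)
    fix \<Phi> assume \<Phi>: "\<Phi> \<in> tfib E (Suc r) x"
    show "amp_form E s t x \<Phi> \<in> tfib E (Suc s) x" using m[OF \<Phi>] .
    show "amp_form E s t x (\<lambda>ws. c * \<Phi> ws) = (\<lambda>ws. c * amp_form E s t x \<Phi> ws)" for c
      by (rule tfib_Suc_ext[OF m[OF tfib_scl[OF \<Phi>]] tfib_scl[OF m[OF \<Phi>]]])
        (simp add: slice_amp_form[OF l] \<Phi> tfib_scl slice_linear tlinear_scl[OF l] slice_tfib[OF \<Phi>])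
    fix \<Psi> assume \<Psi>: "\<Psi> \<in> tfib E (Suc r) x"
    show "amp_form E s t x (\<lambda>ws. \<Phi> ws + \<Psi> ws) = (\<lambda>ws. amp_form E s t x \<Phi> ws + amp_form E s t x \<Psi> ws)"
      by (rule tfib_Suc_ext[OF m[OF tfib_add[OF \<Phi> \<Psi>]] tfib_add[OF m[OF \<Phi>] m[OF \<Psi>]]])
        (simp add: slice_amp_form[OF l] \<Phi> \<Psi> tfib_add slice_linear tlinear_add[OF l] slice_tfib)
  qed
qed

lemma amplify_tmor:
  assumes t: "t \<in> tmors E r s"
  shows "amplify E r s t \<in> tmors E (Suc r) (Suc s)"
  unfolding amplify_tmor_of[OF t]
proof (rule tmorI)
  fix x assume "x \<in> topspace (base E)"
  then show "tlinear E (Suc r) (Suc s) x (amp_form E s t x)" by (intro amp_form_tlinear tmor_tlinear[OF t])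
next
  fix U \<sigma>s assume U: "section_list E U (Suc s) \<sigma>s"
  then have "length \<sigma>s = Suc s" by (simp add: section_list_def)
  then obtain \<sigma>s' \<tau> where \<sigma>: "\<sigma>s = \<sigma>s' @ [\<tau>]" by (cases \<sigma>s rule: rev_cases) auto
  then have U': "section_list E U s \<sigma>s'" using U by (simp add: section_list_def)
  have o: "openin (base E) U" and \<tau>: "local_section E U \<tau>" using U \<sigma> by (auto simp: section_list_def)
  have sub: "U \<subseteq> topspace (base E)" using openin_subset[OF o] .
  have \<tau>f: "\<tau> y \<in> fib E y" if "y \<in> U" for y using local_section_fib[OF \<tau>, of y] sub that by auto
  let ?S = "{v \<in> topspace (ttop E (Suc r)). fst v \<in> U}"
  let ?Z = "subtopology (ttop E (Suc r)) ?S"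
  have g: "continuous_map ?Z (ttop E r) (\<lambda>v. (fst v, slice (snd v) (\<tau> (fst v))))"
  proof (rule continuous_into_ttop)
    fix z assume "z \<in> topspace ?Z"
    then show "(fst z, slice (snd z) (\<tau> (fst z))) \<in> topspace (ttop E r)"
      by (cases z) (auto intro: slice_tfib \<tau>f)
  next
    show "continuous_map ?Z (base E) (\<lambda>z. fst (fst z, slice (snd z) (\<tau> (fst z))))"
      by (simp add: continuous_map_from_subtopology fst_continuous)
  next
    fix V \<rho>s assume V: "section_list E V r \<rho>s"
    have oV: "openin (base E) (U \<inter> V)" using o V by (auto simp: section_list_def)
    have "section_list E (U \<inter> V) (Suc r) (\<rho>s @ [\<tau>])"
      using section_list_mono[OF V oV] local_section_mono[OF \<tau>, of "U \<inter> V"] by (simp add: section_list_def)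
    from coef_continuous[OF this]
    have "continuous_map (subtopology (ttop E (Suc r)) {v \<in> topspace (ttop E (Suc r)). fst v \<in> U \<inter> V}) euclidean
       (\<lambda>v. slice (snd v) (\<tau> (fst v)) (eval_secs \<rho>s (fst v)))" by (simp add: slice_def)
    moreover have "subtopology ?Z {z \<in> topspace ?Z. fst (fst z, slice (snd z) (\<tau> (fst z))) \<in> V} =
      subtopology (ttop E (Suc r)) {v \<in> topspace (ttop E (Suc r)). fst v \<in> U \<inter> V}"
      unfolding subtopology_subtopology by (rule arg_cong[where f = "subtopology (ttop E (Suc r))"]) auto
    ultimately show "continuous_map (subtopology ?Z {z \<in> topspace ?Z. fst (fst z, slice (snd z) (\<tau> (fst z))) \<in> V}) euclidean
       (\<lambda>z. snd (fst z, slice (snd z) (\<tau> (fst z))) (eval_secs \<rho>s (fst (fst z, slice (snd z) (\<tau> (fst z))))))"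
      by simp
  qed
  have "continuous_map ?Z (ttop E s) (\<lambda>v. (fst v, act t (fst v) (slice (snd v) (\<tau> (fst v)))))"
    using continuous_map_compose[OF g tmor_cont'[OF t]] by (simp add: o_def)
  from coef_comp[OF this U']
  have "continuous_map (subtopology ?Z {z \<in> topspace ?Z. fst z \<in> U}) euclidean
      (\<lambda>v. act t (fst v) (slice (snd v) (\<tau> (fst v))) (eval_secs \<sigma>s' (fst v)))" by simp
  moreover have "subtopology ?Z {z \<in> topspace ?Z. fst z \<in> U} = ?Z"
    unfolding subtopology_subtopology by (rule arg_cong[where f = "subtopology (ttop E (Suc r))"]) auto
  ultimately have c: "continuous_map ?Z euclidean
      (\<lambda>v. act t (fst v) (slice (snd v) (\<tau> (fst v))) (eval_secs \<sigma>s' (fst v)))" by simp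
  show "continuous_map ?Z euclidean (\<lambda>v. amp_form E s t (fst v) (snd v) (eval_secs \<sigma>s (fst v)))"
    by (rule continuous_map_eq[OF c]) (use section_list_tup[OF U] in \<open>auto simp: amp_form_def \<sigma>\<close>)
qed

text \<open>The characterisation of the amplification from which its compatibility with all operations follows.\<close>

lemma slice_amplify:
  assumes "t \<in> tmors E r s" "x \<in> topspace (base E)" "\<Phi> \<in> tfib E (Suc r) x" "b \<in> fib E x"
  shows "slice (act (amplify E r s t) x \<Phi>) b = act t x (slice \<Phi> b)"
  using assms by (simp add: amplify_tmor_of slice_amp_form[OF tmor_tlinear])

lemma amplify_eqI:
  assumes t: "t \<in> tmors E r s" and t': "t' \<in> tmors E (Suc r) (Suc s)"
    and eq: "\<And>x \<Phi> b. x \<in> topspace (base E) \<Longrightarrow> \<Phi> \<in> tfib E (Suc r) x \<Longrightarrow> b \<in> fib E x \<Longrightarrow>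
      slice (act t' x \<Phi>) b = act t x (slice \<Phi> b)"
  shows "amplify E r s t = t'"
proof (rule tmor_eqI[OF amplify_tmor[OF t] t'])
  fix x \<Phi> assume x: "x \<in> topspace (base E)" "\<Phi> \<in> tfib E (Suc r) x"
  show "act (amplify E r s t) x \<Phi> = act t' x \<Phi>"
    by (rule tfib_Suc_ext[OF act_tfib[OF amplify_tmor[OF t] x] act_tfib[OF t' x]])
      (simp add: eq[OF x] slice_amplify[OF t x])
qed

lemma amplify_tzero: "amplify E r s (tzero E r) = tzero E (Suc r)"
  by (rule amplify_eqI) (simp_all add: tzero_tmor slice_linear slice_tfib)

lemma amplify_madd:
  "t \<in> tmors E r s \<Longrightarrow> t' \<in> tmors E r s \<Longrightarrow> amplify E r s (madd (tpow E r) (tpow E s) t t') =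
     madd (tpow E (Suc r)) (tpow E (Suc s)) (amplify E r s t) (amplify E r s t')"
  by (rule amplify_eqI)
    (simp_all add: madd_tmor amplify_tmor act_madd slice_tfib slice_linear slice_amplify)

lemma amplify_mscl:
  "t \<in> tmors E r s \<Longrightarrow> amplify E r s (mscl (tpow E r) (tpow E s) c t) =
     mscl (tpow E (Suc r)) (tpow E (Suc s)) c (amplify E r s t)"
  by (rule amplify_eqI)
    (simp_all add: mscl_tmor amplify_tmor act_mscl slice_tfib slice_linear slice_amplify)

lemma amplify_mcomp:
  assumes "t \<in> tmors E r s" "t' \<in> tmors E s q"
  shows "amplify E r q (mcomp (tpow E r) t' t) = mcomp (tpow E (Suc r)) (amplify E s q t') (amplify E r s t)"
proof (rule amplify_eqI)
  have a: "amplify E r s t \<in> tmors E (Suc r) (Suc s)" "amplify E s q t' \<in> tmors E (Suc s) (Suc q)"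
    using assms by (simp_all add: amplify_tmor)
  show "mcomp (tpow E (Suc r)) (amplify E s q t') (amplify E r s t) \<in> tmors E (Suc r) (Suc q)"
    by (rule mcomp_tmor[OF a])
  fix x \<Phi> b assume x: "x \<in> topspace (base E)" "\<Phi> \<in> tfib E (Suc r) x" and b: "b \<in> fib E x"
  show "slice (act (mcomp (tpow E (Suc r)) (amplify E s q t') (amplify E r s t)) x \<Phi>) b =
      act (mcomp (tpow E r) t' t) x (slice \<Phi> b)"
    unfolding act_mcomp[OF a x] act_mcomp[OF assms x(1) slice_tfib[OF x(2) b]]
      slice_amplify[OF assms(2) x(1) act_tfib[OF a(1) x] b] slice_amplify[OF assms(1) x b] ..
qed (rule mcomp_tmor[OF assms])

lemma amplify_mor_sum:
  assumes "finite I" "\<And>i. i \<in> I \<Longrightarrow> f i \<in> tmors E r s"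
  shows "amplify E r s (mor_sum E r I f) = mor_sum E (Suc r) I (\<lambda>i. amplify E r s (f i))"
proof (rule amplify_eqI)
  fix x \<Phi> b assume "x \<in> topspace (base E)" "\<Phi> \<in> tfib E (Suc r) x" "b \<in> fib E x"
  then show "slice (act (mor_sum E (Suc r) I (\<lambda>i. amplify E r s (f i))) x \<Phi>) b = act (mor_sum E r I f) x (slice \<Phi> b)"
    using assms(2) by (simp add: act_mor_sum slice_tfib slice_linear slice_amplify)
qed (use assms in \<open>auto intro: mor_sum_tmor amplify_tmor\<close>)

text \<open>The scalar product of the next power is the sum over a basis of the scalar products of the slices
  (\<open>tip_Suc\<close>), and amplification acts on each slice by \<open>t\<close>.\<close>

lemma amplify_madj:
  assumes t: "t \<in> tmors E r s"
  shows "amplify E s r (madj (tpow E r) (tpow E s) t) = madj (tpow E (Suc r)) (tpow E (Suc s)) (amplify E r s t)"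
proof (rule madj_eqI[symmetric])
  fix x \<Phi> \<Psi> assume x: "x \<in> topspace (base E)" and \<Phi>: "\<Phi> \<in> tfib E (Suc r) x" and \<Psi>: "\<Psi> \<in> tfib E (Suc s) x"
  have b: "b \<in> fib E x" if "b \<in> chosen_onb E x" for b using onb_chosen_onb[OF x] that by (auto simp: onb_def)
  show "tip E (Suc r) x \<Phi> (act (amplify E s r (madj (tpow E r) (tpow E s) t)) x \<Psi>) =
       tip E (Suc s) x (act (amplify E r s t) x \<Phi>) \<Psi>"
    unfolding tip_Suc[OF x]
  proof (rule sum.cong[OF refl])
    fix c assume "c \<in> chosen_onb E x"
    note c = b[OF this]
    show "tip E r x (slice \<Phi> c) (slice (act (amplify E s r (madj (tpow E r) (tpow E s) t)) x \<Psi>) c) =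
         tip E s x (slice (act (amplify E r s t) x \<Phi>) c) (slice \<Psi> c)"
      unfolding slice_amplify[OF t x \<Phi> c] slice_amplify[OF madj_tmor[OF t] x \<Psi> c]
      by (rule tip_madj[OF t x slice_tfib[OF \<Phi> c] slice_tfib[OF \<Psi> c]])
  qed
qed (use t in \<open>auto intro: amplify_tmor madj_tmor\<close>)

end

section \<open>The algebraic Cuntz--Pimsner algebra\<close>

text \<open>Together with \<open>stable\<close>, this splits the definition of \<^const>\<open>tmats\<close>, so
  that bounds can be named.\<close>

definition banded :: "('e, 'x) vbundle \<Rightarrow> nat \<Rightarrow> ('e, 'x) tmat \<Rightarrow> bool" where
  "banded E K a \<longleftrightarrow> (\<forall>n m. n + K < m \<or> m + K < n \<longrightarrow> a n m = tzero E n)"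

definition stable :: "('e, 'x) vbundle \<Rightarrow> nat \<Rightarrow> ('e, 'x) tmat \<Rightarrow> bool" where
  "stable E N a \<longleftrightarrow> (\<forall>n\<ge>N. \<forall>m. a (Suc n) (Suc m) = amplify E n m (a n m))"

definition tadd :: "('e, 'x) vbundle \<Rightarrow> ('e, 'x) tmat \<Rightarrow> ('e, 'x) tmat \<Rightarrow> ('e, 'x) tmat" where
  "tadd E a b = (\<lambda>n m. madd (tpow E n) (tpow E m) (a n m) (b n m))"

definition tscl :: "('e, 'x) vbundle \<Rightarrow> complex \<Rightarrow> ('e, 'x) tmat \<Rightarrow> ('e, 'x) tmat" where
  "tscl E c a = (\<lambda>n m. mscl (tpow E n) (tpow E m) c (a n m))"

definition tstar :: "('e, 'x) vbundle \<Rightarrow> ('e, 'x) tmat \<Rightarrow> ('e, 'x) tmat" where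
  "tstar E a = (\<lambda>n m. madj (tpow E m) (tpow E n) (a m n))"

definition tcirc :: "('e, 'x) vbundle \<Rightarrow> complex \<Rightarrow> ('e, 'x) tmat \<Rightarrow> ('e, 'x) tmat" where
  "tcirc E z a = (\<lambda>n m. mscl (tpow E n) (tpow E m) (z powi (int m - int n)) (a n m))"

definition core_class :: "('e, 'x) vbundle \<Rightarrow> ('e, 'x) tmat \<Rightarrow> ('e, 'x) cpcore" where
  "core_class E a = tmat_rel E `` {a}"

lemma tmats_iff: "a \<in> tmats E \<longleftrightarrow> (\<forall>n m. a n m \<in> tmors E n m) \<and> (\<exists>K. banded E K a) \<and> (\<exists>N. stable E N a)"
  by (simp add: tmats_def banded_def stable_def)

lemma tmatsI: "(\<And>n m. a n m \<in> tmors E n m) \<Longrightarrow> banded E K a \<Longrightarrow> stable E N a \<Longrightarrow> a \<in> tmats E"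
  by (auto simp: tmats_iff)

lemma tmats_tmor: "a \<in> tmats E \<Longrightarrow> a n m \<in> tmors E n m"
  by (simp add: tmats_iff)

lemma banded_mono: "banded E K a \<Longrightarrow> K \<le> L \<Longrightarrow> banded E L a"
  by (auto simp: banded_def)

lemma stable_mono: "stable E N a \<Longrightarrow> N \<le> M \<Longrightarrow> stable E M a"
  by (auto simp: stable_def)

lemma tmats_banded2:
  assumes "a \<in> tmats E" "b \<in> tmats E"
  obtains K where "banded E K a" "banded E K b"
proof -
  obtain K L where "banded E K a" "banded E L b" using assms by (auto simp: tmats_iff)
  then show ?thesis using that[of "max K L"] banded_mono[of E _ _ "max K L"] by simp
qed

lemma tmats_stable2:
  assumes "a \<in> tmats E" "b \<in> tmats E"
  obtains K where "stable E K a" "stable E K b"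
proof -
  obtain K L where "stable E K a" "stable E L b" using assms by (auto simp: tmats_iff)
  then show ?thesis using that[of "max K L"] stable_mono[of E _ _ "max K L"] by simp
qed

lemma tmat_relI: "a \<in> tmats E \<Longrightarrow> b \<in> tmats E \<Longrightarrow> (\<And>n m. N \<le> n \<Longrightarrow> a n m = b n m) \<Longrightarrow> (a, b) \<in> tmat_rel E"
  by (auto simp: tmat_rel_def)

lemma equiv_tmat_rel: "equiv (tmats E) (tmat_rel E)"
proof (rule equivI)
  show "tmat_rel E \<subseteq> tmats E \<times> tmats E" by (auto simp: tmat_rel_def)
  show "refl_on (tmats E) (tmat_rel E)" by (auto simp: refl_on_def tmat_rel_def)
  show "sym (tmat_rel E)" unfolding sym_def tmat_rel_def by fastforce
  show "trans (tmat_rel E)"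
  proof (rule transI)
    fix a b c assume "(a, b) \<in> tmat_rel E" "(b, c) \<in> tmat_rel E"
    then obtain N M where 1: "a \<in> tmats E" "b \<in> tmats E" "c \<in> tmats E"
      and 2: "\<forall>n\<ge>N. \<forall>m. a n m = b n m" "\<forall>n\<ge>M. \<forall>m. b n m = c n m"
      by (auto simp: tmat_rel_def)
    show "(a, c) \<in> tmat_rel E" by (rule tmat_relI[OF 1(1,3), of "max N M"]) (use 2 in auto)
  qed
qed

lemma qmap_class:
  assumes R: "equiv A R" "equiv B S" and a: "a \<in> A" and f: "\<And>a b. (a, b) \<in> R \<Longrightarrow> (f a, f b) \<in> S"
  shows "qmap S f (R `` {a}) = S `` {f a}"
proof -
  have "S `` {f b} = S `` {f a}" if "b \<in> R `` {a}" for b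
    using equiv_class_eq[OF R(2) f[of a b]] that by auto
  moreover have "a \<in> R `` {a}" using equiv_class_self[OF R(1) a] .
  ultimately show ?thesis unfolding qmap_def by blast
qed

lemma qmap2_class:
  assumes R: "equiv A R" and a: "a \<in> A" "b \<in> A"
    and f: "\<And>a a' b b'. (a, a') \<in> R \<Longrightarrow> (b, b') \<in> R \<Longrightarrow> (f a b, f a' b') \<in> R"
  shows "qmap2 R f (R `` {a}) (R `` {b}) = R `` {f a b}"
proof -
  have "R `` {f a' b'} = R `` {f a b}" if "a' \<in> R `` {a}" "b' \<in> R `` {b}" for a' b'
    using equiv_class_eq[OF R f[of a a' b b']] that by auto
  moreover have "a \<in> R `` {a}" "b \<in> R `` {b}" using equiv_class_self[OF R] a by auto
  ultimately show ?thesis unfolding qmap2_def by blast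
qed

lemma core_class_car: "a \<in> tmats E \<Longrightarrow> core_class E a \<in> car (cp_core E)"
  by (simp add: core_class_def cp_core_def quotientI)

lemma carE:
  assumes "X \<in> car (cp_core E)"
  obtains a where "a \<in> tmats E" "X = core_class E a"
  using assms by (auto simp: core_class_def cp_core_def elim: quotientE)

lemma core_class_eq_iff: "a \<in> tmats E \<Longrightarrow> b \<in> tmats E \<Longrightarrow> core_class E a = core_class E b \<longleftrightarrow> (a, b) \<in> tmat_rel E"
  unfolding core_class_def by (rule eq_equiv_class_iff[OF equiv_tmat_rel])

lemma mor_sum_reindex: "inj_on h I \<Longrightarrow> mor_sum E r (h ` I) f = mor_sum E r I (\<lambda>i. f (h i))"
  by (simp add: mor_sum_def sum.reindex)

context framed_bundle
begin

lemma tmat_eqI: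
  assumes "a \<in> tmats E" "b \<in> tmats E"
    "\<And>n m x \<Phi> ws. x \<in> topspace (base E) \<Longrightarrow> \<Phi> \<in> tfib E n x \<Longrightarrow> act (a n m) x \<Phi> ws = act (b n m) x \<Phi> ws"
  shows "a = b"
proof (intro ext)
  fix n m v
  have "a n m = b n m"
    by (rule tmor_eqI[OF tmats_tmor[OF assms(1)] tmats_tmor[OF assms(2)]]) (use assms(3) in blast)
  then show "a n m v = b n m v" by simp
qed

lemma act_tlinear: "a \<in> tmats E \<Longrightarrow> x \<in> topspace (base E) \<Longrightarrow> tlinear E n m x (act (a n m) x)"
  by (rule tmor_tlinear[OF tmats_tmor])

lemma act_fib: "a \<in> tmats E \<Longrightarrow> x \<in> topspace (base E) \<Longrightarrow> \<Phi> \<in> tfib E n x \<Longrightarrow> act (a n m) x \<Phi> \<in> tfib E m x"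
  by (rule act_tfib[OF tmats_tmor])

lemma act_tadd: "a \<in> tmats E \<Longrightarrow> b \<in> tmats E \<Longrightarrow> x \<in> topspace (base E) \<Longrightarrow> \<Phi> \<in> tfib E n x \<Longrightarrow>
    act (tadd E a b n m) x \<Phi> = (\<lambda>ws. act (a n m) x \<Phi> ws + act (b n m) x \<Phi> ws)"
  unfolding tadd_def by (rule act_madd[OF tmats_tmor tmats_tmor])

lemma act_tscl: "a \<in> tmats E \<Longrightarrow> x \<in> topspace (base E) \<Longrightarrow> \<Phi> \<in> tfib E n x \<Longrightarrow>
    act (tscl E c a n m) x \<Phi> = (\<lambda>ws. c * act (a n m) x \<Phi> ws)"
  unfolding tscl_def by (rule act_mscl[OF tmats_tmor])

lemma act_tcirc: "a \<in> tmats E \<Longrightarrow> x \<in> topspace (base E) \<Longrightarrow> \<Phi> \<in> tfib E n x \<Longrightarrow>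
    act (tcirc E z a n m) x \<Phi> = (\<lambda>ws. z powi (int m - int n) * act (a n m) x \<Phi> ws)"
  unfolding tcirc_def by (rule act_mscl[OF tmats_tmor])

lemma tip_tstar: "a \<in> tmats E \<Longrightarrow> x \<in> topspace (base E) \<Longrightarrow> \<Phi> \<in> tfib E m x \<Longrightarrow> \<Psi> \<in> tfib E n x \<Longrightarrow>
    tip E m x \<Phi> (act (tstar E a n m) x \<Psi>) = tip E n x (act (a m n) x \<Phi>) \<Psi>"
  unfolding tstar_def by (rule tip_madj[OF tmats_tmor])

lemma madd_tzero: "madd (tpow E n) (tpow E m) (tzero E n) (tzero E n) = tzero E n"
  by (rule tmor_eqI[OF madd_tmor[OF tzero_tmor tzero_tmor] tzero_tmor])
    (simp add: act_madd[OF tzero_tmor tzero_tmor])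

lemma mscl_tzero: "mscl (tpow E n) (tpow E m) c (tzero E n) = tzero E n"
  by (rule tmor_eqI[OF mscl_tmor[OF tzero_tmor] tzero_tmor]) (simp add: act_mscl[OF tzero_tmor])

lemma tadd_tmats:
  assumes a: "a \<in> tmats E" and b: "b \<in> tmats E"
  shows "tadd E a b \<in> tmats E"
proof -
  obtain K where K: "banded E K a" "banded E K b" using tmats_banded2[OF a b] .
  obtain N where N: "stable E N a" "stable E N b" using tmats_stable2[OF a b] .
  show ?thesis
  proof (rule tmatsI)
    show "tadd E a b n m \<in> tmors E n m" for n m
      unfolding tadd_def by (rule madd_tmor[OF tmats_tmor[OF a] tmats_tmor[OF b]])
    show "banded E K (tadd E a b)"
      using K by (simp add: banded_def tadd_def madd_tzero)
    show "stable E N (tadd E a b)"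
      using N by (simp add: stable_def tadd_def amplify_madd[OF tmats_tmor[OF a] tmats_tmor[OF b]])
  qed
qed

lemma scale_tmats:
  assumes a: "a \<in> tmats E" and c: "\<And>n m. c (Suc n) (Suc m) = c n m"
  shows "(\<lambda>n m. mscl (tpow E n) (tpow E m) (c n m) (a n m)) \<in> tmats E"
proof -
  obtain K N where K: "banded E K a" and N: "stable E N a" using a by (auto simp: tmats_iff)
  show ?thesis
  proof (rule tmatsI)
    show "mscl (tpow E n) (tpow E m) (c n m) (a n m) \<in> tmors E n m" for n m
      by (rule mscl_tmor[OF tmats_tmor[OF a]])
    show "banded E K (\<lambda>n m. mscl (tpow E n) (tpow E m) (c n m) (a n m))"
      using K by (simp add: banded_def mscl_tzero)
    show "stable E N (\<lambda>n m. mscl (tpow E n) (tpow E m) (c n m) (a n m))"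
      using N by (simp add: stable_def amplify_mscl[OF tmats_tmor[OF a]] c)
  qed
qed

lemma tscl_tmats: "a \<in> tmats E \<Longrightarrow> tscl E c a \<in> tmats E"
  unfolding tscl_def by (rule scale_tmats[of a "\<lambda>_ _. c"]) simp_all

lemma tcirc_tmats: "a \<in> tmats E \<Longrightarrow> tcirc E z a \<in> tmats E"
  unfolding tcirc_def by (rule scale_tmats) simp_all

lemma tstar_tmats:
  assumes a: "a \<in> tmats E"
  shows "tstar E a \<in> tmats E"
proof -
  obtain K N where K: "banded E K a" and N: "stable E N a" using a by (auto simp: tmats_iff)
  show ?thesis
  proof (rule tmatsI)
    show "tstar E a n m \<in> tmors E n m" for n m
      unfolding tstar_def by (rule madj_tmor[OF tmats_tmor[OF a]])
    show bs: "banded E K (tstar E a)"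
      unfolding banded_def
    proof (intro allI impI)
      fix n m assume "n + K < m \<or> m + K < n"
      then have "a m n = tzero E m" using K unfolding banded_def by blast
      then show "tstar E a n m = tzero E n" by (simp add: tstar_def madj_tzero)
    qed
    show "stable E (N + K) (tstar E a)"
      unfolding stable_def
    proof (intro allI impI)
      fix n m assume n: "N + K \<le> n"
      show "tstar E a (Suc n) (Suc m) = amplify E n m (tstar E a n m)"
      proof (cases "N \<le> m")
        case True
        then have "a (Suc m) (Suc n) = amplify E m n (a m n)" using N by (simp add: stable_def)
        then show ?thesis unfolding tstar_def using amplify_madj[OF tmats_tmor[OF a]] by simp
      next
        case False
        then have "tstar E a (Suc n) (Suc m) = tzero E (Suc n)" "tstar E a n m = tzero E n"
          using bs n by (simp_all add: banded_def)
        then show ?thesis by (simp add: amplify_tzero)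
      qed
    qed
  qed
qed

text \<open>The index set in the definition of the product depends on the zero pattern of the matrix. Over any
  finite set that contains it the sum has the same value.\<close>

lemma tmat_mult_mor_sum:
  assumes a: "a \<in> tmats E" and b: "b \<in> tmats E" and I: "finite I" "\<And>l. b n l \<noteq> tzero E n \<Longrightarrow> l \<in> I"
  shows "tmat_mult E a b n m = mor_sum E n I (\<lambda>l. mcomp (tpow E n) (a l m) (b n l))"
  unfolding mor_sum_def
proof (rule tmor_of_eqI)
  fix x \<Phi> assume x: "x \<in> topspace (base E)" "\<Phi> \<in> tfib E n x"
  have e: "snd (a l m (b n l (x, \<Phi>))) = act (mcomp (tpow E n) (a l m) (b n l)) x \<Phi>" for l
    unfolding act_mcomp[OF tmats_tmor[OF b] tmats_tmor[OF a] x] tmor_apply[OF tmats_tmor[OF b] x]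
    by (simp add: act_def)
  have z: "act (mcomp (tpow E n) (a l m) (b n l)) x \<Phi> = (\<lambda>_. 0)" if "b n l = tzero E n" for l
    unfolding act_mcomp[OF tmats_tmor[OF b] tmats_tmor[OF a] x]
    using x by (simp add: that tlinear_zero[OF act_tlinear[OF a x(1)]])
  have "(\<Sum>l | b n l \<noteq> tzero E n. act (mcomp (tpow E n) (a l m) (b n l)) x \<Phi> ws) =
     (\<Sum>l\<in>I. act (mcomp (tpow E n) (a l m) (b n l)) x \<Phi> ws)" for ws
    using I z by (intro sum.mono_neutral_left) auto
  then show "tmat_mult E a b n m (x, \<Phi>) = (x, \<lambda>ws. \<Sum>l\<in>I. act (mcomp (tpow E n) (a l m) (b n l)) x \<Phi> ws)"
    using x by (simp add: tmat_mult_def e)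
qed (simp add: tmat_mult_def)

lemma act_tmat_mult:
  assumes a: "a \<in> tmats E" and b: "b \<in> tmats E" and K: "banded E K b" and n: "n + K \<le> L"
    and x: "x \<in> topspace (base E)" "\<Phi> \<in> tfib E n x"
  shows "act (tmat_mult E a b n m) x \<Phi> ws = (\<Sum>l\<le>L. act (a l m) x (act (b n l) x \<Phi>) ws)"
proof -
  have I: "l \<in> {..L}" if "b n l \<noteq> tzero E n" for l
  proof -
    have "\<not> (n + K < l \<or> l + K < n)" using K that unfolding banded_def by blast
    then show ?thesis using n by simp
  qed
  show ?thesis
    by (simp add: tmat_mult_mor_sum[OF a b _ I] act_mor_sum[OF x] act_mcomp[OF tmats_tmor[OF b] tmats_tmor[OF a] x])
qed

text \<open>From the row \<open>N + K\<close> on, only indices \<open>l \<ge> N\<close> contribute to the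
  product, and there both factors are stable. Stability of the product then follows from
  multiplicativity of the amplification and a shift of the summation index.\<close>

lemma tmat_mult_tmats:
  assumes a: "a \<in> tmats E" and b: "b \<in> tmats E"
  shows "tmat_mult E a b \<in> tmats E"
proof -
  obtain K where K: "banded E K a" "banded E K b" using tmats_banded2[OF a b] .
  obtain N where N: "stable E N a" "stable E N b" using tmats_stable2[OF a b] .
  have c: "mcomp (tpow E n) (a l m) (b n l) \<in> tmors E n m" for n l m
    by (rule mcomp_tmor[OF tmats_tmor[OF b] tmats_tmor[OF a]])
  have supp: "l \<in> {..n + K}" if "b n l \<noteq> tzero E n" for n l
  proof -
    have "\<not> (n + K < l \<or> l + K < n)" using K(2) that unfolding banded_def by blast
    then show ?thesis by simp
  qed
  have mem: "tmat_mult E a b n m \<in> tmors E n m" for n m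
  proof -
    have "tmat_mult E a b n m = mor_sum E n {..n + K} (\<lambda>l. mcomp (tpow E n) (a l m) (b n l))"
      by (rule tmat_mult_mor_sum[OF a b finite_atMost supp])
    then show ?thesis using mor_sum_tmor[OF finite_atMost c] by simp
  qed
  show ?thesis
  proof (rule tmatsI[OF mem])
    show "banded E (K + K) (tmat_mult E a b)"
      unfolding banded_def
    proof (intro allI impI)
      fix n m assume out: "n + (K + K) < m \<or> m + (K + K) < n"
      show "tmat_mult E a b n m = tzero E n"
      proof (rule tmor_eqI[OF mem tzero_tmor])
        fix x \<Phi> assume x: "x \<in> topspace (base E)" "\<Phi> \<in> tfib E n x"
        have "act (a l m) x (act (b n l) x \<Phi>) = (\<lambda>_. 0)" for l
        proof (cases "n + K < l \<or> l + K < n")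
          case True
          then have "b n l = tzero E n" using K(2) unfolding banded_def by blast
          then show ?thesis using x tlinear_zero[OF act_tlinear[OF a x(1)]] by simp
        next
          case False
          then have "l + K < m \<or> m + K < l" using out by linarith
          then have "a l m = tzero E l" using K(1) unfolding banded_def by blast
          then show ?thesis using x act_fib[OF b x] by simp
        qed
        then show "act (tmat_mult E a b n m) x \<Phi> = act (tzero E n) x \<Phi>"
          using x by (simp add: fun_eq_iff act_tmat_mult[OF a b K(2) order_refl x])
      qed
    qed
    show "stable E (N + K) (tmat_mult E a b)"
      unfolding stable_def
    proof (intro allI impI)
      fix n m assume n: "N + K \<le> n"
      let ?I = "{N..n + K}"
      have I: "l \<in> ?I" if "b n l \<noteq> tzero E n" for l
      proof -
        have "\<not> (n + K < l \<or> l + K < n)" using K(2) that unfolding banded_def by blast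
        then show ?thesis using n by auto
      qed
      have I': "l \<in> Suc ` ?I" if "b (Suc n) l \<noteq> tzero E (Suc n)" for l
      proof -
        have "\<not> (Suc n + K < l \<or> l + K < Suc n)" using K(2) that unfolding banded_def by blast
        then have "l \<noteq> 0" "l - 1 \<in> ?I" using n by auto
        then show ?thesis by (intro image_eqI[of _ _ "l - 1"]) auto
      qed
      have "tmat_mult E a b (Suc n) (Suc m) =
          mor_sum E (Suc n) (Suc ` ?I) (\<lambda>l. mcomp (tpow E (Suc n)) (a l (Suc m)) (b (Suc n) l))"
        by (rule tmat_mult_mor_sum[OF a b _ I']) auto
      also have "\<dots> = mor_sum E (Suc n) ?I (\<lambda>l. mcomp (tpow E (Suc n)) (a (Suc l) (Suc m)) (b (Suc n) (Suc l)))"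
        by (rule mor_sum_reindex) simp
      also have "\<dots> = mor_sum E (Suc n) ?I (\<lambda>l. amplify E n m (mcomp (tpow E n) (a l m) (b n l)))"
        unfolding mor_sum_def
      proof (intro tmor_of_cong ext sum.cong refl)
        fix x \<Phi> ws l assume l: "l \<in> ?I"
        have "a (Suc l) (Suc m) = amplify E l m (a l m)" using N(1) l by (simp add: stable_def)
        moreover have "b (Suc n) (Suc l) = amplify E n l (b n l)" using N(2) n by (simp add: stable_def)
        ultimately show "act (mcomp (tpow E (Suc n)) (a (Suc l) (Suc m)) (b (Suc n) (Suc l))) x \<Phi> ws =
            act (amplify E n m (mcomp (tpow E n) (a l m) (b n l))) x \<Phi> ws"
          using amplify_mcomp[OF tmats_tmor[OF b] tmats_tmor[OF a]] by simp
      qed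
      also have "\<dots> = amplify E n m (mor_sum E n ?I (\<lambda>l. mcomp (tpow E n) (a l m) (b n l)))"
        by (rule amplify_mor_sum[symmetric]) (simp_all add: c)
      also have "\<dots> = amplify E n m (tmat_mult E a b n m)"
        using tmat_mult_mor_sum[OF a b _ I] by simp
      finally show "tmat_mult E a b (Suc n) (Suc m) = amplify E n m (tmat_mult E a b n m)" .
    qed
  qed
qed

lemma tadd_cong: "(a, a') \<in> tmat_rel E \<Longrightarrow> (b, b') \<in> tmat_rel E \<Longrightarrow> (tadd E a b, tadd E a' b') \<in> tmat_rel E"
proof -
  assume "(a, a') \<in> tmat_rel E" "(b, b') \<in> tmat_rel E"
  then obtain N M where 1: "a \<in> tmats E" "a' \<in> tmats E" "b \<in> tmats E" "b' \<in> tmats E"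
    and 2: "\<forall>n\<ge>N. \<forall>m. a n m = a' n m" "\<forall>n\<ge>M. \<forall>m. b n m = b' n m"
    by (auto simp: tmat_rel_def)
  show ?thesis
    by (rule tmat_relI[OF tadd_tmats[OF 1(1,3)] tadd_tmats[OF 1(2,4)], of "max N M"])
      (use 2 in \<open>simp add: tadd_def\<close>)
qed

lemma tscl_cong: "(a, a') \<in> tmat_rel E \<Longrightarrow> (tscl E c a, tscl E c a') \<in> tmat_rel E"
proof -
  assume "(a, a') \<in> tmat_rel E"
  then obtain N where 1: "a \<in> tmats E" "a' \<in> tmats E" and 2: "\<forall>n\<ge>N. \<forall>m. a n m = a' n m"
    by (auto simp: tmat_rel_def)
  show ?thesis
    by (rule tmat_relI[OF tscl_tmats[OF 1(1)] tscl_tmats[OF 1(2)], of N]) (use 2 in \<open>simp add: tscl_def\<close>)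
qed

lemma tcirc_cong: "(a, a') \<in> tmat_rel E \<Longrightarrow> (tcirc E z a, tcirc E z a') \<in> tmat_rel E"
proof -
  assume "(a, a') \<in> tmat_rel E"
  then obtain N where 1: "a \<in> tmats E" "a' \<in> tmats E" and 2: "\<forall>n\<ge>N. \<forall>m. a n m = a' n m"
    by (auto simp: tmat_rel_def)
  show ?thesis
    by (rule tmat_relI[OF tcirc_tmats[OF 1(1)] tcirc_tmats[OF 1(2)], of N]) (use 2 in \<open>simp add: tcirc_def\<close>)
qed

lemma tstar_cong: "(a, a') \<in> tmat_rel E \<Longrightarrow> (tstar E a, tstar E a') \<in> tmat_rel E"
proof -
  assume "(a, a') \<in> tmat_rel E"
  then obtain N where 1: "a \<in> tmats E" "a' \<in> tmats E" and 2: "\<forall>n\<ge>N. \<forall>m. a n m = a' n m"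
    by (auto simp: tmat_rel_def)
  obtain K where K: "banded E K a" "banded E K a'" using tmats_banded2[OF 1] .
  show ?thesis
  proof (rule tmat_relI[OF tstar_tmats[OF 1(1)] tstar_tmats[OF 1(2)], of "N + K"])
    fix n m assume n: "N + K \<le> n"
    show "tstar E a n m = tstar E a' n m"
    proof (cases "N \<le> m")
      case True then show ?thesis using 2 by (simp add: tstar_def)
    next
      case False
      then have "m + K < n" using n by simp
      then have "a m n = tzero E m" "a' m n = tzero E m" using K unfolding banded_def by blast+
      then show ?thesis by (simp add: tstar_def)
    qed
  qed
qed

lemma tmat_mult_cong: "(a, a') \<in> tmat_rel E \<Longrightarrow> (b, b') \<in> tmat_rel E \<Longrightarrow>
    (tmat_mult E a b, tmat_mult E a' b') \<in> tmat_rel E"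
proof -
  assume "(a, a') \<in> tmat_rel E" "(b, b') \<in> tmat_rel E"
  then obtain N M where 1: "a \<in> tmats E" "a' \<in> tmats E" "b \<in> tmats E" "b' \<in> tmats E"
    and 2: "\<forall>n\<ge>N. \<forall>m. a n m = a' n m" "\<forall>n\<ge>M. \<forall>m. b n m = b' n m"
    by (auto simp: tmat_rel_def)
  obtain K where K: "banded E K b" using 1(3) by (auto simp: tmats_iff)
  show ?thesis
  proof (rule tmat_relI[OF tmat_mult_tmats[OF 1(1,3)] tmat_mult_tmats[OF 1(2,4)], of "N + K + M"])
    fix n m assume n: "N + K + M \<le> n"
    have b: "b n l = b' n l" for l using 2(2) n by simp
    have I: "l \<in> {N..n + K}" if "b n l \<noteq> tzero E n" for l
    proof -
      have "\<not> (n + K < l \<or> l + K < n)" using K that unfolding banded_def by blast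
      then show ?thesis using n by auto
    qed
    have I': "l \<in> {N..n + K}" if "b' n l \<noteq> tzero E n" for l using I that b by simp
    have "tmat_mult E a b n m = mor_sum E n {N..n + K} (\<lambda>l. mcomp (tpow E n) (a l m) (b n l))"
      by (rule tmat_mult_mor_sum[OF 1(1,3) finite_atLeastAtMost I])
    also have "\<dots> = mor_sum E n {N..n + K} (\<lambda>l. mcomp (tpow E n) (a' l m) (b' n l))"
      unfolding mor_sum_def by (intro tmor_of_cong ext sum.cong refl) (use 2(1) b in simp)
    also have "\<dots> = tmat_mult E a' b' n m"
      by (rule tmat_mult_mor_sum[OF 1(2,4) finite_atLeastAtMost I', symmetric])
    finally show "tmat_mult E a b n m = tmat_mult E a' b' n m" .
  qed
qed

lemma plus_core_class:
  assumes "a \<in> tmats E" "b \<in> tmats E"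
  shows "alg_plus (cp_core E) (core_class E a) (core_class E b) = core_class E (tadd E a b)"
proof -
  have "alg_plus (cp_core E) = qmap2 (tmat_rel E) (tadd E)" by (simp add: cp_core_def tadd_def[abs_def])
  then show ?thesis using qmap2_class[OF equiv_tmat_rel assms tadd_cong] by (simp add: core_class_def)
qed

lemma scl_core_class:
  assumes "a \<in> tmats E"
  shows "alg_scl (cp_core E) c (core_class E a) = core_class E (tscl E c a)"
proof -
  have "alg_scl (cp_core E) c = qmap (tmat_rel E) (tscl E c)" by (simp add: cp_core_def tscl_def[abs_def])
  then show ?thesis using qmap_class[OF equiv_tmat_rel equiv_tmat_rel assms tscl_cong] by (simp add: core_class_def)
qed

lemma times_core_class:
  assumes "a \<in> tmats E" "b \<in> tmats E"
  shows "alg_times (cp_core E) (core_class E a) (core_class E b) = core_class E (tmat_mult E a b)"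
proof -
  have "alg_times (cp_core E) = qmap2 (tmat_rel E) (tmat_mult E)" by (simp add: cp_core_def)
  then show ?thesis using qmap2_class[OF equiv_tmat_rel assms tmat_mult_cong] by (simp add: core_class_def)
qed

lemma star_core_class:
  assumes "a \<in> tmats E"
  shows "alg_star (cp_core E) (core_class E a) = core_class E (tstar E a)"
proof -
  have "alg_star (cp_core E) = qmap (tmat_rel E) (tstar E)" by (simp add: cp_core_def tstar_def[abs_def])
  then show ?thesis using qmap_class[OF equiv_tmat_rel equiv_tmat_rel assms tstar_cong] by (simp add: core_class_def)
qed

lemma circle_core_class:
  assumes "a \<in> tmats E"
  shows "circle_action E z (core_class E a) = core_class E (tcirc E z a)"
proof -
  have "circle_action E z = qmap (tmat_rel E) (tcirc E z)" by (simp add: circle_action_def tcirc_def[abs_def])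
  then show ?thesis using qmap_class[OF equiv_tmat_rel equiv_tmat_rel assms tcirc_cong] by (simp add: core_class_def)
qed

lemma minus_core_class: "a \<in> tmats E \<Longrightarrow> b \<in> tmats E \<Longrightarrow>
    minus_in (cp_core E) (core_class E a) (core_class E b) = core_class E (tadd E a (tscl E (- 1) b))"
  by (simp add: minus_in_def scl_core_class plus_core_class tscl_tmats)

lemmas tmats_closed = tadd_tmats tscl_tmats tmat_mult_tmats tstar_tmats tcirc_tmats
lemmas core_class_ops = plus_core_class scl_core_class times_core_class star_core_class circle_core_class minus_core_class

lemma tstar_tadd: "a \<in> tmats E \<Longrightarrow> b \<in> tmats E \<Longrightarrow> tstar E (tadd E a b) = tadd E (tstar E a) (tstar E b)"
  by (simp add: fun_eq_iff tstar_def tadd_def madj_madd[OF tmats_tmor tmats_tmor])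

lemma tstar_tscl: "a \<in> tmats E \<Longrightarrow> tstar E (tscl E c a) = tscl E (cnj c) (tstar E a)"
  by (simp add: fun_eq_iff tstar_def tscl_def madj_mscl[OF tmats_tmor])

lemma tstar_tstar: "a \<in> tmats E \<Longrightarrow> tstar E (tstar E a) = a"
  by (simp add: fun_eq_iff tstar_def madj_madj[OF tmats_tmor])

lemma minus_times_eq:
  assumes "a \<in> tmats E" "b \<in> tmats E" "c \<in> tmats E" "d \<in> tmats E"
  shows "tadd E (tmat_mult E a b) (tscl E (- 1) (tmat_mult E c d)) =
     tadd E (tmat_mult E (tadd E a (tscl E (- 1) c)) b) (tmat_mult E c (tadd E b (tscl E (- 1) d)))"
proof -
  obtain K where K: "banded E K b" "banded E K d" using tmats_banded2[OF assms(2,4)] .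
  have K': "banded E K (tadd E b (tscl E (- 1) d))"
    using K by (simp add: banded_def tadd_def tscl_def madd_tzero mscl_tzero)
  show ?thesis
  proof (rule tmat_eqI)
    fix n m x \<Phi> ws assume x: "x \<in> topspace (base E)" "\<Phi> \<in> tfib E n x"
    have "act (c l m) x (act (tadd E b (tscl E (- 1) d) n l) x \<Phi>) =
       (\<lambda>ws. act (c l m) x (act (b n l) x \<Phi>) ws + (- 1) * act (c l m) x (act (d n l) x \<Phi>) ws)" for l
    proof -
      have f: "act (b n l) x \<Phi> \<in> tfib E l x" "act (d n l) x \<Phi> \<in> tfib E l x"
        using act_fib[OF assms(2) x] act_fib[OF assms(4) x] by auto
      show ?thesis
        unfolding act_tadd[OF assms(2) tscl_tmats[OF assms(4)] x] act_tscl[OF assms(4) x]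
          tlinear_add[OF act_tlinear[OF assms(3) x(1)] f(1) tfib_scl[OF f(2)]] tlinear_scl[OF act_tlinear[OF assms(3) x(1)] f(2)] ..
    qed
    moreover have "act (tadd E a (tscl E (- 1) c) l m) x (act (b n l) x \<Phi>) =
       (\<lambda>ws. act (a l m) x (act (b n l) x \<Phi>) ws + (- 1) * act (c l m) x (act (b n l) x \<Phi>) ws)" for l
      using act_fib[OF assms(2) x] assms x(1) by (simp add: act_tadd tscl_tmats act_tscl)
    ultimately show "act (tadd E (tmat_mult E a b) (tscl E (- 1) (tmat_mult E c d)) n m) x \<Phi> ws =
       act (tadd E (tmat_mult E (tadd E a (tscl E (- 1) c)) b) (tmat_mult E c (tadd E b (tscl E (- 1) d))) n m) x \<Phi> ws"
      using x assms K K'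
      by (simp add: act_tadd act_tscl tmats_closed act_tmat_mult[where L = "n + K" and K = K] sum.distrib sum_negf sum_subtractf)
  qed (use assms in \<open>simp_all add: tmats_closed\<close>)
qed

end

section \<open>Completions of star-algebras with a submultiplicative seminorm\<close>

text \<open>The identities for differences are those by which the operations extend to Cauchy sequences. They
  stand in for the vector space axioms, as the algebra is given by a carrier without a distinguished
  zero element.\<close>

locale seminormed_star_alg =
  fixes A :: "('a, 'z) star_alg_scheme" and p :: "'a \<Rightarrow> real"
  assumes nonempty: "car A \<noteq> {}"
    and plus_car: "a \<in> car A \<Longrightarrow> b \<in> car A \<Longrightarrow> alg_plus A a b \<in> car A"
    and scl_car: "a \<in> car A \<Longrightarrow> alg_scl A k a \<in> car A"
    and times_car: "a \<in> car A \<Longrightarrow> b \<in> car A \<Longrightarrow> alg_times A a b \<in> car A"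
    and star_car: "a \<in> car A \<Longrightarrow> alg_star A a \<in> car A"
    and minus_plus: "a \<in> car A \<Longrightarrow> b \<in> car A \<Longrightarrow> c \<in> car A \<Longrightarrow> d \<in> car A \<Longrightarrow>
      minus_in A (alg_plus A a b) (alg_plus A c d) = alg_plus A (minus_in A a c) (minus_in A b d)"
    and minus_scl: "a \<in> car A \<Longrightarrow> b \<in> car A \<Longrightarrow>
      minus_in A (alg_scl A k a) (alg_scl A k b) = alg_scl A k (minus_in A a b)"
    and minus_times: "a \<in> car A \<Longrightarrow> b \<in> car A \<Longrightarrow> c \<in> car A \<Longrightarrow> d \<in> car A \<Longrightarrow>
      minus_in A (alg_times A a b) (alg_times A c d) =
        alg_plus A (alg_times A (minus_in A a c) b) (alg_times A c (minus_in A b d))"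
    and minus_star: "a \<in> car A \<Longrightarrow> b \<in> car A \<Longrightarrow>
      minus_in A (alg_star A a) (alg_star A b) = alg_star A (minus_in A a b)"
    and minus_chain: "a \<in> car A \<Longrightarrow> b \<in> car A \<Longrightarrow> c \<in> car A \<Longrightarrow>
      minus_in A a c = alg_plus A (minus_in A a b) (minus_in A b c)"
    and minus_swap: "a \<in> car A \<Longrightarrow> b \<in> car A \<Longrightarrow> minus_in A a b = alg_scl A (- 1) (minus_in A b a)"
    and minus_self: "a \<in> car A \<Longrightarrow> minus_in A a a = alg_scl A 0 a"
    and plus_minus: "a \<in> car A \<Longrightarrow> b \<in> car A \<Longrightarrow> a = alg_plus A b (minus_in A a b)"
    and p_nonneg: "a \<in> car A \<Longrightarrow> 0 \<le> p a"
    and p_plus: "a \<in> car A \<Longrightarrow> b \<in> car A \<Longrightarrow> p (alg_plus A a b) \<le> p a + p b"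
    and p_scl: "a \<in> car A \<Longrightarrow> p (alg_scl A k a) \<le> cmod k * p a"
    and p_times: "a \<in> car A \<Longrightarrow> b \<in> car A \<Longrightarrow> p (alg_times A a b) \<le> p a * p b"
    and p_star: "a \<in> car A \<Longrightarrow> p (alg_star A a) \<le> p a"
begin

abbreviation "pd a b \<equiv> p (minus_in A a b)"
abbreviation "null_class f \<equiv> null_rel A p `` {f}"

lemma minus_car: "a \<in> car A \<Longrightarrow> b \<in> car A \<Longrightarrow> minus_in A a b \<in> car A"
  by (simp add: minus_in_def plus_car scl_car)

lemma pd_nonneg: "a \<in> car A \<Longrightarrow> b \<in> car A \<Longrightarrow> 0 \<le> pd a b"
  by (simp add: p_nonneg minus_car)

lemma pd_self: "a \<in> car A \<Longrightarrow> pd a a = 0"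
  using p_scl[of a 0] p_nonneg[OF scl_car, of a 0] minus_self[of a] by simp

lemma pd_sym:
  assumes "a \<in> car A" "b \<in> car A"
  shows "pd a b = pd b a"
proof -
  have "pd c d \<le> pd d c" if "c \<in> car A" "d \<in> car A" for c d
    unfolding minus_swap[OF that] using p_scl[OF minus_car[OF that(2,1)], of "-1"] by simp
  then show ?thesis using assms by (intro antisym) auto
qed

lemma pd_tri: "a \<in> car A \<Longrightarrow> b \<in> car A \<Longrightarrow> c \<in> car A \<Longrightarrow> pd a c \<le> pd a b + pd b c"
  using p_plus[OF minus_car minus_car, of a b b c] minus_chain[of a b c] by simp

lemma p_le_pd:
  assumes "a \<in> car A" "b \<in> car A"
  shows "p a \<le> p b + pd a b"
proof -
  have "p a = p (alg_plus A b (minus_in A a b))" using arg_cong[OF plus_minus[OF assms], of p] .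
  also have "\<dots> \<le> p b + pd a b" using assms by (intro p_plus minus_car)
  finally show ?thesis .
qed

lemma pd_plus: "a \<in> car A \<Longrightarrow> b \<in> car A \<Longrightarrow> c \<in> car A \<Longrightarrow> d \<in> car A \<Longrightarrow>
    pd (alg_plus A a b) (alg_plus A c d) \<le> pd a c + pd b d"
  using p_plus[OF minus_car minus_car, of a c b d] minus_plus[of a b c d] by simp

lemma pd_scl: "a \<in> car A \<Longrightarrow> b \<in> car A \<Longrightarrow> pd (alg_scl A c a) (alg_scl A c b) \<le> cmod c * pd a b"
  using p_scl[OF minus_car, of a b c] minus_scl[of a b c] by simp

lemma pd_star: "a \<in> car A \<Longrightarrow> b \<in> car A \<Longrightarrow> pd (alg_star A a) (alg_star A b) \<le> pd a b"
  using p_star[OF minus_car, of a b] minus_star[of a b] by simp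

lemma pd_times:
  assumes "a \<in> car A" "b \<in> car A" "c \<in> car A" "d \<in> car A"
  shows "pd (alg_times A a b) (alg_times A c d) \<le> pd a c * p b + p c * pd b d"
proof -
  have "pd (alg_times A a b) (alg_times A c d) \<le>
     p (alg_times A (minus_in A a c) b) + p (alg_times A c (minus_in A b d))"
    unfolding minus_times[OF assms] using assms by (intro p_plus times_car minus_car)
  also have "\<dots> \<le> pd a c * p b + p c * pd b d"
    using assms by (intro add_mono p_times minus_car)
  finally show ?thesis .
qed

lemma cauchyD: "f \<in> cauchy_in A p \<Longrightarrow> f n \<in> car A"
  by (simp add: cauchy_in_def)

lemma cauchy_eps: "f \<in> cauchy_in A p \<Longrightarrow> \<epsilon> > 0 \<Longrightarrow> \<exists>M. \<forall>m\<ge>M. \<forall>n\<ge>M. pd (f m) (f n) < \<epsilon>"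
  by (simp add: cauchy_in_def)

text \<open>All operations of the completion are Lipschitz on bounded sets, in this form.\<close>

lemma cauchyI_bound:
  assumes f: "f \<in> cauchy_in A p" and g: "g \<in> cauchy_in A p" and h: "\<And>n. h n \<in> car A"
    and b: "\<And>m n. pd (h m) (h n) \<le> M * (pd (f m) (f n) + pd (g m) (g n))"
  shows "h \<in> cauchy_in A p"
  unfolding cauchy_in_def
proof (intro CollectI conjI allI impI h)
  fix \<epsilon> :: real assume "\<epsilon> > 0"
  define N where "N = max M 1"
  have N: "N > 0" by (simp add: N_def)
  then have "\<epsilon> / (2 * N) > 0" using \<open>\<epsilon> > 0\<close> by simp
  then obtain k l where k: "\<forall>m\<ge>k. \<forall>n\<ge>k. pd (f m) (f n) < \<epsilon> / (2 * N)"
    and l: "\<forall>m\<ge>l. \<forall>n\<ge>l. pd (g m) (g n) < \<epsilon> / (2 * N)"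
    using cauchy_eps[OF f] cauchy_eps[OF g] by blast
  show "\<exists>M. \<forall>m\<ge>M. \<forall>n\<ge>M. pd (h m) (h n) < \<epsilon>"
  proof (intro exI[of _ "max k l"] allI impI)
    fix m n assume mn: "max k l \<le> m" "max k l \<le> n"
    have nn: "0 \<le> pd (f m) (f n) + pd (g m) (g n)"
      using pd_nonneg[OF cauchyD[OF f] cauchyD[OF f]] pd_nonneg[OF cauchyD[OF g] cauchyD[OF g]]
      by (simp add: add_nonneg_nonneg)
    have "pd (h m) (h n) \<le> M * (pd (f m) (f n) + pd (g m) (g n))" by (rule b)
    also have "\<dots> \<le> N * (pd (f m) (f n) + pd (g m) (g n))"
      using nn by (intro mult_right_mono) (simp_all add: N_def)
    also have "\<dots> < N * (\<epsilon> / (2 * N) + \<epsilon> / (2 * N))"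
      using k l mn N by (intro mult_strict_left_mono add_strict_mono) auto
    also have "\<dots> = \<epsilon>" using N by (simp add: field_simps)
    finally show "pd (h m) (h n) < \<epsilon>" .
  qed
qed

lemma cauchy_bounded:
  assumes f: "f \<in> cauchy_in A p"
  obtains M where "\<forall>n. p (f n) \<le> M" "M \<ge> 0"
proof -
  obtain k where k: "\<forall>m\<ge>k. \<forall>n\<ge>k. pd (f m) (f n) < 1" using cauchy_eps[OF f, of 1] by auto
  define M where "M = Max (insert 0 ((\<lambda>n. p (f n)) ` {..k})) + 1"
  have M: "p (f n) \<le> Max (insert 0 ((\<lambda>n. p (f n)) ` {..k}))" if "n \<le> k" for n
    using that by (intro Max_ge) auto
  have "p (f n) \<le> M" for n
  proof (cases "n \<le> k")
    case True then show ?thesis using M[OF True] by (simp add: M_def)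
  next
    case False
    then have "pd (f n) (f k) < 1" using k by simp
    then show ?thesis
      using p_le_pd[OF cauchyD[OF f] cauchyD[OF f], of n k] M[of k] by (simp add: M_def)
  qed
  moreover have "M \<ge> 0"
  proof -
    have "0 \<le> Max (insert 0 ((\<lambda>n. p (f n)) ` {..k}))" by (intro Max_ge) auto
    then show ?thesis by (simp add: M_def)
  qed
  ultimately show ?thesis using that by blast
qed

text \<open>The usual estimate $ab - a'b' = (a - a') b + a' (b - b')$ with a bound for the Cauchy sequences
  \<open>f'\<close> and \<open>g\<close>.\<close>

lemma times_bound:
  assumes f: "f \<in> cauchy_in A p" and g: "g \<in> cauchy_in A p"
    and f': "f' \<in> cauchy_in A p" and g': "g' \<in> cauchy_in A p"
  obtains M where "\<And>m n. pd (alg_times A (f m) (g m)) (alg_times A (f' n) (g' n)) \<le>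
     M * (pd (f m) (f' n) + pd (g m) (g' n))"
proof -
  obtain K where K: "\<forall>n. p (g n) \<le> K" "K \<ge> 0" using cauchy_bounded[OF g] by blast
  obtain L where L: "\<forall>n. p (f' n) \<le> L" "L \<ge> 0" using cauchy_bounded[OF f'] by blast
  show ?thesis
  proof (rule that[of "K + L"])
    fix m n
    have c: "f m \<in> car A" "g m \<in> car A" "f' n \<in> car A" "g' n \<in> car A"
      using f g f' g' cauchyD by auto
    have nn: "0 \<le> pd (f m) (f' n)" "0 \<le> pd (g m) (g' n)" using c pd_nonneg by auto
    have "pd (alg_times A (f m) (g m)) (alg_times A (f' n) (g' n)) \<le>
        pd (f m) (f' n) * p (g m) + p (f' n) * pd (g m) (g' n)"
      by (rule pd_times[OF c])
    also have "\<dots> \<le> pd (f m) (f' n) * K + L * pd (g m) (g' n)"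
      using nn K L by (intro add_mono mult_left_mono mult_right_mono) auto
    also have "\<dots> \<le> (K + L) * (pd (f m) (f' n) + pd (g m) (g' n))"
      using nn K(2) L(2) by (simp add: algebra_simps)
    finally show "pd (alg_times A (f m) (g m)) (alg_times A (f' n) (g' n)) \<le>
      (K + L) * (pd (f m) (f' n) + pd (g m) (g' n))" .
  qed
qed

lemma cauchy_plus: "f \<in> cauchy_in A p \<Longrightarrow> g \<in> cauchy_in A p \<Longrightarrow> (\<lambda>n. alg_plus A (f n) (g n)) \<in> cauchy_in A p"
  by (rule cauchyI_bound[where M = 1 and f = f and g = g]) (simp_all add: plus_car cauchyD pd_plus)

lemma cauchy_scl:
  assumes f: "f \<in> cauchy_in A p"
  shows "(\<lambda>n. alg_scl A c (f n)) \<in> cauchy_in A p"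
proof (rule cauchyI_bound[OF f f])
  fix m n
  have "pd (alg_scl A c (f m)) (alg_scl A c (f n)) \<le> cmod c * pd (f m) (f n)"
    using pd_scl cauchyD[OF f] by simp
  also have "\<dots> \<le> cmod c * (pd (f m) (f n) + pd (f m) (f n))"
    using pd_nonneg[OF cauchyD[OF f] cauchyD[OF f], of m n] by (intro mult_left_mono) auto
  finally show "pd (alg_scl A c (f m)) (alg_scl A c (f n)) \<le> cmod c * (pd (f m) (f n) + pd (f m) (f n))" .
qed (simp add: scl_car cauchyD[OF f])

lemma cauchy_star:
  assumes f: "f \<in> cauchy_in A p"
  shows "(\<lambda>n. alg_star A (f n)) \<in> cauchy_in A p"
proof (rule cauchyI_bound[OF f f])
  fix m n
  show "pd (alg_star A (f m)) (alg_star A (f n)) \<le> 1 * (pd (f m) (f n) + pd (f m) (f n))"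
    using pd_star[OF cauchyD[OF f] cauchyD[OF f], of m n] pd_nonneg[OF cauchyD[OF f] cauchyD[OF f], of m n] by simp
qed (simp add: star_car cauchyD[OF f])

lemma cauchy_times:
  assumes f: "f \<in> cauchy_in A p" and g: "g \<in> cauchy_in A p"
  shows "(\<lambda>n. alg_times A (f n) (g n)) \<in> cauchy_in A p"
proof -
  obtain M where "\<And>m n. pd (alg_times A (f m) (g m)) (alg_times A (f n) (g n)) \<le>
     M * (pd (f m) (f n) + pd (g m) (g n))" using times_bound[OF f g f g] by blast
  then show ?thesis by (intro cauchyI_bound[OF f g]) (simp_all add: times_car cauchyD[OF f] cauchyD[OF g])
qed

lemma null_iff: "(f, g) \<in> null_rel A p \<longleftrightarrow> f \<in> cauchy_in A p \<and> g \<in> cauchy_in A p \<and> (\<lambda>n. pd (f n) (g n)) \<longlonglongrightarrow> 0"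
  by (simp add: null_rel_def)

lemma nullD: "(f, g) \<in> null_rel A p \<Longrightarrow> f \<in> cauchy_in A p" "(f, g) \<in> null_rel A p \<Longrightarrow> g \<in> cauchy_in A p"
  "(f, g) \<in> null_rel A p \<Longrightarrow> (\<lambda>n. pd (f n) (g n)) \<longlonglongrightarrow> 0"
  by (simp_all add: null_rel_def)

lemma nullI_le:
  assumes "f \<in> cauchy_in A p" "g \<in> cauchy_in A p" "\<And>n. pd (f n) (g n) \<le> u n" "u \<longlonglongrightarrow> 0"
  shows "(f, g) \<in> null_rel A p"
  unfolding null_iff
proof (intro conjI assms(1,2))
  show "(\<lambda>n. pd (f n) (g n)) \<longlonglongrightarrow> 0"
    by (rule tendsto_sandwich[OF _ _ tendsto_const assms(4)])
      (use assms(3) pd_nonneg[OF cauchyD[OF assms(1)] cauchyD[OF assms(2)]] in auto)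
qed

lemma equiv_null: "equiv (cauchy_in A p) (null_rel A p)"
proof (rule equivI)
  show "null_rel A p \<subseteq> cauchy_in A p \<times> cauchy_in A p" by (auto simp: null_rel_def)
  show "refl_on (cauchy_in A p) (null_rel A p)"
    by (auto simp: refl_on_def null_iff pd_self cauchyD)
  show "sym (null_rel A p)"
  proof (rule symI)
    fix f g assume fg: "(f, g) \<in> null_rel A p"
    show "(g, f) \<in> null_rel A p"
      by (rule nullI_le[OF nullD(2)[OF fg] nullD(1)[OF fg] _ nullD(3)[OF fg]])
        (simp add: pd_sym[OF cauchyD[OF nullD(2)[OF fg]] cauchyD[OF nullD(1)[OF fg]]])
  qed
  show "trans (null_rel A p)"
  proof (rule transI)
    fix f g h assume fg: "(f, g) \<in> null_rel A p" and gh: "(g, h) \<in> null_rel A p"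
    show "(f, h) \<in> null_rel A p"
      by (rule nullI_le[OF nullD(1)[OF fg] nullD(2)[OF gh] pd_tri[OF cauchyD[OF nullD(1)[OF fg]] cauchyD[OF nullD(2)[OF fg]] cauchyD[OF nullD(2)[OF gh]]]])
        (use tendsto_add[OF nullD(3)[OF fg] nullD(3)[OF gh]] in simp)
  qed
qed

lemma null_plus:
  assumes fg: "(f, f') \<in> null_rel A p" "(g, g') \<in> null_rel A p"
  shows "((\<lambda>n. alg_plus A (f n) (g n)), (\<lambda>n. alg_plus A (f' n) (g' n))) \<in> null_rel A p"
proof (rule nullI_le)
  show "(\<lambda>n. pd (f n) (f' n) + pd (g n) (g' n)) \<longlonglongrightarrow> 0"
    using tendsto_add[OF nullD(3)[OF fg(1)] nullD(3)[OF fg(2)]] by simp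
qed (use nullD(1,2)[OF fg(1)] nullD(1,2)[OF fg(2)] in \<open>simp_all add: cauchy_plus pd_plus cauchyD\<close>)

lemma null_scl:
  assumes fg: "(f, f') \<in> null_rel A p"
  shows "((\<lambda>n. alg_scl A c (f n)), (\<lambda>n. alg_scl A c (f' n))) \<in> null_rel A p"
proof (rule nullI_le)
  show "(\<lambda>n. cmod c * pd (f n) (f' n)) \<longlonglongrightarrow> 0"
    using tendsto_mult_left[OF nullD(3)[OF fg], of "cmod c"] by simp
qed (use nullD(1,2)[OF fg] in \<open>simp_all add: cauchy_scl pd_scl cauchyD\<close>)

lemma null_star:
  assumes fg: "(f, f') \<in> null_rel A p"
  shows "((\<lambda>n. alg_star A (f n)), (\<lambda>n. alg_star A (f' n))) \<in> null_rel A p"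
  by (rule nullI_le[OF _ _ _ nullD(3)[OF fg]])
    (use nullD(1,2)[OF fg] in \<open>simp_all add: cauchy_star pd_star cauchyD\<close>)

lemma null_times:
  assumes fg: "(f, f') \<in> null_rel A p" "(g, g') \<in> null_rel A p"
  shows "((\<lambda>n. alg_times A (f n) (g n)), (\<lambda>n. alg_times A (f' n) (g' n))) \<in> null_rel A p"
proof -
  note c = nullD(1,2)[OF fg(1)] nullD(1,2)[OF fg(2)]
  obtain M where M: "\<And>m n. pd (alg_times A (f m) (g m)) (alg_times A (f' n) (g' n)) \<le>
     M * (pd (f m) (f' n) + pd (g m) (g' n))" using times_bound[OF c(1,3,2,4)] by blast
  have "(\<lambda>n. M * (pd (f n) (f' n) + pd (g n) (g' n))) \<longlonglongrightarrow> M * (0 + 0)"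
    by (intro tendsto_intros nullD(3) fg)
  then have l: "(\<lambda>n. M * (pd (f n) (f' n) + pd (g n) (g' n))) \<longlonglongrightarrow> 0" by simp
  show ?thesis
    by (rule nullI_le[OF cauchy_times[OF c(1,3)] cauchy_times[OF c(2,4)] M l])
qed

lemma completion_carE:
  assumes "y \<in> car (completion A p)"
  obtains f where "f \<in> cauchy_in A p" "y = null_class f"
  using assms by (auto simp: completion_def elim: quotientE)

lemma null_class_car: "f \<in> cauchy_in A p \<Longrightarrow> null_class f \<in> car (completion A p)"
  by (simp add: completion_def quotientI)

lemma completion_plus: "f \<in> cauchy_in A p \<Longrightarrow> g \<in> cauchy_in A p \<Longrightarrow>
    alg_plus (completion A p) (null_class f) (null_class g) = null_class (\<lambda>n. alg_plus A (f n) (g n))"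
  using qmap2_class[OF equiv_null, of f g "\<lambda>f g n. alg_plus A (f n) (g n)"] null_plus by (simp add: completion_def)

lemma completion_times: "f \<in> cauchy_in A p \<Longrightarrow> g \<in> cauchy_in A p \<Longrightarrow>
    alg_times (completion A p) (null_class f) (null_class g) = null_class (\<lambda>n. alg_times A (f n) (g n))"
  using qmap2_class[OF equiv_null, of f g "\<lambda>f g n. alg_times A (f n) (g n)"] null_times by (simp add: completion_def)

lemma completion_scl: "f \<in> cauchy_in A p \<Longrightarrow> alg_scl (completion A p) c (null_class f) = null_class (\<lambda>n. alg_scl A c (f n))"
  using qmap_class[OF equiv_null equiv_null, of f "\<lambda>f n. alg_scl A c (f n)"] null_scl by (simp add: completion_def)

lemma completion_star: "f \<in> cauchy_in A p \<Longrightarrow> alg_star (completion A p) (null_class f) = null_class (\<lambda>n. alg_star A (f n))"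
  using qmap_class[OF equiv_null equiv_null, of f "\<lambda>f n. alg_star A (f n)"] null_star by (simp add: completion_def)

lemma cauchy_minus: "f \<in> cauchy_in A p \<Longrightarrow> g \<in> cauchy_in A p \<Longrightarrow> (\<lambda>n. minus_in A (f n) (g n)) \<in> cauchy_in A p"
  unfolding minus_in_def by (intro cauchy_plus cauchy_scl)

lemma completion_minus: "f \<in> cauchy_in A p \<Longrightarrow> g \<in> cauchy_in A p \<Longrightarrow>
    minus_in (completion A p) (null_class f) (null_class g) = null_class (\<lambda>n. minus_in A (f n) (g n))"
  unfolding minus_in_def by (simp add: completion_scl completion_plus cauchy_scl)

lemma cauchy_p_convergent:
  assumes f: "f \<in> cauchy_in A p"
  shows "convergent (\<lambda>n. p (f n))"
proof (rule Cauchy_convergent, rule CauchyI)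
  fix \<epsilon> :: real assume "\<epsilon> > 0"
  then obtain k where k: "\<forall>m\<ge>k. \<forall>n\<ge>k. pd (f m) (f n) < \<epsilon>" using cauchy_eps[OF f] by blast
  show "\<exists>M. \<forall>m\<ge>M. \<forall>n\<ge>M. norm (p (f m) - p (f n)) < \<epsilon>"
  proof (intro exI[of _ k] allI impI)
    fix m n assume mn: "k \<le> m" "k \<le> n"
    have "pd (f m) (f n) < \<epsilon>" "pd (f n) (f m) < \<epsilon>" using k mn by auto
    then show "norm (p (f m) - p (f n)) < \<epsilon>"
      using p_le_pd[OF cauchyD[OF f] cauchyD[OF f], of m n] p_le_pd[OF cauchyD[OF f] cauchyD[OF f], of n m]
      unfolding real_norm_def abs_less_iff by linarith
  qed
qed

text \<open>The norm of a class is computed along one representative, but a difference of representatives tends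
  to zero.\<close>

lemma completion_nrm_less:
  assumes f: "f \<in> cauchy_in A p" and less: "nrm (completion A p) (null_class f) < \<epsilon>"
  shows "\<forall>\<^sub>F n in sequentially. p (f n) < \<epsilon>"
proof -
  define g where "g = (SOME g. g \<in> null_class f)"
  have "f \<in> null_class f" using equiv_class_self[OF equiv_null f] .
  then have "g \<in> null_class f" unfolding g_def by (rule someI[of "\<lambda>g. g \<in> null_class f"])
  then have fg: "(f, g) \<in> null_rel A p" by simp
  have g: "g \<in> cauchy_in A p" using nullD(2)[OF fg] .
  have "nrm (completion A p) (null_class f) = lim (\<lambda>n. p (g n))"
    by (simp add: completion_def g_def)
  then have l: "(\<lambda>n. p (g n)) \<longlonglongrightarrow> nrm (completion A p) (null_class f)"
    using cauchy_p_convergent[OF g] by (simp add: convergent_LIMSEQ_iff)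
  have "(\<lambda>n. p (g n) + pd (f n) (g n)) \<longlonglongrightarrow> nrm (completion A p) (null_class f) + 0"
    by (intro tendsto_add l nullD(3)[OF fg])
  then have "\<forall>\<^sub>F n in sequentially. p (g n) + pd (f n) (g n) < \<epsilon>"
    using less by (simp add: order_tendstoD(2))
  then show ?thesis
  proof eventually_elim
    case (elim n)
    then show ?case using p_le_pd[OF cauchyD[OF f] cauchyD[OF g], of n n] by linarith
  qed
qed

end

locale seminormed_star_hom = S: seminormed_star_alg A p + T: seminormed_star_alg B q
  for A :: "('a, 'z) star_alg_scheme" and p and B :: "('b, 'y) star_alg_scheme" and q +
  fixes \<alpha> :: "'a \<Rightarrow> 'b"
  assumes hom_car: "a \<in> car A \<Longrightarrow> \<alpha> a \<in> car B"
    and hom_plus: "a \<in> car A \<Longrightarrow> b \<in> car A \<Longrightarrow> \<alpha> (alg_plus A a b) = alg_plus B (\<alpha> a) (\<alpha> b)"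
    and hom_scl: "a \<in> car A \<Longrightarrow> \<alpha> (alg_scl A c a) = alg_scl B c (\<alpha> a)"
    and hom_times: "a \<in> car A \<Longrightarrow> b \<in> car A \<Longrightarrow> \<alpha> (alg_times A a b) = alg_times B (\<alpha> a) (\<alpha> b)"
    and hom_star: "a \<in> car A \<Longrightarrow> \<alpha> (alg_star A a) = alg_star B (\<alpha> a)"
    and contractive: "a \<in> car A \<Longrightarrow> q (\<alpha> a) \<le> p a"
begin

lemma hom_minus: "a \<in> car A \<Longrightarrow> b \<in> car A \<Longrightarrow> \<alpha> (minus_in A a b) = minus_in B (\<alpha> a) (\<alpha> b)"
  by (simp add: minus_in_def hom_plus hom_scl S.scl_car)

lemma hom_pd: "a \<in> car A \<Longrightarrow> b \<in> car A \<Longrightarrow> T.pd (\<alpha> a) (\<alpha> b) \<le> S.pd a b"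
  using contractive[OF S.minus_car, of a b] hom_minus by simp

lemma hom_cauchy: 
  assumes f: "f \<in> cauchy_in A p"
  shows "(\<lambda>n. \<alpha> (f n)) \<in> cauchy_in B q"
  unfolding cauchy_in_def
proof (intro CollectI conjI allI impI)
  show "\<alpha> (f n) \<in> car B" for n using hom_car[OF S.cauchyD[OF f]] .
  fix \<epsilon> :: real assume "\<epsilon> > 0"
  then obtain k where "\<forall>m\<ge>k. \<forall>n\<ge>k. S.pd (f m) (f n) < \<epsilon>" using S.cauchy_eps[OF f] by meson
  then have "T.pd (\<alpha> (f m)) (\<alpha> (f n)) < \<epsilon>" if "k \<le> m" "k \<le> n" for m n
    using hom_pd[OF S.cauchyD[OF f] S.cauchyD[OF f], of m n] that by force
  then show "\<exists>M. \<forall>m\<ge>M. \<forall>n\<ge>M. T.pd (\<alpha> (f m)) (\<alpha> (f n)) < \<epsilon>" by blast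
qed

lemma hom_null:
  assumes fg: "(f, g) \<in> null_rel A p"
  shows "(\<lambda>n. \<alpha> (f n), \<lambda>n. \<alpha> (g n)) \<in> null_rel B q"
  by (rule T.nullI_le[OF hom_cauchy[OF S.nullD(1)[OF fg]] hom_cauchy[OF S.nullD(2)[OF fg]] _ S.nullD(3)[OF fg]])
    (rule hom_pd[OF S.cauchyD[OF S.nullD(1)[OF fg]] S.cauchyD[OF S.nullD(2)[OF fg]]])

lemma hom_class:
  assumes f: "f \<in> cauchy_in A p"
  shows "qmap (null_rel B q) (\<lambda>f n. \<alpha> (f n)) (S.null_class f) = T.null_class (\<lambda>n. \<alpha> (f n))"
  by (rule qmap_class[OF S.equiv_null T.equiv_null f hom_null])

end

text \<open>Continuous \<open>*\<close>-homomorphisms agree on a closed \<open>*\<close>-subalgebra. With this,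
  agreement on generators suffices for agreement on a generated subalgebra.\<close>

lemma equalizer_cstar_subalgebra:
  assumes \<alpha>: "seminormed_star_hom A p B q \<alpha>" and \<beta>: "seminormed_star_hom A p B q \<beta>"
  shows "cstar_subalgebra (completion A p)
     {y \<in> car (completion A p).
        qmap (null_rel B q) (\<lambda>f n. \<alpha> (f n)) y = qmap (null_rel B q) (\<lambda>f n. \<beta> (f n)) y}"
proof -
  interpret a: seminormed_star_hom A p B q \<alpha> by fact
  interpret b: seminormed_star_hom A p B q \<beta> by fact
  let ?C = "{y \<in> car (completion A p).
        qmap (null_rel B q) (\<lambda>f n. \<alpha> (f n)) y = qmap (null_rel B q) (\<lambda>f n. \<beta> (f n)) y}"
  have C: "a.S.null_class f \<in> ?C \<longleftrightarrow> (\<lambda>n. \<alpha> (f n), \<lambda>n. \<beta> (f n)) \<in> null_rel B q" if f: "f \<in> cauchy_in A p" for f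
    using eq_equiv_class_iff[OF a.T.equiv_null a.hom_cauchy[OF f] b.hom_cauchy[OF f]]
    by (simp add: a.hom_class[OF f] b.hom_class[OF f] a.S.null_class_car[OF f])
  have CE: "\<exists>f. f \<in> cauchy_in A p \<and> y = a.S.null_class f \<and> (\<lambda>n. \<alpha> (f n), \<lambda>n. \<beta> (f n)) \<in> null_rel B q" if "y \<in> ?C" for y
  proof -
    have "y \<in> car (completion A p)" using that by simp
    then obtain f where f: "f \<in> cauchy_in A p" "y = a.S.null_class f" by (rule a.S.completion_carE)
    then show ?thesis using C[OF f(1)] that by blast
  qed
  show ?thesis
    unfolding cstar_subalgebra_def
  proof (intro conjI ballI allI impI)
    show "?C \<subseteq> car (completion A p)" by blast
    show "?C \<noteq> {}"
    proof -
      obtain x where x: "x \<in> car A" using a.S.nonempty by blast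
      have f: "(\<lambda>_. alg_scl A 0 x) \<in> cauchy_in A p"
        by (simp add: cauchy_in_def a.S.pd_self a.S.scl_car x)
      have g: "a.T.pd (alg_scl B 0 (\<alpha> x)) (alg_scl B 0 (\<beta> x)) \<le> 0"
        using a.T.pd_scl[OF a.hom_car b.hom_car, OF x x, of 0] by simp
      have "(\<lambda>n. \<alpha> (alg_scl A 0 x), \<lambda>n. \<beta> (alg_scl A 0 x)) \<in> null_rel B q"
        by (rule a.T.nullI_le[OF a.hom_cauchy[OF f] b.hom_cauchy[OF f], of "\<lambda>_. 0"])
          (use g x in \<open>simp_all add: a.hom_scl b.hom_scl\<close>)
      then have "a.S.null_class (\<lambda>_. alg_scl A 0 x) \<in> ?C" using C[OF f] by simp
      then show ?thesis by blast
    qed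
  next
    fix y z assume "y \<in> ?C" "z \<in> ?C"
    then obtain f g where f: "f \<in> cauchy_in A p" "y = a.S.null_class f" "(\<lambda>n. \<alpha> (f n), \<lambda>n. \<beta> (f n)) \<in> null_rel B q"
      and g: "g \<in> cauchy_in A p" "z = a.S.null_class g" "(\<lambda>n. \<alpha> (g n), \<lambda>n. \<beta> (g n)) \<in> null_rel B q"
      using CE[OF \<open>y \<in> ?C\<close>] CE[OF \<open>z \<in> ?C\<close>] by blast
    note fc = a.S.cauchyD[OF f(1)] a.S.cauchyD[OF g(1)]
    have "a.S.null_class (\<lambda>n. alg_plus A (f n) (g n)) \<in> ?C"
      unfolding C[OF a.S.cauchy_plus[OF f(1) g(1)]]
      using a.T.null_plus[OF f(3) g(3)] fc by (simp add: a.hom_plus b.hom_plus)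
    then show "alg_plus (completion A p) y z \<in> ?C"
      by (simp only: f(2) g(2) a.S.completion_plus[OF f(1) g(1)])
    have "a.S.null_class (\<lambda>n. alg_times A (f n) (g n)) \<in> ?C"
      unfolding C[OF a.S.cauchy_times[OF f(1) g(1)]]
      using a.T.null_times[OF f(3) g(3)] fc by (simp add: a.hom_times b.hom_times)
    then show "alg_times (completion A p) y z \<in> ?C"
      by (simp only: f(2) g(2) a.S.completion_times[OF f(1) g(1)])
  next
    fix y assume "y \<in> ?C"
    then obtain f where f: "f \<in> cauchy_in A p" "y = a.S.null_class f" "(\<lambda>n. \<alpha> (f n), \<lambda>n. \<beta> (f n)) \<in> null_rel B q"
      using CE[OF \<open>y \<in> ?C\<close>] by blast
    note fc = a.S.cauchyD[OF f(1)]
    have "a.S.null_class (\<lambda>n. alg_star A (f n)) \<in> ?C"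
      unfolding C[OF a.S.cauchy_star[OF f(1)]]
      using a.T.null_star[OF f(3)] fc by (simp add: a.hom_star b.hom_star)
    then show "alg_star (completion A p) y \<in> ?C"
      by (simp only: f(2) a.S.completion_star[OF f(1)])
    fix c
    have "a.S.null_class (\<lambda>n. alg_scl A c (f n)) \<in> ?C"
      unfolding C[OF a.S.cauchy_scl[OF f(1)]]
      using a.T.null_scl[OF f(3)] fc by (simp add: a.hom_scl b.hom_scl)
    then show "alg_scl (completion A p) c y \<in> ?C"
      by (simp only: f(2) a.S.completion_scl[OF f(1)])
  next
    fix y assume y: "y \<in> car (completion A p)"
      and close: "\<forall>\<epsilon>>0. \<exists>z\<in>?C. nrm (completion A p) (minus_in (completion A p) y z) < \<epsilon>"
    obtain f where f: "f \<in> cauchy_in A p" "y = a.S.null_class f" using a.S.completion_carE[OF y] .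
    note fc = a.S.cauchyD[OF f(1)]
    have "(\<lambda>n. a.T.pd (\<alpha> (f n)) (\<beta> (f n))) \<longlonglongrightarrow> 0"
    proof (rule tendstoI)
      fix \<epsilon> :: real assume "\<epsilon> > 0"
      then have e: "\<epsilon> / 3 > 0" by simp
      obtain z where z: "z \<in> ?C" "nrm (completion A p) (minus_in (completion A p) y z) < \<epsilon> / 3"
        using close e by blast
      obtain g where g: "g \<in> cauchy_in A p" "z = a.S.null_class g" "(\<lambda>n. \<alpha> (g n), \<lambda>n. \<beta> (g n)) \<in> null_rel B q"
        using CE[OF z(1)] by blast
      note gc = a.S.cauchyD[OF g(1)]
      have 1: "\<forall>\<^sub>F n in sequentially. a.S.pd (f n) (g n) < \<epsilon> / 3"
        by (rule a.S.completion_nrm_less[OF a.S.cauchy_minus[OF f(1) g(1)]])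
          (use z(2) in \<open>simp only: f(2) g(2) a.S.completion_minus[OF f(1) g(1)]\<close>)
      have 2: "\<forall>\<^sub>F n in sequentially. a.T.pd (\<alpha> (g n)) (\<beta> (g n)) < \<epsilon> / 3"
        using order_tendstoD(2)[OF a.T.nullD(3)[OF g(3)] e] .
      show "\<forall>\<^sub>F n in sequentially. dist (a.T.pd (\<alpha> (f n)) (\<beta> (f n))) 0 < \<epsilon>"
        using 1 2
      proof eventually_elim
        case (elim n)
        have "a.T.pd (\<alpha> (f n)) (\<beta> (f n)) \<le> a.T.pd (\<alpha> (f n)) (\<alpha> (g n)) + a.T.pd (\<alpha> (g n)) (\<beta> (f n))"
          using fc gc by (intro a.T.pd_tri a.hom_car b.hom_car)
        also have "a.T.pd (\<alpha> (g n)) (\<beta> (f n)) \<le> a.T.pd (\<alpha> (g n)) (\<beta> (g n)) + a.T.pd (\<beta> (g n)) (\<beta> (f n))"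
          using fc gc by (intro a.T.pd_tri a.hom_car b.hom_car)
        also have "a.T.pd (\<alpha> (f n)) (\<alpha> (g n)) \<le> a.S.pd (f n) (g n)" by (rule a.hom_pd[OF fc gc])
        also have "a.T.pd (\<beta> (g n)) (\<beta> (f n)) \<le> a.S.pd (f n) (g n)"
          using b.hom_pd[OF gc fc, of n n] a.S.pd_sym[OF gc fc, of n n] by simp
        finally have "a.T.pd (\<alpha> (f n)) (\<beta> (f n)) < \<epsilon>" using elim by simp
        moreover have "0 \<le> a.T.pd (\<alpha> (f n)) (\<beta> (f n))"
          by (rule a.T.pd_nonneg[OF a.hom_car[OF fc] b.hom_car[OF fc]])
        ultimately show ?case by simp
      qed
    qed
    then have "(\<lambda>n. \<alpha> (f n), \<lambda>n. \<beta> (f n)) \<in> null_rel B q"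
      using a.hom_cauchy[OF f(1)] b.hom_cauchy[OF f(1)] by (simp add: a.T.null_iff)
    then show "y \<in> ?C" using C[OF f(1)] f(2) by simp
  qed
qed

section \<open>Operators on tails of the Fock space\<close>

definition sq_norm :: "('e, 'x) vbundle \<Rightarrow> nat \<Rightarrow> 'x \<Rightarrow> ('e list \<Rightarrow> complex) \<Rightarrow> real" where
  "sq_norm E r x \<Phi> = (\<Sum>bs\<in>words (chosen_onb E x) r. (cmod (\<Phi> bs))\<^sup>2)"

text \<open>The norms and scalar products of Fock vectors are truncated at the power \<open>L\<close>, which
  makes the sums finite; for a vector supported up to \<open>L\<close> nothing is lost.\<close>

definition fnorm :: "('e, 'x) vbundle \<Rightarrow> 'x \<Rightarrow> nat \<Rightarrow> (nat \<Rightarrow> 'e list \<Rightarrow> complex) \<Rightarrow> real" where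
  "fnorm E x L v = sqrt (\<Sum>n\<le>L. sq_norm E n x (v n))"

definition fip :: "('e, 'x) vbundle \<Rightarrow> 'x \<Rightarrow> nat \<Rightarrow> (nat \<Rightarrow> 'e list \<Rightarrow> complex) \<Rightarrow> (nat \<Rightarrow> 'e list \<Rightarrow> complex) \<Rightarrow> complex" where
  "fip E x L v w = (\<Sum>n\<le>L. tip E n x (v n) (w n))"

text \<open>The matrix acts on a vector without components beyond the power \<open>M\<close>.\<close>

definition matapp ::
  "('e, 'x) tmat \<Rightarrow> 'x \<Rightarrow> nat \<Rightarrow> (nat \<Rightarrow> 'e list \<Rightarrow> complex) \<Rightarrow> nat \<Rightarrow> 'e list \<Rightarrow> complex" where
  "matapp a x M v m = (\<lambda>ws. \<Sum>n\<le>M. act (a n m) x (v n) ws)"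

text \<open>Vectors of the Fock space of the fibre over \<open>x\<close> with components in the powers from
  \<open>N\<close> to \<open>M\<close> only.\<close>

definition fock :: "('e, 'x) vbundle \<Rightarrow> 'x \<Rightarrow> nat \<Rightarrow> nat \<Rightarrow> (nat \<Rightarrow> 'e list \<Rightarrow> complex) \<Rightarrow> bool" where
  "fock E x N M v \<longleftrightarrow> (\<forall>n. v n \<in> tfib E n x) \<and> (\<forall>n. n < N \<or> M < n \<longrightarrow> v n = (\<lambda>_. 0))"

text \<open>The first rows of a matrix are not determined by its class. A norm on classes therefore takes into
  account only the action on vectors that are supported sufficiently far out.\<close>

definition tail_bounded_from :: "('e, 'x) vbundle \<Rightarrow> nat \<Rightarrow> ('e, 'x) tmat \<Rightarrow> real \<Rightarrow> bool" where
  "tail_bounded_from E N a c \<longleftrightarrow>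
     (\<forall>x\<in>topspace (base E). \<forall>M v L. fock E x N M v \<longrightarrow> fnorm E x L (matapp a x M v) \<le> c * fnorm E x M v)"

definition tail_bounded :: "('e, 'x) vbundle \<Rightarrow> ('e, 'x) tmat \<Rightarrow> real \<Rightarrow> bool" where
  "tail_bounded E a c \<longleftrightarrow> 0 \<le> c \<and> (\<exists>N. tail_bounded_from E N a c)"

text \<open>The matrix of \<open>t\<close> in the definition of \<^const>\<open>cp_embed\<close>.\<close>

definition core_embed :: "('e, 'x) vbundle \<Rightarrow> nat \<Rightarrow> nat \<Rightarrow> ('e, 'x) tmor \<Rightarrow> ('e, 'x) tmat" where
  "core_embed E r s t = (\<lambda>n m. if r \<le> n \<and> m = s + (n - r) then amplify_iter E r s (n - r) t else tzero E n)"

lemma sq_norm_nonneg [simp]: "0 \<le> sq_norm E r x \<Phi>"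
  by (simp add: sq_norm_def sum_nonneg)

lemma sq_norm_zero [simp]: "sq_norm E r x (\<lambda>_. 0) = 0"
  by (simp add: sq_norm_def)

lemma sq_norm_scl: "sq_norm E r x (\<lambda>ws. c * \<Phi> ws) = (cmod c)\<^sup>2 * sq_norm E r x \<Phi>"
  by (simp add: sq_norm_def norm_mult power_mult_distrib sum_distrib_left)

lemma fnorm_nonneg [simp]: "0 \<le> fnorm E x L v"
  by (simp add: fnorm_def sum_nonneg)

lemma fnorm_sq: "(fnorm E x L v)\<^sup>2 = (\<Sum>n\<le>L. sq_norm E n x (v n))"
  by (simp add: fnorm_def sum_nonneg)

lemma fnorm_L2: "fnorm E x L v = L2_set (\<lambda>(n, bs). cmod (v n bs)) (SIGMA n:{..L}. words (chosen_onb E x) n)"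
  if "finite (chosen_onb E x)"
  unfolding fnorm_def L2_set_def sq_norm_def using that
  by (subst sum.Sigma) (auto simp: finite_words case_prod_unfold)

lemma fnorm_add:
  assumes "finite (chosen_onb E x)"
  shows "fnorm E x L (\<lambda>n ws. v n ws + w n ws) \<le> fnorm E x L v + fnorm E x L w"
proof -
  let ?S = "SIGMA n:{..L}. words (chosen_onb E x) n"
  have "fnorm E x L (\<lambda>n ws. v n ws + w n ws) \<le>
     L2_set (\<lambda>z. (case z of (n, bs) \<Rightarrow> cmod (v n bs)) + (case z of (n, bs) \<Rightarrow> cmod (w n bs))) ?S"
    unfolding fnorm_L2[OF assms] by (intro L2_set_mono) (auto simp: norm_triangle_ineq)
  also have "\<dots> \<le> fnorm E x L v + fnorm E x L w"
    unfolding fnorm_L2[OF assms] by (rule L2_set_triangle_ineq)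
  finally show ?thesis .
qed

lemma fnorm_scl: "fnorm E x L (\<lambda>n ws. c * v n ws) = cmod c * fnorm E x L v"
  by (simp add: fnorm_def sq_norm_scl real_sqrt_mult flip: sum_distrib_left)

lemma fnorm_phase: "(\<And>n. cmod (c n) = 1) \<Longrightarrow> fnorm E x L (\<lambda>n ws. c n * v n ws) = fnorm E x L v"
  by (simp add: fnorm_def sq_norm_scl)

lemma fnorm_mono: "L \<le> L' \<Longrightarrow> fnorm E x L v \<le> fnorm E x L' v"
  unfolding fnorm_def by (intro real_sqrt_le_mono sum_mono2) auto

text \<open>Cauchy--Schwarz for the coordinates of both vectors with respect to the basis of all words.\<close>

lemma fip_CS:
  assumes "finite (chosen_onb E x)"
  shows "cmod (fip E x L v w) \<le> fnorm E x L v * fnorm E x L w"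
proof -
  let ?S = "SIGMA n:{..L}. words (chosen_onb E x) n"
  have "fip E x L v w = (\<Sum>z\<in>?S. case z of (n, bs) \<Rightarrow> cnj (v n bs) * w n bs)"
    unfolding fip_def tip_def words_def[symmetric] chosen_onb_def[symmetric] using assms
    by (subst sum.Sigma) (auto simp: finite_words words_def[symmetric])
  also have "cmod \<dots> \<le> (\<Sum>z\<in>?S. \<bar>case z of (n, bs) \<Rightarrow> cmod (v n bs)\<bar> * \<bar>case z of (n, bs) \<Rightarrow> cmod (w n bs)\<bar>)"
    by (rule order_trans[OF norm_sum]) (auto simp: norm_mult intro!: sum_mono)
  also have "\<dots> \<le> fnorm E x L v * fnorm E x L w"
    unfolding fnorm_L2[OF assms] by (rule L2_set_mult_ineq)
  finally show ?thesis .
qed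

lemma fock_mono: "fock E x N M v \<Longrightarrow> N' \<le> N \<Longrightarrow> M \<le> M' \<Longrightarrow> fock E x N' M' v"
  by (auto simp: fock_def)

lemma fnorm_support:
  assumes "fock E x N M v" "M \<le> L"
  shows "fnorm E x L v = fnorm E x M v"
proof -
  have "(\<Sum>n\<le>L. sq_norm E n x (v n)) = (\<Sum>n\<le>M. sq_norm E n x (v n))"
    using assms by (intro sum.mono_neutral_right) (auto simp: fock_def)
  then show ?thesis by (simp add: fnorm_def)
qed

lemma fnorm_support_le: "fock E x N M v \<Longrightarrow> fnorm E x L v \<le> fnorm E x M v"
  using fnorm_support[of E x N M v "max L M"] fnorm_mono[of L "max L M" E x v] by simp

lemma tail_bounded_from_mono: "tail_bounded_from E N a c \<Longrightarrow> N \<le> N' \<Longrightarrow> c \<le> c' \<Longrightarrow> tail_bounded_from E N' a c'"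
  unfolding tail_bounded_from_def
proof (intro ballI allI impI)
  fix x M v L
  assume "\<forall>x\<in>topspace (base E). \<forall>M v L. fock E x N M v \<longrightarrow> fnorm E x L (matapp a x M v) \<le> c * fnorm E x M v"
    and *: "N \<le> N'" "c \<le> c'" "x \<in> topspace (base E)" "fock E x N' M v"
  then have "fnorm E x L (matapp a x M v) \<le> c * fnorm E x M v" using fock_mono[OF *(4,1) order_refl] by blast
  also have "\<dots> \<le> c' * fnorm E x M v" using * by (intro mult_right_mono) auto
  finally show "fnorm E x L (matapp a x M v) \<le> c' * fnorm E x M v" .
qed

context framed_bundle
begin

lemma tip_sq_norm: "tip E r x \<Phi> \<Phi> = complex_of_real (sq_norm E r x \<Phi>)"
  by (simp add: tip_self sq_norm_def)

lemma fip_self: "fip E x L v v = complex_of_real ((fnorm E x L v)\<^sup>2)"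
  unfolding fip_def fnorm_sq tip_sq_norm by simp

lemma matapp_tfib:
  assumes "a \<in> tmats E" "x \<in> topspace (base E)" "\<And>n. v n \<in> tfib E n x"
  shows "matapp a x M v m \<in> tfib E m x"
  unfolding matapp_def by (intro tfib_sum act_fib assms)

lemma matapp_fock:
  assumes a: "a \<in> tmats E" and K: "banded E K a" and x: "x \<in> topspace (base E)" and v: "fock E x N M v"
  shows "fock E x (N - K) (M + K) (matapp a x M v)"
proof -
  have vt: "v n \<in> tfib E n x" for n using v by (simp add: fock_def)
  have "act (a n m) x (v n) = (\<lambda>_. 0)" if m: "m < N - K \<or> M + K < m" for n m
  proof (cases "n < N \<or> M < n")
    case True
    then have "v n = (\<lambda>_. 0)" using v by (auto simp: fock_def)
    then show ?thesis using tlinear_zero[OF act_tlinear[OF a x]] by simp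
  next
    case False
    then have "n + K < m \<or> m + K < n" using m by auto
    then have "a n m = tzero E n" using K unfolding banded_def by blast
    then show ?thesis using x vt by simp
  qed
  then show ?thesis unfolding fock_def using matapp_tfib[OF a x vt] by (auto simp: matapp_def)
qed

lemma fip_matapp:
  assumes a: "a \<in> tmats E" and x: "x \<in> topspace (base E)" and v: "\<And>n. v n \<in> tfib E n x" and w: "\<And>n. w n \<in> tfib E n x"
  shows "fip E x M (matapp a x L w) v = fip E x L w (matapp (tstar E a) x M v)"
proof -
  have "fip E x M (matapp a x L w) v = (\<Sum>n\<le>M. \<Sum>m\<le>L. tip E n x (act (a m n) x (w m)) (v n))"
    unfolding fip_def matapp_def using tip_sum_left[where I = "{..L}" and c = "\<lambda>_. 1"] by simp
  also have "\<dots> = (\<Sum>n\<le>M. \<Sum>m\<le>L. tip E m x (w m) (act (tstar E a n m) x (v n)))"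
    using tip_tstar[OF a x w v] by simp
  also have "\<dots> = fip E x L w (matapp (tstar E a) x M v)"
    unfolding fip_def matapp_def using tip_sum_right[where I = "{..M}" and c = "\<lambda>_. 1"] by (subst sum.swap) simp
  finally show ?thesis .
qed

lemma matapp_tmat_mult:
  assumes a: "a \<in> tmats E" and b: "b \<in> tmats E" and K: "banded E K b" and x: "x \<in> topspace (base E)"
    and v: "\<And>n. v n \<in> tfib E n x"
  shows "matapp (tmat_mult E a b) x M v m = matapp a x (M + K) (matapp b x M v) m"
proof
  fix ws
  have s: "act (a l m) x (\<lambda>ws. \<Sum>n\<le>M. act (b n l) x (v n) ws) = (\<lambda>ws. \<Sum>n\<le>M. act (a l m) x (act (b n l) x (v n)) ws)" for l
    using tlinear_sum[OF act_tlinear[OF a x], where I = "{..M}" and \<Phi> = "\<lambda>n. act (b n l) x (v n)" and c = "\<lambda>_. 1"]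
      act_fib[OF b x v] by simp
  have "matapp (tmat_mult E a b) x M v m ws = (\<Sum>n\<le>M. \<Sum>l\<le>M + K. act (a l m) x (act (b n l) x (v n)) ws)"
    unfolding matapp_def by (intro sum.cong refl act_tmat_mult[OF a b K _ x v]) auto
  also have "\<dots> = (\<Sum>l\<le>M + K. \<Sum>n\<le>M. act (a l m) x (act (b n l) x (v n)) ws)" by (rule sum.swap)
  also have "\<dots> = matapp a x (M + K) (matapp b x M v) m ws"
    by (simp add: matapp_def s)
  finally show "matapp (tmat_mult E a b) x M v m ws = matapp a x (M + K) (matapp b x M v) m ws" .
qed

lemma tail_bounded_add:
  assumes a: "a \<in> tmats E" and b: "b \<in> tmats E" and "tail_bounded E a c" "tail_bounded E b c'"
  shows "tail_bounded E (tadd E a b) (c + c')"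
proof -
  obtain N where N: "tail_bounded_from E N a c" "tail_bounded_from E N b c'"
    using assms(3,4) tail_bounded_from_mono[OF _ max.cobounded1 order_refl] tail_bounded_from_mono[OF _ max.cobounded2 order_refl]
    unfolding tail_bounded_def by meson
  have "tail_bounded_from E N (tadd E a b) (c + c')"
    unfolding tail_bounded_from_def
  proof (intro ballI allI impI)
    fix x M v L assume x: "x \<in> topspace (base E)" and v: "fock E x N M v"
    have vt: "v n \<in> tfib E n x" for n using v by (simp add: fock_def)
    have "matapp (tadd E a b) x M v = (\<lambda>m ws. matapp a x M v m ws + matapp b x M v m ws)"
      by (simp add: matapp_def act_tadd[OF a b x vt] sum.distrib fun_eq_iff)
    then have "fnorm E x L (matapp (tadd E a b) x M v) \<le> fnorm E x L (matapp a x M v) + fnorm E x L (matapp b x M v)"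
      using fnorm_add[OF finite_chosen_onb[OF x]] by simp
    also have "\<dots> \<le> c * fnorm E x M v + c' * fnorm E x M v"
      using N x v unfolding tail_bounded_from_def by (intro add_mono) blast+
    finally show "fnorm E x L (matapp (tadd E a b) x M v) \<le> (c + c') * fnorm E x M v"
      by (simp add: algebra_simps)
  qed
  then show ?thesis using assms(3,4) unfolding tail_bounded_def by fastforce
qed

lemma tail_bounded_scl:
  assumes a: "a \<in> tmats E" and "tail_bounded E a c"
  shows "tail_bounded E (tscl E k a) (cmod k * c)"
proof -
  obtain N where N: "tail_bounded_from E N a c" and c: "0 \<le> c" using assms(2) by (auto simp: tail_bounded_def)
  have "tail_bounded_from E N (tscl E k a) (cmod k * c)"
    unfolding tail_bounded_from_def
  proof (intro ballI allI impI)
    fix x M v L assume x: "x \<in> topspace (base E)" and v: "fock E x N M v"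
    have vt: "v n \<in> tfib E n x" for n using v by (simp add: fock_def)
    have "matapp (tscl E k a) x M v = (\<lambda>m ws. k * matapp a x M v m ws)"
      by (simp add: matapp_def act_tscl[OF a x vt] sum_distrib_left fun_eq_iff)
    then have "fnorm E x L (matapp (tscl E k a) x M v) = cmod k * fnorm E x L (matapp a x M v)"
      by (simp add: fnorm_scl)
    also have "\<dots> \<le> cmod k * (c * fnorm E x M v)"
      using N x v unfolding tail_bounded_from_def by (intro mult_left_mono) (blast, simp)
    finally show "fnorm E x L (matapp (tscl E k a) x M v) \<le> cmod k * c * fnorm E x M v"
      by (simp add: algebra_simps)
  qed
  then show ?thesis using c unfolding tail_bounded_def by fastforce
qed

text \<open>The circle acts by conjugation with the unitaries that multiply the $n$-th tensor power by $z^n$.\<close>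

lemma tail_bounded_circ:
  assumes a: "a \<in> tmats E" and "tail_bounded E a c" and z: "cmod z = 1"
  shows "tail_bounded E (tcirc E z a) c"
proof -
  obtain N where N: "tail_bounded_from E N a c" and c: "0 \<le> c" using assms(2) by (auto simp: tail_bounded_def)
  have z0: "z \<noteq> 0" using z by auto
  have "tail_bounded_from E N (tcirc E z a) c"
    unfolding tail_bounded_from_def
  proof (intro ballI allI impI)
    fix x M v L assume x: "x \<in> topspace (base E)" and v: "fock E x N M v"
    have vt: "v n \<in> tfib E n x" for n using v by (simp add: fock_def)
    define w where "w = (\<lambda>n ws. z powi (- int n) * v n ws)"
    have w: "fock E x N M w" using v by (auto simp: fock_def w_def tfib_scl)
    have "act (tcirc E z a n m) x (v n) ws = z powi int m * act (a n m) x (w n) ws" for n m ws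
      unfolding w_def tlinear_scl[OF act_tlinear[OF a x] vt] act_tcirc[OF a x vt]
      using z0 by (simp add: power_int_diff power_int_minus field_simps)
    then have "matapp (tcirc E z a) x M v = (\<lambda>m ws. z powi int m * matapp a x M w m ws)"
      by (simp add: matapp_def sum_distrib_left fun_eq_iff)
    then have "fnorm E x L (matapp (tcirc E z a) x M v) = fnorm E x L (matapp a x M w)"
      using fnorm_phase[of "\<lambda>m. z powi int m"] z by (simp add: norm_power_int norm_power)
    also have "\<dots> \<le> c * fnorm E x M w"
      using N x w unfolding tail_bounded_from_def by blast
    also have "fnorm E x M w = fnorm E x M v"
      unfolding w_def using fnorm_phase[of "\<lambda>m. z powi (- int m)"] z by (simp add: norm_power_int)
    finally show "fnorm E x L (matapp (tcirc E z a) x M v) \<le> c * fnorm E x M v" .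
  qed
  then show ?thesis using c unfolding tail_bounded_def by fastforce
qed

text \<open>The inner factor may move a vector towards the vacuum by its bandwidth \<open>K\<close>, and the
  tail for the product starts correspondingly later.\<close>

lemma tail_bounded_mult:
  assumes a: "a \<in> tmats E" and b: "b \<in> tmats E" and "tail_bounded E a c" "tail_bounded E b c'"
  shows "tail_bounded E (tmat_mult E a b) (c * c')"
proof -
  obtain N N' where N: "tail_bounded_from E N a c" "tail_bounded_from E N' b c'" and c: "0 \<le> c" "0 \<le> c'"
    using assms(3,4) by (auto simp: tail_bounded_def)
  obtain K where K: "banded E K b" using b by (auto simp: tmats_iff)
  have "tail_bounded_from E (N + K + N') (tmat_mult E a b) (c * c')"
    unfolding tail_bounded_from_def
  proof (intro ballI allI impI)
    fix x M v L assume x: "x \<in> topspace (base E)" and v: "fock E x (N + K + N') M v"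
    have vt: "v n \<in> tfib E n x" for n using v by (simp add: fock_def)
    have v': "fock E x N' M v" by (rule fock_mono[OF v]) auto
    have w: "fock E x N (M + K) (matapp b x M v)"
      by (rule fock_mono[OF matapp_fock[OF b K x v]]) auto
    have "fnorm E x L (matapp (tmat_mult E a b) x M v) = fnorm E x L (matapp a x (M + K) (matapp b x M v))"
      unfolding fnorm_def matapp_tmat_mult[OF a b K x vt] ..
    also have "\<dots> \<le> c * fnorm E x (M + K) (matapp b x M v)"
      using N(1) x w unfolding tail_bounded_from_def by blast
    also have "\<dots> \<le> c * (c' * fnorm E x M v)"
      using N(2) x v' c unfolding tail_bounded_from_def by (intro mult_left_mono) blast+
    finally show "fnorm E x L (matapp (tmat_mult E a b) x M v) \<le> c * c' * fnorm E x M v"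
      by (simp add: algebra_simps)
  qed
  then show ?thesis using c unfolding tail_bounded_def by fastforce
qed

text \<open>$\lVert a^* v\rVert^2 = \langle a a^* v, v\rangle \le c\,\lVert a^* v\rVert\,\lVert v\rVert$.\<close>

lemma tail_bounded_star:
  assumes a: "a \<in> tmats E" and "tail_bounded E a c"
  shows "tail_bounded E (tstar E a) c"
proof -
  obtain N where N: "tail_bounded_from E N a c" and c: "0 \<le> c" using assms(2) by (auto simp: tail_bounded_def)
  obtain K where K: "banded E K (tstar E a)" using tstar_tmats[OF a] by (auto simp: tmats_iff)
  have "tail_bounded_from E (N + K) (tstar E a) c"
    unfolding tail_bounded_from_def
  proof (intro ballI allI impI)
    fix x M v L assume x: "x \<in> topspace (base E)" and v: "fock E x (N + K) M v"
    have vt: "v n \<in> tfib E n x" for n using v by (simp add: fock_def)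
    define w where "w = matapp (tstar E a) x M v"
    have w: "fock E x N (M + K) w"
      unfolding w_def by (rule fock_mono[OF matapp_fock[OF tstar_tmats[OF a] K x v]]) auto
    have wt: "w n \<in> tfib E n x" for n using w by (simp add: fock_def)
    have "complex_of_real ((fnorm E x (M + K) w)\<^sup>2) = fip E x (M + K) w (matapp (tstar E a) x M v)"
      unfolding fip_self[symmetric] w_def ..
    also have "\<dots> = fip E x M (matapp a x (M + K) w) v"
      by (rule fip_matapp[OF a x vt wt, symmetric])
    finally have "(fnorm E x (M + K) w)\<^sup>2 = cmod (fip E x M (matapp a x (M + K) w) v)"
      by (metis norm_of_real abs_of_nonneg zero_le_power2)
    also have "\<dots> \<le> fnorm E x M (matapp a x (M + K) w) * fnorm E x M v"
      by (rule fip_CS[OF finite_chosen_onb[OF x]])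
    also have "\<dots> \<le> c * fnorm E x (M + K) w * fnorm E x M v"
      using N x w unfolding tail_bounded_from_def by (intro mult_right_mono) (blast, simp)
    finally have sq: "fnorm E x (M + K) w * fnorm E x (M + K) w \<le> fnorm E x (M + K) w * (c * fnorm E x M v)"
      by (simp add: power2_eq_square mult_ac)
    have "fnorm E x (M + K) w \<le> c * fnorm E x M v"
    proof (cases "fnorm E x (M + K) w = 0")
      case True then show ?thesis using c by simp
    next
      case False
      then have "0 < fnorm E x (M + K) w" using fnorm_nonneg[of E x "M + K" w] by linarith
      then show ?thesis using sq by (rule mult_left_le_imp_le[rotated])
    qed
    then show "fnorm E x L (matapp (tstar E a) x M v) \<le> c * fnorm E x M v"
      using fnorm_support_le[OF w, of L] unfolding w_def by linarith
  qed
  then show ?thesis using c unfolding tail_bounded_def by blast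
qed

text \<open>$\lVert a v\rVert^2 = \langle v, a^* a v\rangle \le c\,\lVert v\rVert^2$.\<close>

lemma tail_bounded_cstar:
  assumes a: "a \<in> tmats E" and "tail_bounded E (tmat_mult E (tstar E a) a) c"
  shows "tail_bounded E a (sqrt c)"
proof -
  obtain N where N: "tail_bounded_from E N (tmat_mult E (tstar E a) a) c" and c: "0 \<le> c" using assms(2) by (auto simp: tail_bounded_def)
  obtain K where K: "banded E K a" using a by (auto simp: tmats_iff)
  have "tail_bounded_from E N a (sqrt c)"
    unfolding tail_bounded_from_def
  proof (intro ballI allI impI)
    fix x M v L assume x: "x \<in> topspace (base E)" and v: "fock E x N M v"
    have vt: "v n \<in> tfib E n x" for n using v by (simp add: fock_def)
    define w where "w = matapp a x M v"
    have w: "fock E x (N - K) (M + K) w"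
      unfolding w_def by (rule matapp_fock[OF a K x v])
    have wt: "w n \<in> tfib E n x" for n using w by (simp add: fock_def)
    have e: "matapp (tstar E a) x (M + K) w = matapp (tmat_mult E (tstar E a) a) x M v"
      unfolding w_def by (rule ext) (rule matapp_tmat_mult[OF tstar_tmats[OF a] a K x vt, symmetric])
    have "complex_of_real ((fnorm E x (M + K) w)\<^sup>2) = fip E x (M + K) (matapp a x M v) w"
      unfolding fip_self[symmetric] w_def ..
    also have "\<dots> = fip E x M v (matapp (tmat_mult E (tstar E a) a) x M v)"
      unfolding e[symmetric] by (rule fip_matapp[OF a x wt vt])
    finally have "(fnorm E x (M + K) w)\<^sup>2 = cmod (fip E x M v (matapp (tmat_mult E (tstar E a) a) x M v))"
      by (metis norm_of_real abs_of_nonneg zero_le_power2)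
    also have "\<dots> \<le> fnorm E x M v * fnorm E x M (matapp (tmat_mult E (tstar E a) a) x M v)"
      by (rule fip_CS[OF finite_chosen_onb[OF x]])
    also have "\<dots> \<le> fnorm E x M v * (c * fnorm E x M v)"
      using N x v unfolding tail_bounded_from_def by (intro mult_left_mono) (blast, simp)
    finally have "(fnorm E x (M + K) w)\<^sup>2 \<le> (sqrt c * fnorm E x M v)\<^sup>2"
      using c by (simp add: power_mult_distrib) (simp add: power2_eq_square mult_ac)
    then have "fnorm E x (M + K) w \<le> sqrt c * fnorm E x M v"
      by (rule power2_le_imp_le) (use c in simp)
    then show "fnorm E x L (matapp a x M v) \<le> sqrt c * fnorm E x M v"
      using fnorm_support_le[OF w, of L] unfolding w_def by linarith
  qed
  then show ?thesis using c unfolding tail_bounded_def by fastforce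
qed

lemma tail_bounded_rel:
  assumes "(a, b) \<in> tmat_rel E" "tail_bounded E a c"
  shows "tail_bounded E b c"
proof -
  obtain N where N: "\<forall>n\<ge>N. \<forall>m. a n m = b n m" and ab: "a \<in> tmats E" "b \<in> tmats E"
    using assms(1) by (auto simp: tmat_rel_def)
  obtain N' where N': "tail_bounded_from E N' a c" and c: "0 \<le> c" using assms(2) by (auto simp: tail_bounded_def)
  have "tail_bounded_from E (N + N') b c"
    unfolding tail_bounded_from_def
  proof (intro ballI allI impI)
    fix x M v L assume x: "x \<in> topspace (base E)" and v: "fock E x (N + N') M v"
    have vt: "v n = (\<lambda>_. 0)" if "n < N" for n using v that by (simp add: fock_def)
    have "act (b n m) x (v n) = act (a n m) x (v n)" for n m
    proof (cases "n < N")
      case True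
      then show ?thesis using tlinear_zero[OF act_tlinear[OF ab(1) x]] tlinear_zero[OF act_tlinear[OF ab(2) x]] vt by simp
    qed (use N in simp)
    then have "matapp b x M v = matapp a x M v" by (simp add: matapp_def fun_eq_iff)
    moreover have "fnorm E x L (matapp a x M v) \<le> c * fnorm E x M v"
      using N' x fock_mono[OF v, of N' M] unfolding tail_bounded_from_def by simp
    ultimately show "fnorm E x L (matapp b x M v) \<le> c * fnorm E x M v" by simp
  qed
  then show ?thesis using c unfolding tail_bounded_def by blast
qed

lemma amplify_iter_tmor: "t \<in> tmors E r s \<Longrightarrow> amplify_iter E r s j t \<in> tmors E (r + j) (s + j)"
  by (induction j) (simp_all add: amplify_tmor)

lemma core_embed_tmats:
  assumes t: "t \<in> tmors E r s"
  shows "core_embed E r s t \<in> tmats E"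
proof (rule tmatsI)
  fix n m show "core_embed E r s t n m \<in> tmors E n m"
    using amplify_iter_tmor[OF t, of "n - r"] tzero_tmor by (auto simp: core_embed_def)
next
  show "banded E (r + s) (core_embed E r s t)" by (auto simp: banded_def core_embed_def)
  show "stable E r (core_embed E r s t)"
    unfolding stable_def
  proof (intro allI impI)
    fix n m assume n: "r \<le> n"
    then have "Suc n - r = Suc (n - r)" by simp
    then show "core_embed E r s t (Suc n) (Suc m) = amplify E n m (core_embed E r s t n m)"
      using n by (auto simp: core_embed_def amplify_tzero)
  qed
qed

text \<open>$t \otimes 1$ acts on the slices of a form along a basis separately.\<close>

lemma sq_norm_amplify:
  assumes t: "t \<in> tmors E r s" and x: "x \<in> topspace (base E)" and \<Phi>: "\<Phi> \<in> tfib E (Suc r) x"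
  shows "sq_norm E (Suc s) x (act (amplify E r s t) x \<Phi>) = (\<Sum>b\<in>chosen_onb E x. sq_norm E s x (act t x (slice \<Phi> b)))"
proof -
  have b: "b \<in> fib E x" if "b \<in> chosen_onb E x" for b using onb_chosen_onb[OF x] that by (auto simp: onb_def)
  have "sq_norm E (Suc s) x \<Psi> = (\<Sum>b\<in>chosen_onb E x. sq_norm E s x (slice \<Psi> b))" for \<Psi>
    unfolding sq_norm_def sum_words_snoc[OF finite_chosen_onb[OF x]] by (simp add: slice_def)
  then show ?thesis using slice_amplify[OF t x \<Phi> b] by simp
qed

lemma sq_norm_Suc:
  assumes x: "x \<in> topspace (base E)"
  shows "sq_norm E (Suc r) x \<Phi> = (\<Sum>b\<in>chosen_onb E x. sq_norm E r x (slice \<Phi> b))"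
  unfolding sq_norm_def sum_words_snoc[OF finite_chosen_onb[OF x]] by (simp add: slice_def)

text \<open>Amplification does not increase the bound of a morphism.\<close>

lemma amplify_iter_bound:
  assumes t: "t \<in> tmors E r s"
    and C: "\<And>x \<Phi>. x \<in> topspace (base E) \<Longrightarrow> \<Phi> \<in> tfib E r x \<Longrightarrow> sq_norm E s x (act t x \<Phi>) \<le> C * sq_norm E r x \<Phi>"
    and x: "x \<in> topspace (base E)" and \<Phi>: "\<Phi> \<in> tfib E (r + j) x"
  shows "sq_norm E (s + j) x (act (amplify_iter E r s j t) x \<Phi>) \<le> C * sq_norm E (r + j) x \<Phi>"
  using \<Phi>
proof (induction j arbitrary: \<Phi>)
  case 0
  then show ?case using C[OF x] by simp
next
  case (Suc j)
  have b: "b \<in> fib E x" if "b \<in> chosen_onb E x" for b using onb_chosen_onb[OF x] that by (auto simp: onb_def)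
  have \<Phi>: "\<Phi> \<in> tfib E (Suc (r + j)) x" using Suc.prems by simp
  have "sq_norm E (s + Suc j) x (act (amplify_iter E r s (Suc j) t) x \<Phi>) =
     (\<Sum>b\<in>chosen_onb E x. sq_norm E (s + j) x (act (amplify_iter E r s j t) x (slice \<Phi> b)))"
    using sq_norm_amplify[OF amplify_iter_tmor[OF t] x \<Phi>] by simp
  also have "\<dots> \<le> (\<Sum>b\<in>chosen_onb E x. C * sq_norm E (r + j) x (slice \<Phi> b))"
    by (intro sum_mono Suc.IH slice_tfib[OF \<Phi>] b)
  also have "\<dots> = C * sq_norm E (r + Suc j) x \<Phi>"
    using sq_norm_Suc[OF x, of "r + j" \<Phi>] by (simp add: sum_distrib_left)
  finally show ?case .
qed

text \<open>A homogeneous element maps different tensor powers to different ones, so that the bounds of the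
  entries on its diagonal bound the whole matrix.\<close>

lemma tail_bounded_core_embed:
  assumes t: "t \<in> tmors E r s" and C0: "0 \<le> C"
    and C: "\<And>x \<Phi>. x \<in> topspace (base E) \<Longrightarrow> \<Phi> \<in> tfib E r x \<Longrightarrow> sq_norm E s x (act t x \<Phi>) \<le> C * sq_norm E r x \<Phi>"
  shows "tail_bounded E (core_embed E r s t) (sqrt C)"
proof -
  have "tail_bounded_from E r (core_embed E r s t) (sqrt C)"
    unfolding tail_bounded_from_def
  proof (intro ballI allI impI)
    fix x M v L assume x: "x \<in> topspace (base E)" and v: "fock E x r M v"
    have vt: "v n \<in> tfib E n x" for n using v by (simp add: fock_def)
    have v0: "v n = (\<lambda>_. 0)" if "n < r \<or> M < n" for n using v that by (auto simp: fock_def)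
    let ?w = "matapp (core_embed E r s t) x M v"
    let ?f = "\<lambda>n. sq_norm E n x (v n)"
    have w: "sq_norm E m x (?w m) \<le> (if s \<le> m then C * ?f (r + (m - s)) else 0)" for m
    proof -
      have z: "act (core_embed E r s t n m) x (v n) = (\<lambda>_. 0)" if "\<not> (s \<le> m \<and> n = r + (m - s))" for n
      proof (cases "n < r")
        case True
        then show ?thesis using v0 tlinear_zero[OF act_tlinear[OF core_embed_tmats[OF t] x]] by simp
      next
        case False
        then have "core_embed E r s t n m = tzero E n" using that by (auto simp: core_embed_def)
        then show ?thesis using x vt by simp
      qed
      show ?thesis
      proof (cases "s \<le> m \<and> r + (m - s) \<le> M")
        case True
        let ?n = "r + (m - s)"
        have "?w m = (\<lambda>ws. \<Sum>n\<in>{?n}. act (core_embed E r s t n m) x (v n) ws)"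
          unfolding matapp_def using z True by (intro ext sum.mono_neutral_right) auto
        also have "\<dots> = act (amplify_iter E r s (m - s) t) x (v ?n)"
        proof -
          have "core_embed E r s t ?n (s + (m - s)) = amplify_iter E r s (m - s) t" by (simp only: core_embed_def) simp
          then show ?thesis using True by simp
        qed
        finally show ?thesis
          using amplify_iter_bound[OF t C x vt, of "m - s"] True by simp
      next
        case False
        then have "?w m = (\<lambda>_. 0)" unfolding matapp_def using z by (intro ext sum.neutral) auto
        then show ?thesis using C0 by simp
      qed
    qed
    have "(\<Sum>m\<le>L. sq_norm E m x (?w m)) \<le> (\<Sum>m\<le>L. if s \<le> m then C * ?f (r + (m - s)) else 0)"
      by (intro sum_mono w)
    also have "\<dots> = C * (\<Sum>m\<in>{m. m \<le> L \<and> s \<le> m}. ?f (r + (m - s)))"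
      by (simp add: sum.If_cases sum_distrib_left Int_def)
    also have "(\<Sum>m\<in>{m. m \<le> L \<and> s \<le> m}. ?f (r + (m - s))) = sum ?f ((\<lambda>m. r + (m - s)) ` {m. m \<le> L \<and> s \<le> m})"
      by (subst sum.reindex) (auto simp: inj_on_def)
    also have "\<dots> \<le> sum ?f {..M + r + L}"
      by (intro sum_mono2) auto
    also have "\<dots> = (\<Sum>n\<le>M. ?f n)"
      using v0 by (intro sum.mono_neutral_right) auto
    finally have "(\<Sum>m\<le>L. sq_norm E m x (?w m)) \<le> C * (\<Sum>n\<le>M. ?f n)"
      using C0 by (simp add: mult_left_mono)
    then show "fnorm E x L ?w \<le> sqrt C * fnorm E x M v"
      unfolding fnorm_def by (simp flip: real_sqrt_mult)
  qed
  then show ?thesis using C0 unfolding tail_bounded_def by fastforce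
qed

text \<open>Up to equivalence a matrix is the sum of the diagonals through the entries of one row, and each of
  these is obtained from that entry by amplification. Statements that respect sums and the
  equivalence thus reduce to single morphisms.\<close>

lemma tmats_decompose [consumes 1, case_names rel add core_embed]:
  assumes a: "a \<in> tmats E"
    and rel: "\<And>a b. (a, b) \<in> tmat_rel E \<Longrightarrow> Q a \<Longrightarrow> Q b"
    and add: "\<And>a b. a \<in> tmats E \<Longrightarrow> b \<in> tmats E \<Longrightarrow> Q a \<Longrightarrow> Q b \<Longrightarrow> Q (tadd E a b)"
    and core_embed: "\<And>r s t. t \<in> tmors E r s \<Longrightarrow> Q (core_embed E r s t)"
  shows "Q a"
proof -
  obtain K N0 where K: "banded E K a" and N0: "stable E N0 a" using a by (auto simp: tmats_iff)
  \<comment> \<open>All diagonals with non-zero entries meet the row \<open>N\<close>, because of $K \le N$.\<close>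
  define N where "N = N0 + K"
  have iter: "a (N + j) (s + j) = amplify_iter E N s j (a N s)" for s j
    using N0 by (induction j) (simp_all add: stable_def N_def)
  have emt: "core_embed E N s (a N s) \<in> tmats E" for s by (rule core_embed_tmats[OF tmats_tmor[OF a]])
  define S where "S = rec_nat (core_embed E N 0 (a N 0)) (\<lambda>k b. tadd E b (core_embed E N (Suc k) (a N (Suc k))))"
  have S0: "S 0 = core_embed E N 0 (a N 0)" and SS: "S (Suc k) = tadd E (S k) (core_embed E N (Suc k) (a N (Suc k)))" for k
    by (simp_all add: S_def)
  have St: "S k \<in> tmats E" for k by (induction k) (simp_all add: S0 SS emt tadd_tmats)
  have QS: "Q (S k)" for k
    by (induction k) (simp_all add: S0 SS core_embed[OF tmats_tmor[OF a]] add[OF St emt])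
  have emv: "core_embed E N s (a N s) n m = (if m = s + (n - N) then a n m else tzero E n)" if "N \<le> n" for s n m
    using iter[of "n - N" s] that by (simp add: core_embed_def)
  have mz: "madd (tpow E n) (tpow E m) t (tzero E n) = t" "madd (tpow E n) (tpow E m) (tzero E n) t = t"
    if "t \<in> tmors E n m" for t n m
    by (rule tmor_eqI[OF madd_tmor[OF that tzero_tmor] that], simp add: act_madd[OF that tzero_tmor])
      (rule tmor_eqI[OF madd_tmor[OF tzero_tmor that] that], simp add: act_madd[OF tzero_tmor that])
  have Sv: "S k n m = (if n - N \<le> m \<and> m \<le> k + (n - N) then a n m else tzero E n)" if n: "N \<le> n" for k n m
  proof (induction k)
    case 0
    then show ?case using emv[OF n, of 0] by (auto simp: S0)
  next
    case (Suc k)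
    then show ?case
      using emv[OF n, of "Suc k" m] mz[OF tmats_tmor[OF a], of n m] madd_tzero[of n m] by (auto simp: SS tadd_def)
  qed
  have "(S (N + K), a) \<in> tmat_rel E"
  proof (rule tmat_relI[OF St a, of N])
    fix n m assume n: "N \<le> n"
    show "S (N + K) n m = a n m"
    proof (cases "n - N \<le> m \<and> m \<le> N + K + (n - N)")
      case True then show ?thesis using Sv[OF n, of "N + K" m] by simp
    next
      case False
      then have "n + K < m \<or> m + K < n" using n by (auto simp: N_def)
      then have "a n m = tzero E n" using K unfolding banded_def by blast
      then show ?thesis using Sv[OF n, of "N + K" m] by simp
    qed
  qed
  then show ?thesis using rel QS by blast
qed

text \<open>$\Theta = \Phi \otimes b$.\<close>

lemma tensor_extend:
  assumes x: "x \<in> topspace (base E)" and b: "b \<in> chosen_onb E x" and \<Phi>: "\<Phi> \<in> tfib E n x"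
  obtains \<Theta> where "\<Theta> \<in> tfib E (Suc n) x" "\<And>c. c \<in> fib E x \<Longrightarrow> slice \<Theta> c = (\<lambda>ws. ip E c b * \<Phi> ws)" "slice \<Theta> b = \<Phi>"
proof -
  have bf: "b \<in> fib E x" and bb: "ip E b b = 1" using onb_chosen_onb[OF x] b by (auto simp: onb_def)
  define \<Theta> where "\<Theta> = (\<lambda>ws. if ws \<in> tup E (Suc n) x then ip E (last ws) b * \<Phi> (butlast ws) else 0)"
  have sl: "slice \<Theta> c = (\<lambda>ws. ip E c b * \<Phi> ws)" if "c \<in> fib E x" for c
    using that tfib_outside[OF \<Phi>] by (auto simp: slice_def \<Theta>_def tup_snoc fun_eq_iff)
  have \<Theta>: "\<Theta> \<in> tfib E (Suc n) x"
  proof (rule tfib_SucI)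
    fix zs assume "zs \<in> tup E n x"
    show "conj_linear E x (\<lambda>c. slice \<Theta> c zs)"
      unfolding conj_linear_def using conj_linear_ip[OF bf]
      by (auto simp: sl vadd_fib vscl_fib conj_linear_def algebra_simps)
  qed (simp_all add: \<Theta>_def[THEN fun_cong] sl tfib_scl \<Phi>)
  then show ?thesis using that sl sl[OF bf] bb by simp
qed

lemma tfib_chosen_onb_empty:
  assumes x: "x \<in> topspace (base E)" and "chosen_onb E x = {}" and \<Phi>: "\<Phi> \<in> tfib E (Suc r) x"
  shows "\<Phi> = (\<lambda>_. 0)"
proof -
  have "words (chosen_onb E x) (Suc r) = {}" using assms(2) by (auto simp: words_def)
  then show ?thesis using tfib_simple_tensor_sum[OF onb_chosen_onb[OF x] \<Phi>] by simp
qed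

text \<open>A bound on far tails bounds all entries from the stable row on. Tensoring with a unit vector
  \<open>b\<close> moves an entry one step down its diagonal: $a_{n+1,m+1}(\Phi \otimes b) =
  (a_{n,m}\Phi) \otimes b$, without a change of norms. This is repeated until the tail begins. If
  the fibre is zero there is no unit vector, but then \<open>\<Phi>\<close> is zero because of $n
  \ge 1$; for $n = 0$ the claim would fail, since scalars do not vanish over a zero fibre while
  their amplifications do.\<close>

lemma tail_bounded_lower:
  assumes a: "a \<in> tmats E" and N: "tail_bounded_from E N a c" and st: "stable E S a" and n: "S \<le> n" "1 \<le> n"
    and x: "x \<in> topspace (base E)" and \<Phi>: "\<Phi> \<in> tfib E n x"
  shows "sqrt (sq_norm E m x (act (a n m) x \<Phi>)) \<le> c * sqrt (sq_norm E n x \<Phi>)"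
  using n \<Phi>
proof (induction "N - n" arbitrary: n m \<Phi>)
  case 0
  then have nN: "N \<le> n" by simp
  let ?v = "\<lambda>k. if k = n then \<Phi> else (\<lambda>_. 0)"
  have v: "fock E x N n ?v" using 0 nN by (auto simp: fock_def)
  have "act (a k m) x (?v k) = (\<lambda>_. 0)" if "k \<noteq> n" for k m
    using that tlinear_zero[OF act_tlinear[OF a x]] by simp
  then have w: "matapp a x n ?v m = act (a n m) x \<Phi>" for m
  proof -
    have "matapp a x n ?v m = (\<lambda>ws. \<Sum>k\<in>{n}. act (a k m) x (?v k) ws)"
      unfolding matapp_def using tlinear_zero[OF act_tlinear[OF a x]] by (intro ext sum.mono_neutral_right) auto
    then show ?thesis by simp
  qed
  have "sqrt (sq_norm E m x (act (a n m) x \<Phi>)) \<le> fnorm E x m (matapp a x n ?v)"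
    unfolding fnorm_def w
    by (intro real_sqrt_le_mono member_le_sum[of m "{..m}" "\<lambda>m. sq_norm E m x (act (a n m) x \<Phi>)"]) auto
  also have "\<dots> \<le> c * fnorm E x n ?v" using N x v unfolding tail_bounded_from_def by blast
  also have "fnorm E x n ?v = sqrt (sq_norm E n x \<Phi>)"
  proof -
    have "(\<Sum>k\<le>n. sq_norm E k x (?v k)) = (\<Sum>k\<in>{n}. sq_norm E k x (?v k))"
      by (intro sum.mono_neutral_right) auto
    then show ?thesis by (simp add: fnorm_def)
  qed
  finally show ?case .
next
  case (Suc j)
  show ?case
  proof (cases "chosen_onb E x = {}")
    case True
    then have "\<Phi> = (\<lambda>_. 0)" using tfib_chosen_onb_empty[OF x, of \<Phi> "n - 1"] Suc.prems by simp
    then show ?thesis using tlinear_zero[OF act_tlinear[OF a x]] by simp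
  next
    case False
    then obtain b where b: "b \<in> chosen_onb E x" by blast
    have on: "ip E c b = (if c = b then 1 else 0)" and bf: "c \<in> fib E x" if "c \<in> chosen_onb E x" for c
      using onb_chosen_onb[OF x] b that by (auto simp: onb_def)
    obtain \<Theta> where \<Theta>: "\<Theta> \<in> tfib E (Suc n) x"
      and sl: "\<And>c. c \<in> fib E x \<Longrightarrow> slice \<Theta> c = (\<lambda>ws. ip E c b * \<Phi> ws)"
      using tensor_extend[OF x b Suc.prems(3)] by blast
    have "act (a (Suc n) (Suc m)) x \<Theta> = act (amplify E n m (a n m)) x \<Theta>"
      using st Suc.prems(1) by (simp add: stable_def)
    then have "sq_norm E (Suc m) x (act (a (Suc n) (Suc m)) x \<Theta>) = (\<Sum>c\<in>chosen_onb E x. sq_norm E m x (act (a n m) x (slice \<Theta> c)))"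
      using sq_norm_amplify[OF tmats_tmor[OF a] x \<Theta>] by simp
    also have "\<dots> = (\<Sum>c\<in>chosen_onb E x. if c = b then sq_norm E m x (act (a n m) x \<Phi>) else 0)"
      by (intro sum.cong refl)
        (simp add: sl bf on tlinear_zero[OF act_tlinear[OF a x]])
    also have "\<dots> = sq_norm E m x (act (a n m) x \<Phi>)" using b finite_chosen_onb[OF x] by simp
    finally have 1: "sq_norm E (Suc m) x (act (a (Suc n) (Suc m)) x \<Theta>) = sq_norm E m x (act (a n m) x \<Phi>)" .
    have "sq_norm E (Suc n) x \<Theta> = (\<Sum>c\<in>chosen_onb E x. if c = b then sq_norm E n x \<Phi> else 0)"
      unfolding sq_norm_Suc[OF x] by (intro sum.cong refl) (simp add: sl bf on)
    also have "\<dots> = sq_norm E n x \<Phi>" using b finite_chosen_onb[OF x] by simp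
    finally have 2: "sq_norm E (Suc n) x \<Theta> = sq_norm E n x \<Phi>" .
    have "j = N - Suc n" using Suc.hyps(2) by simp
    from Suc.hyps(1)[OF this _ _ \<Theta>, of "Suc m"] Suc.prems show ?thesis unfolding 1 2 by simp
  qed
qed

end

section \<open>Global frames\<close>

definition tensor_section :: "('e, 'x) vbundle \<Rightarrow> nat \<Rightarrow> ('x \<Rightarrow> 'e list \<Rightarrow> complex) \<Rightarrow> bool" where
  "tensor_section E r f \<longleftrightarrow> continuous_map (base E) (ttop E r) (\<lambda>y. (y, f y))"

text \<open>A section of the tensor power as the morphism from the trivial line bundle that maps the unit
  section to it.\<close>

definition section_mor :: "('e, 'x) vbundle \<Rightarrow> ('x \<Rightarrow> 'e list \<Rightarrow> complex) \<Rightarrow> ('e, 'x) tmor" where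
  "section_mor E f = tmor_of E 0 (\<lambda>x \<Phi> ws. \<Phi> [] * f x ws)"

text \<open>Multiplication by a function, as an endomorphism of the trivial line bundle.\<close>

definition function_mor :: "('e, 'x) vbundle \<Rightarrow> ('x \<Rightarrow> complex) \<Rightarrow> ('e, 'x) tmor" where
  "function_mor E h = tmor_of E 0 (\<lambda>x \<Phi> ws. h x * \<Phi> ws)"

text \<open>The set over which the supremum in \<^const>\<open>cp_norm\<close> is taken.\<close>

definition circle_norms :: "('e, 'x) vbundle \<Rightarrow> (('e, 'x) cpcore \<Rightarrow> real) set" where
  "circle_norms E = {p. cstar_norm (cp_core E) p \<and>
                  (\<forall>z. cmod z = 1 \<longrightarrow> (\<forall>b\<in>car (cp_core E). p (circle_action E z b) = p b))}"

lemma continuous_map_complex_of_real: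
  "continuous_map X euclideanreal f \<Longrightarrow> continuous_map X euclidean (\<lambda>x. complex_of_real (f x))"
  by (simp add: continuous_map_atin tendsto_of_real)

lemma continuous_map_real_sqrt:
  "continuous_map X euclideanreal f \<Longrightarrow> continuous_map X euclideanreal (\<lambda>x. sqrt (f x))"
  by (simp add: continuous_map_atin tendsto_real_sqrt)

lemma continuous_map_real_divide:
  "continuous_map X euclideanreal f \<Longrightarrow> continuous_map X euclideanreal g \<Longrightarrow>
    (\<And>x. x \<in> topspace X \<Longrightarrow> g x \<noteq> 0) \<Longrightarrow> continuous_map X euclideanreal (\<lambda>x. f x / g x)"
  by (simp add: continuous_map_atin tendsto_divide)

lemma continuous_map_Re: "continuous_map X euclidean f \<Longrightarrow> continuous_map X euclideanreal (\<lambda>x. Re (f x))"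
  by (simp add: continuous_map_atin tendsto_Re)

lemma continuous_bounded:
  assumes "compact_space X" "continuous_map X euclideanreal f"
  obtains C where "C > 0" "\<forall>x\<in>topspace X. \<bar>f x\<bar> \<le> C"
proof -
  have "compactin euclideanreal (f ` topspace X)"
    using image_compactin[OF _ assms(2)] assms(1) by (simp add: compact_space_def)
  then have "bounded (f ` topspace X)" using compact_imp_bounded by simp
  then obtain C where "C > 0" "\<forall>y\<in>f ` topspace X. norm y \<le> C" unfolding bounded_pos by blast
  then show ?thesis using that by auto
qed

context framed_bundle
begin

lemma tensor_section_tfib: "tensor_section E r f \<Longrightarrow> x \<in> topspace (base E) \<Longrightarrow> f x \<in> tfib E r x"
  using continuous_map_image_subset_topspace[of "base E" "ttop E r" "\<lambda>y. (y, f y)"] mem_ttop[of x "f x" r]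
  unfolding tensor_section_def by blast

lemma scaled_continuous:
  assumes f: "continuous_map Z (ttop E r) (\<lambda>z. (q z, f z))" and h: "continuous_map Z euclidean h"
  shows "continuous_map Z (ttop E r) (\<lambda>z. (q z, \<lambda>ws. h z * f z ws))"
proof (rule continuous_into_ttop)
  fix z assume "z \<in> topspace Z"
  then have "(q z, f z) \<in> topspace (ttop E r)" using continuous_map_image_subset_topspace[OF f] by blast
  then show "(q z, \<lambda>ws. h z * f z ws) \<in> topspace (ttop E r)" by (simp add: tfib_scl)
next
  show "continuous_map Z (base E) (\<lambda>z. fst (q z, \<lambda>ws. h z * f z ws))" using fst_comp[OF f] by simp
next
  fix U \<sigma>s assume "section_list E U r \<sigma>s"
  from coef_comp[OF f this]
  show "continuous_map (subtopology Z {z \<in> topspace Z. fst (q z, \<lambda>ws. h z * f z ws) \<in> U}) euclidean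
     (\<lambda>z. snd (q z, \<lambda>ws. h z * f z ws) (eval_secs \<sigma>s (fst (q z, \<lambda>ws. h z * f z ws))))"
    using h by (simp add: continuous_map_complex_mult continuous_map_from_subtopology)
qed

lemma zero_section_continuous: "continuous_map (subtopology (base E) W) (ttop E r) (\<lambda>z. (z, \<lambda>_. 0))"
  by (rule continuous_into_ttop) (simp_all add: continuous_map_from_subtopology)

lemma tensor_section_act: "t \<in> tmors E r s \<Longrightarrow> tensor_section E r f \<Longrightarrow> tensor_section E s (\<lambda>x. act t x (f x))"
  unfolding tensor_section_def using continuous_map_compose[OF _ tmor_cont'] by (fastforce simp: o_def)

lemma tensor_section_tip: "tensor_section E r f \<Longrightarrow> tensor_section E r g \<Longrightarrow> continuous_map (base E) euclidean (\<lambda>x. tip E r x (f x) (g x))"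
  unfolding tensor_section_def by (rule tip_continuous[where q = "\<lambda>x. x"])

lemma tensor_section_sq_norm: "tensor_section E r f \<Longrightarrow> continuous_map (base E) euclideanreal (\<lambda>x. sq_norm E r x (f x))"
  using continuous_map_Re[OF tensor_section_tip, of r f f] by (simp add: tip_sq_norm)

lemma frame_expand:
  assumes F: "frame E U n s" "U \<subseteq> topspace (base E)" "y \<in> U" and \<Phi>: "\<Phi> \<in> tfib E r y"
  shows "(\<Sum>is\<in>words {..<n} r. tip E r y (simple_tensor E y (eval_secs (map s is) y)) \<Phi> * simple_tensor E y (eval_secs (map s is) y) ws) = \<Phi> ws"
proof -
  let ?B = "(\<lambda>i. s i y) ` {..<n}"
  have B: "onb E y ?B" by (rule frame_onb[OF F])
  have y: "y \<in> topspace (base E)" using F by blast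
  have "\<Phi> ws = (\<Sum>bs\<in>words ?B r. \<Phi> bs * simple_tensor E y bs ws)" using fun_cong[OF tfib_simple_tensor_sum[OF B \<Phi>]] .
  also have "\<dots> = (\<Sum>is\<in>words {..<n} r. \<Phi> (map (\<lambda>i. s i y) is) * simple_tensor E y (map (\<lambda>i. s i y) is) ws)"
    by (rule sum_words_image[OF frame_inj[OF F(1,3)]])
  also have "\<dots> = (\<Sum>is\<in>words {..<n} r. tip E r y (simple_tensor E y (eval_secs (map s is) y)) \<Phi> * simple_tensor E y (eval_secs (map s is) y) ws)"
  proof (rule sum.cong[OF refl])
    fix "is" assume "is \<in> words {..<n} r"
    then have "map (\<lambda>i. s i y) is \<in> words ?B r" unfolding words_image by blast
    then have "tip E r y (simple_tensor E y (map (\<lambda>i. s i y) is)) \<Phi> = \<Phi> (map (\<lambda>i. s i y) is)"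
      using tip_simple_tensor[OF y words_onb_tup[OF B] \<Phi>] by blast
    then show "\<Phi> (map (\<lambda>i. s i y) is) * simple_tensor E y (map (\<lambda>i. s i y) is) ws =
       tip E r y (simple_tensor E y (eval_secs (map s is) y)) \<Phi> * simple_tensor E y (eval_secs (map s is) y) ws"
      by (simp add: eval_secs_def o_def)
  qed
  finally show ?thesis by simp
qed

text \<open>A partition of unity into squares, subordinate to a finite cover by domains of frames. The sets
  \<open>W x\<close> on which a cutoff vanishes are open and not just the complements of \<open>U
  x\<close>, so that sections over \<open>U x\<close> multiplied by the cutoff can be continued by
  zero.\<close>

lemma cutoffs:
  obtains D :: "'x set" and U n s \<zeta> and W :: "'x \<Rightarrow> 'x set" where "finite D"
    "\<forall>x\<in>D. openin (base E) (U x) \<and> frame E (U x) (n x) (s x)"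
    "\<forall>x\<in>D. continuous_map (base E) euclideanreal (\<zeta> x)"
    "\<forall>x\<in>D. openin (base E) (W x) \<and> U x \<union> W x = topspace (base E) \<and> (\<forall>y\<in>W x. \<zeta> x y = 0)"
    "\<forall>y\<in>topspace (base E). (\<Sum>x\<in>D. (\<zeta> x y)\<^sup>2) = (1::real)"
proof -
  let ?X = "topspace (base E)"
  obtain U n s where F: "\<forall>x\<in>?X. openin (base E) (U x) \<and> x \<in> U x \<and> frame E (U x) (n x) (s x)"
    using bchoice[of ?X "\<lambda>x (U, n, s). openin (base E) U \<and> x \<in> U \<and> frame E U n s"] local_frame
    by (auto simp: case_prod_beta)
  have nrml: "normal_space (base E)"
    using compact_Hausdorff_or_regular_imp_normal_space compact_base Hausdorff_base by blast
  have "\<exists>f. continuous_map (base E) euclideanreal f \<and> f x = 1 \<and> (\<forall>y\<in>?X - U x. f y = 0)" if x: "x \<in> ?X" for x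
  proof -
    have c: "closedin (base E) (?X - U x)" "closedin (base E) {x}"
      using F x closedin_Hausdorff_singleton[OF Hausdorff_base x] by auto
    have "disjnt (?X - U x) {x}" using F x by (auto simp: disjnt_def)
    from Urysohn_lemma[OF nrml c this, of 0 1]
    obtain f where "continuous_map (base E) (top_of_set {0..1::real}) f" "f ` (?X - U x) \<subseteq> {0}" "f ` {x} \<subseteq> {1}"
      by auto
    then show ?thesis by (auto simp: continuous_map_in_subtopology intro!: exI[of _ f])
  qed
  then obtain f where f: "\<And>x. x \<in> ?X \<Longrightarrow> continuous_map (base E) euclideanreal (f x) \<and> f x x = 1 \<and> (\<forall>y\<in>?X - U x. f x y = 0)"
    by metis
  define V where "V = (\<lambda>x. {y \<in> ?X. f x y \<in> {1/2<..}})"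
  have Vo: "openin (base E) (V x)" if "x \<in> ?X" for x
    unfolding V_def using f[OF that] openin_continuous_map_preimage[of "base E" euclideanreal "f x" "{1/2<..}"] by simp
  have xV: "x \<in> V x" if "x \<in> ?X" for x using f[OF that] that by (simp add: V_def)
  have "\<exists>\<F>. finite \<F> \<and> \<F> \<subseteq> V ` ?X \<and> ?X \<subseteq> \<Union>\<F>"
  proof (rule compactinD[of "base E"])
    show "compactin (base E) ?X" using compact_base by (simp add: compact_space_def)
  qed (use Vo xV in auto)
  then obtain D where D: "D \<subseteq> ?X" "finite D" "?X \<subseteq> (\<Union>x\<in>D. V x)"
    by (metis finite_subset_image)
  \<comment> \<open>The threshold $1/2$ leaves room for the open set where \<open>f x\<close> is smaller, on
    which the cutoff vanishes.\<close>
  define \<eta> where "\<eta> = (\<lambda>x y. max 0 (f x y - 1/2))"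
  define g where "g = (\<lambda>y. \<Sum>x\<in>D. (\<eta> x y)\<^sup>2)"
  have \<eta>c: "continuous_map (base E) euclideanreal (\<eta> x)" if "x \<in> D" for x
    unfolding \<eta>_def using f[of x] D that by (intro continuous_map_real_max continuous_map_diff) auto
  have gc: "continuous_map (base E) euclideanreal g"
    unfolding g_def using \<eta>c by (intro continuous_map_sum D continuous_map_real_pow)
  have gpos: "0 < g y" if y: "y \<in> ?X" for y
  proof -
    obtain x where x: "x \<in> D" "y \<in> V x" using D y by blast
    then have "0 < \<eta> x y" by (simp add: \<eta>_def V_def)
    then show ?thesis unfolding g_def using D(2) x(1) by (intro sum_pos2[of D x]) auto
  qed
  define \<zeta> where "\<zeta> = (\<lambda>x y. \<eta> x y / sqrt (g y))"
  define W where "W = (\<lambda>x. {y \<in> ?X. f x y \<in> {..<1/2}})"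
  show ?thesis
  proof (rule that[of D U n s \<zeta> W])
    show "finite D" by fact
    show "\<forall>x\<in>D. openin (base E) (U x) \<and> frame E (U x) (n x) (s x)" using F D by blast
    show "\<forall>x\<in>D. continuous_map (base E) euclideanreal (\<zeta> x)"
    proof
      fix x assume x: "x \<in> D"
      show "continuous_map (base E) euclideanreal (\<zeta> x)"
        unfolding \<zeta>_def
        by (rule continuous_map_real_divide[OF \<eta>c[OF x] continuous_map_real_sqrt[OF gc]]) (use gpos in force)
    qed
    show "\<forall>x\<in>D. openin (base E) (W x) \<and> U x \<union> W x = ?X \<and> (\<forall>y\<in>W x. \<zeta> x y = 0)"
    proof (intro ballI conjI)
      fix x assume "x \<in> D"
      then have x: "x \<in> ?X" using D by blast
      show "openin (base E) (W x)"
        unfolding W_def using f[OF x] openin_continuous_map_preimage[of "base E" euclideanreal "f x" "{..<1/2}"] by simp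
      show "U x \<union> W x = ?X"
      proof -
        have "U x \<subseteq> ?X" using F x openin_subset by blast
        moreover have "y \<in> W x" if "y \<in> ?X - U x" for y using f[OF x] that by (simp add: W_def)
        ultimately show ?thesis by (auto simp: W_def)
      qed
      fix y assume "y \<in> W x"
      then show "\<zeta> x y = 0" by (simp add: W_def \<zeta>_def \<eta>_def)
    qed
    show "\<forall>y\<in>?X. (\<Sum>x\<in>D. (\<zeta> x y)\<^sup>2) = 1"
    proof
      fix y assume y: "y \<in> ?X"
      have "(\<Sum>x\<in>D. (\<zeta> x y)\<^sup>2) = (\<Sum>x\<in>D. (\<eta> x y)\<^sup>2 / g y)"
        unfolding \<zeta>_def using gpos[OF y] by (simp add: power_divide)
      also have "\<dots> = g y / g y"
        by (subst (2) g_def) (rule sum_divide_distrib[symmetric])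
      finally show "(\<Sum>x\<in>D. (\<zeta> x y)\<^sup>2) = 1" using gpos[OF y] by simp
    qed
  qed
qed

text \<open>Simple tensors in the local frames, multiplied by cutoffs whose squares sum to one: each cutoff
  enters the reconstruction formula twice, once in the coefficient and once in the vector. The index
  of a frame element consists of a point, which selects a local frame, and a word of indices of that
  frame.\<close>

lemma global_frame:
  obtains J :: "('x \<times> nat list) set" and \<xi> where "finite J" "\<forall>j\<in>J. tensor_section E r (\<xi> j)"
    "\<forall>y\<in>topspace (base E). \<forall>\<Phi>\<in>tfib E r y. \<forall>ws. (\<Sum>j\<in>J. tip E r y (\<xi> j y) \<Phi> * \<xi> j y ws) = \<Phi> ws"
proof -
  let ?X = "topspace (base E)"
  obtain D :: "'x set" and U n s \<zeta> W where D: "finite D"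
    and F: "\<forall>x\<in>D. openin (base E) (U x) \<and> frame E (U x) (n x) (s x)"
    and \<zeta>: "\<forall>x\<in>D. continuous_map (base E) euclideanreal (\<zeta> x)"
    and W: "\<forall>x\<in>D. openin (base E) (W x) \<and> U x \<union> W x = ?X \<and> (\<forall>y\<in>W x. \<zeta> x y = 0)"
    and part: "\<forall>y\<in>?X. (\<Sum>x\<in>D. (\<zeta> x y)\<^sup>2) = 1" by (rule cutoffs)
  define J where "J = (SIGMA x:D. words {..<n x} r)"
  define \<xi> where "\<xi> = (\<lambda>(x, is) y. if y \<in> U x then (\<lambda>ws. complex_of_real (\<zeta> x y) * simple_tensor E y (eval_secs (map (s x) is) y) ws) else (\<lambda>_. 0))"
  show ?thesis
  proof (rule that[of J \<xi>])
    show "finite J" unfolding J_def using D by (intro finite_SigmaI finite_words) auto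
    show "\<forall>j\<in>J. tensor_section E r (\<xi> j)"
    proof
      fix j assume "j \<in> J"
      then obtain x "is" where j: "j = (x, is)" "x \<in> D" "is \<in> words {..<n x} r" by (auto simp: J_def)
      have U: "openin (base E) (U x)" "frame E (U x) (n x) (s x)" using F j by auto
      have ls: "section_list E (U x) r (map (s x) is)"
        using U j(3) unfolding section_list_def frame_def words_def by auto
      have 1: "continuous_map (subtopology (base E) (U x)) (ttop E r) (\<lambda>y. (y, \<xi> j y))"
      proof (rule continuous_map_eq[OF scaled_continuous[OF simple_tensor_section_continuous[OF ls]]])
        show "continuous_map (subtopology (base E) (U x)) euclidean (\<lambda>y. complex_of_real (\<zeta> x y))"
          using \<zeta> j by (intro continuous_map_complex_of_real continuous_map_from_subtopology) auto
      qed (simp add: \<xi>_def j)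
      have 2: "continuous_map (subtopology (base E) (W x)) (ttop E r) (\<lambda>y. (y, \<xi> j y))"
        by (rule continuous_map_eq[OF zero_section_continuous]) (use W j in \<open>auto simp: \<xi>_def\<close>)
      show "tensor_section E r (\<xi> j)"
        unfolding tensor_section_def
      proof (rule continuous_map_local)
        fix y assume "y \<in> ?X"
        then have "y \<in> U x \<or> y \<in> W x" using W j by blast
        then show "\<exists>V. openin (base E) V \<and> y \<in> V \<and> continuous_map (subtopology (base E) V) (ttop E r) (\<lambda>y. (y, \<xi> j y))"
          using 1 2 U W j by blast
      qed
    qed
    show "\<forall>y\<in>?X. \<forall>\<Phi>\<in>tfib E r y. \<forall>ws. (\<Sum>j\<in>J. tip E r y (\<xi> j y) \<Phi> * \<xi> j y ws) = \<Phi> ws"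
    proof (intro ballI allI)
      fix y \<Phi> ws assume y: "y \<in> ?X" and \<Phi>: "\<Phi> \<in> tfib E r y"
      have "(\<Sum>j\<in>J. tip E r y (\<xi> j y) \<Phi> * \<xi> j y ws) =
         (\<Sum>x\<in>D. \<Sum>is\<in>words {..<n x} r. tip E r y (\<xi> (x, is) y) \<Phi> * \<xi> (x, is) y ws)"
        unfolding J_def using D by (subst sum.Sigma) (auto simp: finite_words case_prod_unfold)
      also have "\<dots> = (\<Sum>x\<in>D. complex_of_real ((\<zeta> x y)\<^sup>2) * \<Phi> ws)"
      proof (rule sum.cong[OF refl])
        fix x assume x: "x \<in> D"
        show "(\<Sum>is\<in>words {..<n x} r. tip E r y (\<xi> (x, is) y) \<Phi> * \<xi> (x, is) y ws) = complex_of_real ((\<zeta> x y)\<^sup>2) * \<Phi> ws"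
        proof (cases "y \<in> U x")
          case True
          have U: "U x \<subseteq> ?X" "frame E (U x) (n x) (s x)" using F x openin_subset by blast+
          have "(\<Sum>is\<in>words {..<n x} r. tip E r y (\<xi> (x, is) y) \<Phi> * \<xi> (x, is) y ws) =
            complex_of_real ((\<zeta> x y)\<^sup>2) *
            (\<Sum>is\<in>words {..<n x} r. tip E r y (simple_tensor E y (eval_secs (map (s x) is) y)) \<Phi> * simple_tensor E y (eval_secs (map (s x) is) y) ws)"
            using True by (simp add: \<xi>_def tip_scl sum_distrib_left power2_eq_square mult_ac)
          then show ?thesis using frame_expand[OF U(2,1) True \<Phi>] by simp
        next
          case False
          then have "\<zeta> x y = 0" using W x y by blast
          then show ?thesis using False by (simp add: \<xi>_def)
        qed
      qed
      also have "\<dots> = complex_of_real (\<Sum>x\<in>D. (\<zeta> x y)\<^sup>2) * \<Phi> ws" by (simp add: sum_distrib_right)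
      also have "\<dots> = \<Phi> ws" using part y by simp
      finally show "(\<Sum>j\<in>J. tip E r y (\<xi> j y) \<Phi> * \<xi> j y ws) = \<Phi> ws" .
    qed
  qed
qed

lemma sq_norm_sum_CS:
  assumes "finite J"
  shows "sq_norm E s x (\<lambda>ws. \<Sum>j\<in>J. c j * \<Psi> j ws) \<le> (\<Sum>j\<in>J. (cmod (c j))\<^sup>2) * (\<Sum>j\<in>J. sq_norm E s x (\<Psi> j))"
proof -
  have "sq_norm E s x (\<lambda>ws. \<Sum>j\<in>J. c j * \<Psi> j ws) \<le>
     (\<Sum>bs\<in>words (chosen_onb E x) s. (\<Sum>j\<in>J. (cmod (c j))\<^sup>2) * (\<Sum>j\<in>J. (cmod (\<Psi> j bs))\<^sup>2))"
    unfolding sq_norm_def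
  proof (rule sum_mono)
    fix bs
    have "cmod (\<Sum>j\<in>J. c j * \<Psi> j bs) \<le> (\<Sum>j\<in>J. \<bar>cmod (c j)\<bar> * \<bar>cmod (\<Psi> j bs)\<bar>)"
      by (rule order_trans[OF norm_sum]) (simp add: norm_mult)
    also have "\<dots> \<le> L2_set (\<lambda>j. cmod (c j)) J * L2_set (\<lambda>j. cmod (\<Psi> j bs)) J" by (rule L2_set_mult_ineq)
    finally have "(cmod (\<Sum>j\<in>J. c j * \<Psi> j bs))\<^sup>2 \<le> (L2_set (\<lambda>j. cmod (c j)) J * L2_set (\<lambda>j. cmod (\<Psi> j bs)) J)\<^sup>2"
      by (intro power_mono) auto
    also have "\<dots> = (\<Sum>j\<in>J. (cmod (c j))\<^sup>2) * (\<Sum>j\<in>J. (cmod (\<Psi> j bs))\<^sup>2)"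
      by (simp add: power_mult_distrib L2_set_def sum_nonneg)
    finally show "(cmod (\<Sum>j\<in>J. c j * \<Psi> j bs))\<^sup>2 \<le> (\<Sum>j\<in>J. (cmod (c j))\<^sup>2) * (\<Sum>j\<in>J. (cmod (\<Psi> j bs))\<^sup>2)" .
  qed
  also have "\<dots> = (\<Sum>j\<in>J. (cmod (c j))\<^sup>2) * (\<Sum>j\<in>J. sq_norm E s x (\<Psi> j))"
    unfolding sq_norm_def sum_distrib_left[symmetric] by (simp add: sum.swap[of _ J])
  finally show ?thesis .
qed

text \<open>For a global frame, $t\Phi = \sum_j \langle \xi_j, \Phi\rangle\, t\xi_j$ and $\sum_j |\langle \xi_j,
  \Phi\rangle|^2 = \lVert\Phi\rVert^2$. By Cauchy--Schwarz it suffices to bound $\sum_j \lVert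
  t\xi_j\rVert^2$, a continuous function on a compact space.\<close>

lemma tmor_bounded:
  assumes t: "t \<in> tmors E r s"
  obtains C where "0 \<le> C"
    "\<And>x \<Phi>. x \<in> topspace (base E) \<Longrightarrow> \<Phi> \<in> tfib E r x \<Longrightarrow> sq_norm E s x (act t x \<Phi>) \<le> C * sq_norm E r x \<Phi>"
proof -
  obtain J :: "('x \<times> nat list) set" and \<xi> where J: "finite J" and \<xi>: "\<forall>j\<in>J. tensor_section E r (\<xi> j)"
    and ex: "\<forall>y\<in>topspace (base E). \<forall>\<Phi>\<in>tfib E r y. \<forall>ws. (\<Sum>j\<in>J. tip E r y (\<xi> j y) \<Phi> * \<xi> j y ws) = \<Phi> ws"
    by (rule global_frame)
  have "continuous_map (base E) euclideanreal (\<lambda>x. \<Sum>j\<in>J. sq_norm E s x (act t x (\<xi> j x)))"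
    using \<xi> tensor_section_sq_norm[OF tensor_section_act[OF t]] by (intro continuous_map_sum J) blast
  then obtain C where C: "C > 0" "\<forall>x\<in>topspace (base E). \<bar>\<Sum>j\<in>J. sq_norm E s x (act t x (\<xi> j x))\<bar> \<le> C"
    by (rule continuous_bounded[OF compact_base])
  show ?thesis
  proof (rule that[of C])
    show "0 \<le> C" using C by simp
    fix x \<Phi> assume x: "x \<in> topspace (base E)" and \<Phi>: "\<Phi> \<in> tfib E r x"
    let ?c = "\<lambda>j. tip E r x (\<xi> j x) \<Phi>"
    have e: "\<Phi> = (\<lambda>ws. \<Sum>j\<in>J. ?c j * \<xi> j x ws)" using ex x \<Phi> by simp
    have "act t x \<Phi> = act t x (\<lambda>ws. \<Sum>j\<in>J. ?c j * \<xi> j x ws)" by (rule arg_cong[OF e])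
    also have "\<dots> = (\<lambda>ws. \<Sum>j\<in>J. ?c j * act t x (\<xi> j x) ws)"
      using \<xi> tensor_section_tfib x by (intro tlinear_sum[OF tmor_tlinear[OF t x] J]) blast
    finally have 1: "sq_norm E s x (act t x \<Phi>) \<le> (\<Sum>j\<in>J. (cmod (?c j))\<^sup>2) * (\<Sum>j\<in>J. sq_norm E s x (act t x (\<xi> j x)))"
      using sq_norm_sum_CS[OF J] by simp
    have "complex_of_real (sq_norm E r x \<Phi>) = tip E r x \<Phi> (\<lambda>ws. \<Sum>j\<in>J. ?c j * \<xi> j x ws)"
      unfolding tip_sq_norm[symmetric] by (rule arg_cong[OF e])
    also have "\<dots> = (\<Sum>j\<in>J. ?c j * tip E r x \<Phi> (\<xi> j x))" by (rule tip_sum_right)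
    also have "\<dots> = complex_of_real (\<Sum>j\<in>J. (cmod (?c j))\<^sup>2)"
      unfolding of_real_sum using tip_cnj by (intro sum.cong refl) (metis complex_norm_square)
    finally have 2: "sq_norm E r x \<Phi> = (\<Sum>j\<in>J. (cmod (?c j))\<^sup>2)" by (simp only: of_real_eq_iff)
    show "sq_norm E s x (act t x \<Phi>) \<le> C * sq_norm E r x \<Phi>"
    proof (rule order_trans[OF 1])
      have "(\<Sum>j\<in>J. sq_norm E s x (act t x (\<xi> j x))) \<le> C" using C x by fastforce
      then show "(\<Sum>j\<in>J. (cmod (?c j))\<^sup>2) * (\<Sum>j\<in>J. sq_norm E s x (act t x (\<xi> j x))) \<le> C * sq_norm E r x \<Phi>"
        unfolding 2 by (subst mult.commute[of C]) (intro mult_left_mono sum_nonneg, auto)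
    qed
  qed
qed

lemma tail_bounded_exists:
  assumes "a \<in> tmats E"
  shows "\<exists>c. tail_bounded E a c"
  using assms
proof (induction a rule: tmats_decompose)
  case (rel a b) then show ?case using tail_bounded_rel by blast
next
  case (add a b) then show ?case using tail_bounded_add by blast
next
  case (core_embed r s t)
  then obtain C where "0 \<le> C" "\<And>x \<Phi>. x \<in> topspace (base E) \<Longrightarrow> \<Phi> \<in> tfib E r x \<Longrightarrow> sq_norm E s x (act t x \<Phi>) \<le> C * sq_norm E r x \<Phi>"
    using tmor_bounded by blast
  then show ?case using tail_bounded_core_embed[OF core_embed] by blast
qed

lemma section_mor_tmor:
  assumes f: "tensor_section E r f"
  shows "section_mor E f \<in> tmors E 0 r"
  unfolding section_mor_def
proof (rule tmorI_cont)
  fix x assume "x \<in> topspace (base E)"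
  then show "tlinear E 0 r x (\<lambda>\<Phi> ws. \<Phi> [] * f x ws)"
    using tensor_section_tfib[OF f] by (auto simp: tlinear_def tfib_scl algebra_simps)
next
  have "continuous_map (ttop E 0) (ttop E r) (\<lambda>v. (fst v, f (fst v)))"
    using continuous_map_compose[OF fst_continuous f[unfolded tensor_section_def]] by (simp add: o_def)
  moreover have "continuous_map (ttop E 0) euclidean (\<lambda>v. snd v [])"
  proof -
    have l: "section_list E (topspace (base E)) 0 []" by (simp add: section_list_def)
    have "subtopology (ttop E 0) {v \<in> topspace (ttop E 0). fst v \<in> topspace (base E)} = ttop E 0"
      by (rule subtopology_superset) (auto simp: topspace_ttop)
    then show ?thesis using coef_continuous[OF l] by simp
  qed
  ultimately show "continuous_map (ttop E 0) (ttop E r) (\<lambda>v. (fst v, \<lambda>ws. snd v [] * f (fst v) ws))"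
    by (rule scaled_continuous)
qed

lemma function_mor_tmor:
  assumes h: "continuous_map (base E) euclidean h"
  shows "function_mor E h \<in> tmors E 0 0"
  unfolding function_mor_def
proof (rule tmorI_cont)
  show "tlinear E 0 0 x (\<lambda>\<Phi> ws. h x * \<Phi> ws)" for x
    by (auto simp: tlinear_def tfib_scl distrib_left mult.left_commute)
  have "continuous_map (ttop E 0) euclidean (\<lambda>v. h (fst v))"
    using continuous_map_compose[OF fst_continuous h] by (simp add: o_def)
  then show "continuous_map (ttop E 0) (ttop E 0) (\<lambda>v. (fst v, \<lambda>ws. h (fst v) * snd v ws))"
    by (intro scaled_continuous) simp_all
qed

lemma act_section_mor: "x \<in> topspace (base E) \<Longrightarrow> \<Phi> \<in> tfib E 0 x \<Longrightarrow> act (section_mor E f) x \<Phi> = (\<lambda>ws. \<Phi> [] * f x ws)"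
  by (simp add: section_mor_def)

lemma act_function_mor: "x \<in> topspace (base E) \<Longrightarrow> \<Phi> \<in> tfib E 0 x \<Longrightarrow> act (function_mor E h) x \<Phi> = (\<lambda>ws. h x * \<Phi> ws)"
  by (simp add: function_mor_def)

lemma tfib0: "\<Phi> \<in> tfib E 0 x \<longleftrightarrow> (\<forall>ws. ws \<noteq> [] \<longrightarrow> \<Phi> ws = 0)"
  by (auto simp: tfib_def)

lemma tip0: "tip E 0 x \<Phi> \<Psi> = cnj (\<Phi> []) * \<Psi> []"
  by (simp add: tip_words)

lemma act_section_mor_adj:
  assumes f: "tensor_section E r f" and x: "x \<in> topspace (base E)" and \<Psi>: "\<Psi> \<in> tfib E r x"
  shows "act (madj (tpow E 0) (tpow E r) (section_mor E f)) x \<Psi> = (\<lambda>ws. if ws = [] then tip E r x (f x) \<Psi> else 0)"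
proof (rule tip_eqI[OF x])
  show "act (madj (tpow E 0) (tpow E r) (section_mor E f)) x \<Psi> \<in> tfib E 0 x"
    by (rule act_tfib[OF madj_tmor[OF section_mor_tmor[OF f]] x \<Psi>])
  show "(\<lambda>ws. if ws = [] then tip E r x (f x) \<Psi> else 0) \<in> tfib E 0 x" by (simp add: tfib0)
  fix \<Phi> assume \<Phi>: "\<Phi> \<in> tfib E 0 x"
  show "tip E 0 x \<Phi> (act (madj (tpow E 0) (tpow E r) (section_mor E f)) x \<Psi>) =
      tip E 0 x \<Phi> (\<lambda>ws. if ws = [] then tip E r x (f x) \<Psi> else 0)"
    unfolding tip_madj[OF section_mor_tmor[OF f] x \<Phi> \<Psi>] act_section_mor[OF x \<Phi>] tip_scl by (simp add: tip0)
qed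

text \<open>The square of the \<open>C\<^sup>*\<close>-norm of a section is the norm of a continuous function.\<close>

lemma section_mor_gram:
  assumes f: "tensor_section E r f"
  shows "mcomp (tpow E 0) (madj (tpow E 0) (tpow E r) (section_mor E f)) (section_mor E f) =
     function_mor E (\<lambda>x. complex_of_real (sq_norm E r x (f x)))"
proof (rule tmor_eqI[OF mcomp_tmor[OF section_mor_tmor[OF f] madj_tmor[OF section_mor_tmor[OF f]]]])
  show "function_mor E (\<lambda>x. complex_of_real (sq_norm E r x (f x))) \<in> tmors E 0 0"
    by (intro function_mor_tmor continuous_map_complex_of_real tensor_section_sq_norm f)
  fix x \<Phi> assume x: "x \<in> topspace (base E)" "\<Phi> \<in> tfib E 0 x"
  show "act (mcomp (tpow E 0) (madj (tpow E 0) (tpow E r) (section_mor E f)) (section_mor E f)) x \<Phi> =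
        act (function_mor E (\<lambda>x. complex_of_real (sq_norm E r x (f x)))) x \<Phi>"
    unfolding act_mcomp[OF section_mor_tmor[OF f] madj_tmor[OF section_mor_tmor[OF f]] x] act_section_mor[OF x] act_function_mor[OF x]
      act_section_mor_adj[OF f x(1) tfib_scl[OF tensor_section_tfib[OF f x(1)]]] tip_scl tip_sq_norm
    using x(2) by (auto simp: tfib0 fun_eq_iff)
qed

text \<open>$t = \sum_j (t\xi_j)\,\xi_j^*$, by the reconstruction formula of the frame.\<close>

lemma tmor_frame_sum:
  assumes t: "t \<in> tmors E r s" and J: "finite J" and \<xi>: "\<forall>j\<in>J. tensor_section E r (\<xi> j)"
    and ex: "\<forall>y\<in>topspace (base E). \<forall>\<Phi>\<in>tfib E r y. \<forall>ws. (\<Sum>j\<in>J. tip E r y (\<xi> j y) \<Phi> * \<xi> j y ws) = \<Phi> ws"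
  shows "t = mor_sum E r J (\<lambda>j. mcomp (tpow E r) (section_mor E (\<lambda>x. act t x (\<xi> j x))) (madj (tpow E 0) (tpow E r) (section_mor E (\<xi> j))))"
    (is "t = mor_sum E r J ?f")
proof (rule tmor_eqI[OF t])
  have ts: "tensor_section E s (\<lambda>x. act t x (\<xi> j x))" if "j \<in> J" for j using \<xi> that by (intro tensor_section_act[OF t]) blast
  have f: "?f j \<in> tmors E r s" if "j \<in> J" for j
    using \<xi> that by (intro mcomp_tmor[OF madj_tmor[OF section_mor_tmor] section_mor_tmor[OF ts[OF that]]]) blast
  show "mor_sum E r J ?f \<in> tmors E r s" by (rule mor_sum_tmor[OF J f])
  fix x \<Phi> assume x: "x \<in> topspace (base E)" and \<Phi>: "\<Phi> \<in> tfib E r x"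
  have a: "act (?f j) x \<Phi> = (\<lambda>ws. tip E r x (\<xi> j x) \<Phi> * act t x (\<xi> j x) ws)" if j: "j \<in> J" for j
  proof -
    have sj: "tensor_section E r (\<xi> j)" using \<xi> j by blast
    show ?thesis
      unfolding act_mcomp[OF madj_tmor[OF section_mor_tmor[OF sj]] section_mor_tmor[OF ts[OF j]] x \<Phi>] act_section_mor_adj[OF sj x \<Phi>]
      by (subst act_section_mor[OF x]) (simp_all add: tfib0)
  qed
  have "act t x \<Phi> = act t x (\<lambda>ws. \<Sum>j\<in>J. tip E r x (\<xi> j x) \<Phi> * \<xi> j x ws)" using ex x \<Phi> by simp
  also have "\<dots> = (\<lambda>ws. \<Sum>j\<in>J. tip E r x (\<xi> j x) \<Phi> * act t x (\<xi> j x) ws)"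
    using \<xi> tensor_section_tfib x by (intro tlinear_sum[OF tmor_tlinear[OF t x] J]) blast
  also have "\<dots> = act (mor_sum E r J ?f) x \<Phi>" unfolding act_mor_sum[OF x \<Phi>] using a by simp
  finally show "act t x \<Phi> = act (mor_sum E r J ?f) x \<Phi>" .
qed

end

section \<open>The norm of the Cuntz--Pimsner algebra\<close>

text \<open>The operator norm at infinity. All representatives of a class admit the same bounds
  (\<open>tail_bounded_rel\<close>).\<close>

definition op_norm :: "('e, 'x) vbundle \<Rightarrow> ('e, 'x) cpcore \<Rightarrow> real" where
  "op_norm E X = Inf {c. \<exists>a\<in>tmats E. X = core_class E a \<and> tail_bounded E a c}"

lemma le_mult_limit:
  fixes b k x :: real
  assumes "\<And>c. b < c \<Longrightarrow> x \<le> k * c" "0 \<le> k"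
  shows "x \<le> k * b"
proof (cases "k = 0")
  case True then show ?thesis using assms(1)[of "b + 1"] by simp
next
  case False
  then have k: "0 < k" using assms(2) by simp
  have "x / k \<le> b"
  proof (rule dense_ge)
    fix c assume "b < c"
    then show "x / k \<le> c" using assms(1)[of c] k by (simp add: divide_le_eq mult.commute)
  qed
  then show ?thesis using k by (simp add: divide_le_eq mult.commute)
qed

context framed_bundle
begin

lemma tail_bounded_mono: "tail_bounded E a c \<Longrightarrow> c \<le> c' \<Longrightarrow> tail_bounded E a c'"
  unfolding tail_bounded_def using tail_bounded_from_mono[OF _ order_refl] by fastforce

lemma op_norm_core_class:
  assumes a: "a \<in> tmats E"
  shows "op_norm E (core_class E a) = Inf {c. tail_bounded E a c}"
proof -
  have "(\<exists>b\<in>tmats E. core_class E a = core_class E b \<and> tail_bounded E b c) \<longleftrightarrow> tail_bounded E a c" for c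
  proof
    assume "\<exists>b\<in>tmats E. core_class E a = core_class E b \<and> tail_bounded E b c"
    then obtain b where b: "b \<in> tmats E" "core_class E b = core_class E a" "tail_bounded E b c" by auto
    then have "(b, a) \<in> tmat_rel E" using core_class_eq_iff[OF b(1) a] by simp
    then show "tail_bounded E a c" using tail_bounded_rel b(3) by blast
  qed (use a in blast)
  then show ?thesis unfolding op_norm_def by simp
qed

lemma op_norm_le: "a \<in> tmats E \<Longrightarrow> tail_bounded E a c \<Longrightarrow> op_norm E (core_class E a) \<le> c"
  unfolding op_norm_core_class by (rule cInf_lower) (auto simp: bdd_below_def tail_bounded_def intro: exI[of _ 0])

lemma op_norm_nonneg: "a \<in> tmats E \<Longrightarrow> 0 \<le> op_norm E (core_class E a)"
  unfolding op_norm_core_class using tail_bounded_exists by (intro cInf_greatest) (auto simp: tail_bounded_def)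

text \<open>The infimum need not be attained, as the tail on which a bound holds may depend on the bound.\<close>

lemma op_norm_tail_bounded:
  assumes a: "a \<in> tmats E" and c: "op_norm E (core_class E a) < c"
  shows "tail_bounded E a c"
proof -
  obtain c' where "c' \<in> {c. tail_bounded E a c}" "c' < c"
    using cInf_lessD[of "{c. tail_bounded E a c}" c] tail_bounded_exists[OF a] c unfolding op_norm_core_class[OF a] by blast
  then show ?thesis using tail_bounded_mono[of a c' c] by simp
qed

lemma op_norm_scl_le:
  assumes a: "a \<in> tmats E"
  shows "op_norm E (core_class E (tscl E k a)) \<le> cmod k * op_norm E (core_class E a)"
proof (rule le_mult_limit)
  fix c assume "op_norm E (core_class E a) < c"
  then show "op_norm E (core_class E (tscl E k a)) \<le> cmod k * c"
    using op_norm_le[OF tscl_tmats[OF a] tail_bounded_scl[OF a op_norm_tail_bounded[OF a]]] by blast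
qed simp

lemma op_norm_add:
  assumes a: "a \<in> tmats E" and b: "b \<in> tmats E"
  shows "op_norm E (core_class E (tadd E a b)) \<le> op_norm E (core_class E a) + op_norm E (core_class E b)"
proof (rule field_le_epsilon)
  fix e :: real assume "0 < e"
  then have "tail_bounded E a (op_norm E (core_class E a) + e / 2)" "tail_bounded E b (op_norm E (core_class E b) + e / 2)"
    by (intro op_norm_tail_bounded a b; simp)+
  from op_norm_le[OF tadd_tmats[OF a b] tail_bounded_add[OF a b this]]
  show "op_norm E (core_class E (tadd E a b)) \<le> op_norm E (core_class E a) + op_norm E (core_class E b) + e" by simp
qed

lemma op_norm_mult:
  assumes a: "a \<in> tmats E" and b: "b \<in> tmats E"
  shows "op_norm E (core_class E (tmat_mult E a b)) \<le> op_norm E (core_class E a) * op_norm E (core_class E b)"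
proof (rule le_mult_limit[OF _ op_norm_nonneg[OF a]])
  fix c assume c: "op_norm E (core_class E b) < c"
  have c0: "0 \<le> c" using op_norm_nonneg[OF b] c by simp
  have "op_norm E (core_class E (tmat_mult E a b)) \<le> c * op_norm E (core_class E a)"
  proof (rule le_mult_limit[OF _ c0])
    fix d assume d: "op_norm E (core_class E a) < d"
    show "op_norm E (core_class E (tmat_mult E a b)) \<le> c * d"
      using op_norm_le[OF tmat_mult_tmats[OF a b] tail_bounded_mult[OF a b op_norm_tail_bounded[OF a d] op_norm_tail_bounded[OF b c]]]
      by (simp add: mult.commute)
  qed
  then show "op_norm E (core_class E (tmat_mult E a b)) \<le> op_norm E (core_class E a) * c" by (simp add: mult.commute)
qed

lemma op_norm_star:
  assumes a: "a \<in> tmats E"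
  shows "op_norm E (core_class E (tstar E a)) \<le> op_norm E (core_class E a)"
proof (rule dense_ge)
  fix c assume "op_norm E (core_class E a) < c"
  then show "op_norm E (core_class E (tstar E a)) \<le> c"
    using op_norm_le[OF tstar_tmats[OF a] tail_bounded_star[OF a op_norm_tail_bounded[OF a]]] by blast
qed

lemma op_norm_cstar:
  assumes a: "a \<in> tmats E"
  shows "op_norm E (core_class E (tmat_mult E (tstar E a) a)) = (op_norm E (core_class E a))\<^sup>2"
proof (rule antisym)
  have "op_norm E (core_class E (tmat_mult E (tstar E a) a)) \<le> op_norm E (core_class E (tstar E a)) * op_norm E (core_class E a)"
    by (rule op_norm_mult[OF tstar_tmats[OF a] a])
  also have "\<dots> \<le> op_norm E (core_class E a) * op_norm E (core_class E a)"
    by (rule mult_right_mono[OF op_norm_star[OF a] op_norm_nonneg[OF a]])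
  finally show "op_norm E (core_class E (tmat_mult E (tstar E a) a)) \<le> (op_norm E (core_class E a))\<^sup>2"
    by (simp add: power2_eq_square)
  show "(op_norm E (core_class E a))\<^sup>2 \<le> op_norm E (core_class E (tmat_mult E (tstar E a) a))"
  proof (rule dense_ge)
    fix c assume c: "op_norm E (core_class E (tmat_mult E (tstar E a) a)) < c"
    have aa: "tmat_mult E (tstar E a) a \<in> tmats E" by (rule tmat_mult_tmats[OF tstar_tmats[OF a] a])
    have "0 \<le> c" using op_norm_nonneg[OF aa] c by simp
    have "op_norm E (core_class E a) \<le> sqrt c"
      by (rule op_norm_le[OF a tail_bounded_cstar[OF a op_norm_tail_bounded[OF aa c]]])
    then have "(op_norm E (core_class E a))\<^sup>2 \<le> (sqrt c)\<^sup>2"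
      using op_norm_nonneg[OF a] by (rule power_mono)
    then show "(op_norm E (core_class E a))\<^sup>2 \<le> c" using \<open>0 \<le> c\<close> by simp
  qed
qed

lemma op_norm_circ_le:
  assumes a: "a \<in> tmats E" and z: "cmod z = 1"
  shows "op_norm E (core_class E (tcirc E z a)) \<le> op_norm E (core_class E a)"
proof (rule dense_ge)
  fix c assume "op_norm E (core_class E a) < c"
  then show "op_norm E (core_class E (tcirc E z a)) \<le> c"
    using op_norm_le[OF tcirc_tmats[OF a] tail_bounded_circ[OF a op_norm_tail_bounded[OF a] z]] by blast
qed

lemma tscl_tscl: "a \<in> tmats E \<Longrightarrow> tscl E c (tscl E d a) = tscl E (c * d) a"
  by (rule tmat_eqI) (simp_all add: tscl_tmats act_tscl)

lemma tscl_1: "a \<in> tmats E \<Longrightarrow> tscl E 1 a = a"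
  by (rule tmat_eqI) (simp_all add: tscl_tmats act_tscl)

lemma tcirc_inverse: "a \<in> tmats E \<Longrightarrow> z \<noteq> 0 \<Longrightarrow> tcirc E (inverse z) (tcirc E z a) = a"
  by (rule tmat_eqI) (simp_all add: tcirc_tmats act_tcirc power_int_inverse)

text \<open>If all positive constants are bounds on some tail, then all entries from the stable row on vanish.
  The successor of the stable row avoids the row of the scalars.\<close>

lemma op_norm_zero:
  assumes a: "a \<in> tmats E"
  shows "op_norm E (core_class E a) = 0 \<longleftrightarrow> core_class E a = core_class E (tscl E 0 a)"
proof
  assume "core_class E a = core_class E (tscl E 0 a)"
  then show "op_norm E (core_class E a) = 0"
    using op_norm_scl_le[OF a, of 0] op_norm_nonneg[OF a] by simp
next
  assume z: "op_norm E (core_class E a) = 0"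
  obtain S where S: "stable E S a" using a by (auto simp: tmats_iff)
  have "(a, tscl E 0 a) \<in> tmat_rel E"
  proof (rule tmat_relI[OF a tscl_tmats[OF a], of "Suc S"])
    fix n m assume n: "Suc S \<le> n"
    show "a n m = tscl E 0 a n m"
    proof (rule tmor_eqI[OF tmats_tmor[OF a] tmats_tmor[OF tscl_tmats[OF a]]])
      fix x \<Phi> assume x: "x \<in> topspace (base E)" and \<Phi>: "\<Phi> \<in> tfib E n x"
      have "sqrt (sq_norm E m x (act (a n m) x \<Phi>)) \<le> sqrt (sq_norm E n x \<Phi>) * 0"
      proof (rule le_mult_limit)
        fix c :: real assume "0 < c"
        then have "tail_bounded E a c" using op_norm_tail_bounded[OF a] z by simp
        then obtain N where N: "tail_bounded_from E N a c" by (auto simp: tail_bounded_def)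
        show "sqrt (sq_norm E m x (act (a n m) x \<Phi>)) \<le> sqrt (sq_norm E n x \<Phi>) * c"
          using tail_bounded_lower[OF a N S _ _ x \<Phi>, of m] n by (simp add: mult.commute)
      qed simp
      then have "sq_norm E m x (act (a n m) x \<Phi>) = 0" using sq_norm_nonneg[of E m x "act (a n m) x \<Phi>"] by simp
      then have "act (a n m) x \<Phi> = (\<lambda>_. 0)"
        using tip_zero_imp[OF x act_fib[OF a x \<Phi>]] by (simp add: tip_sq_norm)
      then show "act (a n m) x \<Phi> = act (tscl E 0 a n m) x \<Phi>" by (simp add: act_tscl[OF a x \<Phi>])
    qed
  qed
  then show "core_class E a = core_class E (tscl E 0 a)" using core_class_eq_iff[OF a tscl_tmats[OF a]] by blast
qed

lemma ball_car: "(\<forall>X\<in>car (cp_core E). Q X) \<longleftrightarrow> (\<forall>a\<in>tmats E. Q (core_class E a))"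
  using core_class_car carE by blast

lemma circle_norms_iff:
  "p \<in> circle_norms E \<longleftrightarrow>
     (\<forall>a\<in>tmats E. 0 \<le> p (core_class E a)) \<and>
     (\<forall>a\<in>tmats E. p (core_class E a) = 0 \<longleftrightarrow> core_class E a = core_class E (tscl E 0 a)) \<and>
     (\<forall>a\<in>tmats E. \<forall>b\<in>tmats E. p (core_class E (tadd E a b)) \<le> p (core_class E a) + p (core_class E b)) \<and>
     (\<forall>a\<in>tmats E. \<forall>c. p (core_class E (tscl E c a)) = cmod c * p (core_class E a)) \<and>
     (\<forall>a\<in>tmats E. \<forall>b\<in>tmats E. p (core_class E (tmat_mult E a b)) \<le> p (core_class E a) * p (core_class E b)) \<and>
     (\<forall>a\<in>tmats E. p (core_class E (tmat_mult E (tstar E a) a)) = (p (core_class E a))\<^sup>2) \<and>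
     (\<forall>z. cmod z = 1 \<longrightarrow> (\<forall>a\<in>tmats E. p (core_class E (tcirc E z a)) = p (core_class E a)))"
  unfolding circle_norms_def cstar_norm_def mem_Collect_eq ball_car
  by (simp add: core_class_ops tmats_closed)

text \<open>The family of norms is not empty; for boundedness of the supremum see
  \<open>circle_norm_bounded\<close>.\<close>

lemma op_norm_circle_norms: "op_norm E \<in> circle_norms E"
  unfolding circle_norms_iff
proof (intro conjI ballI allI impI)
  fix a c assume a: "a \<in> tmats E"
  show "op_norm E (core_class E (tscl E c a)) = cmod c * op_norm E (core_class E a)"
  proof (cases "c = 0")
    case True
    then show ?thesis
      using op_norm_scl_le[OF a, of c] op_norm_nonneg[OF tscl_tmats[OF a], of c] by simp
  next
    case False
    have "op_norm E (core_class E a) \<le> cmod (1 / c) * op_norm E (core_class E (tscl E c a))"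
      using op_norm_scl_le[OF tscl_tmats[OF a], of "1 / c" c] False by (simp add: tscl_tscl[OF a] tscl_1[OF a])
    then have "cmod c * op_norm E (core_class E a) \<le> op_norm E (core_class E (tscl E c a))"
      using False by (simp add: norm_divide field_simps)
    then show ?thesis using op_norm_scl_le[OF a, of c] by simp
  qed
next
  fix z a assume z: "cmod z = 1" and a: "a \<in> tmats E"
  have "cmod (inverse z) = 1" "z \<noteq> 0" using z by (auto simp: norm_inverse)
  then show "op_norm E (core_class E (tcirc E z a)) = op_norm E (core_class E a)"
    using op_norm_circ_le[OF a z] op_norm_circ_le[OF tcirc_tmats[OF a], of "inverse z" z] tcirc_inverse[OF a, of z]
    by simp
qed (simp_all add: op_norm_nonneg op_norm_zero op_norm_add op_norm_mult op_norm_cstar)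

lemma circle_norm_nonneg: "p \<in> circle_norms E \<Longrightarrow> a \<in> tmats E \<Longrightarrow> 0 \<le> p (core_class E a)"
  and circle_norm_zero: "p \<in> circle_norms E \<Longrightarrow> a \<in> tmats E \<Longrightarrow> p (core_class E a) = 0 \<longleftrightarrow> core_class E a = core_class E (tscl E 0 a)"
  and circle_norm_add: "p \<in> circle_norms E \<Longrightarrow> a \<in> tmats E \<Longrightarrow> b \<in> tmats E \<Longrightarrow> p (core_class E (tadd E a b)) \<le> p (core_class E a) + p (core_class E b)"
  and circle_norm_scl: "p \<in> circle_norms E \<Longrightarrow> a \<in> tmats E \<Longrightarrow> p (core_class E (tscl E c a)) = cmod c * p (core_class E a)"
  and circle_norm_mult: "p \<in> circle_norms E \<Longrightarrow> a \<in> tmats E \<Longrightarrow> b \<in> tmats E \<Longrightarrow> p (core_class E (tmat_mult E a b)) \<le> p (core_class E a) * p (core_class E b)"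
  and circle_norm_cstar: "p \<in> circle_norms E \<Longrightarrow> a \<in> tmats E \<Longrightarrow> p (core_class E (tmat_mult E (tstar E a) a)) = (p (core_class E a))\<^sup>2"
  and circle_norm_circ: "p \<in> circle_norms E \<Longrightarrow> cmod z = 1 \<Longrightarrow> a \<in> tmats E \<Longrightarrow> p (core_class E (tcirc E z a)) = p (core_class E a)"
  unfolding circle_norms_iff by blast+

text \<open>$p(a)^2 = p(a^* a) \le p(a^*)\,p(a)$.\<close>

lemma circle_norm_star_le:
  assumes p: "p \<in> circle_norms E" and a: "a \<in> tmats E"
  shows "p (core_class E a) \<le> p (core_class E (tstar E a))"
proof (cases "p (core_class E a) = 0")
  case True then show ?thesis using circle_norm_nonneg[OF p tstar_tmats[OF a]] by simp
next
  case False
  then have pos: "0 < p (core_class E a)" using circle_norm_nonneg[OF p a] by simp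
  have "p (core_class E a) * p (core_class E a) \<le> p (core_class E (tstar E a)) * p (core_class E a)"
    using circle_norm_cstar[OF p a] circle_norm_mult[OF p tstar_tmats[OF a] a] by (simp add: power2_eq_square)
  then show ?thesis using pos by simp
qed

lemma circle_norm_star:
  assumes p: "p \<in> circle_norms E" and a: "a \<in> tmats E"
  shows "p (core_class E (tstar E a)) = p (core_class E a)"
  using circle_norm_star_le[OF p a] circle_norm_star_le[OF p tstar_tmats[OF a]] tstar_tstar[OF a] by simp

section \<open>Boundedness of the norms\<close>

lemma amplify_iter_madj:
  assumes t: "t \<in> tmors E r s"
  shows "amplify_iter E s r j (madj (tpow E r) (tpow E s) t) = madj (tpow E (r + j)) (tpow E (s + j)) (amplify_iter E r s j t)"
  by (induction j) (simp_all add: amplify_madj[OF amplify_iter_tmor[OF t]])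

lemma amplify_iter_mcomp:
  assumes "t \<in> tmors E r s" "t' \<in> tmors E s q"
  shows "amplify_iter E r q j (mcomp (tpow E r) t' t) = mcomp (tpow E (r + j)) (amplify_iter E s q j t') (amplify_iter E r s j t)"
  by (induction j) (simp_all add: amplify_mcomp[OF amplify_iter_tmor[OF assms(1)] amplify_iter_tmor[OF assms(2)]])

lemma amplify_iter_madd:
  assumes "t \<in> tmors E r s" "t' \<in> tmors E r s"
  shows "amplify_iter E r s j (madd (tpow E r) (tpow E s) t t') =
    madd (tpow E (r + j)) (tpow E (s + j)) (amplify_iter E r s j t) (amplify_iter E r s j t')"
  by (induction j) (simp_all add: amplify_madd[OF amplify_iter_tmor[OF assms(1)] amplify_iter_tmor[OF assms(2)]])

lemma amplify_iter_mscl: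
  assumes "t \<in> tmors E r s"
  shows "amplify_iter E r s j (mscl (tpow E r) (tpow E s) c t) =
    mscl (tpow E (r + j)) (tpow E (s + j)) c (amplify_iter E r s j t)"
  by (induction j) (simp_all add: amplify_mscl[OF amplify_iter_tmor[OF assms(1)]])

lemma core_embed_diag: "core_embed E r s t (r + j) (s + j) = amplify_iter E r s j t"
  by (simp add: core_embed_def)

lemma core_embed_off: "\<not> (\<exists>j. n = r + j \<and> m = s + j) \<Longrightarrow> core_embed E r s t n m = tzero E n"
  unfolding core_embed_def using le_add_diff_inverse by (metis (no_types, lifting))

lemma core_embed_star:
  assumes t: "t \<in> tmors E r s"
  shows "tstar E (core_embed E r s t) = core_embed E s r (madj (tpow E r) (tpow E s) t)"
proof (intro ext)
  fix n m v
  have "tstar E (core_embed E r s t) n m = core_embed E s r (madj (tpow E r) (tpow E s) t) n m"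
  proof (cases "\<exists>j. n = s + j \<and> m = r + j")
    case True
    then show ?thesis by (auto simp: tstar_def core_embed_diag amplify_iter_madj[OF t])
  next
    case False
    then have "core_embed E r s t m n = tzero E m" by (intro core_embed_off) auto
    then show ?thesis using core_embed_off[OF False] by (simp add: tstar_def madj_tzero)
  qed
  then show "tstar E (core_embed E r s t) n m v = core_embed E s r (madj (tpow E r) (tpow E s) t) n m v" by simp
qed

lemma core_embed_add:
  assumes t: "t \<in> tmors E r s" "t' \<in> tmors E r s"
  shows "tadd E (core_embed E r s t) (core_embed E r s t') = core_embed E r s (madd (tpow E r) (tpow E s) t t')"
proof (intro ext)
  fix n m v
  have "tadd E (core_embed E r s t) (core_embed E r s t') n m = core_embed E r s (madd (tpow E r) (tpow E s) t t') n m"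
  proof (cases "\<exists>j. n = r + j \<and> m = s + j")
    case True
    then show ?thesis by (auto simp: tadd_def core_embed_diag amplify_iter_madd[OF t])
  next
    case False
    then show ?thesis using core_embed_off[OF False] by (simp add: tadd_def madd_tzero)
  qed
  then show "tadd E (core_embed E r s t) (core_embed E r s t') n m v = core_embed E r s (madd (tpow E r) (tpow E s) t t') n m v" by simp
qed

lemma core_embed_scl:
  assumes t: "t \<in> tmors E r s"
  shows "tscl E c (core_embed E r s t) = core_embed E r s (mscl (tpow E r) (tpow E s) c t)"
proof (intro ext)
  fix n m v
  have "tscl E c (core_embed E r s t) n m = core_embed E r s (mscl (tpow E r) (tpow E s) c t) n m"
  proof (cases "\<exists>j. n = r + j \<and> m = s + j")
    case True
    then show ?thesis by (auto simp: tscl_def core_embed_diag amplify_iter_mscl[OF t])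
  next
    case False
    then show ?thesis using core_embed_off[OF False] by (simp add: tscl_def mscl_tzero)
  qed
  then show "tscl E c (core_embed E r s t) n m v = core_embed E r s (mscl (tpow E r) (tpow E s) c t) n m v" by simp
qed

lemma core_embed_comp:
  assumes t: "t \<in> tmors E r s" and t': "t' \<in> tmors E s q"
  shows "(tmat_mult E (core_embed E s q t') (core_embed E r s t), core_embed E r q (mcomp (tpow E r) t' t)) \<in> tmat_rel E"
proof (rule tmat_relI[of _ _ _ r])
  show "tmat_mult E (core_embed E s q t') (core_embed E r s t) \<in> tmats E" by (intro tmat_mult_tmats core_embed_tmats t t')
  show "core_embed E r q (mcomp (tpow E r) t' t) \<in> tmats E" by (rule core_embed_tmats[OF mcomp_tmor[OF t t']])
  fix n m assume "r \<le> n"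
  then obtain j where n: "n = r + j" using le_Suc_ex by blast
  let ?l = "s + j"
  have "l \<in> {?l}" if "core_embed E r s t n l \<noteq> tzero E n" for l
    using core_embed_off[of n r l s t] that n by auto
  then have "tmat_mult E (core_embed E s q t') (core_embed E r s t) n m = mor_sum E n {?l} (\<lambda>l. mcomp (tpow E n) (core_embed E s q t' l m) (core_embed E r s t n l))"
    by (intro tmat_mult_mor_sum core_embed_tmats t t') auto
  also have "\<dots> = mcomp (tpow E n) (core_embed E s q t' ?l m) (core_embed E r s t n ?l)"
    unfolding mor_sum_def using tmor_tmor_of[OF mcomp_tmor[OF tmats_tmor[OF core_embed_tmats[OF t]] tmats_tmor[OF core_embed_tmats[OF t']]]] by simp
  also have "\<dots> = core_embed E r q (mcomp (tpow E r) t' t) n m"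
  proof (cases "m = q + j")
    case True
    then show ?thesis by (simp add: n core_embed_diag amplify_iter_mcomp[OF t t'])
  next
    case False
    have a: "amplify_iter E r s j t \<in> tmors E (r + j) (s + j)" by (rule amplify_iter_tmor[OF t])
    have "core_embed E s q t' ?l m = tzero E ?l" "core_embed E r q (mcomp (tpow E r) t' t) n m = tzero E n"
      using False n by (auto intro!: core_embed_off)
    moreover have "mcomp (tpow E n) (tzero E ?l) (core_embed E r s t n ?l) = tzero E n"
      unfolding n core_embed_diag
      by (rule tmor_eqI[OF mcomp_tmor[OF a tzero_tmor] tzero_tmor]) (simp add: act_mcomp[OF a tzero_tmor] act_tfib[OF a])
    ultimately show ?thesis by simp
  qed
  finally show "tmat_mult E (core_embed E s q t') (core_embed E r s t) n m = core_embed E r q (mcomp (tpow E r) t' t) n m" .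
qed

lemma core_embed_comp_core_class:
  assumes t: "t \<in> tmors E r s" and t': "t' \<in> tmors E s q"
  shows "core_class E (core_embed E r q (mcomp (tpow E r) t' t)) = core_class E (tmat_mult E (core_embed E s q t') (core_embed E r s t))"
  using core_embed_comp[OF assms] core_class_eq_iff[OF tmat_mult_tmats[OF core_embed_tmats[OF t'] core_embed_tmats[OF t]] core_embed_tmats[OF mcomp_tmor[OF t t']]] by simp

lemma circle_norm_core_embed_comp:
  assumes p: "p \<in> circle_norms E" and t: "t \<in> tmors E r s" and t': "t' \<in> tmors E s q"
  shows "p (core_class E (core_embed E r q (mcomp (tpow E r) t' t))) \<le> p (core_class E (core_embed E s q t')) * p (core_class E (core_embed E r s t))"
  unfolding core_embed_comp_core_class[OF t t'] by (rule circle_norm_mult[OF p core_embed_tmats[OF t'] core_embed_tmats[OF t]])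

lemma circle_norm_core_embed_cstar:
  assumes p: "p \<in> circle_norms E" and t: "t \<in> tmors E r s"
  shows "p (core_class E (core_embed E r r (mcomp (tpow E r) (madj (tpow E r) (tpow E s) t) t))) = (p (core_class E (core_embed E r s t)))\<^sup>2"
  unfolding core_embed_comp_core_class[OF t madj_tmor[OF t]] core_embed_star[OF t, symmetric] by (rule circle_norm_cstar[OF p core_embed_tmats[OF t]])

lemma circle_norm_core_embed_star:
  assumes p: "p \<in> circle_norms E" and t: "t \<in> tmors E r s"
  shows "p (core_class E (core_embed E s r (madj (tpow E r) (tpow E s) t))) = p (core_class E (core_embed E r s t))"
  unfolding core_embed_star[OF t, symmetric] by (rule circle_norm_star[OF p core_embed_tmats[OF t]])

lemma circle_norm_core_embed_tzero:
  assumes p: "p \<in> circle_norms E"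
  shows "p (core_class E (core_embed E r s (tzero E r))) = 0"
proof -
  have "mscl (tpow E r) (tpow E s) 0 (tzero E r) = tzero E r" by (rule mscl_tzero)
  then show ?thesis
    using circle_norm_scl[OF p core_embed_tmats[OF tzero_tmor], of 0 r s] core_embed_scl[OF tzero_tmor, of 0 r s] by simp
qed

lemma circle_norm_core_embed_mor_sum:
  assumes p: "p \<in> circle_norms E" and "finite J" "\<And>j. j \<in> J \<Longrightarrow> f j \<in> tmors E r s"
  shows "p (core_class E (core_embed E r s (mor_sum E r J f))) \<le> (\<Sum>j\<in>J. p (core_class E (core_embed E r s (f j))))"
  using assms(2,3)
proof (induction J rule: finite_induct)
  case empty
  have "mor_sum E r {} f = tzero E r" by (simp add: mor_sum_def tzero_tmor_of)
  then show ?case using circle_norm_core_embed_tzero[OF p] by simp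
next
  case (insert j J)
  have f: "f j \<in> tmors E r s" "mor_sum E r J f \<in> tmors E r s"
    using insert by (auto intro: mor_sum_tmor)
  have "mor_sum E r (insert j J) f = madd (tpow E r) (tpow E s) (f j) (mor_sum E r J f)"
    unfolding madd_tmor_of[OF f] mor_sum_def[of E r "insert j J"] using insert by (intro tmor_of_cong) (simp add: act_mor_sum)
  then have "p (core_class E (core_embed E r s (mor_sum E r (insert j J) f))) \<le> p (core_class E (core_embed E r s (f j))) + p (core_class E (core_embed E r s (mor_sum E r J f)))"
    using circle_norm_add[OF p core_embed_tmats[OF f(1)] core_embed_tmats[OF f(2)]] core_embed_add[OF f] by simp
  then show ?case using insert by fastforce
qed

lemma function_mor_comp:
  assumes "continuous_map (base E) euclidean g" "continuous_map (base E) euclidean h"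
  shows "mcomp (tpow E 0) (function_mor E g) (function_mor E h) = function_mor E (\<lambda>x. g x * h x)"
proof (rule tmor_eqI[OF mcomp_tmor[OF function_mor_tmor function_mor_tmor] function_mor_tmor])
  fix x \<Phi> assume x: "x \<in> topspace (base E)" "\<Phi> \<in> tfib E 0 x"
  show "act (mcomp (tpow E 0) (function_mor E g) (function_mor E h)) x \<Phi> = act (function_mor E (\<lambda>x. g x * h x)) x \<Phi>"
    unfolding act_mcomp[OF function_mor_tmor[OF assms(2)] function_mor_tmor[OF assms(1)] x] act_function_mor[OF x]
    using x by (simp add: act_function_mor tfib_scl mult.assoc)
qed (use assms continuous_map_complex_mult in auto)

lemma function_mor_adj:
  assumes h: "continuous_map (base E) euclidean h"
  shows "madj (tpow E 0) (tpow E 0) (function_mor E h) = function_mor E (\<lambda>x. cnj (h x))"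
  by (rule madj_eqI) (use h in \<open>simp_all add: function_mor_tmor continuous_map_cnj act_function_mor tip_scl\<close>)

lemma function_mor_1: "function_mor E (\<lambda>_. 1) = mid (tpow E 0)"
  by (simp add: function_mor_def mid_tmor_of)

text \<open>The square of the norm of a self-adjoint idempotent is its norm, which is therefore at most one.\<close>

lemma circle_norm_unit:
  assumes p: "p \<in> circle_norms E"
  shows "p (core_class E (core_embed E 0 0 (mid (tpow E 0)))) \<le> 1"
proof -
  let ?P = "p (core_class E (core_embed E 0 0 (mid (tpow E 0))))"
  have c: "continuous_map (base E) euclidean (\<lambda>_. 1 :: complex)" by simp
  have "?P = ?P\<^sup>2"
    using circle_norm_core_embed_cstar[OF p function_mor_tmor[OF c]] function_mor_adj[OF c] function_mor_comp[OF c c] by (simp add: function_mor_1)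
  then have "?P * (1 - ?P) = 0" by (simp add: power2_eq_square algebra_simps)
  then show ?thesis by auto
qed

text \<open>$f/M$ is the real part of the unitary function $u = f/M + i \sqrt{1 - (f/M)^2}$, and a
  \<open>C\<^sup>*\<close>-norm of a unitary is at most one. The argument stays inside the algebra,
  which is not complete.\<close>

lemma circle_norm_real_function:
  assumes p: "p \<in> circle_norms E" and f: "continuous_map (base E) euclideanreal f"
    and M: "0 < M" "\<forall>x\<in>topspace (base E). \<bar>f x\<bar> \<le> M"
  shows "p (core_class E (core_embed E 0 0 (function_mor E (\<lambda>x. complex_of_real (f x))))) \<le> M"
proof -
  define u where "u = (\<lambda>x. Complex (f x / M) (sqrt (1 - (f x / M)\<^sup>2)))"
  have u_eq: "u x = complex_of_real (f x / M) + \<i> * complex_of_real (sqrt (1 - (f x / M)\<^sup>2))" for x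
    by (simp add: u_def complex_eq_iff)
  have uc: "continuous_map (base E) euclidean u"
    unfolding u_eq
    by (intro continuous_map_add continuous_map_complex_mult continuous_map_complex_of_real continuous_map_real_sqrt
        continuous_map_diff continuous_map_real_pow continuous_map_real_divide f) (use M in auto)
  note uc' = continuous_map_cnj[OF uc]
  have uu: "cnj (u x) * u x = 1" if "x \<in> topspace (base E)" for x
  proof -
    have "\<bar>f x / M\<bar> \<le> 1" using M that by simp
    then have "(f x / M)\<^sup>2 \<le> 1" using abs_square_le_1 by blast
    then have "(cmod (u x))\<^sup>2 = 1" by (simp add: u_def cmod_def)
    then show ?thesis by (metis complex_norm_square mult.commute of_real_1)
  qed
  have mid1: "function_mor E (\<lambda>x. cnj (u x) * u x) = mid (tpow E 0)"
    unfolding function_mor_1[symmetric] function_mor_def by (intro tmor_of_cong) (simp add: uu)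
  have "(p (core_class E (core_embed E 0 0 (function_mor E u))))\<^sup>2 \<le> 1"
    using circle_norm_core_embed_cstar[OF p function_mor_tmor[OF uc]] circle_norm_unit[OF p] by (simp add: function_mor_adj[OF uc] function_mor_comp[OF uc' uc] mid1)
  then have 1: "p (core_class E (core_embed E 0 0 (function_mor E u))) \<le> 1" using power2_le_imp_le[of _ 1] by simp
  then have 2: "p (core_class E (core_embed E 0 0 (function_mor E (\<lambda>x. cnj (u x))))) \<le> 1"
    using circle_norm_core_embed_star[OF p function_mor_tmor[OF uc]] function_mor_adj[OF uc] by simp
  let ?c = "complex_of_real (M / 2)"
  have fc: "continuous_map (base E) euclidean (\<lambda>x. complex_of_real (f x))" by (rule continuous_map_complex_of_real[OF f])
  have s: "function_mor E (\<lambda>x. complex_of_real (f x)) =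
     mscl (tpow E 0) (tpow E 0) ?c (madd (tpow E 0) (tpow E 0) (function_mor E u) (function_mor E (\<lambda>x. cnj (u x))))"
  proof (rule tmor_eqI[OF function_mor_tmor[OF fc] mscl_tmor[OF madd_tmor[OF function_mor_tmor[OF uc] function_mor_tmor[OF uc']]]])
    fix x \<Phi> assume x: "x \<in> topspace (base E)" "\<Phi> \<in> tfib E 0 x"
    have e: "complex_of_real (f x) = ?c * (u x + cnj (u x))" using M by (simp add: complex_add_cnj u_def)
    show "act (function_mor E (\<lambda>x. complex_of_real (f x))) x \<Phi> =
      act (mscl (tpow E 0) (tpow E 0) ?c (madd (tpow E 0) (tpow E 0) (function_mor E u) (function_mor E (\<lambda>x. cnj (u x))))) x \<Phi>"
      unfolding act_mscl[OF madd_tmor[OF function_mor_tmor[OF uc] function_mor_tmor[OF uc']] x]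
        act_madd[OF function_mor_tmor[OF uc] function_mor_tmor[OF uc'] x] act_function_mor[OF x]
      by (rule ext, subst e) (simp only: distrib_right mult.assoc)
  qed
  note t = function_mor_tmor[OF uc] function_mor_tmor[OF uc'] madd_tmor[OF function_mor_tmor[OF uc] function_mor_tmor[OF uc']]
  have "p (core_class E (core_embed E 0 0 (function_mor E (\<lambda>x. complex_of_real (f x))))) =
     M / 2 * p (core_class E (tadd E (core_embed E 0 0 (function_mor E u)) (core_embed E 0 0 (function_mor E (\<lambda>x. cnj (u x))))))"
    unfolding s core_embed_scl[OF t(3), symmetric] circle_norm_scl[OF p core_embed_tmats[OF t(3)]] core_embed_add[OF t(1,2)] using M by simp
  also have "\<dots> \<le> M / 2 * (1 + 1)"
    using M circle_norm_add[OF p core_embed_tmats[OF t(1)] core_embed_tmats[OF t(2)]] 1 2 by (intro mult_left_mono) auto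
  finally show ?thesis by simp
qed

text \<open>$p(\xi)^2 = p(\xi^*\xi)$, which is the norm of the function $\lVert\xi\rVert^2$.\<close>

lemma circle_norm_section_bounded:
  assumes f: "tensor_section E r f"
  shows "\<exists>C. \<forall>p\<in>circle_norms E. p (core_class E (core_embed E 0 r (section_mor E f))) \<le> C"
proof -
  obtain M where M: "M > 0" "\<forall>x\<in>topspace (base E). \<bar>sq_norm E r x (f x)\<bar> \<le> M"
    using continuous_bounded[OF compact_base tensor_section_sq_norm[OF f]] by blast
  have "p (core_class E (core_embed E 0 r (section_mor E f))) \<le> sqrt M" if p: "p \<in> circle_norms E" for p
  proof -
    have "(p (core_class E (core_embed E 0 r (section_mor E f))))\<^sup>2 \<le> M"
      using circle_norm_real_function[OF p tensor_section_sq_norm[OF f] M] circle_norm_core_embed_cstar[OF p section_mor_tmor[OF f]] section_mor_gram[OF f] by simp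
    then show ?thesis by (rule real_le_rsqrt)
  qed
  then show ?thesis by blast
qed

text \<open>By \<open>tmor_frame_sum\<close> every morphism is a finite sum of products of sections with
  adjoints of sections.\<close>

lemma circle_norm_core_embed_bounded:
  assumes t: "t \<in> tmors E r s"
  shows "\<exists>C. \<forall>p\<in>circle_norms E. p (core_class E (core_embed E r s t)) \<le> C"
proof -
  obtain J :: "('x \<times> nat list) set" and \<xi> where J: "finite J" and \<xi>: "\<forall>j\<in>J. tensor_section E r (\<xi> j)"
    and ex: "\<forall>y\<in>topspace (base E). \<forall>\<Phi>\<in>tfib E r y. \<forall>ws. (\<Sum>j\<in>J. tip E r y (\<xi> j y) \<Phi> * \<xi> j y ws) = \<Phi> ws"
    by (rule global_frame)
  let ?A = "\<lambda>j. section_mor E (\<lambda>x. act t x (\<xi> j x))"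
  let ?B = "\<lambda>j. madj (tpow E 0) (tpow E r) (section_mor E (\<xi> j))"
  have tA: "?A j \<in> tmors E 0 s" and tB: "?B j \<in> tmors E r 0" and tS: "section_mor E (\<xi> j) \<in> tmors E 0 r" if "j \<in> J" for j
    using \<xi> that section_mor_tmor madj_tmor tensor_section_act[OF t] by blast+
  have "\<exists>C. \<forall>p\<in>circle_norms E. p (core_class E (core_embed E 0 s (?A j))) \<le> C" if "j \<in> J" for j
    using circle_norm_section_bounded[OF tensor_section_act[OF t]] \<xi> that by blast
  then obtain C where C: "\<And>j p. j \<in> J \<Longrightarrow> p \<in> circle_norms E \<Longrightarrow> p (core_class E (core_embed E 0 s (?A j))) \<le> C j" by metis
  have "\<exists>C. \<forall>p\<in>circle_norms E. p (core_class E (core_embed E 0 r (section_mor E (\<xi> j)))) \<le> C" if "j \<in> J" for j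
    using circle_norm_section_bounded \<xi> that by blast
  then obtain D where D: "\<And>j p. j \<in> J \<Longrightarrow> p \<in> circle_norms E \<Longrightarrow> p (core_class E (core_embed E 0 r (section_mor E (\<xi> j)))) \<le> D j" by metis
  have "p (core_class E (core_embed E r s t)) \<le> (\<Sum>j\<in>J. C j * D j)" if p: "p \<in> circle_norms E" for p
  proof -
    have "p (core_class E (core_embed E r s t)) = p (core_class E (core_embed E r s (mor_sum E r J (\<lambda>j. mcomp (tpow E r) (?A j) (?B j)))))"
      using tmor_frame_sum[OF t J \<xi> ex] by simp
    also have "\<dots> \<le> (\<Sum>j\<in>J. p (core_class E (core_embed E r s (mcomp (tpow E r) (?A j) (?B j)))))"
      by (rule circle_norm_core_embed_mor_sum[OF p J mcomp_tmor[OF tB tA]])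
    also have "\<dots> \<le> (\<Sum>j\<in>J. C j * D j)"
    proof (rule sum_mono)
      fix j assume j: "j \<in> J"
      have "p (core_class E (core_embed E r s (mcomp (tpow E r) (?A j) (?B j)))) \<le> p (core_class E (core_embed E 0 s (?A j))) * p (core_class E (core_embed E r 0 (?B j)))"
        by (rule circle_norm_core_embed_comp[OF p tB[OF j] tA[OF j]])
      also have "\<dots> = p (core_class E (core_embed E 0 s (?A j))) * p (core_class E (core_embed E 0 r (section_mor E (\<xi> j))))"
        unfolding circle_norm_core_embed_star[OF p tS[OF j]] ..
      also have "\<dots> \<le> C j * D j"
        by (intro mult_mono' C[OF j p] D[OF j p] circle_norm_nonneg[OF p core_embed_tmats[OF tA[OF j]]] circle_norm_nonneg[OF p core_embed_tmats[OF tS[OF j]]])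
      finally show "p (core_class E (core_embed E r s (mcomp (tpow E r) (?A j) (?B j)))) \<le> C j * D j" .
    qed
    finally show ?thesis .
  qed
  then show ?thesis by blast
qed

lemma circle_norm_bounded:
  assumes "a \<in> tmats E"
  shows "\<exists>C. \<forall>p\<in>circle_norms E. p (core_class E a) \<le> C"
  using assms
proof (induction a rule: tmats_decompose)
  case (rel a b)
  then have "core_class E a = core_class E b" using core_class_eq_iff[of a E b] by (auto simp: tmat_rel_def)
  then show ?case using rel by simp
next
  case (add a b)
  then obtain C D where "\<forall>p\<in>circle_norms E. p (core_class E a) \<le> C" "\<forall>p\<in>circle_norms E. p (core_class E b) \<le> D" by blast
  then have "\<forall>p\<in>circle_norms E. p (core_class E (tadd E a b)) \<le> C + D" using circle_norm_add[OF _ add(1,2)] by fastforce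
  then show ?case by blast
next
  case (core_embed r s t)
  then show ?case by (rule circle_norm_core_embed_bounded)
qed

lemma cp_norm_upper: "p \<in> circle_norms E \<Longrightarrow> a \<in> tmats E \<Longrightarrow> p (core_class E a) \<le> cp_norm E (core_class E a)"
  unfolding cp_norm_def circle_norms_def[symmetric]
  using circle_norm_bounded[of a] by (intro cSUP_upper) (auto simp: bdd_above_def)

lemma cp_norm_least: "(\<And>p. p \<in> circle_norms E \<Longrightarrow> p X \<le> c) \<Longrightarrow> cp_norm E X \<le> c"
  unfolding cp_norm_def circle_norms_def[symmetric]
  using op_norm_circle_norms by (intro cSUP_least) auto

lemma cp_norm_nonneg: "a \<in> tmats E \<Longrightarrow> 0 \<le> cp_norm E (core_class E a)"
  using cp_norm_upper[OF op_norm_circle_norms] op_norm_nonneg order_trans by blast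

end

section \<open>Functors between categories of tensor powers\<close>

definition map_entries :: "(nat \<Rightarrow> nat \<Rightarrow> ('e, 'x) tmor \<Rightarrow> ('e, 'x) tmor) \<Rightarrow> ('e, 'x) tmat \<Rightarrow> ('e, 'x) tmat" where
  "map_entries H a = (\<lambda>n m. H n m (a n m))"

context framed_bundle
begin

lemma core_seminormed: "seminormed_star_alg (cp_core E) (cp_norm E)"
proof (unfold_locales)
  have "tzero E n \<in> tmors E n m" for n m by (rule tzero_tmor)
  then have "(\<lambda>n m. tzero E n) \<in> tmats E"
    by (intro tmatsI[of _ _ 0 0]) (auto simp: banded_def stable_def amplify_tzero)
  then show "car (cp_core E) \<noteq> {}" using core_class_car by blast
next
  fix X Y assume "X \<in> car (cp_core E)" "Y \<in> car (cp_core E)"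
  then obtain a b where ab: "a \<in> tmats E" "X = core_class E a" "b \<in> tmats E" "Y = core_class E b" by (elim carE)
  show "alg_plus (cp_core E) X Y \<in> car (cp_core E)" "alg_times (cp_core E) X Y \<in> car (cp_core E)"
    using ab by (simp_all add: core_class_ops tmats_closed core_class_car)
  show "minus_in (cp_core E) (alg_scl (cp_core E) k X) (alg_scl (cp_core E) k Y) = alg_scl (cp_core E) k (minus_in (cp_core E) X Y)" for k
    using ab by (simp add: core_class_ops tmats_closed)
      (intro arg_cong[where f = "core_class E"] tmat_eqI, simp_all add: tmats_closed act_tadd act_tscl algebra_simps)
  show "minus_in (cp_core E) (alg_star (cp_core E) X) (alg_star (cp_core E) Y) = alg_star (cp_core E) (minus_in (cp_core E) X Y)"
    using ab by (simp add: core_class_ops tmats_closed tstar_tadd tstar_tscl)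
  show "minus_in (cp_core E) X Y = alg_scl (cp_core E) (- 1) (minus_in (cp_core E) Y X)"
    using ab by (simp add: core_class_ops tmats_closed)
      (intro arg_cong[where f = "core_class E"] tmat_eqI, simp_all add: tmats_closed act_tadd act_tscl algebra_simps)
  show "X = alg_plus (cp_core E) Y (minus_in (cp_core E) X Y)"
    using ab by (simp add: core_class_ops tmats_closed)
      (intro arg_cong[where f = "core_class E"] tmat_eqI, simp_all add: tmats_closed act_tadd act_tscl algebra_simps)
  have p: "p X \<le> cp_norm E X" "p Y \<le> cp_norm E Y" "0 \<le> p X" "0 \<le> p Y" if "p \<in> circle_norms E" for p
    using cp_norm_upper[OF that] circle_norm_nonneg[OF that] ab by auto
  show "cp_norm E (alg_plus (cp_core E) X Y) \<le> cp_norm E X + cp_norm E Y"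
  proof (rule cp_norm_least)
    fix p assume "p \<in> circle_norms E"
    then show "p (alg_plus (cp_core E) X Y) \<le> cp_norm E X + cp_norm E Y"
      using circle_norm_add[of p a b] p[of p] ab by (simp add: core_class_ops)
  qed
  show "cp_norm E (alg_times (cp_core E) X Y) \<le> cp_norm E X * cp_norm E Y"
  proof (rule cp_norm_least)
    fix q assume q: "q \<in> circle_norms E"
    have "q (alg_times (cp_core E) X Y) \<le> q X * q Y"
      using circle_norm_mult[OF q, of a b] ab by (simp add: core_class_ops)
    also have "\<dots> \<le> cp_norm E X * cp_norm E Y" by (rule mult_mono'[OF p(1,2,3,4)[OF q]])
    finally show "q (alg_times (cp_core E) X Y) \<le> cp_norm E X * cp_norm E Y" .
  qed
next
  fix X assume "X \<in> car (cp_core E)"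
  then obtain a where a: "a \<in> tmats E" "X = core_class E a" by (elim carE)
  show "alg_scl (cp_core E) k X \<in> car (cp_core E)" "alg_star (cp_core E) X \<in> car (cp_core E)" for k
    using a by (simp_all add: core_class_ops tmats_closed core_class_car)
  show "minus_in (cp_core E) X X = alg_scl (cp_core E) 0 X"
    using a by (simp add: core_class_ops tmats_closed)
      (intro arg_cong[where f = "core_class E"] tmat_eqI, simp_all add: tmats_closed act_tadd act_tscl algebra_simps)
  show "0 \<le> cp_norm E X" using cp_norm_nonneg a by simp
  show "cp_norm E (alg_scl (cp_core E) k X) \<le> cmod k * cp_norm E X" for k
  proof (rule cp_norm_least)
    fix p assume "p \<in> circle_norms E"
    then show "p (alg_scl (cp_core E) k X) \<le> cmod k * cp_norm E X"
      using circle_norm_scl[of p a k] cp_norm_upper[of p a] a by (simp add: core_class_ops mult_left_mono)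
  qed
  show "cp_norm E (alg_star (cp_core E) X) \<le> cp_norm E X"
  proof (rule cp_norm_least)
    fix p assume "p \<in> circle_norms E"
    then show "p (alg_star (cp_core E) X) \<le> cp_norm E X"
      using circle_norm_star[of p a] cp_norm_upper[of p a] a by (simp add: core_class_ops)
  qed
next
  fix X Y Z W assume "X \<in> car (cp_core E)" "Y \<in> car (cp_core E)" "Z \<in> car (cp_core E)" "W \<in> car (cp_core E)"
  then obtain a b c d where ab: "a \<in> tmats E" "X = core_class E a" "b \<in> tmats E" "Y = core_class E b"
     "c \<in> tmats E" "Z = core_class E c" "d \<in> tmats E" "W = core_class E d" by (elim carE)
  show "minus_in (cp_core E) (alg_plus (cp_core E) X Y) (alg_plus (cp_core E) Z W) =
      alg_plus (cp_core E) (minus_in (cp_core E) X Z) (minus_in (cp_core E) Y W)"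
    using ab by (simp add: core_class_ops tmats_closed)
      (intro arg_cong[where f = "core_class E"] tmat_eqI, simp_all add: tmats_closed act_tadd act_tscl algebra_simps)
  show "minus_in (cp_core E) (alg_times (cp_core E) X Y) (alg_times (cp_core E) Z W) =
      alg_plus (cp_core E) (alg_times (cp_core E) (minus_in (cp_core E) X Z) Y)
        (alg_times (cp_core E) Z (minus_in (cp_core E) Y W))"
    using ab by (simp add: core_class_ops tmats_closed minus_times_eq)
next
  fix X Y Z assume "X \<in> car (cp_core E)" "Y \<in> car (cp_core E)" "Z \<in> car (cp_core E)"
  then obtain a b c where ab: "a \<in> tmats E" "X = core_class E a" "b \<in> tmats E" "Y = core_class E b"
     "c \<in> tmats E" "Z = core_class E c" by (elim carE)
  show "minus_in (cp_core E) X Z = alg_plus (cp_core E) (minus_in (cp_core E) X Y) (minus_in (cp_core E) Y Z)"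
    using ab by (simp add: core_class_ops tmats_closed)
      (intro arg_cong[where f = "core_class E"] tmat_eqI, simp_all add: tmats_closed act_tadd act_tscl algebra_simps)
qed

lemma cp_embed_core_embed: "cp_embed E r s t = cp_rel E `` {\<lambda>_. core_class E (core_embed E r s t)}"
  by (simp add: cp_embed_def core_class_def core_embed_def)

text \<open>Equality in the completion means that the difference has norm zero for every norm of the family, in
  particular for the operator norm at infinity, which is definite.\<close>

lemma cp_embed_inject_class:
  assumes t: "t \<in> tmors E r s" and t': "t' \<in> tmors E r s" and eq: "cp_embed E r s t = cp_embed E r s t'"
  obtains N where "\<forall>j\<ge>N. amplify_iter E r s j t = amplify_iter E r s j t'"
proof -
  interpret A: seminormed_star_alg "cp_core E" "cp_norm E" by (rule core_seminormed)
  let ?a = "core_embed E r s t" and ?b = "core_embed E r s t'"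
  have ab: "?a \<in> tmats E" "?b \<in> tmats E" using core_embed_tmats t t' by auto
  have c: "(\<lambda>_. core_class E ?a) \<in> cauchy_in (cp_core E) (cp_norm E)" "(\<lambda>_. core_class E ?b) \<in> cauchy_in (cp_core E) (cp_norm E)"
    by (simp_all add: cauchy_in_def A.pd_self core_class_car ab)
  have "(\<lambda>_. core_class E ?a, \<lambda>_. core_class E ?b) \<in> cp_rel E"
    using eq eq_equiv_class_iff[OF A.equiv_null c] by (simp add: cp_embed_core_embed)
  then have "(\<lambda>n::nat. cp_norm E (minus_in (cp_core E) (core_class E ?a) (core_class E ?b))) \<longlonglongrightarrow> 0" by (rule A.nullD(3))
  then have z: "cp_norm E (minus_in (cp_core E) (core_class E ?a) (core_class E ?b)) = 0" by (simp add: LIMSEQ_const_iff)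
  let ?d = "tadd E ?a (tscl E (- 1) ?b)"
  have d: "?d \<in> tmats E" using ab tmats_closed by blast
  have "op_norm E (core_class E ?d) \<le> 0"
    using cp_norm_upper[OF op_norm_circle_norms d] z by (simp add: core_class_ops ab)
  then have "op_norm E (core_class E ?d) = 0" using op_norm_nonneg[OF d] by simp
  then have "(?d, tscl E 0 ?d) \<in> tmat_rel E"
    using op_norm_zero[OF d] core_class_eq_iff[OF d tscl_tmats[OF d]] by blast
  then obtain N where N: "\<forall>n\<ge>N. \<forall>m. ?d n m = tscl E 0 ?d n m" by (auto simp: tmat_rel_def)
  show ?thesis
  proof (rule that[of N], intro allI impI)
    fix j assume j: "N \<le> j"
    have "?a (r + j) (s + j) = ?b (r + j) (s + j)"
    proof (rule tmor_eqI[OF tmats_tmor[OF ab(1)] tmats_tmor[OF ab(2)]])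
      fix x \<Phi> assume x: "x \<in> topspace (base E)" "\<Phi> \<in> tfib E (r + j) x"
      have "?d (r + j) (s + j) = tscl E 0 ?d (r + j) (s + j)" using N j by simp
      then have "act (?d (r + j) (s + j)) x \<Phi> = act (tscl E 0 ?d (r + j) (s + j)) x \<Phi>" by simp
      then show "act (?a (r + j) (s + j)) x \<Phi> = act (?b (r + j) (s + j)) x \<Phi>"
        using x ab by (simp add: act_tadd act_tscl tmats_closed fun_eq_iff)
    qed
    then show "amplify_iter E r s j t = amplify_iter E r s j t'" by (simp add: core_embed_diag)
  qed
qed

end

text \<open>A \<open>*\<close>-functor that maps the $r$-th tensor power of \<open>E\<close> to that of
  \<open>F\<close> and commutes with tensoring by the identity of the generating object. Applied to
  the entries of matrices it induces a \<open>*\<close>-homomorphism of the Cuntz--Pimsner algebras.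
  Both examples that matter, restriction to a fibre and conjugation by a unitary, are of this form.\<close>

locale tensor_functor = S: framed_bundle E + T: framed_bundle F
  for E F :: "('e, 'x) vbundle" +
  fixes H :: "nat \<Rightarrow> nat \<Rightarrow> ('e, 'x) tmor \<Rightarrow> ('e, 'x) tmor"
  assumes H_tmor: "t \<in> tmors E n m \<Longrightarrow> H n m t \<in> tmors F n m"
    and H_tzero: "H n m (tzero E n) = tzero F n"
    and H_madd: "t \<in> tmors E n m \<Longrightarrow> t' \<in> tmors E n m \<Longrightarrow>
       H n m (madd (tpow E n) (tpow E m) t t') = madd (tpow F n) (tpow F m) (H n m t) (H n m t')"
    and H_mscl: "t \<in> tmors E n m \<Longrightarrow> H n m (mscl (tpow E n) (tpow E m) c t) = mscl (tpow F n) (tpow F m) c (H n m t)"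
    and H_mcomp: "t \<in> tmors E n m \<Longrightarrow> u \<in> tmors E m k \<Longrightarrow>
       H n k (mcomp (tpow E n) u t) = mcomp (tpow F n) (H m k u) (H n m t)"
    and H_madj: "t \<in> tmors E n m \<Longrightarrow> H m n (madj (tpow E n) (tpow E m) t) = madj (tpow F n) (tpow F m) (H n m t)"
    and H_amplify: "t \<in> tmors E n m \<Longrightarrow> H (Suc n) (Suc m) (amplify E n m t) = amplify F n m (H n m t)"
begin

abbreviation "core_map \<equiv> qmap (tmat_rel F) (map_entries H)"

lemma map_entries_tmats:
  assumes a: "a \<in> tmats E"
  shows "map_entries H a \<in> tmats F"
proof -
  obtain K N where K: "banded E K a" and N: "stable E N a" using a by (auto simp: tmats_iff)
  show ?thesis
  proof (rule tmatsI)
    show "map_entries H a n m \<in> tmors F n m" for n m by (simp add: map_entries_def H_tmor[OF tmats_tmor[OF a]])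
    show "banded F K (map_entries H a)" using K by (simp add: banded_def map_entries_def H_tzero)
    show "stable F N (map_entries H a)" using N by (simp add: stable_def map_entries_def H_amplify[OF tmats_tmor[OF a]])
  qed
qed

lemma map_entries_rel: "(a, b) \<in> tmat_rel E \<Longrightarrow> (map_entries H a, map_entries H b) \<in> tmat_rel F"
proof -
  assume "(a, b) \<in> tmat_rel E"
  then obtain N where "a \<in> tmats E" "b \<in> tmats E" "\<forall>n\<ge>N. \<forall>m. a n m = b n m" by (auto simp: tmat_rel_def)
  then show ?thesis by (intro tmat_relI[of _ _ _ N] map_entries_tmats) (simp_all add: map_entries_def)
qed

lemma core_map_core_class: "a \<in> tmats E \<Longrightarrow> core_map (core_class E a) = core_class F (map_entries H a)"
  unfolding core_class_def by (rule qmap_class[OF equiv_tmat_rel equiv_tmat_rel _ map_entries_rel])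

lemma map_entries_tadd: "a \<in> tmats E \<Longrightarrow> b \<in> tmats E \<Longrightarrow> map_entries H (tadd E a b) = tadd F (map_entries H a) (map_entries H b)"
  by (simp add: map_entries_def tadd_def H_madd[OF tmats_tmor tmats_tmor])

lemma map_entries_tscl: "a \<in> tmats E \<Longrightarrow> map_entries H (tscl E c a) = tscl F c (map_entries H a)"
  by (simp add: map_entries_def tscl_def H_mscl[OF tmats_tmor])

lemma map_entries_tcirc: "a \<in> tmats E \<Longrightarrow> map_entries H (tcirc E z a) = tcirc F z (map_entries H a)"
  by (simp add: map_entries_def tcirc_def H_mscl[OF tmats_tmor])

lemma map_entries_tstar: "a \<in> tmats E \<Longrightarrow> map_entries H (tstar E a) = tstar F (map_entries H a)"
  by (simp add: map_entries_def tstar_def H_madj[OF tmats_tmor])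

lemma H_mor_sum:
  assumes "finite I" "\<And>i. i \<in> I \<Longrightarrow> f i \<in> tmors E n m"
  shows "H n m (mor_sum E n I f) = mor_sum F n I (\<lambda>i. H n m (f i))"
  using assms
proof (induction I rule: finite_induct)
  case empty
  have "mor_sum E n {} f = tzero E n" by (simp add: mor_sum_def S.tzero_tmor_of)
  moreover have "mor_sum F n {} (\<lambda>i. H n m (f i)) = tzero F n" by (simp add: mor_sum_def T.tzero_tmor_of)
  ultimately show ?case by (simp add: H_tzero)
next
  case (insert i I)
  have f: "f i \<in> tmors E n m" "mor_sum E n I f \<in> tmors E n m"
    using insert by (auto intro: S.mor_sum_tmor)
  have g: "H n m (f i) \<in> tmors F n m" "mor_sum F n I (\<lambda>i. H n m (f i)) \<in> tmors F n m"
    using insert by (auto intro!: T.mor_sum_tmor H_tmor)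
  have "mor_sum E n (insert i I) f = madd (tpow E n) (tpow E m) (f i) (mor_sum E n I f)"
    unfolding S.madd_tmor_of[OF f] mor_sum_def[of E n "insert i I"] using insert by (intro S.tmor_of_cong) (simp add: S.act_mor_sum)
  moreover have "mor_sum F n (insert i I) (\<lambda>i. H n m (f i)) = madd (tpow F n) (tpow F m) (H n m (f i)) (mor_sum F n I (\<lambda>i. H n m (f i)))"
    unfolding T.madd_tmor_of[OF g] mor_sum_def[of F n "insert i I"] using insert by (intro T.tmor_of_cong) (simp add: T.act_mor_sum)
  ultimately show ?case using insert H_madd[OF f] by simp
qed

lemma map_entries_tmat_mult:
  assumes a: "a \<in> tmats E" and b: "b \<in> tmats E"
  shows "map_entries H (tmat_mult E a b) = tmat_mult F (map_entries H a) (map_entries H b)"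
proof (intro ext)
  fix n m v
  obtain K where K: "banded E K b" using b by (auto simp: tmats_iff)
  have I: "l \<in> {..n + K}" if "b n l \<noteq> tzero E n" for l
  proof -
    have "\<not> (n + K < l \<or> l + K < n)" using K that unfolding banded_def by blast
    then show ?thesis by simp
  qed
  have I': "l \<in> {..n + K}" if "map_entries H b n l \<noteq> tzero F n" for l
  proof -
    have "b n l \<noteq> tzero E n" using that by (auto simp: map_entries_def H_tzero)
    then show ?thesis by (rule I)
  qed
  have "map_entries H (tmat_mult E a b) n m = H n m (mor_sum E n {..n + K} (\<lambda>l. mcomp (tpow E n) (a l m) (b n l)))"
    using S.tmat_mult_mor_sum[OF a b finite_atMost I] by (simp add: map_entries_def)
  also have "\<dots> = mor_sum F n {..n + K} (\<lambda>l. H n m (mcomp (tpow E n) (a l m) (b n l)))"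
    by (rule H_mor_sum) (simp_all add: S.mcomp_tmor[OF tmats_tmor[OF b] tmats_tmor[OF a]])
  also have "\<dots> = mor_sum F n {..n + K} (\<lambda>l. mcomp (tpow F n) (map_entries H a l m) (map_entries H b n l))"
    by (simp add: map_entries_def H_mcomp[OF tmats_tmor[OF b] tmats_tmor[OF a]])
  also have "\<dots> = tmat_mult F (map_entries H a) (map_entries H b) n m"
    by (rule T.tmat_mult_mor_sum[OF map_entries_tmats[OF a] map_entries_tmats[OF b] finite_atMost I', symmetric])
  finally show "map_entries H (tmat_mult E a b) n m v = tmat_mult F (map_entries H a) (map_entries H b) n m v" by simp
qed

lemmas map_entries_ops = map_entries_tadd map_entries_tscl map_entries_tcirc map_entries_tstar map_entries_tmat_mult

lemma core_map_scl0: "a \<in> tmats E \<Longrightarrow> core_class E a = core_class E (tscl E 0 a) \<Longrightarrow> core_class F (map_entries H a) = core_class F (tscl F 0 (map_entries H a))"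
  using core_map_core_class[of a] core_map_core_class[OF S.tscl_tmats, of a 0] map_entries_tscl[of a 0] by simp

text \<open>The pullback of a norm along a functor is only a seminorm in general; the maximum with a
  \<open>C\<^sup>*\<close>-norm is a \<open>C\<^sup>*\<close>-norm. It is in the family of
  \<open>E\<close>, whose supremum therefore dominates the pullback.\<close>

lemma max_circle_norms:
  assumes q: "q \<in> circle_norms F"
  shows "(\<lambda>X. max (op_norm E X) (q (core_map X))) \<in> circle_norms E"
  unfolding S.circle_norms_iff
proof (intro conjI ballI allI impI)
  let ?p = "op_norm E"
  note p = S.op_norm_circle_norms
  fix a assume a: "a \<in> tmats E"
  note ha = map_entries_tmats[OF a]
  note nn = S.circle_norm_nonneg[OF p a] T.circle_norm_nonneg[OF q ha]
  show "0 \<le> max (?p (core_class E a)) (q (core_map (core_class E a)))" using nn by (simp add: core_map_core_class a)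
  show "max (?p (core_class E a)) (q (core_map (core_class E a))) = 0 \<longleftrightarrow> core_class E a = core_class E (tscl E 0 a)"
    using S.circle_norm_zero[OF p a] T.circle_norm_zero[OF q ha] core_map_scl0[OF a] nn by (auto simp: core_map_core_class a max_def)
  show "max (?p (core_class E (tscl E c a))) (q (core_map (core_class E (tscl E c a)))) = cmod c * max (?p (core_class E a)) (q (core_map (core_class E a)))" for c
    using S.circle_norm_scl[OF p a] T.circle_norm_scl[OF q ha] a by (simp add: core_map_core_class map_entries_ops S.tmats_closed max_mult_distrib_left)
  show "max (?p (core_class E (tmat_mult E (tstar E a) a))) (q (core_map (core_class E (tmat_mult E (tstar E a) a)))) =
      (max (?p (core_class E a)) (q (core_map (core_class E a))))\<^sup>2"
    using S.circle_norm_cstar[OF p a] T.circle_norm_cstar[OF q ha] a nn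
    by (simp add: core_map_core_class map_entries_ops S.tmats_closed max_def power2_le_iff_abs_le abs_le_square_iff[symmetric])
  fix b assume b: "b \<in> tmats E"
  note hb = map_entries_tmats[OF b]
  note nn' = S.circle_norm_nonneg[OF p b] T.circle_norm_nonneg[OF q hb]
  show "max (?p (core_class E (tadd E a b))) (q (core_map (core_class E (tadd E a b)))) \<le>
     max (?p (core_class E a)) (q (core_map (core_class E a))) + max (?p (core_class E b)) (q (core_map (core_class E b)))"
    using S.circle_norm_add[OF p a b] T.circle_norm_add[OF q ha hb] a b
    by (simp add: core_map_core_class map_entries_ops S.tmats_closed) (simp add: max_def)
  have "?p (core_class E (tmat_mult E a b)) \<le> max (?p (core_class E a)) (q (core_class F (map_entries H a))) * max (?p (core_class E b)) (q (core_class F (map_entries H b)))"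
    by (rule order_trans[OF S.circle_norm_mult[OF p a b] mult_mono']) (use nn nn' in auto)
  moreover have "q (core_class F (tmat_mult F (map_entries H a) (map_entries H b))) \<le> max (?p (core_class E a)) (q (core_class F (map_entries H a))) * max (?p (core_class E b)) (q (core_class F (map_entries H b)))"
    by (rule order_trans[OF T.circle_norm_mult[OF q ha hb] mult_mono']) (use nn nn' in auto)
  ultimately show "max (?p (core_class E (tmat_mult E a b))) (q (core_map (core_class E (tmat_mult E a b)))) \<le>
     max (?p (core_class E a)) (q (core_map (core_class E a))) * max (?p (core_class E b)) (q (core_map (core_class E b)))"
    using a b by (simp add: core_map_core_class map_entries_ops S.tmats_closed)
next
  fix z a assume z: "cmod z = 1" and a: "a \<in> tmats E"
  show "max (op_norm E (core_class E (tcirc E z a))) (q (core_map (core_class E (tcirc E z a)))) = max (op_norm E (core_class E a)) (q (core_map (core_class E a)))"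
    using S.circle_norm_circ[OF S.op_norm_circle_norms z a] T.circle_norm_circ[OF q z map_entries_tmats[OF a]] a
    by (simp add: core_map_core_class map_entries_ops S.tmats_closed)
qed

lemma core_map_contractive:
  assumes a: "a \<in> tmats E"
  shows "cp_norm F (core_map (core_class E a)) \<le> cp_norm E (core_class E a)"
proof (rule T.cp_norm_least)
  fix q assume "q \<in> circle_norms F"
  from S.cp_norm_upper[OF max_circle_norms[OF this] a] show "q (core_map (core_class E a)) \<le> cp_norm E (core_class E a)" by simp
qed

lemma core_map_hom: "seminormed_star_hom (cp_core E) (cp_norm E) (cp_core F) (cp_norm F) core_map"
proof -
  interpret A: seminormed_star_alg "cp_core E" "cp_norm E" by (rule S.core_seminormed)
  interpret B: seminormed_star_alg "cp_core F" "cp_norm F" by (rule T.core_seminormed)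
  show ?thesis
  proof (unfold_locales)
    fix X Y assume "X \<in> car (cp_core E)" "Y \<in> car (cp_core E)"
    then obtain a b where ab: "a \<in> tmats E" "X = core_class E a" "b \<in> tmats E" "Y = core_class E b" by (elim carE)
    show "core_map (alg_plus (cp_core E) X Y) = alg_plus (cp_core F) (core_map X) (core_map Y)"
      "core_map (alg_times (cp_core E) X Y) = alg_times (cp_core F) (core_map X) (core_map Y)"
      using ab by (simp_all add: S.core_class_ops T.core_class_ops core_map_core_class map_entries_tmats S.tmats_closed map_entries_ops)
  next
    fix X assume "X \<in> car (cp_core E)"
    then obtain a where a: "a \<in> tmats E" "X = core_class E a" by (elim carE)
    show "core_map X \<in> car (cp_core F)" using a by (simp add: core_map_core_class map_entries_tmats core_class_car)
    show "core_map (alg_scl (cp_core E) c X) = alg_scl (cp_core F) c (core_map X)" for c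
      using a by (simp add: S.core_class_ops T.core_class_ops core_map_core_class map_entries_tmats S.tmats_closed map_entries_ops)
    show "core_map (alg_star (cp_core E) X) = alg_star (cp_core F) (core_map X)"
      using a by (simp add: S.core_class_ops T.core_class_ops core_map_core_class map_entries_tmats S.tmats_closed map_entries_ops)
    show "cp_norm F (core_map X) \<le> cp_norm E X" using a core_map_contractive by simp
  qed
qed

lemma cp_map_class:
  assumes "f \<in> cauchy_in (cp_core E) (cp_norm E)"
  shows "cp_map F (map_entries H) (cp_rel E `` {f}) = cp_rel F `` {\<lambda>n. core_map (f n)}"
  unfolding cp_map_def by (rule seminormed_star_hom.hom_class[OF core_map_hom assms])

lemma H_amplify_iter: "t \<in> tmors E r s \<Longrightarrow> H (r + j) (s + j) (amplify_iter E r s j t) = amplify_iter F r s j (H r s t)"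
  by (induction j) (simp_all add: H_amplify[OF S.amplify_iter_tmor])

lemma map_entries_core_embed:
  assumes t: "t \<in> tmors E r s"
  shows "map_entries H (core_embed E r s t) = core_embed F r s (H r s t)"
proof (intro ext)
  fix n m v
  have "map_entries H (core_embed E r s t) n m = core_embed F r s (H r s t) n m"
  proof (cases "\<exists>j. n = r + j \<and> m = s + j")
    case True
    then show ?thesis by (auto simp: map_entries_def S.core_embed_diag T.core_embed_diag H_amplify_iter[OF t])
  next
    case False
    then show ?thesis using S.core_embed_off[OF False] T.core_embed_off[OF False] by (simp add: map_entries_def H_tzero)
  qed
  then show "map_entries H (core_embed E r s t) n m v = core_embed F r s (H r s t) n m v" by simp
qed

lemma cp_map_embed:
  assumes t: "t \<in> tmors E r s"
  shows "cp_map F (map_entries H) (cp_embed E r s t) = cp_embed F r s (H r s t)"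
proof -
  interpret A: seminormed_star_alg "cp_core E" "cp_norm E" by (rule S.core_seminormed)
  have c: "(\<lambda>_. core_class E (core_embed E r s t)) \<in> cauchy_in (cp_core E) (cp_norm E)"
    by (simp add: cauchy_in_def A.pd_self core_class_car S.core_embed_tmats[OF t])
  show ?thesis
    unfolding S.cp_embed_core_embed T.cp_embed_core_embed cp_map_class[OF c] core_map_core_class[OF S.core_embed_tmats[OF t]] map_entries_core_embed[OF t] ..
qed

end

lemma tensor_functor_comp:
  assumes "tensor_functor E F H" "tensor_functor F F H'"
  shows "tensor_functor E F (\<lambda>n m t. H' n m (H n m t))"
proof -
  interpret A: tensor_functor E F H by fact
  interpret B: tensor_functor F F H' by fact
  show ?thesis
    by unfold_locales
      (simp_all add: A.H_tmor B.H_tmor A.H_tzero B.H_tzero A.H_madd B.H_madd A.H_mscl B.H_mscl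
        A.H_mcomp B.H_mcomp[OF A.H_tmor A.H_tmor] A.H_madj B.H_madj A.H_amplify B.H_amplify)
qed

lemma cp_map_comp:
  assumes H: "tensor_functor E F H" and H': "tensor_functor F F H'" and y: "y \<in> car (cuntz_pimsner E)"
  shows "cp_map F (map_entries H') (cp_map F (map_entries H) y) = cp_map F (map_entries (\<lambda>n m t. H' n m (H n m t))) y"
proof -
  interpret A: tensor_functor E F H by fact
  interpret B: tensor_functor F F H' by fact
  interpret C: tensor_functor E F "\<lambda>n m t. H' n m (H n m t)" by (rule tensor_functor_comp[OF H H'])
  interpret N: seminormed_star_alg "cp_core E" "cp_norm E" by (rule A.S.core_seminormed)
  interpret hA: seminormed_star_hom "cp_core E" "cp_norm E" "cp_core F" "cp_norm F" A.core_map by (rule A.core_map_hom)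
  obtain f where f: "f \<in> cauchy_in (cp_core E) (cp_norm E)" "y = cp_rel E `` {f}"
    using N.completion_carE[of y] y unfolding cuntz_pimsner_def by blast
  have "B.core_map (A.core_map (f n)) = C.core_map (f n)" for n
  proof -
    obtain a where a: "a \<in> tmats E" "f n = core_class E a" using carE[OF N.cauchyD[OF f(1)]] by blast
    show ?thesis
      unfolding a(2) A.core_map_core_class[OF a(1)] C.core_map_core_class[OF a(1)] B.core_map_core_class[OF A.map_entries_tmats[OF a(1)]] by (simp add: map_entries_def)
  qed
  then show ?thesis
    unfolding f(2) A.cp_map_class[OF f(1)] B.cp_map_class[OF hA.hom_cauchy[OF f(1)]] C.cp_map_class[OF f(1)] by simp
qed

text \<open>Two functors that agree on a set of morphisms agree on the \<open>C\<^sup>*\<close>-subalgebra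
  generated by it.\<close>

lemma cp_map_equalizer:
  assumes H: "tensor_functor E F H" and H': "tensor_functor E F H'"
    and eq: "\<And>r s y. y \<in> Y r s \<Longrightarrow> y \<in> tmors E r s \<and> H r s y = H' r s y"
    and y: "y \<in> cstar_generated (cuntz_pimsner E) (\<Union>r s. cp_embed E r s ` Y r s)"
  shows "cp_map F (map_entries H) y = cp_map F (map_entries H') y" "y \<in> car (cuntz_pimsner E)"
proof -
  interpret A: tensor_functor E F H by fact
  interpret B: tensor_functor E F H' by fact
  interpret N: seminormed_star_alg "cp_core E" "cp_norm E" by (rule A.S.core_seminormed)
  let ?C = "{y \<in> car (cuntz_pimsner E). cp_map F (map_entries H) y = cp_map F (map_entries H') y}"
  have "cstar_subalgebra (cuntz_pimsner E) ?C"
    using equalizer_cstar_subalgebra[OF A.core_map_hom B.core_map_hom] unfolding cuntz_pimsner_def cp_map_def .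
  moreover have "cp_embed E r s t \<in> ?C" if "t \<in> Y r s" for r s t
  proof -
    have t: "t \<in> tmors E r s" "H r s t = H' r s t" using eq[OF that] by auto
    have c: "(\<lambda>_. core_class E (core_embed E r s t)) \<in> cauchy_in (cp_core E) (cp_norm E)"
      by (simp add: cauchy_in_def N.pd_self core_class_car A.S.core_embed_tmats[OF t(1)])
    have "cp_embed E r s t \<in> car (cuntz_pimsner E)"
      unfolding A.S.cp_embed_core_embed cuntz_pimsner_def by (rule N.null_class_car[OF c])
    then show ?thesis using A.cp_map_embed[OF t(1)] B.cp_map_embed[OF t(1)] t(2) by simp
  qed
  ultimately have "y \<in> ?C" using y unfolding cstar_generated_def by blast
  then show "cp_map F (map_entries H) y = cp_map F (map_entries H') y" "y \<in> car (cuntz_pimsner E)" by auto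
qed

section \<open>Unitaries and their action on tensor powers\<close>

text \<open>A unitary of the fibre over \<open>x\<close>, linear because it preserves scalar products, together
  with its inverse and adjoint. Carrying the inverse along avoids the description operator in
  \<^const>\<open>madj\<close>.\<close>

definition unitary_pair :: "('e, 'x) vbundle \<Rightarrow> 'x \<Rightarrow> ('e \<Rightarrow> 'e) \<Rightarrow> ('e \<Rightarrow> 'e) \<Rightarrow> bool" where
  "unitary_pair E x u u' \<longleftrightarrow>
     (\<forall>w\<in>fib E x. u w \<in> fib E x \<and> u' w \<in> fib E x \<and> u' (u w) = w \<and> u (u' w) = w) \<and>
     (\<forall>v\<in>fib E x. \<forall>w\<in>fib E x. ip E w (u' v) = ip E (u w) v)"

text \<open>For \<open>h\<close> the adjoint of \<open>g\<close>, this is the tensor power of \<open>g\<close>,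
  see \<^const>\<open>gpow\<close>.\<close>

definition subst_form :: "('e, 'x) vbundle \<Rightarrow> nat \<Rightarrow> 'x \<Rightarrow> ('e \<Rightarrow> 'e) \<Rightarrow> ('e list \<Rightarrow> complex) \<Rightarrow> 'e list \<Rightarrow> complex" where
  "subst_form E r x h \<Phi> = (\<lambda>ws. if ws \<in> tup E r x then \<Phi> (map h ws) else 0)"

lemma subst_form_cong: "(\<And>w. w \<in> fib E x \<Longrightarrow> h w = h' w) \<Longrightarrow> subst_form E r x h = subst_form E r x h'"
proof (intro ext)
  fix \<Phi> ws assume h: "\<And>w. w \<in> fib E x \<Longrightarrow> h w = h' w"
  have "map h ws = map h' ws" if "ws \<in> tup E r x" using that h by (auto simp: tup_def)
  then show "subst_form E r x h \<Phi> ws = subst_form E r x h' \<Phi> ws"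
    unfolding subst_form_def by presburger
qed

lemma continuous_map_point:
  assumes "topspace Z \<subseteq> {x}" "f \<in> topspace Z \<rightarrow> topspace Y"
  shows "continuous_map Z Y f"
  unfolding continuous_map_def
proof (intro conjI allI impI assms(2))
  fix U
  have "{z \<in> topspace Z. f z \<in> U} = {} \<or> {z \<in> topspace Z. f z \<in> U} = topspace Z" using assms(1) by auto
  then show "openin Z {z \<in> topspace Z. f z \<in> U}"
    using openin_empty[of Z] openin_topspace[of Z] by metis
qed

context framed_bundle
begin

lemma ip_eqI:
  assumes "v \<in> fib E x" "v' \<in> fib E x" "\<And>z. z \<in> fib E x \<Longrightarrow> ip E z v = ip E z v'"
  shows "v = v'"
proof -
  define d where "d = vadd E v (vscl E (- 1) v')"
  have d: "d \<in> fib E x" using assms vadd_fib vscl_fib by (simp add: d_def)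
  have "ip E d d = ip E d v + (- 1) * ip E d v'"
    using ip_vadd[OF d assms(1) vscl_fib[OF assms(2)], of "-1"] ip_vscl[OF d assms(2), of "-1"] by (simp add: d_def)
  then have "ip E d d = 0" using assms(3)[OF d] by simp
  then have "vscl E 0 d = d" using ip_definite[OF d] by force
  then show ?thesis using diff_zero_eq[OF assms(1,2)] by (simp add: d_def)
qed

lemma unitary_pair_sym:
  assumes "unitary_pair E x u u'"
  shows "unitary_pair E x u' u"
  unfolding unitary_pair_def
proof (intro conjI ballI)
  fix v w assume v: "v \<in> fib E x" and w: "w \<in> fib E x"
  have "ip E v (u' w) = ip E (u v) w" "u v \<in> fib E x" "u' w \<in> fib E x" using assms v w by (auto simp: unitary_pair_def)
  then show "ip E w (u v) = ip E (u' w) v"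
    using ip_cnj[of "u v" x w] ip_cnj[of v x "u' w"] v w by simp
qed (use assms in \<open>auto simp: unitary_pair_def\<close>)

lemma unitary_pair_D:
  assumes "unitary_pair E x u u'" "w \<in> fib E x"
  shows "u w \<in> fib E x" "u' w \<in> fib E x" "u' (u w) = w" "u (u' w) = w"
  using assms by (auto simp: unitary_pair_def)

lemma unitary_pair_ip: "unitary_pair E x u u' \<Longrightarrow> v \<in> fib E x \<Longrightarrow> w \<in> fib E x \<Longrightarrow> ip E w (u' v) = ip E (u w) v"
  by (simp add: unitary_pair_def)

lemma unitary_pair_linear:
  assumes u: "unitary_pair E x u u'"
  shows "v \<in> fib E x \<Longrightarrow> w \<in> fib E x \<Longrightarrow> u' (vadd E v w) = vadd E (u' v) (u' w)"
    and "v \<in> fib E x \<Longrightarrow> u' (vscl E c v) = vscl E c (u' v)"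
proof -
  note D = unitary_pair_D[OF u]
  show "u' (vadd E v w) = vadd E (u' v) (u' w)" if "v \<in> fib E x" "w \<in> fib E x"
    by (rule ip_eqI[of _ x]) (use that in \<open>simp_all add: D vadd_fib unitary_pair_ip[OF u] ip_vadd[of _ x]\<close>)
  show "u' (vscl E c v) = vscl E c (u' v)" if "v \<in> fib E x"
    by (rule ip_eqI[of _ x]) (use that in \<open>simp_all add: D vscl_fib unitary_pair_ip[OF u] ip_vscl[of _ x]\<close>)
qed

lemma madj_the:
  assumes v: "v \<in> fib E x" and a: "a \<in> fib E x" and ad: "\<And>w. w \<in> fib E x \<Longrightarrow> ip E w a = ip E (t w) v"
  shows "madj E E t v = a"
proof -
  have "prj E v = x" "v \<in> topspace (tot E)" using v by (auto simp: fib_def)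
  moreover have "(THE a. a \<in> fib E x \<and> (\<forall>w\<in>fib E x. ip E w a = ip E (t w) v)) = a"
    using a ad by (intro the_equality) (auto intro: ip_eqI)
  ultimately show ?thesis by (simp add: madj_def)
qed

lemma madj_unitary_pair: "unitary_pair E x u u' \<Longrightarrow> v \<in> fib E x \<Longrightarrow> madj E E u v = u' v"
  by (rule madj_the[of v x]) (auto simp: unitary_pair_D unitary_pair_ip)

lemma madj_adjoint:
  assumes t: "\<And>w. w \<in> fib E x \<Longrightarrow> t w \<in> fib E x"
    and add: "\<And>v w. v \<in> fib E x \<Longrightarrow> w \<in> fib E x \<Longrightarrow> t (vadd E v w) = vadd E (t v) (t w)"
    and scl: "\<And>v c. v \<in> fib E x \<Longrightarrow> t (vscl E c v) = vscl E c (t v)"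
    and v: "v \<in> fib E x"
  shows "madj E E t v \<in> fib E x" "w \<in> fib E x \<Longrightarrow> ip E w (madj E E t v) = ip E (t w) v"
proof -
  have x: "x \<in> topspace (base E)" using fib_base v by blast
  have B: "onb E x (chosen_onb E x)" "finite (chosen_onb E x)" "\<And>b. b \<in> chosen_onb E x \<Longrightarrow> b \<in> fib E x"
    using onb_chosen_onb[OF x] by (auto simp: onb_def)
  obtain s where s: "s \<in> fib E x"
    "\<And>L. conj_linear E x L \<Longrightarrow> L s = (\<Sum>b\<in>chosen_onb E x. cnj (ip E (t b) v) * L b)"
    using lincomb[of "chosen_onb E x" v x "\<lambda>b. b" "\<lambda>b. ip E (t b) v"] B v by auto
  have L: "conj_linear E x (\<lambda>w. ip E (t w) v)"
    using conj_linear_ip[OF v] t unfolding conj_linear_def by (auto simp: add scl)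
  have ad: "ip E w s = ip E (t w) v" if w: "w \<in> fib E x" for w
  proof -
    have "ip E w s = cnj (ip E s w)" using ip_cnj[OF s(1) w] .
    also have "\<dots> = (\<Sum>b\<in>chosen_onb E x. ip E (t b) v * cnj (ip E b w))"
      using s(2)[OF conj_linear_ip[OF w]] by simp
    also have "\<dots> = (\<Sum>b\<in>chosen_onb E x. ip E w b * ip E (t b) v)"
      using ip_cnj[OF B(3) w] by (intro sum.cong) auto
    also have "\<dots> = ip E (t w) v" using onb_expand[OF B(1) L w] by simp
    finally show ?thesis .
  qed
  have "madj E E t v = s" by (rule madj_the[OF v s(1) ad])
  then show "madj E E t v \<in> fib E x" "w \<in> fib E x \<Longrightarrow> ip E w (madj E E t v) = ip E (t w) v"
    using s(1) ad by auto
qed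

lemma unitary_unitary_pair:
  assumes g: "g \<in> carrier (unitary_group E)"
  shows "unitary_pair E x g (madj E E g)"
proof -
  have m: "g \<in> mor E E" and l: "mcomp E (madj E E g) g = mid E" and r: "mcomp E g (madj E E g) = mid E"
    using g by (auto simp: unitary_group_def)
  have gf: "g w \<in> fib E x" if "w \<in> fib E x" for w
  proof -
    have w: "w \<in> topspace (tot E)" "prj E w = x" using that by (auto simp: fib_def)
    have "continuous_map (tot E) (tot E) g" using m by (simp add: mor_def)
    then have "g w \<in> topspace (tot E)" using w(1) continuous_map_image_subset_topspace by blast
    then show ?thesis using mor_prj[OF m w(1)] w(2) by (simp add: fib_def)
  qed
  have ad1: "madj E E g v \<in> fib E x" if "v \<in> fib E x" for v
    by (rule madj_adjoint(1)[OF gf mor_vadd[OF m] mor_vscl[OF m] that])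
  have ad2: "ip E w (madj E E g v) = ip E (g w) v" if "v \<in> fib E x" "w \<in> fib E x" for v w
    by (rule madj_adjoint(2)[OF gf mor_vadd[OF m] mor_vscl[OF m] that])
  have "madj E E g (g w) = w" "g (madj E E g w) = w" if "w \<in> fib E x" for w
  proof -
    have w: "w \<in> topspace (tot E)" using that by (simp add: fib_def)
    show "madj E E g (g w) = w" using fun_cong[OF l, of w] w by (simp add: mcomp_def compose_def mid_def)
    show "g (madj E E g w) = w" using fun_cong[OF r, of w] w by (simp add: mcomp_def compose_def mid_def)
  qed
  then show ?thesis by (simp add: unitary_pair_def gf ad1 ad2)
qed

lemma map_tup: "unitary_pair E x u u' \<Longrightarrow> ws \<in> tup E r x \<Longrightarrow> map u' ws \<in> tup E r x"
  using unitary_pair_D(2) by (fastforce simp: tup_def)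

lemma subst_form_tfib:
  assumes u: "unitary_pair E x u u'" and \<Phi>: "\<Phi> \<in> tfib E r x"
  shows "subst_form E r x u' \<Phi> \<in> tfib E r x"
proof (rule tfibI)
  fix us v zs assume t: "us @ v # zs \<in> tup E r x"
  have t': "us @ w # zs \<in> tup E r x" if "w \<in> fib E x" for w using t that by (auto simp: tup_def)
  have v: "v \<in> fib E x" using t by (auto simp: tup_def)
  have "map u' us @ u' v # map u' zs \<in> tup E r x" using map_tup[OF u t] by simp
  from tfib_slot'[OF \<Phi> this]
  show "conj_linear E x (\<lambda>v. subst_form E r x u' \<Phi> (us @ v # zs))"
    unfolding conj_linear_def
    by (auto simp: subst_form_def t' vadd_fib vscl_fib unitary_pair_linear[OF u] unitary_pair_D[OF u])
qed (simp add: subst_form_def)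

lemma subst_form_tlinear: "unitary_pair E x u u' \<Longrightarrow> tlinear E r r x (subst_form E r x u')"
  unfolding tlinear_def by (auto simp: subst_form_tfib) (auto simp: subst_form_def)

lemma subst_form_inverse:
  assumes u: "unitary_pair E x u u'" and \<Phi>: "\<Phi> \<in> tfib E r x"
  shows "subst_form E r x u (subst_form E r x u' \<Phi>) = \<Phi>"
proof (rule tfib_ext[OF subst_form_tfib[OF unitary_pair_sym[OF u] subst_form_tfib[OF u \<Phi>]] \<Phi>])
  fix ws assume ws: "ws \<in> tup E r x"
  have "map u' (map u ws) = ws" using ws unitary_pair_D(3)[OF u] by (auto simp: tup_def intro!: map_idI)
  then show "subst_form E r x u (subst_form E r x u' \<Phi>) ws = \<Phi> ws"
    using ws map_tup[OF unitary_pair_sym[OF u] ws] by (simp add: subst_form_def)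
qed

lemma unitary_pair_isometry: "unitary_pair E x u u' \<Longrightarrow> v \<in> fib E x \<Longrightarrow> w \<in> fib E x \<Longrightarrow> ip E (u v) (u w) = ip E v w"
  using unitary_pair_ip[of x u u' "u w" v] unitary_pair_D[of x u u' w] by simp

text \<open>Substitution permutes orthonormal bases of the fibre, and the scalar product does not depend on the
  basis.\<close>

lemma subst_form_unitary:
  assumes u: "unitary_pair E x u u'" and x: "x \<in> topspace (base E)" and \<Phi>: "\<Phi> \<in> tfib E r x" and \<Psi>: "\<Psi> \<in> tfib E r x"
  shows "tip E r x (subst_form E r x u' \<Phi>) (subst_form E r x u' \<Psi>) = tip E r x \<Phi> \<Psi>"
proof -
  let ?B = "chosen_onb E x"
  have B: "finite ?B" "?B \<subseteq> fib E x" "\<And>a b. a \<in> ?B \<Longrightarrow> b \<in> ?B \<Longrightarrow> ip E a b = (if a = b then 1 else 0)"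
    "\<And>v. v \<in> fib E x \<Longrightarrow> (\<And>b. b \<in> ?B \<Longrightarrow> ip E b v = 0) \<Longrightarrow> vscl E 0 v = v"
    using onb_chosen_onb[OF x] by (auto simp: onb_def)
  have inj: "inj_on u ?B"
    using B(2) unitary_pair_D(3)[OF u] by (intro inj_on_inverseI[of _ u']) auto
  have B': "onb E x (u ` ?B)"
    unfolding onb_def
  proof (intro conjI ballI impI)
    show "finite (u ` ?B)" using B by simp
    show "u ` ?B \<subseteq> fib E x" using B(2) unitary_pair_D(1)[OF u] by auto
  next
    fix a b assume "a \<in> u ` ?B" "b \<in> u ` ?B"
    then obtain c d where "a = u c" "b = u d" "c \<in> ?B" "d \<in> ?B" by blast
    moreover have "c \<in> fib E x" "d \<in> fib E x" using calculation B(2) by auto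
    ultimately show "ip E a b = (if a = b then 1 else 0)"
      using unitary_pair_isometry[OF u] B(3) inj_on_eq_iff[OF inj] by simp
  next
    fix v assume v: "v \<in> fib E x" and o: "\<forall>b\<in>u ` ?B. ip E b v = 0"
    have "ip E b (u' v) = 0" if "b \<in> ?B" for b
      using unitary_pair_ip[OF u v, of b] that B(2) o by auto
    then have "vscl E 0 (u' v) = u' v" using B(4) unitary_pair_D(2)[OF u v] by blast
    then have "u' (vscl E 0 v) = u' v" using unitary_pair_linear(2)[OF u v] by simp
    then show "vscl E 0 v = v" using unitary_pair_D(4)[OF u v] unitary_pair_D(4)[OF u vscl_fib[OF v, of 0]] by metis
  qed
  have "tip E r x (subst_form E r x u' \<Phi>) (subst_form E r x u' \<Psi>) =
      (\<Sum>bs\<in>words (u ` ?B) r. cnj (subst_form E r x u' \<Phi> bs) * subst_form E r x u' \<Psi> bs)"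
    by (rule tip_onb[OF x B' subst_form_tfib[OF u \<Phi>] subst_form_tfib[OF u \<Psi>]])
  also have "\<dots> = (\<Sum>bs\<in>words ?B r. cnj (subst_form E r x u' \<Phi> (map u bs)) * subst_form E r x u' \<Psi> (map u bs))"
    by (rule sum_words_image[OF inj])
  also have "\<dots> = (\<Sum>bs\<in>words ?B r. cnj (\<Phi> bs) * \<Psi> bs)"
  proof (rule sum.cong[OF refl])
    fix bs assume "bs \<in> words ?B r"
    then have bs: "bs \<in> tup E r x" using B(2) by (auto simp: words_def tup_def)
    have "map u' (map u bs) = bs" using bs unitary_pair_D(3)[OF u] by (auto simp: tup_def intro!: map_idI)
    then show "cnj (subst_form E r x u' \<Phi> (map u bs)) * subst_form E r x u' \<Psi> (map u bs) = cnj (\<Phi> bs) * \<Psi> bs"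
      using map_tup[OF unitary_pair_sym[OF u] bs] by (simp add: subst_form_def)
  qed
  also have "\<dots> = tip E r x \<Phi> \<Psi>" by (simp add: tip_words)
  finally show ?thesis .
qed

lemma slice_subst_form:
  assumes u: "unitary_pair E x u u'" and b: "b \<in> fib E x" and \<Phi>: "\<Phi> \<in> tfib E (Suc r) x"
  shows "slice (subst_form E (Suc r) x u' \<Phi>) b = subst_form E r x u' (slice \<Phi> (u' b))"
  using b by (auto simp: slice_def subst_form_def tup_snoc fun_eq_iff)

lemma gpow_apply:
  assumes "x \<in> topspace (base E)" "\<Phi> \<in> tfib E r x"
  shows "gpow E r h (x, \<Phi>) = (x, subst_form E r x (madj E E h) \<Phi>)"
  using assms by (simp add: gpow_def subst_form_def)

lemma hat_mor_apply:
  assumes g: "g \<in> carrier (unitary_group E)" and t: "t \<in> tmors E n m"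
    and x: "x \<in> topspace (base E)" and \<Phi>: "\<Phi> \<in> tfib E n x"
  shows "hat_mor E g n m t (x, \<Phi>) = (x, subst_form E m x (madj E E g) (act t x (subst_form E n x g \<Phi>)))"
proof -
  note u = unitary_unitary_pair[OF g, of x]
  have e: "subst_form E n x (madj E E (madj E E g)) = subst_form E n x g"
    by (rule subst_form_cong) (rule madj_unitary_pair[OF unitary_pair_sym[OF u]])
  have f: "subst_form E n x g \<Phi> \<in> tfib E n x" by (rule subst_form_tfib[OF unitary_pair_sym[OF u] \<Phi>])
  have "mcomp (tpow E n) t (gpow E n (madj E E g)) (x, \<Phi>) = (x, act t x (subst_form E n x g \<Phi>))"
    using x \<Phi> by (simp add: mcomp_def compose_def gpow_apply e tmor_apply[OF t x f])
  then show ?thesis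
    using x \<Phi> gpow_apply[OF x act_tfib[OF t x f]] by (simp add: hat_mor_def mcomp_def compose_def)
qed

lemma hat_mor_tmor_of:
  assumes g: "g \<in> carrier (unitary_group E)" and t: "t \<in> tmors E n m"
  shows "hat_mor E g n m t = tmor_of E n (\<lambda>x \<Phi>. subst_form E m x (madj E E g) (act t x (subst_form E n x g \<Phi>)))"
  by (rule tmor_of_eqI) (use hat_mor_apply[OF g t] in \<open>simp_all add: hat_mor_def mcomp_def\<close>)

text \<open>\<open>t\<close> is recovered from $t \otimes 1$ by slicing $(t \otimes 1)(\Phi \otimes b)$ at the
  unit vector \<open>b\<close>.\<close>

lemma amplify_inject:
  assumes t: "t \<in> tmors E r s" and t': "t' \<in> tmors E r s" and eq: "amplify E r s t = amplify E r s t'"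
    and ne: "\<And>x. x \<in> topspace (base E) \<Longrightarrow> chosen_onb E x \<noteq> {}"
  shows "t = t'"
proof (rule tmor_eqI[OF t t'])
  fix x \<Phi> assume x: "x \<in> topspace (base E)" and \<Phi>: "\<Phi> \<in> tfib E r x"
  obtain b where b: "b \<in> chosen_onb E x" using ne[OF x] by blast
  then have bf: "b \<in> fib E x" using onb_chosen_onb[OF x] by (auto simp: onb_def)
  obtain \<Theta> where \<Theta>: "\<Theta> \<in> tfib E (Suc r) x" "slice \<Theta> b = \<Phi>" using tensor_extend[OF x b \<Phi>] by blast
  show "act t x \<Phi> = act t' x \<Phi>"
    using slice_amplify[OF t x \<Theta>(1) bf] slice_amplify[OF t' x \<Theta>(1) bf] eq \<Theta>(2) by simp
qed

lemma amplify_iter_inject: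
  assumes t: "t \<in> tmors E r s" and t': "t' \<in> tmors E r s"
    and eq: "amplify_iter E r s j t = amplify_iter E r s j t'"
    and ne: "\<And>x. x \<in> topspace (base E) \<Longrightarrow> chosen_onb E x \<noteq> {}"
  shows "t = t'"
  using eq
proof (induction j)
  case (Suc j)
  then show ?case
    using amplify_inject[OF amplify_iter_tmor[OF t] amplify_iter_tmor[OF t'], of j] ne by simp
qed simp

end

section \<open>Bundles over a point\<close>

locale point_bundle = framed_bundle F for F :: "('e, 'x) vbundle" +
  fixes x :: 'x
  assumes point: "topspace (base F) = {x}"
begin

lemma local_section_point:
  assumes "\<sigma> x \<in> fib F x"
  shows "local_section F {x} \<sigma>"
proof -
  have "\<sigma> x \<in> topspace (tot F)" "prj F (\<sigma> x) = x" using assms by (simp_all add: fib_def)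
  moreover have "continuous_map (subtopology (base F) {x}) (tot F) \<sigma>"
    by (rule continuous_map_point[where x = x]) (use calculation in simp_all)
  ultimately show ?thesis by (simp add: local_section_def)
qed

text \<open>The coefficients along constant sections are continuous; along an orthonormal basis they are
  coordinates of the tensor power, and a linear map of the fibre is a linear expression in them.\<close>

lemma tmor_point:
  assumes l: "tlinear F r s x (T x)"
  shows "tmor_of F r T \<in> tmors F r s"
proof (rule tmorI)
  fix y assume "y \<in> topspace (base F)"
  then show "tlinear F r s y (T y)" using l point by simp
next
  fix U \<sigma>s assume U: "section_list F U s \<sigma>s"
  let ?Z = "subtopology (ttop F r) {v \<in> topspace (ttop F r). fst v \<in> U}"
  have x: "x \<in> topspace (base F)" using point by simp
  have B: "onb F x (chosen_onb F x)" "finite (chosen_onb F x)" "chosen_onb F x \<subseteq> fib F x" using onb_chosen_onb[OF x] by (auto simp: onb_def)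
  have ox: "openin (base F) {x}" using openin_topspace[of "base F"] point by simp
  have Z: "topspace ?Z \<subseteq> {v \<in> topspace (ttop F r). fst v \<in> {x}}"
  proof
    fix v assume "v \<in> topspace ?Z"
    then have "v \<in> topspace (ttop F r)" by simp
    then show "v \<in> {v \<in> topspace (ttop F r). fst v \<in> {x}}" using point by (cases v) simp
  qed
  have c: "continuous_map ?Z euclidean (\<lambda>v. snd v bs)" if "bs \<in> words (chosen_onb F x) r" for bs
  proof -
    have "section_list F {x} r (map (\<lambda>b _. b) bs)"
      using that B(3) ox by (auto simp: section_list_def words_def intro!: local_section_point)
    from coef_continuous[OF this]
    have "continuous_map (subtopology (ttop F r) {v \<in> topspace (ttop F r). fst v \<in> {x}}) euclidean (\<lambda>v. snd v bs)"
      by (simp add: eval_secs_def o_def)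
    then show ?thesis by (rule continuous_map_from_subtopology_mono) (use Z in auto)
  qed
  have "continuous_map ?Z euclidean
     (\<lambda>v. \<Sum>bs\<in>words (chosen_onb F x) r. snd v bs * T x (simple_tensor F x bs) (eval_secs \<sigma>s x))"
    by (intro continuous_map_sum finite_words B continuous_map_complex_mult c) simp_all
  then show "continuous_map ?Z euclidean (\<lambda>v. T (fst v) (snd v) (eval_secs \<sigma>s (fst v)))"
  proof (rule continuous_map_eq)
    fix v assume "v \<in> topspace ?Z"
    from subsetD[OF Z this] obtain \<Phi> where v: "v = (x, \<Phi>)" "\<Phi> \<in> tfib F r x"
      by (cases v) auto
    have "T x \<Phi> = T x (\<lambda>ws. \<Sum>bs\<in>words (chosen_onb F x) r. \<Phi> bs * simple_tensor F x bs ws)"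
      by (rule arg_cong[OF tfib_simple_tensor_sum[OF B(1) v(2)]])
    also have "\<dots> = (\<lambda>ws. \<Sum>bs\<in>words (chosen_onb F x) r. \<Phi> bs * T x (simple_tensor F x bs) ws)"
      by (rule tlinear_sum[OF l finite_words[OF B(2)] simple_tensor_tfib[OF words_onb_tup[OF B(1)]]])
    finally show "(\<Sum>bs\<in>words (chosen_onb F x) r. snd v bs * T x (simple_tensor F x bs) (eval_secs \<sigma>s x)) = T (fst v) (snd v) (eval_secs \<sigma>s (fst v))"
      by (simp add: v)
  qed
qed

text \<open>The tensor powers of \<open>u\<close> are unitary, so that conjugation by them respects composition
  and adjoints, and the last factor of \<open>u\<close> cancels in the conjugation of $t \otimes 1$.\<close>

lemma hat_functor:
  assumes u: "u \<in> carrier (unitary_group F)"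
  shows "tensor_functor F F (hat_mor F u)"
proof -
  let ?u' = "madj F F u"
  have U: "unitary_pair F x u ?u'" by (rule unitary_unitary_pair[OF u])
  note U' = unitary_pair_sym[OF U]
  have x: "x \<in> topspace (base F)" using point by simp
  have mem: "hat_mor F u n m t \<in> tmors F n m" if t: "t \<in> tmors F n m" for n m t
    unfolding hat_mor_tmor_of[OF u t]
    by (rule tmor_point) (intro tlinear_compose[OF tlinear_compose[OF subst_form_tlinear[OF U'] tmor_tlinear[OF t x]] subst_form_tlinear[OF U]])
  have act: "act (hat_mor F u n m t) x \<Phi> = subst_form F m x ?u' (act t x (subst_form F n x u \<Phi>))"
    if "t \<in> tmors F n m" "\<Phi> \<in> tfib F n x" for n m t \<Phi>
    using hat_mor_apply[OF u that(1) x that(2)] by (simp add: act_def)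
  have g: "subst_form F n x u \<Phi> \<in> tfib F n x" "subst_form F n x ?u' \<Phi> \<in> tfib F n x" if "\<Phi> \<in> tfib F n x" for n \<Phi>
    using subst_form_tfib[OF U that] subst_form_tfib[OF U' that] by auto
  have tipg: "tip F n x \<Phi> (subst_form F n x ?u' \<Psi>) = tip F n x (subst_form F n x u \<Phi>) \<Psi>" if "\<Phi> \<in> tfib F n x" "\<Psi> \<in> tfib F n x" for n \<Phi> \<Psi>
    using subst_form_unitary[OF U' x that(1) g(2)[OF that(2)]] subst_form_inverse[OF U that(2)] by simp
  show ?thesis
  proof (unfold_locales)
    fix n m t assume t: "t \<in> tmors F n m"
    show "hat_mor F u n m t \<in> tmors F n m" by (rule mem[OF t])
    show "hat_mor F u n m (mscl (tpow F n) (tpow F m) c t) = mscl (tpow F n) (tpow F m) c (hat_mor F u n m t)" for c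
    proof (rule tmor_eqI[OF mem[OF mscl_tmor[OF t]] mscl_tmor[OF mem[OF t]]])
      fix y \<Phi> assume "y \<in> topspace (base F)" "\<Phi> \<in> tfib F n y"
      then have y: "y = x" "\<Phi> \<in> tfib F n x" using point by auto
      show "act (hat_mor F u n m (mscl (tpow F n) (tpow F m) c t)) y \<Phi> = act (mscl (tpow F n) (tpow F m) c (hat_mor F u n m t)) y \<Phi>"
        unfolding y(1) act[OF mscl_tmor[OF t] y(2)] act_mscl[OF mem[OF t] x y(2)] act[OF t y(2)] act_mscl[OF t x g(1)[OF y(2)]]
        by (rule tlinear_scl[OF subst_form_tlinear[OF U] act_tfib[OF t x g(1)[OF y(2)]]])
    qed
    show "hat_mor F u m n (madj (tpow F n) (tpow F m) t) = madj (tpow F n) (tpow F m) (hat_mor F u n m t)"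
    proof (rule madj_eqI[OF mem[OF t] mem[OF madj_tmor[OF t]], symmetric])
      fix y \<Phi> \<Psi> assume "y \<in> topspace (base F)" "\<Phi> \<in> tfib F n y" "\<Psi> \<in> tfib F m y"
      then have y: "y = x" "\<Phi> \<in> tfib F n x" "\<Psi> \<in> tfib F m x" using point by auto
      have a: "act t x (subst_form F n x u \<Phi>) \<in> tfib F m x" by (rule act_tfib[OF t x g(1)[OF y(2)]])
      have b: "act (madj (tpow F n) (tpow F m) t) x (subst_form F m x u \<Psi>) \<in> tfib F n x"
        by (rule act_tfib[OF madj_tmor[OF t] x g(1)[OF y(3)]])
      have "tip F n x \<Phi> (subst_form F n x ?u' (act (madj (tpow F n) (tpow F m) t) x (subst_form F m x u \<Psi>))) =
        tip F m x (act t x (subst_form F n x u \<Phi>)) (subst_form F m x u \<Psi>)"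
        unfolding tipg[OF y(2) b] by (rule tip_madj[OF t x g(1)[OF y(2)] g(1)[OF y(3)]])
      also have "\<dots> = cnj (tip F m x (subst_form F m x u \<Psi>) (act t x (subst_form F n x u \<Phi>)))" by (simp add: tip_cnj)
      also have "\<dots> = cnj (tip F m x \<Psi> (subst_form F m x ?u' (act t x (subst_form F n x u \<Phi>))))" unfolding tipg[OF y(3) a] ..
      also have "\<dots> = tip F m x (subst_form F m x ?u' (act t x (subst_form F n x u \<Phi>))) \<Psi>" by (simp add: tip_cnj)
      finally show "tip F n y \<Phi> (act (hat_mor F u m n (madj (tpow F n) (tpow F m) t)) y \<Psi>) =
          tip F m y (act (hat_mor F u n m t) y \<Phi>) \<Psi>"
        unfolding y(1) act[OF madj_tmor[OF t] y(3)] act[OF t y(2)] .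
    qed
    show "hat_mor F u (Suc n) (Suc m) (amplify F n m t) = amplify F n m (hat_mor F u n m t)"
    proof (rule amplify_eqI[OF mem[OF t] mem[OF amplify_tmor[OF t]], symmetric])
      fix y \<Phi> b assume "y \<in> topspace (base F)" "\<Phi> \<in> tfib F (Suc n) y" "b \<in> fib F y"
      then have y: "y = x" "\<Phi> \<in> tfib F (Suc n) x" and b: "b \<in> fib F x" using point by auto
      show "slice (act (hat_mor F u (Suc n) (Suc m) (amplify F n m t)) y \<Phi>) b = act (hat_mor F u n m t) y (slice \<Phi> b)"
        unfolding y(1) act[OF amplify_tmor[OF t] y(2)] act[OF t slice_tfib[OF y(2) b]]
          slice_subst_form[OF U b act_tfib[OF amplify_tmor[OF t] x g(1)[OF y(2)]]]
          slice_amplify[OF t x g(1)[OF y(2)] unitary_pair_D(2)[OF U b]]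
          slice_subst_form[OF U' unitary_pair_D(2)[OF U b] y(2)] unitary_pair_D(4)[OF U b] ..
    qed
    fix t' assume t': "t' \<in> tmors F n m"
    show "hat_mor F u n m (madd (tpow F n) (tpow F m) t t') = madd (tpow F n) (tpow F m) (hat_mor F u n m t) (hat_mor F u n m t')"
    proof (rule tmor_eqI[OF mem[OF madd_tmor[OF t t']] madd_tmor[OF mem[OF t] mem[OF t']]])
      fix y \<Phi> assume "y \<in> topspace (base F)" "\<Phi> \<in> tfib F n y"
      then have y: "y = x" "\<Phi> \<in> tfib F n x" using point by auto
      show "act (hat_mor F u n m (madd (tpow F n) (tpow F m) t t')) y \<Phi> =
          act (madd (tpow F n) (tpow F m) (hat_mor F u n m t) (hat_mor F u n m t')) y \<Phi>"
        unfolding y(1) act[OF madd_tmor[OF t t'] y(2)] act_madd[OF mem[OF t] mem[OF t'] x y(2)] act[OF t y(2)] act[OF t' y(2)]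
          act_madd[OF t t' x g(1)[OF y(2)]]
        by (rule tlinear_add[OF subst_form_tlinear[OF U] act_tfib[OF t x g(1)[OF y(2)]] act_tfib[OF t' x g(1)[OF y(2)]]])
    qed
  next
    fix n m show "hat_mor F u n m (tzero F n) = tzero F n"
    proof (rule tmor_eqI[OF mem[OF tzero_tmor] tzero_tmor])
      fix y \<Phi> assume "y \<in> topspace (base F)" "\<Phi> \<in> tfib F n y"
      then have y: "y = x" "\<Phi> \<in> tfib F n x" using point by auto
      show "act (hat_mor F u n m (tzero F n)) y \<Phi> = act (tzero F n) y \<Phi>"
        unfolding y(1) act[OF tzero_tmor y(2)] act_tzero[OF x y(2)] act_tzero[OF x g(1)[OF y(2)]]
        by (rule tlinear_zero[OF subst_form_tlinear[OF U]])
    qed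
  next
    fix n m k t t' assume t: "t \<in> tmors F n m" and t': "t' \<in> tmors F m k"
    show "hat_mor F u n k (mcomp (tpow F n) t' t) = mcomp (tpow F n) (hat_mor F u m k t') (hat_mor F u n m t)"
    proof (rule tmor_eqI[OF mem[OF mcomp_tmor[OF t t']] mcomp_tmor[OF mem[OF t] mem[OF t']]])
      fix y \<Phi> assume "y \<in> topspace (base F)" "\<Phi> \<in> tfib F n y"
      then have y: "y = x" "\<Phi> \<in> tfib F n x" using point by auto
      have a: "act t x (subst_form F n x u \<Phi>) \<in> tfib F m x" by (rule act_tfib[OF t x g(1)[OF y(2)]])
      show "act (hat_mor F u n k (mcomp (tpow F n) t' t)) y \<Phi> =
         act (mcomp (tpow F n) (hat_mor F u m k t') (hat_mor F u n m t)) y \<Phi>"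
        unfolding y(1) act[OF mcomp_tmor[OF t t'] y(2)] act_mcomp[OF mem[OF t] mem[OF t'] x y(2)] act[OF t y(2)]
          act[OF t' g(2)[OF a]] subst_form_inverse[OF U a] act_mcomp[OF t t' x g(1)[OF y(2)]] ..
    qed
  qed
qed

text \<open>If the fibre is non-zero, the embedding is injective. If it is zero, all tensor powers but the one
  of order zero vanish, and on scalars the action is trivial.\<close>

lemma cp_embed_fixed:
  assumes u: "u \<in> carrier (unitary_group F)" and t: "t \<in> tmors F r s"
    and eq: "cp_embed F r s (hat_mor F u r s t) = cp_embed F r s t"
  shows "hat_mor F u r s t = t"
proof -
  interpret H: tensor_functor F F "hat_mor F u" by (rule hat_functor[OF u])
  have ht: "hat_mor F u r s t \<in> tmors F r s" by (rule H.H_tmor[OF t])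
  have x: "x \<in> topspace (base F)" using point by simp
  show ?thesis
  proof (cases "chosen_onb F x = {}")
    case False
    obtain N where "\<forall>j\<ge>N. amplify_iter F r s j (hat_mor F u r s t) = amplify_iter F r s j t"
      using cp_embed_inject_class[OF ht t eq] .
    then show ?thesis using amplify_iter_inject[OF ht t, of N] False point by simp
  next
    case True
    show ?thesis
    proof (rule tmor_eqI[OF ht t])
      fix y \<Phi> assume "y \<in> topspace (base F)" "\<Phi> \<in> tfib F r y"
      then have y: "y = x" "\<Phi> \<in> tfib F r x" using point by auto
      note l = tlinear_zero[OF tmor_tlinear[OF t x]] tlinear_zero[OF tmor_tlinear[OF ht x]]
      \<comment> \<open>A morphism to or from a power of positive order is zero; what remains are scalars.\<close>
      consider r' where "r = Suc r'" | s' where "s = Suc s'" | "r = 0" "s = 0" by (meson not0_implies_Suc)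
      then show "act (hat_mor F u r s t) y \<Phi> = act t y \<Phi>"
      proof cases
        case 1
        then have "\<Phi> = (\<lambda>_. 0)" using tfib_chosen_onb_empty[OF x True] y by simp
        then show ?thesis using l y by simp
      next
        case 2
        have "act t x \<Phi> \<in> tfib F (Suc s') x" "act (hat_mor F u r s t) x \<Phi> \<in> tfib F (Suc s') x"
          using act_tfib[OF t x y(2)] act_tfib[OF ht x y(2)] 2 by auto
        from this[THEN tfib_chosen_onb_empty[OF x True]] show ?thesis by (simp only: y(1))
      next
        case 3
        have z: "subst_form F 0 x h \<Psi> = \<Psi>" if "\<Psi> \<in> tfib F 0 x" for h \<Psi> using that by (auto simp: subst_form_def tfib0)
        have "act (hat_mor F u 0 0 t) x \<Phi> = subst_form F 0 x (madj F F u) (act t x (subst_form F 0 x u \<Phi>))"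
          using hat_mor_apply[OF u _ x, of t 0 0 \<Phi>] t y(2) 3 by (simp add: act_def)
        also have "\<dots> = act t x \<Phi>" using z y(2) 3 act_tfib[OF t x y(2)] by simp
        finally show ?thesis using y 3 by simp
      qed
    qed
  qed
qed

end

section \<open>Restriction to a fibre\<close>

text \<open>Restriction of a morphism to the fibre over \<open>x\<close>, as in \<^const>\<open>cp_eval\<close>.\<close>

definition at_mor :: "('e, 'x) vbundle \<Rightarrow> 'x \<Rightarrow> nat \<Rightarrow> ('e, 'x) tmor \<Rightarrow> ('e, 'x) tmor" where
  "at_mor E x n t = restrict t (topspace (tot (tpow (at_pt E x) n)))"

lemma at_pt_simps [simp]:
  "base (at_pt E x) = subtopology (base E) {x}"
  "tot (at_pt E x) = subtopology (tot E) (fib E x)"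
  "prj (at_pt E x) = prj E" "vadd (at_pt E x) = vadd E" "vscl (at_pt E x) = vscl E" "ip (at_pt E x) = ip E"
  by (simp_all add: at_pt_def)

lemma fib_at_pt: "fib (at_pt E x) y = (if y = x then fib E x else {})"
  by (auto simp: fib_def)

lemma tup_at_pt: "tup (at_pt E x) r x = tup E r x"
  by (simp add: tup_def fib_at_pt)

lemma tfib_at_pt: "tfib (at_pt E x) r x = tfib E r x"
  by (simp add: tfib_def fib_at_pt tup_at_pt)

lemma tip_at_pt: "tip (at_pt E x) r x = tip E r x"
proof -
  have "onb (at_pt E x) x = onb E x" by (simp add: onb_def fib_at_pt fun_eq_iff)
  then show ?thesis by (simp add: tip_def fun_eq_iff)
qed

lemma tlinear_at_pt: "tlinear (at_pt E x) r s x = tlinear E r s x"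
  by (simp add: tlinear_def tfib_at_pt fun_eq_iff)

lemma subst_form_at_pt: "subst_form (at_pt E x) r x = subst_form E r x"
  by (simp add: subst_form_def tup_at_pt fun_eq_iff)

lemma madj_at_pt:
  assumes "v \<in> fib E x" "\<And>w. w \<in> fib E x \<Longrightarrow> t w = t' w"
  shows "madj (at_pt E x) (at_pt E x) t v = madj E E t' v"
proof -
  have v: "prj E v = x" "v \<in> topspace (tot E)" using assms(1) by (auto simp: fib_def)
  have "(\<forall>w\<in>fib E x. ip E w a = ip E (t w) v) \<longleftrightarrow> (\<forall>w\<in>fib E x. ip E w a = ip E (t' w) v)" for a
    using assms(2) by simp
  then show ?thesis using v assms(1) by (simp add: madj_def fib_at_pt)
qed

context framed_bundle
begin

lemma local_section_at_pt:
  assumes "\<sigma> x \<in> fib E x"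
  shows "local_section (at_pt E x) U \<sigma>"
proof -
  have s: "\<sigma> x \<in> topspace (tot E)" "prj E (\<sigma> x) = x" using assms by (simp_all add: fib_def)
  have "continuous_map (subtopology (base (at_pt E x)) U) (tot (at_pt E x)) \<sigma>"
    by (rule continuous_map_point[where x = x]) (use s assms in auto)
  then show ?thesis using s by (auto simp: local_section_def)
qed

text \<open>A local frame at \<open>x\<close> restricts to an orthonormal basis of the fibre.\<close>

lemma at_pt_point_bundle:
  assumes x: "x \<in> topspace (base E)"
  shows "point_bundle (at_pt E x) x"
proof (unfold_locales)
  let ?F = "at_pt E x"
  show p: "topspace (base ?F) = {x}" using x by auto
  have "compactin (base E) {x}" using x by simp
  then show "compact_space (base ?F)" by (simp add: compact_space_subtopology)
  show "Hausdorff_space (base ?F)" using Hausdorff_base by (simp add: Hausdorff_space_subtopology)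
  show "y \<in> topspace (base ?F)" if "v \<in> fib ?F y" for v y
    using that p by (auto simp: fib_at_pt split: if_splits)
  show "vadd ?F v w \<in> fib ?F y" if "v \<in> fib ?F y" "w \<in> fib ?F y" for v w y
    using that vadd_fib by (auto simp: fib_at_pt split: if_splits)
  show "vscl ?F c v \<in> fib ?F y" if "v \<in> fib ?F y" for v y c
    using that vscl_fib by (auto simp: fib_at_pt split: if_splits)
  show "ip ?F u (vadd ?F v w) = ip ?F u v + ip ?F u w" if "u \<in> fib ?F y" "v \<in> fib ?F y" "w \<in> fib ?F y" for u v w y
    using that ip_vadd[of u x v w] by (simp add: fib_at_pt split: if_splits)
  show "ip ?F u (vscl ?F c v) = c * ip ?F u v" if "u \<in> fib ?F y" "v \<in> fib ?F y" for u v c y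
    using that ip_vscl[of u x v c] by (simp add: fib_at_pt split: if_splits)
  show "ip ?F v u = cnj (ip ?F u v)" if "u \<in> fib ?F y" "v \<in> fib ?F y" for u v y
    using that ip_cnj[of u x v] by (simp add: fib_at_pt split: if_splits)
  show "0 < Re (ip ?F v v)" if "v \<in> fib ?F y" "vscl ?F 0 v \<noteq> v" for v y
    using that ip_definite[of v x] by (simp add: fib_at_pt split: if_splits)
  show "v = w" if "v \<in> fib ?F y" "w \<in> fib ?F y"
    "vscl ?F 0 (vadd ?F v (vscl ?F (- 1) w)) = vadd ?F v (vscl ?F (- 1) w)" for v w y
    using that diff_zero_eq[of v x w] by (simp add: fib_at_pt split: if_splits)
  show "\<exists>U n s. openin (base ?F) U \<and> y \<in> U \<and> frame ?F U n s" if "y \<in> topspace (base ?F)" for y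
  proof -
    have y: "y = x" using that p by simp
    obtain U n s where U: "openin (base E) U" "x \<in> U" "frame E U n s" using local_frame[OF x] by blast
    have "s i x \<in> fib E x" if "i < n" for i
      using frame_fib[OF U(3) openin_subset[OF U(1)] that U(2)] .
    then have "frame ?F {x} n s"
      using U(2,3) by (auto simp: frame_def fib_at_pt intro: local_section_at_pt)
    moreover have "openin (base ?F) {x}" using openin_topspace[of "base ?F"] p by simp
    ultimately show ?thesis using y by blast
  qed
  show "\<exists>U \<sigma>. openin (base ?F) U \<and> y \<in> U \<and> local_section ?F U \<sigma>" if "y \<in> topspace (base ?F)" for y
  proof -
    obtain v where "v \<in> fib E x" using fib_nonempty[OF x] by blast
    then have "local_section ?F {x} (\<lambda>_. v)" by (intro local_section_at_pt)
    moreover have "openin (base ?F) {x}" using openin_topspace[of "base ?F"] p by simp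
    ultimately show ?thesis using that p by blast
  qed
  show "continuous_map (subtopology (base ?F) U) euclidean (\<lambda>y. ip ?F (\<sigma> y) (\<tau> y))" for U \<sigma> \<tau>
    by (rule continuous_map_point[where x = x]) auto
qed

text \<open>All operations on morphisms are fibrewise, so each identity is checked for the maps of the single
  fibre.\<close>

lemma restriction_functor:
  assumes x: "x \<in> topspace (base E)"
  shows "tensor_functor E (at_pt E x) (\<lambda>n m. at_mor E x n)"
proof -
  let ?F = "at_pt E x"
  interpret F: point_bundle ?F x by (rule at_pt_point_bundle[OF x])
  have xF: "x \<in> topspace (base ?F)" using F.point by simp
  have inF: "y = x \<and> \<Phi> \<in> tfib ?F n x \<and> \<Phi> \<in> tfib E n x" if "y \<in> topspace (base ?F)" "\<Phi> \<in> tfib ?F n y" for y \<Phi> n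
    using that F.point by (auto simp: tfib_at_pt)
  have mkr: "at_mor E x n t = tmor_of ?F n (act t)" if "t \<in> tmors E n m" for n m t
  proof (rule F.tmor_of_eqI)
    show "at_mor E x n t \<in> extensional (topspace (ttop ?F n))" by (simp add: at_mor_def)
    fix y \<Phi> assume y0: "y \<in> topspace (base ?F)" "\<Phi> \<in> tfib ?F n y"
    from inF[OF this] have y: "y = x" "\<Phi> \<in> tfib E n x" by auto
    have "(y, \<Phi>) \<in> topspace (tot (tpow ?F n))" unfolding tpow_simps F.mem_ttop using y0 by blast
    then have "at_mor E x n t (y, \<Phi>) = t (y, \<Phi>)" by (simp only: at_mor_def restrict_apply')
    then show "at_mor E x n t (y, \<Phi>) = (y, act t y \<Phi>)" using tmor_apply[OF that x y(2)] y(1) by simp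
  qed
  have mem: "at_mor E x n t \<in> tmors ?F n m" if t: "t \<in> tmors E n m" for n m t
    unfolding mkr[OF t] by (rule F.tmor_point) (simp add: tlinear_at_pt tmor_tlinear[OF t x])
  have a: "act (at_mor E x n t) x \<Phi> = act t x \<Phi>" if "\<Phi> \<in> tfib ?F n x" for n t \<Phi>
  proof -
    have "(x, \<Phi>) \<in> topspace (tot (tpow ?F n))" unfolding tpow_simps F.mem_ttop using that xF by blast
    then show ?thesis by (simp only: act_def at_mor_def restrict_apply')
  qed
  have aE: "act t x \<Phi> \<in> tfib ?F m x" if "t \<in> tmors E n m" "\<Phi> \<in> tfib E n x" for n m t \<Phi>
    using act_tfib[OF that(1) x that(2)] by (simp add: tfib_at_pt)
  show ?thesis
  proof (unfold_locales)
    fix n m t assume t: "t \<in> tmors E n m"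
    show "at_mor E x n t \<in> tmors ?F n m" by (rule mem[OF t])
    show "at_mor E x n (mscl (tpow E n) (tpow E m) c t) = mscl (tpow ?F n) (tpow ?F m) c (at_mor E x n t)" for c
    proof (rule F.tmor_eqI[OF mem[OF mscl_tmor[OF t]] F.mscl_tmor[OF mem[OF t]]])
      fix y \<Phi> assume "y \<in> topspace (base ?F)" "\<Phi> \<in> tfib ?F n y"
      from inF[OF this] have y: "y = x" "\<Phi> \<in> tfib ?F n x" "\<Phi> \<in> tfib E n x" by auto
      show "act (at_mor E x n (mscl (tpow E n) (tpow E m) c t)) y \<Phi> = act (mscl (tpow ?F n) (tpow ?F m) c (at_mor E x n t)) y \<Phi>"
        unfolding y(1) a[OF y(2)] act_mscl[OF t x y(3)] F.act_mscl[OF mem[OF t] xF y(2)] ..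
    qed
    show "at_mor E x m (madj (tpow E n) (tpow E m) t) = madj (tpow ?F n) (tpow ?F m) (at_mor E x n t)"
    proof (rule F.madj_eqI[OF mem[OF t] mem[OF madj_tmor[OF t]], symmetric])
      fix y \<Phi> \<Psi> assume y0: "y \<in> topspace (base ?F)" "\<Phi> \<in> tfib ?F n y" "\<Psi> \<in> tfib ?F m y"
      from inF[OF y0(1,2)] inF[OF y0(1,3)] have y: "y = x" "\<Phi> \<in> tfib ?F n x" "\<Phi> \<in> tfib E n x"
        "\<Psi> \<in> tfib ?F m x" "\<Psi> \<in> tfib E m x" by auto
      show "tip ?F n y \<Phi> (act (at_mor E x m (madj (tpow E n) (tpow E m) t)) y \<Psi>) = tip ?F m y (act (at_mor E x n t) y \<Phi>) \<Psi>"
        unfolding y(1) a[OF y(2)] a[OF y(4)] tip_at_pt by (rule tip_madj[OF t x y(3,5)])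
    qed
    show "at_mor E x (Suc n) (amplify E n m t) = amplify ?F n m (at_mor E x n t)"
    proof (rule F.amplify_eqI[OF mem[OF t] mem[OF amplify_tmor[OF t]], symmetric])
      fix y \<Phi> b assume y0: "y \<in> topspace (base ?F)" "\<Phi> \<in> tfib ?F (Suc n) y" "b \<in> fib ?F y"
      from inF[OF y0(1,2)] y0(3) have y: "y = x" "\<Phi> \<in> tfib ?F (Suc n) x" "\<Phi> \<in> tfib E (Suc n) x" "b \<in> fib E x" "b \<in> fib ?F x"
        by (auto simp: fib_at_pt)
      show "slice (act (at_mor E x (Suc n) (amplify E n m t)) y \<Phi>) b = act (at_mor E x n t) y (slice \<Phi> b)"
        unfolding y(1) a[OF y(2)] a[OF slice_tfib[OF y(2,5)]] by (rule slice_amplify[OF t x y(3,4)])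
    qed
    fix t' assume t': "t' \<in> tmors E n m"
    show "at_mor E x n (madd (tpow E n) (tpow E m) t t') = madd (tpow ?F n) (tpow ?F m) (at_mor E x n t) (at_mor E x n t')"
    proof (rule F.tmor_eqI[OF mem[OF madd_tmor[OF t t']] F.madd_tmor[OF mem[OF t] mem[OF t']]])
      fix y \<Phi> assume "y \<in> topspace (base ?F)" "\<Phi> \<in> tfib ?F n y"
      from inF[OF this] have y: "y = x" "\<Phi> \<in> tfib ?F n x" "\<Phi> \<in> tfib E n x" by auto
      show "act (at_mor E x n (madd (tpow E n) (tpow E m) t t')) y \<Phi> =
          act (madd (tpow ?F n) (tpow ?F m) (at_mor E x n t) (at_mor E x n t')) y \<Phi>"
        unfolding y(1) a[OF y(2)] act_madd[OF t t' x y(3)] F.act_madd[OF mem[OF t] mem[OF t'] xF y(2)] ..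
    qed
  next
    fix n m show "at_mor E x n (tzero E n) = tzero ?F n"
    proof (rule F.tmor_eqI[OF mem[OF tzero_tmor] F.tzero_tmor])
      fix y \<Phi> assume "y \<in> topspace (base ?F)" "\<Phi> \<in> tfib ?F n y"
      from inF[OF this] have y: "y = x" "\<Phi> \<in> tfib ?F n x" "\<Phi> \<in> tfib E n x" by auto
      show "act (at_mor E x n (tzero E n)) y \<Phi> = act (tzero ?F n) y \<Phi>"
        unfolding y(1) a[OF y(2)] act_tzero[OF x y(3)] F.act_tzero[OF xF y(2)] ..
    qed
  next
    fix n m k t t' assume t: "t \<in> tmors E n m" and t': "t' \<in> tmors E m k"
    show "at_mor E x n (mcomp (tpow E n) t' t) = mcomp (tpow ?F n) (at_mor E x m t') (at_mor E x n t)"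
    proof (rule F.tmor_eqI[OF mem[OF mcomp_tmor[OF t t']] F.mcomp_tmor[OF mem[OF t] mem[OF t']]])
      fix y \<Phi> assume "y \<in> topspace (base ?F)" "\<Phi> \<in> tfib ?F n y"
      from inF[OF this] have y: "y = x" "\<Phi> \<in> tfib ?F n x" "\<Phi> \<in> tfib E n x" by auto
      show "act (at_mor E x n (mcomp (tpow E n) t' t)) y \<Phi> = act (mcomp (tpow ?F n) (at_mor E x m t') (at_mor E x n t)) y \<Phi>"
        unfolding y(1) F.act_mcomp[OF mem[OF t] mem[OF t'] xF y(2)] a[OF y(2)] a[OF aE[OF t y(3)]]
        by (rule act_mcomp[OF t t' x y(3)])
    qed
  qed
qed

lemma restrict_unitary:
  assumes g: "g \<in> carrier (unitary_group E)" and x: "x \<in> topspace (base E)"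
  shows "restrict g (fib E x) \<in> carrier (unitary_group (at_pt E x))"
proof -
  let ?F = "at_pt E x" and ?u = "restrict g (fib E x)"
  note U = unitary_unitary_pair[OF g, of x]
  note D = unitary_pair_D[OF U]
  have m: "g \<in> mor E E" using g by (simp add: unitary_group_def)
  have top: "topspace (tot ?F) = fib E x" by (auto simp: fib_def)
  have ad: "madj ?F ?F ?u v = madj E E g v" if "v \<in> fib E x" for v
    by (rule madj_at_pt[OF that]) simp
  have "continuous_map (subtopology (tot E) (fib E x)) (subtopology (tot E) (fib E x)) g"
    using m D(1) by (intro continuous_map_into_subtopology continuous_map_from_subtopology) (auto simp: mor_def)
  then have c: "continuous_map (tot ?F) (tot ?F) ?u"
    unfolding at_pt_simps by (rule continuous_map_eq) simp
  have "?u \<in> mor ?F ?F"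
    unfolding mor_def
  proof (intro CollectI conjI allI ballI c)
    show "?u \<in> extensional (topspace (tot ?F))" unfolding top by simp
    show "prj ?F (?u v) = prj ?F v" if "v \<in> topspace (tot ?F)" for v
      using that D(1)[of v] unfolding top by (auto simp: fib_def)
    show "?u (vadd ?F v w) = vadd ?F (?u v) (?u w)" if "v \<in> fib ?F y" "w \<in> fib ?F y" for v w y
      using that mor_vadd[OF m, of v x w] vadd_fib[of v x w] by (simp add: fib_at_pt split: if_splits)
    show "?u (vscl ?F c v) = vscl ?F c (?u v)" if "v \<in> fib ?F y" for v c y
      using that mor_vscl[OF m, of v x c] vscl_fib[of v x c] by (simp add: fib_at_pt split: if_splits)
  qed
  moreover have "mcomp ?F (madj ?F ?F ?u) ?u = mid ?F"
    unfolding mcomp_def compose_def mid_def top by (rule restrict_ext) (simp add: ad D)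
  moreover have "mcomp ?F ?u (madj ?F ?F ?u) = mid ?F"
    unfolding mcomp_def compose_def mid_def top by (rule restrict_ext) (simp add: ad D)
  ultimately show ?thesis by (simp add: unitary_group_def)
qed

text \<open>The action of a unitary on morphisms is fibrewise.\<close>

lemma hat_mor_at_pt:
  assumes g: "g \<in> carrier (unitary_group E)" and y: "y \<in> tmors E r s"
    and x: "x \<in> topspace (base E)" and \<Phi>: "\<Phi> \<in> tfib E r x"
  shows "hat_mor (at_pt E x) (restrict g (fib E x)) r s (at_mor E x r y) (x, \<Phi>) = hat_mor E g r s y (x, \<Phi>)"
proof -
  let ?F = "at_pt E x" and ?u = "restrict g (fib E x)"
  interpret F: point_bundle ?F x by (rule at_pt_point_bundle[OF x])
  interpret R: tensor_functor E ?F "\<lambda>n m. at_mor E x n" by (rule restriction_functor[OF x])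
  have xF: "x \<in> topspace (base ?F)" and \<Phi>F: "\<Phi> \<in> tfib ?F r x" using F.point \<Phi> by (auto simp: tfib_at_pt)
  have 1: "subst_form E r x ?u = subst_form E r x g" by (rule subst_form_cong) simp
  have 2: "subst_form E s x (madj ?F ?F ?u) = subst_form E s x (madj E E g)"
    by (rule subst_form_cong) (rule madj_at_pt, simp_all)
  have gf: "subst_form E r x g \<Phi> \<in> tfib ?F r x"
    using subst_form_tfib[OF unitary_pair_sym[OF unitary_unitary_pair[OF g]] \<Phi>] by (simp add: tfib_at_pt)
  have 3: "act (at_mor E x r y) x (subst_form E r x g \<Phi>) = act y x (subst_form E r x g \<Phi>)"
  proof -
    have "(x, subst_form E r x g \<Phi>) \<in> topspace (tot (tpow ?F r))" unfolding tpow_simps F.mem_ttop using gf xF by blast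
    then show ?thesis by (simp only: act_def at_mor_def restrict_apply')
  qed
  show ?thesis
    unfolding F.hat_mor_apply[OF restrict_unitary[OF g x] R.H_tmor[OF y] xF \<Phi>F] hat_mor_apply[OF g y x \<Phi>]
      subst_form_at_pt 1 2 3 ..
qed

lemma hat_mor_fixed_iff:
  assumes g: "g \<in> carrier (unitary_group E)" and y: "y \<in> tmors E r s"
  shows "hat_mor E g r s y = y \<longleftrightarrow>
     (\<forall>x\<in>topspace (base E). hat_mor (at_pt E x) (restrict g (fib E x)) r s (at_mor E x r y) = at_mor E x r y)"
proof
  assume fixed: "hat_mor E g r s y = y"
  show "\<forall>x\<in>topspace (base E). hat_mor (at_pt E x) (restrict g (fib E x)) r s (at_mor E x r y) = at_mor E x r y"
  proof
    fix x assume x: "x \<in> topspace (base E)"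
    interpret F: point_bundle "at_pt E x" x by (rule at_pt_point_bundle[OF x])
    show "hat_mor (at_pt E x) (restrict g (fib E x)) r s (at_mor E x r y) = at_mor E x r y"
    proof (rule extensionalityI)
      fix v assume "v \<in> topspace (ttop (at_pt E x) r)"
      then obtain \<Phi> where v: "v = (x, \<Phi>)" "\<Phi> \<in> tfib E r x" "v \<in> topspace (ttop (at_pt E x) r)"
        using F.point by (cases v) (auto simp: tfib_at_pt)
      show "hat_mor (at_pt E x) (restrict g (fib E x)) r s (at_mor E x r y) v = at_mor E x r y v"
        using hat_mor_at_pt[OF g y x v(2)] fixed v(3) by (simp add: v(1) at_mor_def)
    qed (simp_all add: hat_mor_def mcomp_def at_mor_def)
  qed
next
  assume fixed: "\<forall>x\<in>topspace (base E). hat_mor (at_pt E x) (restrict g (fib E x)) r s (at_mor E x r y) = at_mor E x r y"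
  show "hat_mor E g r s y = y"
  proof (rule extensionalityI)
    show "y \<in> extensional (topspace (ttop E r))" using y by (simp add: mor_def)
    fix v assume "v \<in> topspace (ttop E r)"
    then obtain x \<Phi> where v: "v = (x, \<Phi>)" "x \<in> topspace (base E)" "\<Phi> \<in> tfib E r x" by (cases v) auto
    interpret F: point_bundle "at_pt E x" x by (rule at_pt_point_bundle[OF v(2)])
    have "v \<in> topspace (ttop (at_pt E x) r)" using v F.point by (simp add: tfib_at_pt)
    then show "hat_mor E g r s y v = y v"
      using hat_mor_at_pt[OF g y v(2,3)] fixed v(2) by (simp add: v(1) at_mor_def)
  qed (simp add: hat_mor_def mcomp_def)
qed

section \<open>Spectral bundles\<close>

text \<open>The topology of the unitary bundle is generated by a subbasis; that it has all unitaries of fibres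
  as points needs a local section through a neighbourhood of each point of the base.\<close>

lemma spectral_iff:
  "(x, u) \<in> topspace (spectral_bundle E G) \<longleftrightarrow>
     x \<in> topspace (base E) \<and> u \<in> carrier (unitary_group (at_pt E x)) \<and>
     (\<forall>y\<in>cp_eval E x ` O_alg E G. hat (at_pt E x) u y = y)"
proof -
  have "(x, u) \<in> topspace (unitary_bundle E)"
    if x: "x \<in> topspace (base E)" and u: "u \<in> carrier (unitary_group (at_pt E x))"
  proof -
    obtain U \<sigma> where U: "openin (base E) U" "x \<in> U" "local_section E U \<sigma>" using local_section_exists[OF x] by blast
    let ?S = "{(x, u). x \<in> U \<and> u \<in> carrier (unitary_group (at_pt E x)) \<and> ip E (\<sigma> x) (u (\<sigma> x)) \<in> UNIV}"
    have "(x, u) \<in> ?S" using U u by simp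
    moreover have "?S \<subseteq> topspace (unitary_bundle E)"
      unfolding unitary_bundle_def
      by (rule openin_subset, rule topology_generated_by_Basis) (use U in blast)
    ultimately show ?thesis by blast
  qed
  then show ?thesis by (auto simp: spectral_bundle_def)
qed

lemma cp_eval_map_entries: "cp_eval E x = cp_map (at_pt E x) (map_entries (\<lambda>n m. at_mor E x n))"
  by (simp add: cp_eval_def map_entries_def[abs_def] at_mor_def)

lemma hat_map_entries: "hat F u = cp_map F (map_entries (hat_mor F u))"
  by (simp add: hat_def map_entries_def[abs_def])

text \<open>A point of the spectral bundle fixes the image of the value of \<open>y\<close> in the Cuntz algebra
  of the fibre; this descends to the value itself.\<close>

lemma spectral_fixes_invariant:
  assumes xu: "(x, u) \<in> topspace (spectral_bundle E G)" and y: "y \<in> invariant_mors E G r s"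
  shows "hat_mor (at_pt E x) u r s (at_mor E x r y) = at_mor E x r y"
proof -
  have x: "x \<in> topspace (base E)" and u: "u \<in> carrier (unitary_group (at_pt E x))"
    and fixed: "\<forall>y\<in>cp_eval E x ` O_alg E G. hat (at_pt E x) u y = y"
    using xu unfolding spectral_iff by auto
  interpret F: point_bundle "at_pt E x" x by (rule at_pt_point_bundle[OF x])
  interpret R: tensor_functor E "at_pt E x" "\<lambda>n m. at_mor E x n" by (rule restriction_functor[OF x])
  interpret H: tensor_functor "at_pt E x" "at_pt E x" "hat_mor (at_pt E x) u" by (rule F.hat_functor[OF u])
  have yt: "y \<in> tmors E r s" using y by (simp add: invariant_mors_def)
  have "cp_embed E r s y \<in> O_alg E G"
    unfolding O_alg_def cstar_generated_def using y by blast
  then have "hat (at_pt E x) u (cp_eval E x (cp_embed E r s y)) = cp_eval E x (cp_embed E r s y)" using fixed by blast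
  then have "cp_embed (at_pt E x) r s (hat_mor (at_pt E x) u r s (at_mor E x r y)) = cp_embed (at_pt E x) r s (at_mor E x r y)"
    unfolding cp_eval_map_entries hat_map_entries R.cp_map_embed[OF yt] H.cp_map_embed[OF R.H_tmor[OF yt]] .
  then show ?thesis by (rule F.cp_embed_fixed[OF u R.H_tmor[OF yt]])
qed

text \<open>Evaluation at \<open>x\<close>, alone and followed by the action of \<open>g\<close> on the fibre,
  are induced by functors that agree on \<open>G\<close>-invariant morphisms.\<close>

lemma group_in_spectral:
  assumes G: "G \<subseteq> carrier (unitary_group E)" and g: "g \<in> G" and x: "x \<in> topspace (base E)"
  shows "(x, restrict g (fib E x)) \<in> topspace (spectral_bundle E G)"
proof -
  let ?F = "at_pt E x" and ?u = "restrict g (fib E x)"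
  have gu: "g \<in> carrier (unitary_group E)" using G g by blast
  have u: "?u \<in> carrier (unitary_group ?F)" by (rule restrict_unitary[OF gu x])
  interpret F: point_bundle ?F x by (rule at_pt_point_bundle[OF x])
  have R: "tensor_functor E ?F (\<lambda>n m. at_mor E x n)" by (rule restriction_functor[OF x])
  have H: "tensor_functor ?F ?F (hat_mor ?F ?u)" by (rule F.hat_functor[OF u])
  have eq: "y \<in> tmors E r s \<and> hat_mor ?F ?u r s (at_mor E x r y) = at_mor E x r y"
    if "y \<in> invariant_mors E G r s" for r s y
  proof
    show yt: "y \<in> tmors E r s" using that by (simp add: invariant_mors_def)
    have "hat_mor E g r s y = y" using that g by (simp add: invariant_mors_def)
    then show "hat_mor ?F ?u r s (at_mor E x r y) = at_mor E x r y" using hat_mor_fixed_iff[OF gu yt] x by blast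
  qed
  have "hat ?F ?u (cp_eval E x y) = cp_eval E x y" if y: "y \<in> O_alg E G" for y
  proof -
    \<comment> \<open>Restriction followed by the action of \<open>u\<close> is itself a functor, to be compared
      with restriction.\<close>
    note e = cp_map_equalizer[OF tensor_functor_comp[OF R H] R eq y[unfolded O_alg_def]]
    have "cp_map ?F (map_entries (hat_mor ?F ?u)) (cp_map ?F (map_entries (\<lambda>n m. at_mor E x n)) y) =
        cp_map ?F (map_entries (\<lambda>n m t. hat_mor ?F ?u n m (at_mor E x n t))) y"
      by (rule cp_map_comp[OF R H e(2)])
    also have "\<dots> = cp_map ?F (map_entries (\<lambda>n m. at_mor E x n)) y" by (rule e(1))
    finally show ?thesis unfolding cp_eval_map_entries hat_map_entries .
  qed
  then show ?thesis unfolding spectral_iff using x u by blast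
qed

text \<open>The values of \<open>G\<close> lie in the spectral bundle, and the spectral bundle fixes what
  \<open>G\<close> fixes.\<close>

lemma invariant_iff_spectral:
  assumes G: "G \<subseteq> carrier (unitary_group E)"
  shows "y \<in> invariant_mors E G r s \<longleftrightarrow>
     y \<in> tmors E r s \<and>
     (\<forall>(x, u)\<in>topspace (spectral_bundle E G). hat_mor (at_pt E x) u r s (at_mor E x r y) = at_mor E x r y)"
proof
  assume y: "y \<in> invariant_mors E G r s"
  then show "y \<in> tmors E r s \<and>
     (\<forall>(x, u)\<in>topspace (spectral_bundle E G). hat_mor (at_pt E x) u r s (at_mor E x r y) = at_mor E x r y)"
    using spectral_fixes_invariant[OF _ y] by (auto simp: invariant_mors_def)
next
  assume y: "y \<in> tmors E r s \<and>
     (\<forall>(x, u)\<in>topspace (spectral_bundle E G). hat_mor (at_pt E x) u r s (at_mor E x r y) = at_mor E x r y)"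
  have "hat_mor E g r s y = y" if g: "g \<in> G" for g
  proof -
    have gu: "g \<in> carrier (unitary_group E)" using G g by blast
    show ?thesis
      using y group_in_spectral[OF G g] by (subst hat_mor_fixed_iff[OF gu]) blast+
  qed
  then show "y \<in> invariant_mors E G r s" using y by (simp add: invariant_mors_def)
qed

text \<open>The spectral group contains \<open>G\<close>, and its values fix the values of
  \<open>G\<close>-invariant morphisms.\<close>

lemma invariant_spectral_group:
  assumes G: "G \<subseteq> carrier (unitary_group E)"
  shows "invariant_mors E (spectral_group E G) = invariant_mors E G"
proof (intro ext equalityI subsetI)
  fix r s y assume y: "y \<in> invariant_mors E (spectral_group E G) r s"
  have "G \<subseteq> spectral_group E G"
    using G group_in_spectral[OF G] by (auto simp: spectral_group_def)
  then show "y \<in> invariant_mors E G r s" using y by (auto simp: invariant_mors_def)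
next
  fix r s y assume y: "y \<in> invariant_mors E G r s"
  then have yt: "y \<in> tmors E r s" by (simp add: invariant_mors_def)
  have "hat_mor E g r s y = y" if g: "g \<in> spectral_group E G" for g
  proof -
    have gu: "g \<in> carrier (unitary_group E)"
      and sp: "\<forall>x\<in>topspace (base E). (x, restrict g (fib E x)) \<in> topspace (spectral_bundle E G)"
      using g by (auto simp: spectral_group_def)
    show ?thesis
      unfolding hat_mor_fixed_iff[OF gu yt] using spectral_fixes_invariant[OF _ y] sp by blast
  qed
  then show "y \<in> invariant_mors E (spectral_group E G) r s" using yt by (simp add: invariant_mors_def)
qed

end

section \<open>Hermitian vector bundles have local orthonormal frames\<close>

text \<open>A local trivialisation in terms of coordinates \<open>c\<close> and their inverse
  \<open>vec\<close>. Coordinate vectors are extensional functions on \<open>{..<d}\<close>.\<close>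

locale vector_chart = hermitian_bundle E d
  for E :: "('e, 'x) vbundle" and d +
  fixes U :: "'x set" and c :: "'e \<Rightarrow> nat \<Rightarrow> complex" and vec :: "'x \<Rightarrow> (nat \<Rightarrow> complex) \<Rightarrow> 'e"
  assumes U: "openin (base E) U"
    and c_ext: "y \<in> U \<Longrightarrow> v \<in> fib E y \<Longrightarrow> c v \<in> extensional {..<d}"
    and vec_fib: "y \<in> U \<Longrightarrow> a \<in> extensional {..<d} \<Longrightarrow> vec y a \<in> fib E y"
    and c_vec: "y \<in> U \<Longrightarrow> a \<in> extensional {..<d} \<Longrightarrow> c (vec y a) = a"
    and vec_c: "y \<in> U \<Longrightarrow> v \<in> fib E y \<Longrightarrow> vec y (c v) = v"
    and c_vadd: "y \<in> U \<Longrightarrow> v \<in> fib E y \<Longrightarrow> w \<in> fib E y \<Longrightarrow> c (vadd E v w) = (\<lambda>i\<in>{..<d}. c v i + c w i)"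
    and c_vscl: "y \<in> U \<Longrightarrow> v \<in> fib E y \<Longrightarrow> c (vscl E k v) = (\<lambda>i\<in>{..<d}. k * c v i)"
    and vec_section: "(\<And>i. i < d \<Longrightarrow> continuous_map (subtopology (base E) U) euclidean (\<lambda>y. f y i)) \<Longrightarrow>
      local_section E U (\<lambda>y. vec y (restrict (f y) {..<d}))"
    and c_continuous: "local_section E U \<sigma> \<Longrightarrow> i < d \<Longrightarrow>
      continuous_map (subtopology (base E) U) euclidean (\<lambda>y. c (\<sigma> y) i)"

lemma (in hermitian_bundle) chart_exists:
  assumes x: "x \<in> topspace (base E)"
  obtains U c vec where "vector_chart E d U c vec" "x \<in> U"
proof -
  obtain U \<phi> where U: "openin (base E) U" "x \<in> U"
    and \<phi>: "homeomorphic_map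
            (subtopology (tot E) {v \<in> topspace (tot E). prj E v \<in> U})
            (prod_topology (subtopology (base E) U)
               (product_topology (\<lambda>_. euclidean :: complex topology) {..<d})) \<phi>"
    and fst: "\<forall>y\<in>U. \<forall>v\<in>fib E y. fst (\<phi> v) = y"
    and add: "\<forall>y\<in>U. \<forall>v\<in>fib E y. \<forall>w\<in>fib E y. snd (\<phi> (vadd E v w)) = (\<lambda>i\<in>{..<d}. snd (\<phi> v) i + snd (\<phi> w) i)"
    and scl: "\<forall>y\<in>U. \<forall>v\<in>fib E y. \<forall>c. snd (\<phi> (vscl E c v)) = (\<lambda>i\<in>{..<d}. c * snd (\<phi> v) i)"
    using locally_trivial[OF x] by (elim exE conjE)
  let ?T = "subtopology (tot E) {v \<in> topspace (tot E). prj E v \<in> U}"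
  let ?P = "product_topology (\<lambda>_. euclidean :: complex topology) {..<d}"
  let ?B = "prod_topology (subtopology (base E) U) ?P"
  obtain \<psi> where h: "homeomorphic_maps ?T ?B \<phi> \<psi>" using \<phi> homeomorphic_map_maps by blast
  have cp: "continuous_map ?T ?B \<phi>" and cq: "continuous_map ?B ?T \<psi>"
    and qp: "\<And>v. v \<in> topspace ?T \<Longrightarrow> \<psi> (\<phi> v) = v" and pq: "\<And>z. z \<in> topspace ?B \<Longrightarrow> \<phi> (\<psi> z) = z"
    using h unfolding homeomorphic_maps_def by auto
  have sub: "U \<subseteq> topspace (base E)" using openin_subset[OF U(1)] .
  have topB: "(y, a) \<in> topspace ?B \<longleftrightarrow> y \<in> U \<and> a \<in> extensional {..<d}" for y a
    using sub by (auto simp: PiE_def)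
  have topT: "v \<in> topspace ?T" if "y \<in> U" "v \<in> fib E y" for v y
    using that by (auto simp: fib_def)
  have \<phi>v: "\<phi> v = (y, snd (\<phi> v))" if "y \<in> U" "v \<in> fib E y" for v y
    using fst that by (metis prod.collapse)
  define c where "c = (\<lambda>v. snd (\<phi> v))"
  define vec where "vec = (\<lambda>y a. \<psi> (y, a))"
  have mf: "vec y a \<in> fib E y" if "y \<in> U" "a \<in> extensional {..<d}" for y a
  proof -
    have z: "(y, a) \<in> topspace ?B" using that topB by blast
    have "\<psi> (y, a) \<in> topspace ?T" using continuous_map_image_subset_topspace[OF cq] z by blast
    then have "\<psi> (y, a) \<in> fib E (prj E (\<psi> (y, a)))" "prj E (\<psi> (y, a)) \<in> U" by (auto simp: fib_def)
    moreover from this have "Product_Type.fst (\<phi> (\<psi> (y, a))) = prj E (\<psi> (y, a))" using fst by blast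
    ultimately show ?thesis unfolding vec_def using pq[OF z] by simp
  qed
  have "vector_chart E d U c vec"
  proof (unfold_locales)
    show "openin (base E) U" by (rule U(1))
    show "c v \<in> extensional {..<d}" if "y \<in> U" "v \<in> fib E y" for y v
    proof -
      have "\<phi> v \<in> topspace ?B" using continuous_map_image_subset_topspace[OF cp] topT[OF that] by blast
      then have "(y, snd (\<phi> v)) \<in> topspace ?B" using \<phi>v[OF that] by simp
      then show ?thesis unfolding topB c_def by blast
    qed
    show "vec y a \<in> fib E y" if "y \<in> U" "a \<in> extensional {..<d}" for y a by (rule mf[OF that])
    show "c (vec y a) = a" if "y \<in> U" "a \<in> extensional {..<d}" for y a
    proof -
      have "(y, a) \<in> topspace ?B" using that topB by blast
      then show ?thesis using pq by (simp add: c_def vec_def)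
    qed
    show "vec y (c v) = v" if "y \<in> U" "v \<in> fib E y" for y v
      unfolding vec_def c_def using qp[OF topT[OF that]] \<phi>v[OF that] by simp
    show "c (vadd E v w) = (\<lambda>i\<in>{..<d}. c v i + c w i)" if "y \<in> U" "v \<in> fib E y" "w \<in> fib E y" for y v w
      unfolding c_def using add that by blast
    show "c (vscl E k v) = (\<lambda>i\<in>{..<d}. k * c v i)" if "y \<in> U" "v \<in> fib E y" for y v k
      unfolding c_def using scl that by blast
    show "local_section E U (\<lambda>y. vec y (restrict (a y) {..<d}))"
      if a: "\<And>i. i < d \<Longrightarrow> continuous_map (subtopology (base E) U) euclidean (\<lambda>y. a y i)" for a
    proof -
      have "continuous_map (subtopology (base E) U) ?P (\<lambda>y. restrict (a y) {..<d})"
        unfolding continuous_map_componentwise using a by auto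
      then have "continuous_map (subtopology (base E) U) ?B (\<lambda>y. (y, restrict (a y) {..<d}))"
        by (simp add: continuous_map_pairedI)
      from continuous_map_compose[OF this cq]
      have "continuous_map (subtopology (base E) U) ?T (\<lambda>y. vec y (restrict (a y) {..<d}))"
        by (simp add: o_def vec_def)
      then have "continuous_map (subtopology (base E) U) (tot E) (\<lambda>y. vec y (restrict (a y) {..<d}))"
        by (rule continuous_map_into_fulltopology)
      moreover have "prj E (vec y (restrict (a y) {..<d})) = y" if "y \<in> U" for y
        using mf[OF that, of "restrict (a y) {..<d}"] by (simp add: fib_def)
      ultimately show ?thesis by (simp add: local_section_def)
    qed
    show "continuous_map (subtopology (base E) U) euclidean (\<lambda>y. c (\<sigma> y) i)"
      if \<sigma>: "local_section E U \<sigma>" and i: "i < d" for \<sigma> i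
    proof -
      have "continuous_map (subtopology (base E) U) ?T \<sigma>"
        using \<sigma> sub continuous_map_image_subset_topspace[of "subtopology (base E) U" "tot E" \<sigma>]
        unfolding local_section_def by (intro continuous_map_into_subtopology) auto
      from continuous_map_compose[OF continuous_map_compose[OF this cp] continuous_map_snd]
      have "continuous_map (subtopology (base E) U) ?P (\<lambda>y. c (\<sigma> y))" by (simp add: o_def c_def)
      then show ?thesis using i unfolding continuous_map_componentwise by auto
    qed
  qed
  then show ?thesis using that U(2) by blast
qed

context hermitian_bundle
begin

lemma ip_section_continuous:
  assumes \<sigma>: "local_section E U \<sigma>" and \<tau>: "local_section E U \<tau>"
  shows "continuous_map (subtopology (base E) U) euclidean (\<lambda>y. ip E (\<sigma> y) (\<tau> y))"
proof -
  have "continuous_map (subtopology (base E) U) (prod_topology (tot E) (tot E)) (\<lambda>y. (\<sigma> y, \<tau> y))"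
    using \<sigma> \<tau> by (simp add: local_section_def continuous_map_pairedI)
  then have "continuous_map (subtopology (base E) U)
     (subtopology (prod_topology (tot E) (tot E)) {(v, w). prj E v = prj E w}) (\<lambda>y. (\<sigma> y, \<tau> y))"
    by (rule continuous_map_into_subtopology) (use \<sigma> \<tau> in \<open>auto simp: local_section_def\<close>)
  from continuous_map_compose[OF this ip_continuous] show ?thesis by (simp add: o_def)
qed

end

context vector_chart
begin

definition coord_vec :: "nat \<Rightarrow> 'x \<Rightarrow> 'e" where
  "coord_vec k y = vec y (\<lambda>i\<in>{..<d}. if i = k then 1 else 0)"

lemma coord_vec_fib: "y \<in> U \<Longrightarrow> coord_vec k y \<in> fib E y"
  by (simp add: coord_vec_def vec_fib)

lemma coord_vec_section: "local_section E U (coord_vec k)"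
  unfolding coord_vec_def by (rule vec_section) simp

text \<open>Induction on the number of non-zero coordinates, as the fibre has no sums.\<close>

lemma linear_expand:
  assumes y: "y \<in> U" and add: "\<And>v w. v \<in> fib E y \<Longrightarrow> w \<in> fib E y \<Longrightarrow> L (vadd E v w) = L v + L w"
    and scl: "\<And>v k. v \<in> fib E y \<Longrightarrow> L (vscl E k v) = k * L v" and a: "a \<in> extensional {..<d}"
  shows "L (vec y a) = (\<Sum>i<d. a i * (L (coord_vec i y) :: complex))"
proof -
  have "L (vec y (\<lambda>i\<in>{..<d}. if i < k then a i else 0)) = (\<Sum>i<k. a i * L (coord_vec i y))" if "k \<le> d" for k
    using that
  proof (induction k)
    case 0
    let ?z = "vec y (\<lambda>i\<in>{..<d}. 0)"
    have z: "?z \<in> fib E y" using y by (simp add: vec_fib)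
    have "c (vscl E 0 ?z) = c ?z" using y z by (simp add: c_vscl c_vec)
    then have "vscl E 0 ?z = ?z" using vec_c[OF y z] vec_c[OF y vscl_closed[OF z]] by metis
    then have "L ?z = 0" using scl[OF z, of 0] by simp
    moreover have "(\<lambda>i\<in>{..<d}. if i < 0 then a i else 0) = (\<lambda>i\<in>{..<d}. 0)"
      by (rule restrict_ext) simp
    ultimately show ?case by (simp only: lessThan_0 sum.empty)
  next
    case (Suc k)
    let ?v = "vec y (\<lambda>i\<in>{..<d}. if i < k then a i else 0)"
    let ?w = "vec y (\<lambda>i\<in>{..<d}. if i < Suc k then a i else 0)"
    have v: "?v \<in> fib E y" and w: "?w \<in> fib E y" using y by (simp_all add: vec_fib)
    have s: "vscl E (a k) (coord_vec k y) \<in> fib E y" using vscl_closed coord_vec_fib y by blast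
    have cs: "c ?v = (\<lambda>i\<in>{..<d}. if i < k then a i else 0)" "c ?w = (\<lambda>i\<in>{..<d}. if i < Suc k then a i else 0)"
      "c (coord_vec k y) = (\<lambda>i\<in>{..<d}. if i = k then 1 else 0)"
      using y by (simp_all add: c_vec coord_vec_def)
    have "c (vadd E ?v (vscl E (a k) (coord_vec k y))) = c ?w"
      unfolding c_vadd[OF y v s] c_vscl[OF y coord_vec_fib[OF y]] cs
      using Suc.prems by (auto simp: restrict_def fun_eq_iff less_Suc_eq)
    then have "vadd E ?v (vscl E (a k) (coord_vec k y)) = ?w"
      using vec_c[OF y w] vec_c[OF y vadd_closed[OF v s]] by metis
    then have "L ?w = L ?v + a k * L (coord_vec k y)"
      using add[OF v s] scl[OF coord_vec_fib[OF y]] by metis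
    moreover have "L ?v = (\<Sum>i<k. a i * L (coord_vec i y))" by (rule Suc.IH) (use Suc.prems in simp)
    ultimately show ?case by (simp only: sum.lessThan_Suc)
  qed
  from this[of d] have "L (vec y (\<lambda>i\<in>{..<d}. if i < d then a i else 0)) = (\<Sum>i<d. a i * L (coord_vec i y))" by simp
  moreover have "(\<lambda>i\<in>{..<d}. if i < d then a i else 0) = a"
    using a by (auto simp: restrict_def fun_eq_iff extensional_def)
  ultimately show ?thesis by simp
qed

lemma vec_eqI: "y \<in> U \<Longrightarrow> v \<in> fib E y \<Longrightarrow> w \<in> fib E y \<Longrightarrow> c v = c w \<Longrightarrow> v = w"
  using vec_c by metis

lemma ip_expand:
  assumes y: "y \<in> U" and u: "u \<in> fib E y" and v: "v \<in> fib E y"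
  shows "ip E u v = (\<Sum>i<d. c v i * ip E u (coord_vec i y))"
  using linear_expand[OF y, of "ip E u" "c v"] ip_add[OF u] ip_scl[OF u] c_ext[OF y v] vec_c[OF y v] by simp

text \<open>The state of the Gram--Schmidt procedure after \<open>k\<close> steps. Vanishing of the coordinates
  from \<open>k\<close> on makes the next coordinate vector independent of the vectors obtained so
  far; the last condition says that these span the first \<open>k\<close> coordinate vectors, in the
  form in which it is used.\<close>

definition gs_upto :: "nat \<Rightarrow> (nat \<Rightarrow> 'x \<Rightarrow> 'e) \<Rightarrow> bool" where
  "gs_upto k s \<longleftrightarrow>
     (\<forall>i<k. local_section E U (s i)) \<and>
     (\<forall>y\<in>U. \<forall>i<k. s i y \<in> fib E y) \<and>
     (\<forall>y\<in>U. \<forall>i<k. \<forall>j<k. ip E (s i y) (s j y) = (if i = j then 1 else 0)) \<and>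
     (\<forall>y\<in>U. \<forall>i<k. \<forall>j. k \<le> j \<and> j < d \<longrightarrow> c (s i y) j = 0) \<and>
     (\<forall>y\<in>U. \<forall>v\<in>fib E y. (\<forall>i<k. ip E (s i y) v = 0) \<longrightarrow> (\<forall>i<k. ip E (coord_vec i y) v = 0))"

text \<open>The component of the next coordinate vector that is orthogonal to the vectors so far has its
  coordinate \<open>k\<close> equal to one, so that it vanishes nowhere on the chart and can be
  normalised continuously.\<close>

lemma gs_step:
  assumes s: "gs_upto k s" and k: "k < d"
  obtains t where "gs_upto (Suc k) (s(k := t))"
proof -
  have ls: "\<And>i. i < k \<Longrightarrow> local_section E U (s i)"
    and sf: "\<And>y i. y \<in> U \<Longrightarrow> i < k \<Longrightarrow> s i y \<in> fib E y"
    and on: "\<And>y i j. y \<in> U \<Longrightarrow> i < k \<Longrightarrow> j < k \<Longrightarrow> ip E (s i y) (s j y) = (if i = j then 1 else 0)"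
    and cz: "\<And>y i j. y \<in> U \<Longrightarrow> i < k \<Longrightarrow> k \<le> j \<Longrightarrow> j < d \<Longrightarrow> c (s i y) j = 0"
    and perp: "\<And>y v. y \<in> U \<Longrightarrow> v \<in> fib E y \<Longrightarrow> (\<And>i. i < k \<Longrightarrow> ip E (s i y) v = 0) \<Longrightarrow> \<forall>i<k. ip E (coord_vec i y) v = 0"
    using s unfolding gs_upto_def by blast+
  \<comment> \<open>\<open>b\<close> are the coordinates of the $k$-th coordinate vector minus its projection to
    the span of the vectors so far.\<close>
  define \<alpha> where "\<alpha> = (\<lambda>i y. ip E (s i y) (coord_vec k y))"
  define b where "b = (\<lambda>y j. (if j = k then 1 else 0) - (\<Sum>i<k. \<alpha> i y * c (s i y) j))"
  define w where "w = (\<lambda>y. vec y (restrict (b y) {..<d}))"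
  define nw where "nw = (\<lambda>y. sqrt (Re (ip E (w y) (w y))))"
  define t where "t = (\<lambda>y. vec y (restrict (\<lambda>j. complex_of_real (1 / nw y) * b y j) {..<d}))"
  have bc: "continuous_map (subtopology (base E) U) euclidean (\<lambda>y. b y j)" if "j < d" for j
    unfolding b_def \<alpha>_def
    by (intro continuous_map_diff continuous_map_sum continuous_map_complex_mult ip_section_continuous ls coord_vec_section
        c_continuous that) auto
  have wl: "local_section E U w" unfolding w_def by (rule vec_section[OF bc])
  have wf: "w y \<in> fib E y" if "y \<in> U" for y using that by (simp add: w_def vec_fib)
  have cw: "c (w y) = restrict (b y) {..<d}" if "y \<in> U" for y using that by (simp add: w_def c_vec)
  have Lw: "L (w y) = L (coord_vec k y) - (\<Sum>i<k. \<alpha> i y * L (s i y))"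
    if y: "y \<in> U" and add: "\<And>v w. v \<in> fib E y \<Longrightarrow> w \<in> fib E y \<Longrightarrow> L (vadd E v w) = L v + L w"
    and scl: "\<And>v k. v \<in> fib E y \<Longrightarrow> L (vscl E k v) = k * L v" for L :: "'e \<Rightarrow> complex" and y
  proof -
    have Ls: "L (s i y) = (\<Sum>j<d. c (s i y) j * L (coord_vec j y))" if "i < k" for i
      using linear_expand[OF y add scl c_ext[OF y sf[OF y that]]] vec_c[OF y sf[OF y that]] by simp
    have "L (w y) = (\<Sum>j<d. restrict (b y) {..<d} j * L (coord_vec j y))"
      unfolding w_def by (rule linear_expand[OF y add scl]) auto
    also have "\<dots> = (\<Sum>j<d. (if j = k then L (coord_vec k y) else 0) - (\<Sum>i<k. \<alpha> i y * c (s i y) j) * L (coord_vec j y))"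
      by (intro sum.cong) (auto simp: b_def algebra_simps)
    also have "\<dots> = L (coord_vec k y) - (\<Sum>j<d. \<Sum>i<k. \<alpha> i y * (c (s i y) j * L (coord_vec j y)))"
      using k by (simp add: sum_subtractf sum_distrib_right mult.assoc)
    also have "(\<Sum>j<d. \<Sum>i<k. \<alpha> i y * (c (s i y) j * L (coord_vec j y))) = (\<Sum>i<k. \<alpha> i y * L (s i y))"
      by (subst sum.swap) (simp add: Ls sum_distrib_left)
    finally show ?thesis .
  qed
  have ipw: "ip E u (w y) = ip E u (coord_vec k y) - (\<Sum>i<k. \<alpha> i y * ip E u (s i y))" if "y \<in> U" "u \<in> fib E y" for u y
    using Lw[OF that(1), of "ip E u"] ip_add[OF that(2)] ip_scl[OF that(2)] by blast
  have sw: "ip E (s i y) (w y) = 0" if "y \<in> U" "i < k" for i y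
  proof -
    have "(\<Sum>j<k. \<alpha> j y * ip E (s i y) (s j y)) = (\<Sum>j<k. if j = i then \<alpha> i y else 0)"
      using on[OF that(1,2)] by (intro sum.cong) auto
    then show ?thesis using ipw[OF that(1) sf[OF that]] that(2) by (simp add: \<alpha>_def)
  qed
  have bk: "b y k = 1" if "y \<in> U" for y using cz[OF that] k by (simp add: b_def)
  have npos: "0 < Re (ip E (w y) (w y))" if y: "y \<in> U" for y
  proof (rule ip_pos[OF wf[OF y]])
    show "vscl E 0 (w y) \<noteq> w y"
    proof
      assume "vscl E 0 (w y) = w y"
      then have "c (w y) k = 0" using c_vscl[OF y wf[OF y], of 0] k by simp
      then show False using cw[OF y] bk[OF y] k by simp
    qed
  qed
  have nw: "0 < nw y" if "y \<in> U" for y using npos[OF that] by (simp add: nw_def)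
  have ww: "ip E (w y) (w y) = complex_of_real ((nw y)\<^sup>2)" if y: "y \<in> U" for y
  proof -
    have "Im (ip E (w y) (w y)) = 0" using ip_herm[OF wf[OF y] wf[OF y]] by (metis complex_cnj_cancel_iff complex_eq_iff cnj.simps(2) neg_equal_zero)
    then show ?thesis using npos[OF y] by (simp add: nw_def complex_eq_iff)
  qed
  have t_eq: "t y = vscl E (complex_of_real (1 / nw y)) (w y)" if y: "y \<in> U" for y
  proof (rule vec_eqI[OF y])
    show "t y \<in> fib E y" using y by (simp add: t_def vec_fib)
    show "vscl E (complex_of_real (1 / nw y)) (w y) \<in> fib E y" by (rule vscl_closed[OF wf[OF y]])
    show "c (t y) = c (vscl E (complex_of_real (1 / nw y)) (w y))"
    proof -
      have "c (t y) = (\<lambda>j\<in>{..<d}. complex_of_real (1 / nw y) * b y j)" using y by (simp add: t_def c_vec)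
      then show ?thesis unfolding c_vscl[OF y wf[OF y]] cw[OF y] by (simp add: fun_eq_iff restrict_def)
    qed
  qed
  have tf: "t y \<in> fib E y" if "y \<in> U" for y using t_eq[OF that] vscl_closed[OF wf[OF that]] by simp
  have tl: "local_section E U t"
  proof -
    have "continuous_map (subtopology (base E) U) euclideanreal nw"
      unfolding nw_def by (intro continuous_map_real_sqrt continuous_map_Re ip_section_continuous wl)
    then have "continuous_map (subtopology (base E) U) euclideanreal (\<lambda>y. 1 / nw y)"
      by (intro continuous_map_real_divide) (use nw in force)+
    then show ?thesis
      unfolding t_def by (intro vec_section continuous_map_complex_mult continuous_map_complex_of_real bc)
  qed
  have ipt: "ip E u (t y) = complex_of_real (1 / nw y) * ip E u (w y)" if "y \<in> U" "u \<in> fib E y" for u y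
    unfolding t_eq[OF that(1)] by (rule ip_scl[OF that(2) wf[OF that(1)]])
  have st: "ip E (s i y) (t y) = 0" if "y \<in> U" "i < k" for i y
    using ipt[OF that(1) sf[OF that]] sw[OF that] by simp
  have ts: "ip E (t y) (s i y) = 0" if "y \<in> U" "i < k" for i y
    using ip_herm[OF sf[OF that] tf[OF that(1)]] st[OF that] by simp
  have tt: "ip E (t y) (t y) = 1" if y: "y \<in> U" for y
  proof -
    have "ip E (t y) (w y) = cnj (ip E (w y) (t y))" by (rule ip_herm[OF wf[OF y] tf[OF y]])
    then have "ip E (t y) (t y) = complex_of_real (1 / nw y) * cnj (complex_of_real (1 / nw y) * complex_of_real ((nw y)\<^sup>2))"
      using ipt[OF y tf[OF y]] ipt[OF y wf[OF y]] ww[OF y] by simp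
    also have "\<dots> = complex_of_real (1 / nw y * (1 / nw y * (nw y)\<^sup>2))" by simp
    also have "1 / nw y * (1 / nw y * (nw y)\<^sup>2) = 1" using nw[OF y] by (simp add: power2_eq_square)
    finally show ?thesis by simp
  qed
  have "gs_upto (Suc k) (s(k := t))"
    unfolding gs_upto_def
  proof (intro conjI ballI allI impI)
    show "local_section E U ((s(k := t)) i)" if "i < Suc k" for i using that ls tl by simp
    show "(s(k := t)) i y \<in> fib E y" if "y \<in> U" "i < Suc k" for i y using that sf tf by simp
    show "ip E ((s(k := t)) i y) ((s(k := t)) j y) = (if i = j then 1 else 0)" if "y \<in> U" "i < Suc k" "j < Suc k" for y i j
      using that on st ts tt by (auto simp: less_Suc_eq)
    show "c ((s(k := t)) i y) j = 0" if "y \<in> U" "i < Suc k" "Suc k \<le> j \<and> j < d" for y i j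
    proof (cases "i = k")
      case False then show ?thesis using that cz by simp
    next
      case True
      have "b y j = 0" using that cz[OF that(1), of _ j] by (simp add: b_def)
      then show ?thesis using True that by (simp add: t_def c_vec)
    qed
    fix y v i assume y: "y \<in> U" and v: "v \<in> fib E y" and o: "\<forall>i<Suc k. ip E ((s(k := t)) i y) v = 0" and i: "i < Suc k"
    have o': "ip E (s j y) v = 0" if "j < k" for j using o that by (metis fun_upd_other less_Suc_eq less_irrefl)
    have vs: "ip E v (s j y) = 0" if "j < k" for j using ip_herm[OF sf[OF y that] v] o'[OF that] by simp
    have "ip E (t y) v = 0" using o by (metis fun_upd_same lessI)
    then have "ip E v (t y) = 0" using ip_herm[OF tf[OF y] v] by simp
    then have "ip E v (w y) = 0" using ipt[OF y v] nw[OF y] by simp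
    then have "ip E v (coord_vec k y) = 0" using ipw[OF y v] vs by simp
    then have "ip E (coord_vec k y) v = 0" using ip_herm[OF v coord_vec_fib[OF y, of k]] by simp
    then show "ip E (coord_vec i y) v = 0" using perp[OF y v o'] i by (auto simp: less_Suc_eq)
  qed
  then show ?thesis using that by blast
qed

lemma gs_exists: "k \<le> d \<Longrightarrow> \<exists>s. gs_upto k s"
proof (induction k)
  case 0 show ?case by (simp add: gs_upto_def)
next
  case (Suc k)
  then obtain s where "gs_upto k s" by auto
  then show ?case using gs_step[of k s] Suc.prems by (metis Suc_le_eq)
qed

lemma frame_exists: "\<exists>s. frame E U d s"
proof -
  obtain s where s: "gs_upto d s" using gs_exists[of d] by blast
  have "vscl E 0 v = v" if y: "y \<in> U" and v: "v \<in> fib E y" and o: "\<forall>i<d. ip E (s i y) v = 0" for y v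
  proof (rule ccontr)
    assume "vscl E 0 v \<noteq> v"
    then have "0 < Re (ip E v v)" by (rule ip_pos[OF v])
    moreover have "ip E v (coord_vec i y) = 0" if "i < d" for i
    proof -
      have "ip E (coord_vec i y) v = 0" using s y v o that unfolding gs_upto_def by blast
      then show ?thesis using ip_herm[OF coord_vec_fib[OF y] v, of i] by simp
    qed
    ultimately show False using ip_expand[OF y v v] by simp
  qed
  then have "frame E U d s" using s unfolding frame_def gs_upto_def by blast
  then show ?thesis by blast
qed

end

lemma (in hermitian_bundle) framed:
  assumes "compact_space (base E)" "Hausdorff_space (base E)"
  shows "framed_bundle E"
proof -
  have fb: "x \<in> topspace (base E)" if "v \<in> fib E x" for v x
  proof -
    have "v \<in> topspace (tot E)" "prj E v = x" using that by (auto simp: fib_def)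
    then show ?thesis using continuous_map_image_subset_topspace[OF prj_continuous] by blast
  qed
  show ?thesis
  proof (unfold_locales)
    show "compact_space (base E)" "Hausdorff_space (base E)" by fact+
    show "x \<in> topspace (base E)" if "v \<in> fib E x" for v x by (rule fb[OF that])
    show "v = w" if v: "v \<in> fib E x" and w: "w \<in> fib E x"
      and z: "vscl E 0 (vadd E v (vscl E (- 1) w)) = vadd E v (vscl E (- 1) w)" for v w x
    proof -
      obtain U c vec where C: "vector_chart E d U c vec" "x \<in> U" using chart_exists[OF fb[OF v]] .
      interpret C: vector_chart E d U c vec by fact
      have w': "vscl E (- 1) w \<in> fib E x" by (rule vscl_closed[OF w])
      have d: "vadd E v (vscl E (- 1) w) \<in> fib E x" by (rule vadd_closed[OF v w'])
      have "c v i = c w i" if i: "i < d" for i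
      proof -
        have "c (vadd E v (vscl E (- 1) w)) i = 0"
          using C.c_vscl[OF C(2) d, of 0] z i by simp
        then show ?thesis using i C.c_vadd[OF C(2) v w'] C.c_vscl[OF C(2) w, of "-1"] by simp
      qed
      then have "c v = c w" using C.c_ext[OF C(2) v] C.c_ext[OF C(2) w] by (intro extensionalityI[of _ "{..<d}"]) auto
      then show ?thesis by (rule C.vec_eqI[OF C(2) v w])
    qed
    show "\<exists>U n s. openin (base E) U \<and> x \<in> U \<and> frame E U n s" if x: "x \<in> topspace (base E)" for x
    proof -
      obtain U c vec where C: "vector_chart E d U c vec" "x \<in> U" using chart_exists[OF x] .
      interpret C: vector_chart E d U c vec by fact
      show ?thesis using C.U C(2) C.frame_exists by blast
    qed
    show "\<exists>U \<sigma>. openin (base E) U \<and> x \<in> U \<and> local_section E U \<sigma>" if x: "x \<in> topspace (base E)" for x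
    proof -
      obtain U c vec where C: "vector_chart E d U c vec" "x \<in> U" using chart_exists[OF x] .
      interpret C: vector_chart E d U c vec by fact
      show ?thesis using C.U C(2) C.coord_vec_section by blast
    qed
    show "continuous_map (subtopology (base E) U) euclidean (\<lambda>y. ip E (\<sigma> y) (\<tau> y))"
      if "local_section E U \<sigma>" "local_section E U \<tau>" for U \<sigma> \<tau>
      by (rule ip_section_continuous[OF that])
  qed (fact vadd_closed vscl_closed ip_add ip_scl ip_herm ip_pos)+
qed

theorem lemma4p10:
  fixes E :: "('e, 'x) vbundle" and d :: nat and G :: "('e \<Rightarrow> 'e) set"
  assumes "compact_space (base E)" and "Hausdorff_space (base E)"
    and "hermitian_bundle E d"
    and "closed_unitary_subgroup E G"
  shows "(\<forall>G'. closed_unitary_subgroup E G' \<and> spectral_bundle E G = spectral_bundle E G'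
              \<longrightarrow> dual E G = dual E G') \<and>
         dual E G = dual E (spectral_group E G) \<and>
         O_alg E G = O_alg E (spectral_group E G)"
proof -
  interpret framed_bundle E by (rule hermitian_bundle.framed[OF assms(3,1,2)])
  have sub: "G' \<subseteq> carrier (unitary_group E)" if "closed_unitary_subgroup E G'" for G'
    using that by (simp add: closed_unitary_subgroup_def subgroup.subset)
  have "dual E G = dual E G'"
    if G': "closed_unitary_subgroup E G'" and eq: "spectral_bundle E G = spectral_bundle E G'" for G'
  proof -
    have "invariant_mors E G = invariant_mors E G'"
      unfolding fun_eq_iff set_eq_iff
        invariant_iff_spectral[OF sub[OF assms(4)]] invariant_iff_spectral[OF sub[OF G']] eq by blast
    then show ?thesis by (simp add: dual_def)
  qed
  moreover note invariant_spectral_group[OF sub[OF assms(4)]]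
  ultimately show ?thesis by (simp add: dual_def O_alg_def)
qed

end
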